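(* Consider the stochastic differential equation $dX_t=\sigma_t(X)dB_t+b_t(X)dt$, $\mathrm{Law}(X_0)=\eta_0$, with $\eta_0\in\mathcal{P}_{\mathbb{R}^d}$. Assume that weak existence and weak uniqueness of solutions hold for this equation, and that $\eta\in\mathcal{P}_W$, the unique law of its solutions, satisfies $E_\eta\big[\int_0^1(\sigma_t\sigma_t^{T})_{ij}\,dt\big]<\infty$ for all $i,j$. Let $S$ be a Polish space endowed with a regular filtration $(\mathcal{B}_t(S))_{t\in[0,1]}$. Then for all $\nu\in\mathcal{P}_S$ and $\gamma\in\Pi_c(\eta,\nu)$ there exist a complete stochastic basis $(\Omega,\mathcal{A},(\mathcal{A}_t)_{t\in[0,1]},\mathcal{P})$ and (i) an $(\mathcal{A}_t)$-adapted continuous process $(X_t)_{t\in[0,1]}$ and an $(\mathcal{A}_t)$-Brownian motion $(B_t)_{t\in[0,1]}$ such that $(X,B)$ solves the equation on this complete stochastic basis, (ii) a measurable $(\mathcal{A}_t)$-adapted map $Y:\Omega\to S$, i.e. $Y^{-1}(\mathcal{B}_t(S))\subset\mathcal{A}_t$ for all $t\in[0,1]$, such that $\gamma=(X\times Y)_\star\mathcal{P}$, where $X$ is viewed as an $\mathcal{A}/\mathcal{B}(W)$-measurable map $\Omega\to W$. Moreover, if $\eta$-a.s. $\det(\sigma_t)\ne0$ for all $t\in[0,1]$, then one can take $(\Omega,\mathcal{A},(\mathcal{A}_t)_{t\in[0,1]},\mathcal{P})=(W\times S,(\mathcal{B}(W)\otimes\mathcal{B}(S))^\gamma,(\mathcal{G}^\gamma_{t+})_{t\in[0,1]},\gamma)$,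 $X=\pi$, $Y=\widetilde\pi$, where $\mathcal{G}_t=\mathcal{B}_t(W)\otimes\mathcal{B}_t(S)$.
   Context: $W=C([0,1],\mathbb{R}^d)$ with the uniform norm; $W_t(\omega)=\omega(t)$; $\mathcal{B}^0_t(W)=\sigma(W_s,s\le t)$; $\mathcal{B}_t(W):=\mathcal{B}^0_{t+}(W)=\bigcap_{\epsilon>0}\mathcal{B}^0_{(t+\epsilon)\wedge1}(W)$. $\mathcal{P}_Z$: Borel probabilities on a Polish space $Z$. For a sigma-field $\mathcal{G}$ and a probability $\eta$, $\mathcal{G}^\eta$ is the $\eta$-completion (generated by $\mathcal{G}$ and the $\eta$-negligible sets). $\pi:W\times S\to W$, $\widetilde\pi:W\times S\to S$ are the projections; $(X\times Y)_\star\mathcal{P}$ is the joint law of $(X,Y)$. The coefficients $\sigma$ ($d\times d$-matrix valued) and $b$ ($\mathbb{R}^d$-valued) are predictable functionals on $[0,1]\times W$; $B$ is a $d$-dimensional Brownian motion. A complete stochastic basis is a complete probability space with a filtration $(\mathcal{A}_t)_{t\in[0,1]}$ satisfying the usual conditions (complete and right-continuous). A weak solution on it is a pair of an $(\mathcal{A}_t)$-adapted continuous process $X$ and an $(\mathcal{A}_t)$-Brownian motion $B$ satisfying the equation on $[0,1]$. Weak existence: there is a weak solution on some complete stochastic basis. Weak uniqueness: there is a unique $\eta\in\mathcal{P}_W$ such that $X_\star\mathcal{P}=\eta$ for every weak solution. Regular filtration: there are continuous maps $\rho_t:S\to S$, $t\in[0,1]$, with $\mathcal{B}_t(S)=\rho_t^{-1}(\mathcal{B}(S))$,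 $\rho_s\circ\rho_t=\rho_{\min(s,t)}$, and $\rho_{t_f}=\mathrm{Id}_S$ for some $t_f\in[0,1]$. Causal plans (here with first space $W$ carrying the filtration $(\mathcal{B}_t(W))=(\mathcal{B}^0_{t+}(W))$ and second space $S$ with $(\mathcal{B}_t(S))$): $\Pi(\eta,\nu)$ is the set of Borel probabilities on $W\times S$ with marginals $\eta,\nu$. A kernel of $\gamma\in\Pi(\eta,\nu)$ is $\Theta_\gamma:W\times\mathcal{B}(S)\to\mathbb{R}$ with $\Theta^x_\gamma\in\mathcal{P}_S$, $x\mapsto\Theta^x_\gamma(B)$ Borel, $\gamma(A\times B)=\int_A\Theta_\gamma^x(B)d\eta(x)$. $\gamma\in\Pi_c(\eta,\nu)$ iff $\gamma\in\Pi(\eta,\nu)$ and, for all $t\in[0,1]$ and all $C\in\mathcal{B}_t(S)$ with $\nu(\partial C)=0$, $x\mapsto\Theta^x_\gamma(C)$ is $\mathcal{B}_t(W)^\eta$-measurable. *)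

theory Defs
  imports "HOL-Probability.Probability"
begin

section \<open>The path space\<close>

text \<open>
  Paths live on the time interval \<open>[0,1]\<close> and are represented by functions that are fixed
  outside of it (\<^const>\<open>extensional\<close>), so that equality of paths is equality on \<open>[0,1]\<close>.
\<close>

typedef (overloaded) 'd wpath =
  "{f :: real \<Rightarrow> real ^ 'd::finite. continuous_on {0..1} f \<and> f \<in> extensional {0..1}}"
  morphisms path_at Wpath
proof
  show "(\<lambda>t\<in>{0..1}. 0) \<in> {f :: real \<Rightarrow> real ^ 'd. continuous_on {0..1} f \<and> f \<in> extensional {0..1}}"
    by (auto intro: continuous_on_eq[of "{0..1}" "\<lambda>_. 0"])
qed

setup_lifting type_definition_wpath

lemma continuous_on_path_at: "continuous_on {0..1} (path_at \<omega>)"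
  using path_at[of \<omega>] by simp

lemma wpath_eqI:
  assumes "\<And>t. t \<in> {0..1} \<Longrightarrow> path_at \<omega> t = path_at \<omega>' t"
  shows "\<omega> = \<omega>'"
proof -
  have "path_at \<omega> = path_at \<omega>'"
    using path_at[of \<omega>] path_at[of \<omega>'] assms by (intro extensionalityI[of _ "{0..1}"]) auto
  then show ?thesis by (simp add: path_at_inject)
qed

instantiation wpath :: (finite) metric_space
begin

definition dist_wpath :: "'a wpath \<Rightarrow> 'a wpath \<Rightarrow> real"
  where "dist_wpath \<omega> \<omega>' = (SUP t\<in>{0..1}. dist (path_at \<omega> t) (path_at \<omega>' t))"

definition uniformity_wpath :: "('a wpath \<times> 'a wpath) filter"
  where "uniformity_wpath = (INF e\<in>{0 <..}. principal {(x, y). dist x y < e})"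

definition open_wpath :: "'a wpath set \<Rightarrow> bool"
  where "open_wpath U = (\<forall>x\<in>U. \<forall>\<^sub>F (x', y) in uniformity. x' = x \<longrightarrow> y \<in> U)"

lemma bdd_above_dist_wpath:
  "bdd_above ((\<lambda>t. dist (path_at \<omega> t) (path_at \<omega>' t)) ` {0..1})" for \<omega> \<omega>' :: "'a wpath"
  by (intro bounded_imp_bdd_above compact_imp_bounded compact_continuous_image
        continuous_intros continuous_on_path_at compact_Icc)

lemma dist_path_at_le: "t \<in> {0..1} \<Longrightarrow> dist (path_at \<omega> t) (path_at \<omega>' t) \<le> dist \<omega> \<omega>'"
  for \<omega> \<omega>' :: "'a wpath"
  unfolding dist_wpath_def by (intro cSUP_upper bdd_above_dist_wpath)

lemma dist_wpath_le: "(\<And>t. t \<in> {0..1} \<Longrightarrow> dist (path_at \<omega> t) (path_at \<omega>' t) \<le> c) \<Longrightarrow> dist \<omega> \<omega>' \<le> c"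
  for \<omega> \<omega>' :: "'a wpath"
  unfolding dist_wpath_def by (intro cSUP_least) auto

instance
proof
  fix x y z :: "'a wpath"
  show "dist x y = 0 \<longleftrightarrow> x = y"
  proof
    assume "dist x y = 0"
    then show "x = y"
      using dist_path_at_le[of _ x y] by (intro wpath_eqI) force
  qed (simp add: dist_wpath_def)
  show "dist x y \<le> dist x z + dist y z"
  proof (rule dist_wpath_le)
    fix t :: real assume t: "t \<in> {0..1}"
    have "dist (path_at x t) (path_at y t) \<le> dist (path_at x t) (path_at z t) + dist (path_at y t) (path_at z t)"
      by (rule dist_triangle2)
    also have "\<dots> \<le> dist x z + dist y z"
      by (intro add_mono dist_path_at_le t)
    finally show "dist (path_at x t) (path_at y t) \<le> dist x z + dist y z" .
  qed
qed (rule open_wpath_def uniformity_wpath_def)+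

end


section \<open>Sigma-fields and filtrations\<close>

text \<open>
  A sigma-field is represented by a measure of which only the space and the measurable sets matter,
  and a filtration by a function \<open>F :: real \<Rightarrow> 'a measure\<close> of which only the values on
  \<open>[0,1]\<close> matter.
\<close>

definition borel_probs :: "'z::topological_space measure set"
  where "borel_probs = {\<mu>. prob_space \<mu> \<and> sets \<mu> = sets borel}"

definition negligible_sets :: "'a measure \<Rightarrow> 'a set set"
  where "negligible_sets M = {N. \<exists>Z\<in>null_sets M. N \<subseteq> Z}"

definition completed_field :: "'a measure \<Rightarrow> 'a measure \<Rightarrow> 'a measure"
  where "completed_field M G = sigma (space M) (sets G \<union> negligible_sets M)"

definition right_limit :: "(real \<Rightarrow> 'a measure) \<Rightarrow> real \<Rightarrow> 'a measure"
  where "right_limit F t = sigma (space (F t)) (\<Inter>\<epsilon>\<in>{0<..}. sets (F (min (t + \<epsilon>) 1)))"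

text \<open>The generating family in \<^const>\<open>right_limit\<close> is already a sigma-field.\<close>

lemma sets_right_limit:
  assumes "\<And>s. space (F s) = \<Omega>"
  shows "sets (right_limit F t) = (\<Inter>\<epsilon>\<in>{0<..}. sets (F (min (t + \<epsilon>) 1)))"
proof -
  let ?A = "\<Inter>\<epsilon>\<in>{0<..}. sets (F (min (t + \<epsilon>) 1))"
  have sub: "?A \<subseteq> Pow \<Omega>"
  proof
    fix A assume "A \<in> ?A"
    then have "A \<in> sets (F (min (t + 1) 1))" by auto
    then show "A \<in> Pow \<Omega>" using sets.sets_into_space assms by fastforce
  qed
  have top: "\<Omega> \<in> sets (F s)" for s using sets.top[of "F s"] assms by simp
  have "sigma_algebra \<Omega> ?A"
    unfolding sigma_algebra_iff2
  proof (intro conjI ballI allI impI)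
    fix A assume "A \<in> ?A"
    then show "\<Omega> - A \<in> ?A" using top by (auto intro: sets.Diff)
  next
    fix A :: "nat \<Rightarrow> 'a set" assume "range A \<subseteq> ?A"
    then show "(\<Union>i. A i) \<in> ?A" by (auto intro!: sets.countable_nat_UN)
  qed (use sub in auto)
  then show ?thesis
    by (simp add: right_limit_def assms sub sigma_algebra.sigma_sets_eq)
qed

definition raw_path_filtration :: "real \<Rightarrow> 'd::finite wpath measure"
  where "raw_path_filtration t =
    sigma UNIV {(\<lambda>\<omega>. path_at \<omega> s) -` A | s A. s \<in> {0..t} \<and> A \<in> sets borel}"

definition path_filtration :: "real \<Rightarrow> 'd::finite wpath measure"
  where "path_filtration = right_limit raw_path_filtration"

definition complete_stochastic_basis :: "'a measure \<Rightarrow> (real \<Rightarrow> 'a measure) \<Rightarrow> bool"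
  where "complete_stochastic_basis M F \<longleftrightarrow>
    prob_space M \<and> complete_measure M \<and>
    (\<forall>t\<in>{0..1}. subalgebra M (F t)) \<and>
    (\<forall>s\<in>{0..1}. \<forall>t\<in>{0..1}. s \<le> t \<longrightarrow> sets (F s) \<subseteq> sets (F t)) \<and>
    (\<forall>t\<in>{0..1}. null_sets M \<subseteq> sets (F t)) \<and>
    (\<forall>t\<in>{0..1}. sets (F t) = (\<Inter>\<epsilon>\<in>{0<..}. sets (F (min (t + \<epsilon>) 1))))"

definition regular_filtration :: "(real \<Rightarrow> 's::topological_space measure) \<Rightarrow> bool"
  where "regular_filtration BS \<longleftrightarrow> (\<exists>\<rho> :: real \<Rightarrow> 's \<Rightarrow> 's.
    (\<forall>t\<in>{0..1}. continuous_on UNIV (\<rho> t)) \<and>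
    (\<forall>t\<in>{0..1}. space (BS t) = UNIV \<and> sets (BS t) = {\<rho> t -` A | A. A \<in> sets borel}) \<and>
    (\<forall>s\<in>{0..1}. \<forall>t\<in>{0..1}. \<rho> s \<circ> \<rho> t = \<rho> (min s t)) \<and>
    (\<exists>t\<^sub>f\<in>{0..1}. \<rho> t\<^sub>f = id))"


section \<open>Causal plans\<close>

definition plans :: "'x::topological_space measure \<Rightarrow> 'y::topological_space measure \<Rightarrow> ('x \<times> 'y) measure set"
  where "plans \<eta> \<nu> = {\<gamma>\<in>borel_probs. distr \<gamma> borel fst = \<eta> \<and> distr \<gamma> borel snd = \<nu>}"

definition kernel_of ::
    "('x::topological_space \<times> 'y::topological_space) measure \<Rightarrow> 'x measure \<Rightarrow> ('x \<Rightarrow> 'y measure) \<Rightarrow> bool"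
  where "kernel_of \<gamma> \<eta> \<Theta> \<longleftrightarrow>
    (\<forall>x. \<Theta> x \<in> borel_probs) \<and>
    (\<forall>C\<in>sets borel. (\<lambda>x. measure (\<Theta> x) C) \<in> borel_measurable borel) \<and>
    (\<forall>A\<in>sets borel. \<forall>C\<in>sets borel. measure \<gamma> (A \<times> C) = (LINT x:A|\<eta>. measure (\<Theta> x) C))"

text \<open>
  Two kernels of the same plan agree \<open>\<eta>\<close>-almost everywhere for each fixed set, so the
  measurability below does not depend on the kernel: the sigma-field contains all negligible sets.
\<close>

definition causal_plans ::
    "(real \<Rightarrow> 'x::topological_space measure) \<Rightarrow> (real \<Rightarrow> 'y::topological_space measure)
      \<Rightarrow> 'x measure \<Rightarrow> 'y measure \<Rightarrow> ('x \<times> 'y) measure set"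
  where "causal_plans BX BY \<eta> \<nu> = {\<gamma>\<in>plans \<eta> \<nu>. \<exists>\<Theta>. kernel_of \<gamma> \<eta> \<Theta> \<and>
    (\<forall>t\<in>{0..1}. \<forall>C\<in>sets (BY t). measure \<nu> (frontier C) = 0 \<longrightarrow>
      (\<lambda>x. measure (\<Theta> x) C) \<in> borel_measurable (completed_field \<eta> (BX t)))}"


section \<open>Brownian motion and the Ito integral\<close>

text \<open>A continuous process on \<open>[0,1]\<close> is a map into the path space.\<close>

definition adapted_process :: "(real \<Rightarrow> 'a measure) \<Rightarrow> ('a \<Rightarrow> 'd::finite wpath) \<Rightarrow> bool"
  where "adapted_process F X \<longleftrightarrow> (\<forall>t\<in>{0..1}. (\<lambda>\<omega>. path_at (X \<omega>) t) \<in> borel_measurable (F t))"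

definition brownian_motion :: "'a measure \<Rightarrow> (real \<Rightarrow> 'a measure) \<Rightarrow> ('a \<Rightarrow> 'd::finite wpath) \<Rightarrow> bool"
  where "brownian_motion M F B \<longleftrightarrow>
    adapted_process F B \<and>
    (AE \<omega> in M. path_at (B \<omega>) 0 = 0) \<and>
    (\<forall>s t. 0 \<le> s \<and> s < t \<and> t \<le> 1 \<longrightarrow>
      prob_space.indep_set M (sets (F s))
        (sets (vimage_algebra (space M) (\<lambda>\<omega>. path_at (B \<omega>) t - path_at (B \<omega>) s) borel)) \<and>
      distr M borel (\<lambda>\<omega>. path_at (B \<omega>) t - path_at (B \<omega>) s) =
        density lborel (\<lambda>x. ennreal (\<Prod>i\<in>UNIV. normal_density 0 (sqrt (t - s)) (x $ i))))"

definition predictable_field :: "(real \<Rightarrow> 'a measure) \<Rightarrow> (real \<times> 'a) measure"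
  where "predictable_field F = sigma ({0..1} \<times> space (F 0))
    ({{0} \<times> A | A. A \<in> sets (F 0)} \<union>
     {{s<..t} \<times> A | s t A. 0 \<le> s \<and> s < t \<and> t \<le> 1 \<and> A \<in> sets (F s)})"

definition predictable :: "(real \<Rightarrow> 'a measure) \<Rightarrow> (real \<Rightarrow> 'a \<Rightarrow> 'v::topological_space) \<Rightarrow> bool"
  where "predictable F H \<longleftrightarrow> (\<lambda>(t, \<omega>). H t \<omega>) \<in> predictable_field F \<rightarrow>\<^sub>M borel"

text \<open>
  The triple \<open>n, \<tau>, \<xi>\<close> stands for the simple process
  \<open>\<Sum>i<n. \<xi>\<^sub>i 1\<^bsub>(\<tau>\<^sub>i, \<tau>\<^sub>i\<^sub>+\<^sub>1]\<^esub>\<close>.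
\<close>

definition simple_data ::
    "(real \<Rightarrow> 'a measure) \<Rightarrow> nat \<Rightarrow> (nat \<Rightarrow> real) \<Rightarrow> (nat \<Rightarrow> 'a \<Rightarrow> real ^ 'd ^ 'd::finite) \<Rightarrow> bool"
  where "simple_data F n \<tau> \<xi> \<longleftrightarrow>
    (\<forall>i<n. 0 \<le> \<tau> i \<and> \<tau> i \<le> \<tau> (Suc i) \<and> \<tau> (Suc i) \<le> 1 \<and>
      \<xi> i \<in> borel_measurable (F (\<tau> i)) \<and> bounded (\<xi> i ` space (F (\<tau> i))))"

definition simple_process ::
    "nat \<Rightarrow> (nat \<Rightarrow> real) \<Rightarrow> (nat \<Rightarrow> 'a \<Rightarrow> real ^ 'd ^ 'd::finite) \<Rightarrow> real \<Rightarrow> 'a \<Rightarrow> real ^ 'd ^ 'd"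
  where "simple_process n \<tau> \<xi> t \<omega> = (\<Sum>i<n. indicator {\<tau> i<..\<tau> (Suc i)} t *\<^sub>R \<xi> i \<omega>)"

definition simple_integral_process ::
    "('a \<Rightarrow> 'd wpath) \<Rightarrow> nat \<Rightarrow> (nat \<Rightarrow> real) \<Rightarrow> (nat \<Rightarrow> 'a \<Rightarrow> real ^ 'd ^ 'd::finite)
      \<Rightarrow> real \<Rightarrow> 'a \<Rightarrow> real ^ 'd"
  where "simple_integral_process B n \<tau> \<xi> t \<omega> =
    (\<Sum>i<n. \<xi> i \<omega> *v (path_at (B \<omega>) (min (\<tau> (Suc i)) t) - path_at (B \<omega>) (min (\<tau> i) t)))"

definition null_in_probability :: "'a measure \<Rightarrow> (nat \<Rightarrow> 'a \<Rightarrow> ennreal) \<Rightarrow> bool"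
  where "null_in_probability M Z \<longleftrightarrow>
    (\<forall>k. Z k \<in> borel_measurable M) \<and>
    (\<forall>\<epsilon>>0. (\<lambda>k. measure M {\<omega>\<in>space M. \<epsilon> < Z k \<omega>}) \<longlonglongrightarrow> 0)"

text \<open>
  \<open>I\<close> is a version of the Ito integral \<open>\<integral> H dB\<close> of a predictable process with
  almost surely square integrable paths: the limit, uniformly on \<open>[0,1]\<close> in probability, of the
  integrals of simple processes that converge to \<open>H\<close> in \<open>L\<^sup>2([0,1])\<close> in
  probability.  The norm on matrices is the Frobenius norm.
\<close>

definition ito_integral ::
    "'a measure \<Rightarrow> (real \<Rightarrow> 'a measure) \<Rightarrow> (real \<Rightarrow> 'a \<Rightarrow> real ^ 'd ^ 'd::finite)
      \<Rightarrow> ('a \<Rightarrow> 'd wpath) \<Rightarrow> ('a \<Rightarrow> 'd wpath) \<Rightarrow> bool"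
  where "ito_integral M F H B I \<longleftrightarrow>
    predictable F H \<and>
    (AE \<omega> in M. (\<integral>\<^sup>+t\<in>{0..1}. ennreal ((norm (H t \<omega>))\<^sup>2) \<partial>lborel) < \<infinity>) \<and>
    adapted_process F I \<and>
    (\<exists>n \<tau> \<xi>. (\<forall>k. simple_data F (n k) (\<tau> k) (\<xi> k)) \<and>
      null_in_probability M (\<lambda>k \<omega>. \<integral>\<^sup>+t\<in>{0..1}.
        ennreal ((norm (H t \<omega> - simple_process (n k) (\<tau> k) (\<xi> k) t \<omega>))\<^sup>2) \<partial>lborel) \<and>
      null_in_probability M (\<lambda>k \<omega>. SUP t\<in>{0..1}.
        ennreal (norm (path_at (I \<omega>) t - simple_integral_process B (n k) (\<tau> k) (\<xi> k) t \<omega>))))"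


section \<open>Weak solutions\<close>

definition weak_solution ::
    "(real \<Rightarrow> 'd wpath \<Rightarrow> real ^ 'd ^ 'd) \<Rightarrow> (real \<Rightarrow> 'd wpath \<Rightarrow> real ^ 'd) \<Rightarrow> (real ^ 'd) measure
      \<Rightarrow> 'a measure \<Rightarrow> (real \<Rightarrow> 'a measure) \<Rightarrow> ('a \<Rightarrow> 'd::finite wpath) \<Rightarrow> ('a \<Rightarrow> 'd wpath) \<Rightarrow> bool"
  where "weak_solution \<sigma> b \<eta>\<^sub>0 M F X B \<longleftrightarrow>
    adapted_process F X \<and> brownian_motion M F B \<and>
    distr M borel (\<lambda>\<omega>. path_at (X \<omega>) 0) = \<eta>\<^sub>0 \<and>
    (AE \<omega> in M. (\<integral>\<^sup>+t\<in>{0..1}. ennreal (norm (b t (X \<omega>))) \<partial>lborel) < \<infinity>) \<and>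
    (\<exists>I. ito_integral M F (\<lambda>t \<omega>. \<sigma> t (X \<omega>)) B I \<and>
      (AE \<omega> in M. \<forall>t\<in>{0..1}.
        path_at (X \<omega>) t = path_at (X \<omega>) 0 + path_at (I \<omega>) t + (LINT s:{0..t}|lborel. b s (X \<omega>))))"

text \<open>
  HOL cannot quantify over the type of the sample space inside a formula, so the type \<open>'a\<close> is an
  argument.  Existence over some \<open>'a\<close> together with uniqueness over the same \<open>'a\<close> is implied by
  existence over some sample space and uniqueness over all of them, hence a theorem that assumes the
  former for an arbitrary \<open>'a\<close> covers the latter.
\<close>

definition weak_existence ::
    "'a itself \<Rightarrow> (real \<Rightarrow> 'd wpath \<Rightarrow> real ^ 'd ^ 'd) \<Rightarrow> (real \<Rightarrow> 'd wpath \<Rightarrow> real ^ 'd)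
      \<Rightarrow> (real ^ 'd::finite) measure \<Rightarrow> bool"
  where "weak_existence _ \<sigma> b \<eta>\<^sub>0 \<longleftrightarrow>
    (\<exists>(M :: 'a measure) F X B. complete_stochastic_basis M F \<and> weak_solution \<sigma> b \<eta>\<^sub>0 M F X B)"

definition law_of_solutions ::
    "'a itself \<Rightarrow> (real \<Rightarrow> 'd wpath \<Rightarrow> real ^ 'd ^ 'd) \<Rightarrow> (real \<Rightarrow> 'd wpath \<Rightarrow> real ^ 'd)
      \<Rightarrow> (real ^ 'd::finite) measure \<Rightarrow> 'd wpath measure \<Rightarrow> bool"
  where "law_of_solutions _ \<sigma> b \<eta>\<^sub>0 \<eta> \<longleftrightarrow> \<eta> \<in> borel_probs \<and>
    (\<forall>(M :: 'a measure) F X B. complete_stochastic_basis M F \<longrightarrow> weak_solution \<sigma> b \<eta>\<^sub>0 M F X B \<longrightarrow>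
      distr M borel X = \<eta>)"

definition weak_uniqueness ::
    "'a itself \<Rightarrow> (real \<Rightarrow> 'd wpath \<Rightarrow> real ^ 'd ^ 'd) \<Rightarrow> (real \<Rightarrow> 'd wpath \<Rightarrow> real ^ 'd)
      \<Rightarrow> (real ^ 'd::finite) measure \<Rightarrow> bool"
  where "weak_uniqueness T \<sigma> b \<eta>\<^sub>0 \<longleftrightarrow> (\<exists>!\<eta>. law_of_solutions T \<sigma> b \<eta>\<^sub>0 \<eta>)"

definition realizes_plan ::
    "(real \<Rightarrow> 'd wpath \<Rightarrow> real ^ 'd ^ 'd) \<Rightarrow> (real \<Rightarrow> 'd wpath \<Rightarrow> real ^ 'd) \<Rightarrow> (real ^ 'd) measure
      \<Rightarrow> (real \<Rightarrow> 's measure) \<Rightarrow> ('d wpath \<times> 's) measure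
      \<Rightarrow> 'a measure \<Rightarrow> (real \<Rightarrow> 'a measure) \<Rightarrow> ('a \<Rightarrow> 'd::finite wpath) \<Rightarrow> ('a \<Rightarrow> 'd wpath)
      \<Rightarrow> ('a \<Rightarrow> 's::topological_space) \<Rightarrow> bool"
  where "realizes_plan \<sigma> b \<eta>\<^sub>0 BS \<gamma> M F X B Y \<longleftrightarrow>
    complete_stochastic_basis M F \<and>
    weak_solution \<sigma> b \<eta>\<^sub>0 M F X B \<and>
    X \<in> M \<rightarrow>\<^sub>M borel \<and> Y \<in> M \<rightarrow>\<^sub>M borel \<and>
    (\<forall>t\<in>{0..1}. Y \<in> F t \<rightarrow>\<^sub>M BS t) \<and>
    \<gamma> = distr M borel (\<lambda>\<omega>. (X \<omega>, Y \<omega>))"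

end

theory Submission
  imports Defs
begin

text \<open>
  Take any weak solution \<open>(X, B)\<close> and glue it along \<open>X\<close> with the kernel of the plan, so that \<open>Y\<close> and
  \<open>B\<close> are conditionally independent given \<open>X\<close>.  Two things have to be seen.  First, \<open>B\<close> remains a
  Brownian motion for the filtration enlarged by \<open>Y\<close>: on rectangles whose \<open>S\<close>-factor is a
  continuity set, causality replaces \<open>Y\<close> by a functional of the past of \<open>X\<close>, and the
  continuity sets generate the filtration of \<open>S\<close> because it is regular.  Second, the equation only depends on
  the joint law of \<open>(X, B)\<close>: the stochastic integral is the limit of integrals of simple functionals
  of \<open>X\<close>, chosen close to \<open>\<sigma>\<close> under \<open>\<eta>\<close>, and Lenglart's inequality controls the error.

  If \<open>\<sigma>\<close> is non-degenerate, integrating simple approximations of \<open>\<sigma>\<^sup>-\<^sup>1\<close> against the driving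
  integral \<open>X - X\<^sub>0 - \<integral> b dt\<close> recovers \<open>B\<close> as an adapted functional of \<open>X\<close>, so the
  glued space may be replaced by its factor \<open>(W \<times> S, \<gamma>)\<close>.
\<close>


section \<open>The path space as a Polish space\<close>

text \<open>The definition of the Ito integral supplies some approximating simple processes, adapted
  to the given basis but not necessarily functions of \<open>X\<close>, so they cannot be carried to
  another space. They must be exchanged for functionals of the path, and finite energy of \<sigma>
  under \<eta> provides these as L2 limits. The comparison of the two approximations cannot rest on
  second moments, since the given one converges only in probability; this is why an inequality in
  probability takes the place of an isometry. On the measure side, causality speaks about
  \<eta>-completed fields, whereas rectangles of a product field are explicit only before
  completion. Independence on the glued space is therefore proved for the uncompleted product
  filtration, and one general passage, based on continuity of paths, carries a Brownian motion to
  the completed right limit. The kernel is a disintegration under \<eta>; it may be evaluated along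
  \<open>X\<close> because the solution has law \<eta>.\<close>

definition mk_path :: "(real \<Rightarrow> real ^ 'd) \<Rightarrow> 'd::finite wpath"
  where "mk_path f = Wpath (restrict f {0..1})"

lemma path_at_mk_path:
  assumes "continuous_on {0..1} f" "t \<in> {0..1}"
  shows "path_at (mk_path f) t = f t"
proof -
  have "continuous_on {0..1} (restrict f {0..1})"
    using assms(1) by (rule continuous_on_eq) auto
  then show ?thesis
    using assms(2) by (simp add: mk_path_def Wpath_inverse)
qed

lemma closure_rationals_unit_interval: "closure (\<rat> \<inter> {0..1}) = {0..1::real}"
proof
  show "closure (\<rat> \<inter> {0..1}) \<subseteq> {0..1::real}"
    by (rule closure_minimal) auto
  show "{0..1::real} \<subseteq> closure (\<rat> \<inter> {0..1})"
  proof
    fix t :: real assume t: "t \<in> {0..1}"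
    show "t \<in> closure (\<rat> \<inter> {0..1})"
    proof (cases "t = 1")
      case True
      then have "t \<in> \<rat> \<inter> {0..1}" by simp
      then show ?thesis using closure_subset by (rule rev_subsetD)
    next
      case False
      show ?thesis
        unfolding closure_approachable
      proof (intro allI impI)
        fix e :: real assume "0 < e"
        then have "t < min (t + e) 1" using t False by auto
        then obtain q where "q \<in> \<rat>" "t < q" "q < min (t + e) 1"
          using Rats_dense_in_real by blast
        then show "\<exists>y\<in>\<rat> \<inter> {0..1}. dist y t < e"
          using t by (intro bexI[of _ q]) (auto simp: dist_real_def)
      qed
    qed
  qed
qed

text \<open>A closed condition on a continuous function extends from the rational times by density.
  Suprema over \<open>[0,1]\<close> become measurable through this reduction to countably many
  times.\<close>

lemma le_on_unit_interval_iff: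
  fixes f :: "real \<Rightarrow> real"
  assumes "continuous_on {0..1} f"
  shows "(\<forall>t\<in>{0..1}. f t \<le> c) \<longleftrightarrow> (\<forall>t\<in>\<rat> \<inter> {0..1}. f t \<le> c)"
  using continuous_le_on_closure[of "\<rat> \<inter> {0..1}" f _ c] assms
  by (auto simp: closure_rationals_unit_interval)

lemma countable_rationals_unit_interval: "countable (\<rat> \<inter> {0..1::real})"
  by (intro countable_Int1 countable_rat)

lemma dist_wpath_le_iff: "dist \<omega> \<omega>' \<le> c \<longleftrightarrow> (\<forall>t\<in>{0..1}. dist (path_at \<omega> t) (path_at \<omega>' t) \<le> c)"
  for \<omega> \<omega>' :: "'d::finite wpath"
  using dist_wpath_le[of \<omega> \<omega>' c] dist_path_at_le[of _ \<omega> \<omega>'] by (meson order_trans)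

lemma dist_wpath_le_iff_rational:
  "dist \<omega> \<omega>' \<le> c \<longleftrightarrow> (\<forall>t\<in>\<rat> \<inter> {0..1}. dist (path_at \<omega> t) (path_at \<omega>' t) \<le> c)"
  for \<omega> \<omega>' :: "'d::finite wpath"
  unfolding dist_wpath_le_iff
  by (intro le_on_unit_interval_iff continuous_intros continuous_on_path_at)

text \<open>The dense set consists of Bernstein polynomials with coefficients in a countable dense
  set of values. Replacing the true values at k/n by nearby coefficients costs little, because the
  Bernstein weights are nonnegative and sum to 1; the remaining error is Weierstrass approximation
  in each component.\<close>

lemma wpath_countable_dense:
  "\<exists>D :: 'd::finite wpath set. countable D \<and> (\<forall>\<omega> e. 0 < e \<longrightarrow> (\<exists>p\<in>D. dist p \<omega> < e))"
proof -
  obtain Q :: "(real ^ 'd) set" where Q: "countable Q" "\<And>X. open X \<Longrightarrow> X \<noteq> {} \<Longrightarrow> \<exists>q\<in>Q. q \<in> X"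
    by (rule countable_dense_setE) blast
  define poly :: "(real ^ 'd) list \<Rightarrow> 'd wpath" where
    "poly xs = mk_path (\<lambda>t. \<Sum>k\<le>length xs - 1. Bernstein (length xs - 1) k t *\<^sub>R xs ! k)" for xs
  have cont: "continuous_on {0..1} (\<lambda>t. \<Sum>k\<le>n. Bernstein n k t *\<^sub>R x k)" for n and x :: "nat \<Rightarrow> real ^ 'd"
    unfolding Bernstein_def by (intro continuous_intros)
  have "\<exists>p\<in>poly ` lists Q. dist p \<omega> < e" if e: "0 < e" for \<omega> :: "'d wpath" and e :: real
  proof -
    \<comment> \<open>The norm is at most the sum of the absolute components, so this componentwise
      error adds up to e/4.\<close>
    define \<delta> where "\<delta> = e / (4 * real CARD('d))"
    have \<delta>: "0 < \<delta>" using e by (simp add: \<delta>_def)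
    have "\<exists>N. \<forall>n t. N \<le> n \<and> t \<in> {0..1} \<longrightarrow>
        \<bar>path_at \<omega> t $ i - (\<Sum>k\<le>n. path_at \<omega> (k / n) $ i * Bernstein n k t)\<bar> < \<delta>" for i
      by (intro Bernstein_Weierstrass continuous_intros continuous_on_path_at \<delta>)
    then have "\<exists>N. \<forall>i. \<forall>n t. N i \<le> n \<and> t \<in> {0..1} \<longrightarrow>
        \<bar>path_at \<omega> t $ i - (\<Sum>k\<le>n. path_at \<omega> (k / n) $ i * Bernstein n k t)\<bar> < \<delta>"
      by (intro choice allI)
    then obtain N where N: "\<And>i n t. N i \<le> n \<Longrightarrow> t \<in> {0..1} \<Longrightarrow>
        \<bar>path_at \<omega> t $ i - (\<Sum>k\<le>n. path_at \<omega> (k / n) $ i * Bernstein n k t)\<bar> < \<delta>"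
      by blast
    define n where "n = (\<Sum>i\<in>UNIV. N i)"
    have n: "N i \<le> n" for i
      unfolding n_def by (rule member_le_sum) simp_all
    have "\<exists>q\<in>Q. q \<in> ball (path_at \<omega> (real k / real n)) (e/4)" for k
      using e by (intro Q(2)) auto
    then obtain q where q: "\<And>k. q k \<in> Q" "\<And>k. dist (path_at \<omega> (real k / real n)) (q k) < e/4"
      by (metis mem_ball)
    define xs where "xs = map q [0..<Suc n]"
    have xs: "xs \<in> lists Q" using q by (auto simp: xs_def)
    have len: "length xs - 1 = n" by (simp add: xs_def)
    have nth: "xs ! k = q k" if "k \<le> n" for k
      using that by (simp add: xs_def nth_append)
    have "dist (path_at (poly xs) t) (path_at \<omega> t) \<le> e / 2" if t: "t \<in> {0..1}" for t
    proof -
      let ?B = "\<lambda>k. Bernstein n k t"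
      have B: "0 \<le> ?B k" for k using t by (auto intro: Bernstein_nonneg)
      have "path_at (poly xs) t = (\<Sum>k\<le>n. ?B k *\<^sub>R q k)"
        unfolding poly_def len using t nth by (subst path_at_mk_path) (auto intro!: cont sum.cong)
      moreover have "norm ((\<Sum>k\<le>n. ?B k *\<^sub>R q k) - (\<Sum>k\<le>n. ?B k *\<^sub>R path_at \<omega> (k / n))) \<le> e / 4"
      proof -
        have "(\<Sum>k\<le>n. ?B k *\<^sub>R q k) - (\<Sum>k\<le>n. ?B k *\<^sub>R path_at \<omega> (k / n)) = (\<Sum>k\<le>n. ?B k *\<^sub>R (q k - path_at \<omega> (k / n)))"
          by (simp add: sum_subtractf scaleR_right_diff_distrib)
        also have "norm \<dots> \<le> (\<Sum>k\<le>n. ?B k * (e / 4))"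
        proof (rule sum_norm_le)
          fix k
          have "norm (q k - path_at \<omega> (k / n)) \<le> e / 4"
            using q(2)[of k] by (simp add: dist_norm norm_minus_commute)
          then show "norm (?B k *\<^sub>R (q k - path_at \<omega> (k / n))) \<le> ?B k * (e / 4)"
            using B[of k] mult_left_mono[of _ "e / 4" "?B k"] by simp
        qed
        also have "\<dots> = (\<Sum>k\<le>n. ?B k) * (e / 4)" by (rule sum_distrib_right[symmetric])
        also have "\<dots> = e / 4" by simp
        finally show ?thesis .
      qed
      moreover have "norm ((\<Sum>k\<le>n. ?B k *\<^sub>R path_at \<omega> (k / n)) - path_at \<omega> t) \<le> e / 4"
      proof -
        have "norm ((\<Sum>k\<le>n. ?B k *\<^sub>R path_at \<omega> (k / n)) - path_at \<omega> t)
            \<le> (\<Sum>i\<in>UNIV. \<bar>((\<Sum>k\<le>n. ?B k *\<^sub>R path_at \<omega> (k / n)) - path_at \<omega> t) $ i\<bar>)"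
          by (rule norm_le_l1_cart)
        also have "\<dots> \<le> (\<Sum>i\<in>(UNIV :: 'd set). \<delta>)"
        proof (rule sum_mono)
          fix i
          have "((\<Sum>k\<le>n. ?B k *\<^sub>R path_at \<omega> (k / n)) - path_at \<omega> t) $ i =
              (\<Sum>k\<le>n. path_at \<omega> (k / n) $ i * ?B k) - path_at \<omega> t $ i"
            by (simp add: sum_component mult.commute)
          then show "\<bar>((\<Sum>k\<le>n. ?B k *\<^sub>R path_at \<omega> (k / n)) - path_at \<omega> t) $ i\<bar> \<le> \<delta>"
            using N[OF n t, of i] by simp
        qed
        also have "\<dots> = e / 4" by (simp add: \<delta>_def)
        finally show ?thesis .
      qed
      ultimately show ?thesis
        using norm_triangle_ineq[of "(\<Sum>k\<le>n. ?B k *\<^sub>R q k) - (\<Sum>k\<le>n. ?B k *\<^sub>R path_at \<omega> (k / n))"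
            "(\<Sum>k\<le>n. ?B k *\<^sub>R path_at \<omega> (k / n)) - path_at \<omega> t"]
        by (simp add: dist_norm)
    qed
    then have "dist (poly xs) \<omega> \<le> e / 2" by (rule dist_wpath_le)
    then show ?thesis using xs e by (intro bexI[of _ "poly xs"]) auto
  qed
  then show ?thesis
    using Q(1) by (intro exI[of _ "poly ` lists Q"]) (auto intro: countable_lists)
qed

text \<open>Balls rather than arbitrary open sets, since membership in a ball can be expressed by
  the coordinates; this makes the basis suitable for generating the Borel field from the
  evaluations.\<close>

lemma wpath_ball_basis:
  "\<exists>\<B> :: 'd::finite wpath set set. countable \<B> \<and> topological_basis \<B> \<and> (\<forall>U\<in>\<B>. \<exists>\<omega> r. U = ball \<omega> r)"
proof -
  obtain D :: "'d wpath set" where D: "countable D" "\<And>\<omega> e. 0 < e \<Longrightarrow> \<exists>p\<in>D. dist p \<omega> < e"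
    using wpath_countable_dense by metis
  let ?B = "(\<lambda>(p, r). ball p r) ` (D \<times> (\<rat> :: real set))"
  have "topological_basis ?B"
  proof (rule topological_basisI)
    fix U and \<omega> :: "'d wpath" assume "open U" "\<omega> \<in> U"
    then obtain e where e: "0 < e" "ball \<omega> e \<subseteq> U"
      by (auto simp: open_contains_ball)
    obtain r where r: "r \<in> \<rat>" "0 < r" "r < e / 2"
      using Rats_dense_in_real[of 0 "e / 2"] e by auto
    obtain p where p: "p \<in> D" "dist p \<omega> < r" using D(2) r by blast
    have "ball p r \<subseteq> ball \<omega> e"
    proof
      fix z assume "z \<in> ball p r"
      then show "z \<in> ball \<omega> e"
        using p r dist_triangle[of \<omega> z p] by (simp add: dist_commute)
    qed
    then show "\<exists>B'\<in>?B. \<omega> \<in> B' \<and> B' \<subseteq> U"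
      using p r e by (intro bexI[of _ "ball p r"]) auto
  qed auto
  moreover have "countable ?B" using D(1) by (intro countable_image countable_SIGMA countable_rat) auto
  ultimately show ?thesis by (intro exI[of _ ?B]) auto
qed

instance wpath :: (finite) second_countable_topology
proof
  show "\<exists>B :: 'a wpath set set. countable B \<and> open = generate_topology B"
    using wpath_ball_basis topological_basis_imp_subbasis by metis
qed

instance wpath :: (finite) complete_space
proof
  fix X :: "nat \<Rightarrow> 'a wpath" assume X: "Cauchy X"
  have "uniformly_Cauchy_on {0..1} (\<lambda>n. path_at (X n))"
    unfolding uniformly_Cauchy_on_def
  proof (intro allI impI)
    fix e :: real assume "0 < e"
    then obtain N where "\<And>m n. N \<le> m \<Longrightarrow> N \<le> n \<Longrightarrow> dist (X m) (X n) < e"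
      using metric_CauchyD[OF X] by blast
    then show "\<exists>M. \<forall>x\<in>{0..1}. \<forall>m\<ge>M. \<forall>n\<ge>M. dist (path_at (X m) x) (path_at (X n) x) < e"
      using dist_path_at_le order_le_less_trans by (intro exI[of _ N]) blast
  qed
  then have "uniformly_convergent_on {0..1} (\<lambda>n. path_at (X n))"
    by (rule Cauchy_uniformly_convergent)
  then obtain L where L: "uniform_limit {0..1} (\<lambda>n. path_at (X n)) L sequentially"
    by (auto simp: uniformly_convergent_on_def)
  then have "continuous_on {0..1} L"
    by (rule uniform_limit_theorem[rotated]) (auto simp: continuous_on_path_at)
  then have at: "path_at (mk_path L) t = L t" if "t \<in> {0..1}" for t
    using that by (rule path_at_mk_path)
  have "X \<longlonglongrightarrow> mk_path L"
  proof (rule metric_LIMSEQ_I)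
    fix r :: real assume "0 < r"
    then obtain N where N: "\<And>n t. N \<le> n \<Longrightarrow> t \<in> {0..1} \<Longrightarrow> dist (path_at (X n) t) (L t) < r / 2"
      using uniform_limitD[OF L half_gt_zero[OF \<open>0 < r\<close>]] unfolding eventually_sequentially
      by blast
    have "dist (X n) (mk_path L) < r" if "N \<le> n" for n
    proof -
      have "dist (X n) (mk_path L) \<le> r / 2"
        using N[OF that] by (intro dist_wpath_le) (simp add: at less_imp_le)
      then show ?thesis using \<open>0 < r\<close> by simp
    qed
    then show "\<exists>no. \<forall>n\<ge>no. dist (X n) (mk_path L) < r" by blast
  qed
  then show "convergent X" by (rule convergentI)
qed


section \<open>The canonical filtrations of the path space\<close>

lemma space_raw_path_filtration [simp]: "space (raw_path_filtration t) = UNIV"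
  by (simp add: raw_path_filtration_def)

lemma sets_raw_path_filtration:
  "sets (raw_path_filtration t) = sigma_sets UNIV {(\<lambda>\<omega>. path_at \<omega> s) -` A | s A. s \<in> {0..t} \<and> A \<in> sets borel}"
  by (simp add: raw_path_filtration_def)

lemma measurable_path_at_raw:
  assumes "s \<in> {0..t}"
  shows "(\<lambda>\<omega>. path_at \<omega> s) \<in> raw_path_filtration t \<rightarrow>\<^sub>M borel"
  using assms by (intro measurableI) (auto simp: sets_raw_path_filtration intro!: sigma_sets.Basic)

lemma measurable_raw_path_filtration:
  fixes X :: "'a \<Rightarrow> 'd::finite wpath"
  assumes "\<And>s. s \<in> {0..t} \<Longrightarrow> (\<lambda>x. path_at (X x) s) \<in> N \<rightarrow>\<^sub>M borel"
  shows "X \<in> N \<rightarrow>\<^sub>M raw_path_filtration t"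
  unfolding raw_path_filtration_def
proof (rule measurable_measure_of)
  fix U :: "'d wpath set" assume "U \<in> {(\<lambda>\<omega>. path_at \<omega> s) -` A |s A. s \<in> {0..t} \<and> A \<in> sets borel}"
  then obtain s A where "s \<in> {0..t}" "A \<in> sets borel" "U = (\<lambda>\<omega>. path_at \<omega> s) -` A" by auto
  then show "X -` U \<inter> space N \<in> sets N"
    using measurable_sets[OF assms, of s A] by (simp add: vimage_def)
qed auto

lemma raw_path_filtration_mono: "s \<le> t \<Longrightarrow> sets (raw_path_filtration s) \<subseteq> sets (raw_path_filtration t)"
  unfolding sets_raw_path_filtration
proof (rule sigma_sets_mono', rule subsetI)
  fix U assume "s \<le> t" "U \<in> {(\<lambda>\<omega>. path_at \<omega> r) -` A | r A. r \<in> {0..s} \<and> A \<in> sets borel}"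
  then obtain r A where "U = (\<lambda>\<omega>. path_at \<omega> r) -` A" "r \<in> {0..t}" "A \<in> sets borel" by force
  then show "U \<in> {(\<lambda>\<omega>. path_at \<omega> s) -` A | s A. s \<in> {0..t} \<and> A \<in> sets borel}" by blast
qed

text \<open>Evaluations are continuous, which gives one inclusion. Conversely each ball of a
  countable basis is a countable combination of coordinate conditions at rational times, so the
  evaluations generate all Borel sets.\<close>

lemma sets_raw_path_filtration_1: "sets (raw_path_filtration 1) = sets (borel :: 'd::finite wpath measure)"
proof
  have "continuous_on UNIV (\<lambda>\<omega> :: 'd wpath. path_at \<omega> s)" if "s \<in> {0..1}" for s
    using dist_path_at_le[OF that] by (auto simp: continuous_on_iff intro: order_le_less_trans)
  then have "(\<lambda>\<omega> :: 'd wpath. path_at \<omega> s) \<in> borel \<rightarrow>\<^sub>M borel" if "s \<in> {0..1}" for s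
    using that by (intro borel_measurable_continuous_onI)
  then have "(\<lambda>\<omega>. \<omega>) \<in> borel \<rightarrow>\<^sub>M (raw_path_filtration 1 :: 'd wpath measure)"
    by (rule measurable_raw_path_filtration)
  from measurable_sets[OF this] show "sets (raw_path_filtration 1) \<subseteq> sets (borel :: 'd wpath measure)"
    by auto
next
  obtain \<B> :: "'d wpath set set" where \<B>: "countable \<B>" "topological_basis \<B>" "\<And>U. U \<in> \<B> \<Longrightarrow> \<exists>\<omega> r. U = ball \<omega> r"
    using wpath_ball_basis by metis
  have "ball \<omega> r \<in> sets (raw_path_filtration 1)" for \<omega> :: "'d wpath" and r
  proof -
    \<comment> \<open>The open ball is exhausted by closed balls, because only the non-strict
      inequality can be tested at rational times: the supremum in the distance may reach
      \<open>r\<close> although every rational time stays below it.\<close>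
    have "ball \<omega> r = (\<Union>n::nat. \<Inter>t\<in>\<rat> \<inter> {0..1}. (\<lambda>\<omega>'. path_at \<omega>' t) -` cball (path_at \<omega> t) (r - inverse (Suc n)))"
      (is "_ = ?R")
    proof -
      have "\<omega>' \<in> ball \<omega> r \<longleftrightarrow> (\<exists>n::nat. dist \<omega> \<omega>' \<le> r - inverse (Suc n))" for \<omega>'
      proof
        assume "\<omega>' \<in> ball \<omega> r"
        then have "0 < r - dist \<omega> \<omega>'" by simp
        then obtain n where "inverse (real (Suc n)) < r - dist \<omega> \<omega>'" using reals_Archimedean by blast
        then show "\<exists>n::nat. dist \<omega> \<omega>' \<le> r - inverse (Suc n)" by (intro exI[of _ n]) simp
      next
        assume "\<exists>n::nat. dist \<omega> \<omega>' \<le> r - inverse (Suc n)"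
        then obtain n :: nat where "dist \<omega> \<omega>' \<le> r - inverse (Suc n)" by blast
        moreover have "0 < inverse (real (Suc n))" by simp
        ultimately show "\<omega>' \<in> ball \<omega> r" unfolding mem_ball by linarith
      qed
      then show ?thesis
        unfolding dist_wpath_le_iff_rational set_eq_iff by (simp del: of_nat_Suc mem_ball)
    qed
    moreover have "?R \<in> sets (raw_path_filtration 1)"
    proof -
      have "(\<lambda>\<omega>' :: 'd wpath. path_at \<omega>' t) -` cball x c \<in> sets (raw_path_filtration 1)" if "t \<in> \<rat> \<inter> {0..1}" for t x c
        using that measurable_sets[OF measurable_path_at_raw[of t 1], of "cball x c"] by simp
      then have "(\<Inter>t\<in>\<rat> \<inter> {0..1}. (\<lambda>\<omega>'. path_at \<omega>' t) -` cball (path_at \<omega> t) c) \<in> sets (raw_path_filtration 1)" for c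
        using sets.top[of "raw_path_filtration 1"]
        by (intro sets.countable_INT'' countable_rationals_unit_interval) auto
      then show ?thesis
        by (intro sets.countable_nat_UN image_subsetI)
    qed
    ultimately show ?thesis by simp
  qed
  then have "sigma_sets UNIV \<B> \<subseteq> sets (raw_path_filtration 1)"
    using \<B>(3) sets.sigma_sets_subset[of \<B> "raw_path_filtration 1"] by force
  then show "sets (borel :: 'd wpath measure) \<subseteq> sets (raw_path_filtration 1)"
    unfolding borel_eq_countable_basis[OF \<B>(1,2)] by simp
qed

lemma measurable_path_at_borel [measurable]: "t \<in> {0..1} \<Longrightarrow> (\<lambda>\<omega>. path_at \<omega> t) \<in> borel \<rightarrow>\<^sub>M borel"
  using measurable_path_at_raw[of t 1] by (simp add: measurable_def sets_raw_path_filtration_1)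

lemma borel_measurable_wpathI:
  assumes "\<And>s. s \<in> {0..1} \<Longrightarrow> (\<lambda>x. path_at (X x) s) \<in> N \<rightarrow>\<^sub>M borel"
  shows "X \<in> N \<rightarrow>\<^sub>M borel"
  using measurable_raw_path_filtration[of 1 X N] assms by (simp add: measurable_def sets_raw_path_filtration_1)

lemma space_path_filtration [simp]: "space (path_filtration t) = UNIV"
  by (simp add: path_filtration_def right_limit_def)

lemma sets_path_filtration:
  "sets (path_filtration t) = (\<Inter>\<epsilon>\<in>{0<..}. sets (raw_path_filtration (min (t + \<epsilon>) 1)))"
  unfolding path_filtration_def by (rule sets_right_limit) simp

lemma path_filtration_mono: "s \<le> t \<Longrightarrow> sets (path_filtration s) \<subseteq> sets (path_filtration t)"
  unfolding sets_path_filtration by (intro INF_superset_mono subset_refl raw_path_filtration_mono) auto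

lemma raw_le_path_filtration:
  assumes "t \<le> 1" shows "sets (raw_path_filtration t) \<subseteq> sets (path_filtration t)"
  unfolding sets_path_filtration using assms by (intro INT_greatest raw_path_filtration_mono) auto

lemma path_filtration_le_borel: "sets (path_filtration t) \<subseteq> sets (borel :: 'd::finite wpath measure)"
proof -
  have "sets (path_filtration t) \<subseteq> sets (raw_path_filtration (min (t + 1) 1))"
    unfolding sets_path_filtration by (rule INT_lower) simp
  also have "\<dots> \<subseteq> sets (raw_path_filtration 1)" by (rule raw_path_filtration_mono) simp
  finally show ?thesis by (simp add: sets_raw_path_filtration_1)
qed

lemma measurable_path_at_path_filtration:
  assumes "s \<in> {0..t}" "t \<le> 1"
  shows "(\<lambda>\<omega>. path_at \<omega> s) \<in> path_filtration t \<rightarrow>\<^sub>M borel"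
  using measurable_path_at_raw[OF assms(1)] raw_le_path_filtration[OF assms(2)]
  by (auto simp: measurable_def)


section \<open>Completed right limits of filtrations\<close>

lemma space_completed_field [simp]: "space (completed_field M G) = space M"
  by (simp add: completed_field_def space_measure_of_conv)

lemma negligible_sets_subset_Pow: "negligible_sets M \<subseteq> Pow (space M)"
  unfolding negligible_sets_def using sets.sets_into_space by blast

lemma sets_completed_field:
  assumes "subalgebra M G"
  shows "sets (completed_field M G) = sigma_sets (space M) (sets G \<union> negligible_sets M)"
  unfolding completed_field_def
  using assms negligible_sets_subset_Pow[of M] sets.space_closed[of G]
  by (intro sets_measure_of) (auto simp: subalgebra_def)

lemma le_completed_field:
  assumes "subalgebra M G"
  shows "sets G \<subseteq> sets (completed_field M G)" "negligible_sets M \<subseteq> sets (completed_field M G)"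
  unfolding sets_completed_field[OF assms] by auto

lemma negligible_sets_eq: "negligible_sets M = null_sets (completion M)"
proof (rule set_eqI)
  fix N
  have "N \<in> negligible_sets M \<longleftrightarrow> (\<exists>Z\<in>null_sets M. N \<subseteq> Z)"
    unfolding negligible_sets_def by (rule mem_Collect_eq)
  then show "N \<in> negligible_sets M \<longleftrightarrow> N \<in> null_sets (completion M)"
    unfolding null_sets_completion_iff2[of N M] .
qed

lemma completed_field_le_completion:
  assumes "subalgebra M G"
  shows "sets (completed_field M G) \<subseteq> sets (completion M)"
proof -
  have "sigma_sets (space (completion M)) (sets G \<union> negligible_sets M) \<subseteq> sets (completion M)"
    using assms by (intro sets.sigma_sets_subset) (auto simp: negligible_sets_eq subalgebra_def)
  then show ?thesis by (simp add: sets_completed_field[OF assms])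
qed

lemma completed_field_mono:
  assumes "subalgebra M G" "subalgebra M H" "sets G \<subseteq> sets H"
  shows "sets (completed_field M G) \<subseteq> sets (completed_field M H)"
  unfolding sets_completed_field[OF assms(1)] sets_completed_field[OF assms(2)]
  using assms(3) by (intro sigma_sets_mono') auto

text \<open>The sets that agree with a member of \<open>G\<close> up to a negligible set form a
  sigma-field containing \<open>G\<close> and all negligible sets. Probabilities over the completed
  field can thus be computed with representatives from \<open>G\<close>.\<close>

lemma completed_fieldE:
  assumes G: "subalgebra M G" and A: "A \<in> sets (completed_field M G)"
  obtains C where "C \<in> sets G" "(A - C) \<union> (C - A) \<in> negligible_sets M"
proof -
  have "\<exists>C\<in>sets G. (A - C) \<union> (C - A) \<in> null_sets (completion M)"
    using A unfolding sets_completed_field[OF G]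
  proof induction
    case (Basic A)
    then show ?case
    proof
      assume "A \<in> negligible_sets M"
      then show ?thesis by (intro bexI[of _ "{}"]) (auto simp: negligible_sets_eq)
    qed (auto intro!: bexI[of _ A])
  next
    case Empty
    then show ?case by (intro bexI[of _ "{}"]) auto
  next
    case (Compl A)
    then obtain C where C: "C \<in> sets G" "(A - C) \<union> (C - A) \<in> null_sets (completion M)" by auto
    have "space M - C \<in> sets G" using C G sets.compl_sets[of C G] by (simp add: subalgebra_def)
    moreover have "((space M - A) - (space M - C)) \<union> ((space M - C) - (space M - A)) \<in> null_sets (completion M)"
      by (rule null_sets_completion_subset[OF _ C(2)]) auto
    ultimately show ?case by blast
  next
    case (Union A)
    then obtain C where C: "\<And>i::nat. C i \<in> sets G" "\<And>i. (A i - C i) \<union> (C i - A i) \<in> null_sets (completion M)"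
      by metis
    have "((\<Union>i. A i) - (\<Union>i. C i)) \<union> ((\<Union>i. C i) - (\<Union>i. A i)) \<in> null_sets (completion M)"
      by (rule null_sets_completion_subset[OF _ null_sets_UN[of "\<lambda>i. (A i - C i) \<union> (C i - A i)"]]) (use C in auto)
    moreover have "(\<Union>i. C i) \<in> sets G" using C(1) by auto
    ultimately show ?case by blast
  qed
  then show thesis using that by (auto simp: negligible_sets_eq)
qed

text \<open>The order of the two operations shapes the argument: null sets are inserted at every
  time first, so they survive the intersection that defines the right limit, and the right limit
  taken last gives right-continuity.\<close>

lemma complete_stochastic_basis_right_limit:
  assumes P: "prob_space P" and sub: "\<And>t. t \<in> {0..1} \<Longrightarrow> subalgebra P (G t)"
    and mono: "\<And>s t. s \<in> {0..1} \<Longrightarrow> t \<in> {0..1} \<Longrightarrow> s \<le> t \<Longrightarrow> sets (G s) \<subseteq> sets (G t)"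
  shows "complete_stochastic_basis (completion P) (right_limit (\<lambda>t. completed_field P (G t)))"
proof -
  define C where "C t = sets (completed_field P (G t))" for t
  define F where "F = right_limit (\<lambda>t. completed_field P (G t))"
  have F: "sets (F t) = (\<Inter>\<epsilon>\<in>{0<..}. C (min (t + \<epsilon>) 1))" for t
    unfolding F_def C_def by (rule sets_right_limit) simp
  have space_F [simp]: "space (F t) = space P" for t
    by (simp add: F_def right_limit_def space_measure_of_conv)
  have C_mono: "C s \<subseteq> C t" if "s \<in> {0..1}" "t \<in> {0..1}" "s \<le> t" for s t
    unfolding C_def using that by (intro completed_field_mono sub mono)
  have C_le: "C t \<subseteq> sets (completion P)" if "t \<in> {0..1}" for t
    unfolding C_def by (intro completed_field_le_completion sub that)
  have null: "null_sets (completion P) \<subseteq> C t" if "t \<in> {0..1}" for t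
    using le_completed_field(2)[OF sub[OF that]] unfolding C_def negligible_sets_eq .
  have F_mono: "sets (F s) \<subseteq> sets (F t)" if "s \<in> {0..1}" "t \<in> {0..1}" "s \<le> t" for s t
    unfolding F using that by (intro INF_superset_mono subset_refl C_mono) auto
  have F_le: "sets (F t) \<subseteq> sets (completion P)" if "t \<in> {0..1}" for t
  proof -
    have "sets (F t) \<subseteq> C (min (t + 1) 1)" unfolding F by (rule INT_lower) simp
    also have "\<dots> \<subseteq> sets (completion P)" using that by (intro C_le) auto
    finally show ?thesis .
  qed
  have right: "sets (F t) = (\<Inter>\<epsilon>\<in>{0<..}. sets (F (min (t + \<epsilon>) 1)))" if t: "t \<in> {0..1}" for t
  proof
    show "sets (F t) \<subseteq> (\<Inter>\<epsilon>\<in>{0<..}. sets (F (min (t + \<epsilon>) 1)))"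
      using t by (intro INT_greatest F_mono) auto
    show "(\<Inter>\<epsilon>\<in>{0<..}. sets (F (min (t + \<epsilon>) 1))) \<subseteq> sets (F t)"
    proof
      fix A assume A: "A \<in> (\<Inter>\<epsilon>\<in>{0<..}. sets (F (min (t + \<epsilon>) 1)))"
      have "A \<in> C (min (t + \<epsilon>) 1)" if "0 < \<epsilon>" for \<epsilon> :: real
      proof -
        \<comment> \<open>One half of \<epsilon> is spent on moving to a later time, the other half
          on the look-ahead inside the right limit at that time.\<close>
        have "A \<in> sets (F (min (t + \<epsilon> / 2) 1))" using A that by auto
        then have "A \<in> C (min (min (t + \<epsilon> / 2) 1 + \<epsilon> / 2) 1)" unfolding F using that by auto
        also have "min (min (t + \<epsilon> / 2) 1 + \<epsilon> / 2) 1 = min (t + \<epsilon>) 1" using that by (auto simp: min_def field_simps)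
        finally show ?thesis .
      qed
      then show "A \<in> sets (F t)" unfolding F by auto
    qed
  qed
  have F_null: "null_sets (completion P) \<subseteq> sets (F t)" if "t \<in> {0..1}" for t
    unfolding F using that by (intro INT_greatest null) auto
  show ?thesis
    unfolding complete_stochastic_basis_def F_def[symmetric] subalgebra_def
  proof (intro conjI ballI impI)
    show "prob_space (completion P)" by (rule prob_space.prob_space_completion[OF P])
    show "complete_measure (completion P)" by (rule completion.complete_measure_axioms)
  qed (simp, (rule F_le F_mono F_null right; assumption)+)
qed

lemma le_right_limit_completed_field:
  assumes sub: "\<And>t. t \<in> {0..1} \<Longrightarrow> subalgebra P (G t)"
    and mono: "\<And>s t. s \<in> {0..1} \<Longrightarrow> t \<in> {0..1} \<Longrightarrow> s \<le> t \<Longrightarrow> sets (G s) \<subseteq> sets (G t)"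
    and t: "t \<in> {0..1}"
  shows "sets (G t) \<subseteq> sets (right_limit (\<lambda>t. completed_field P (G t)) t)"
proof -
  have "sets (G t) \<subseteq> sets (completed_field P (G (min (t + \<epsilon>) 1)))" if "0 < \<epsilon>" for \<epsilon>
  proof -
    have u: "min (t + \<epsilon>) 1 \<in> {0..1}" "t \<le> min (t + \<epsilon>) 1" using t that by auto
    show ?thesis using mono[OF t u] le_completed_field(1)[OF sub[OF u(1)]] by (rule order_trans)
  qed
  then show ?thesis
    by (subst sets_right_limit[where \<Omega> = "space P"]) (simp, rule INT_greatest, simp)
qed

lemma space_right_limit_completed_field [simp]:
  "space (right_limit (\<lambda>t. completed_field P (G t)) t) = space P"
  by (simp add: right_limit_def space_measure_of_conv)


section \<open>Adapted path-valued maps\<close>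

lemma basisD:
  assumes "complete_stochastic_basis M F"
  shows "prob_space M" "complete_measure M"
    and "t \<in> {0..1} \<Longrightarrow> space (F t) = space M"
    and "t \<in> {0..1} \<Longrightarrow> sets (F t) \<subseteq> sets M"
    and "s \<in> {0..1} \<Longrightarrow> t \<in> {0..1} \<Longrightarrow> s \<le> t \<Longrightarrow> sets (F s) \<subseteq> sets (F t)"
    and "t \<in> {0..1} \<Longrightarrow> null_sets M \<subseteq> sets (F t)"
    and "t \<in> {0..1} \<Longrightarrow> sets (F t) = (\<Inter>\<epsilon>\<in>{0<..}. sets (F (min (t + \<epsilon>) 1)))"
proof -
  have sub: "subalgebra M (F t)" if "t \<in> {0..1}" for t
    using assms that unfolding complete_stochastic_basis_def by (elim conjE bspec)
  show "space (F t) = space M" "sets (F t) \<subseteq> sets M" if "t \<in> {0..1}"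
    using sub[OF that] unfolding subalgebra_def by blast+
  show "prob_space M" "complete_measure M"
    using assms unfolding complete_stochastic_basis_def by blast+
  show "sets (F s) \<subseteq> sets (F t)" if "s \<in> {0..1}" "t \<in> {0..1}" "s \<le> t"
    using assms that unfolding complete_stochastic_basis_def by (elim conjE) blast
  show "null_sets M \<subseteq> sets (F t)" if "t \<in> {0..1}"
    using assms that unfolding complete_stochastic_basis_def by (elim conjE bspec)
  show "sets (F t) = (\<Inter>\<epsilon>\<in>{0<..}. sets (F (min (t + \<epsilon>) 1)))" if "t \<in> {0..1}"
    using assms that unfolding complete_stochastic_basis_def by (elim conjE bspec)
qed

lemma basis_measurable_mono:
  assumes "complete_stochastic_basis M F" "s \<in> {0..1}" "t \<in> {0..1}" "s \<le> t" "f \<in> F s \<rightarrow>\<^sub>M N"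
  shows "f \<in> F t \<rightarrow>\<^sub>M N"
proof (rule measurable_from_subalg[OF _ assms(5)])
  show "subalgebra (F t) (F s)"
    unfolding subalgebra_def
    using basisD(3)[OF assms(1,2)] basisD(3)[OF assms(1,3)] basisD(5)[OF assms(1-4)] by simp
qed

lemma basis_measurable:
  assumes "complete_stochastic_basis M F" "t \<in> {0..1}" "f \<in> F t \<rightarrow>\<^sub>M N"
  shows "f \<in> M \<rightarrow>\<^sub>M N"
  using assms by (intro measurable_from_subalg[OF _ assms(3)]) (simp add: complete_stochastic_basis_def)

lemma adapted_process_measurable:
  assumes basis: "complete_stochastic_basis M F" and X: "adapted_process F X"
  shows "X \<in> M \<rightarrow>\<^sub>M borel"
  using X unfolding adapted_process_def
  by (intro borel_measurable_wpathI basis_measurable[OF basis]) auto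

text \<open>\<open>path_filtration t\<close> looks infinitesimally beyond \<open>t\<close>. The
  preimage of such a set lies in \<open>F\<close> at every later time, and right-continuity of the
  basis brings it back to \<open>t\<close>.\<close>

lemma adapted_process_path_filtration:
  assumes basis: "complete_stochastic_basis M F" and X: "adapted_process F X" and t: "t \<in> {0..1}"
  shows "X \<in> F t \<rightarrow>\<^sub>M path_filtration t"
proof (rule measurableI)
  fix A assume A: "A \<in> sets (path_filtration t :: 'b wpath measure)"
  have "X -` A \<inter> space M \<in> sets (F (min (t + \<epsilon>) 1))" if "0 < \<epsilon>" for \<epsilon>
  proof -
    let ?u = "min (t + \<epsilon>) 1"
    have u: "?u \<in> {0..1}" using t that by auto
    have "X \<in> F ?u \<rightarrow>\<^sub>M raw_path_filtration ?u"
      using X u unfolding adapted_process_def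
      by (intro measurable_raw_path_filtration basis_measurable_mono[OF basis _ u]) auto
    moreover have "A \<in> sets (raw_path_filtration ?u)" using A that unfolding sets_path_filtration by auto
    ultimately show ?thesis using measurable_sets[of X "F ?u"] basisD(3)[OF basis u] by fastforce
  qed
  then show "X -` A \<inter> space (F t) \<in> sets (F t)"
    unfolding basisD(7)[OF basis t] basisD(3)[OF basis t] by auto
qed simp

lemma subalgebra_path_filtration:
  "sets \<eta> = sets (borel :: 'd::finite wpath measure) \<Longrightarrow> subalgebra \<eta> (path_filtration t)"
  using path_filtration_le_borel[of t] sets_eq_imp_space_eq[of \<eta> borel] by (auto simp: subalgebra_def)

lemma null_sets_vimage:
  assumes "X \<in> M \<rightarrow>\<^sub>M N" "Z \<in> null_sets (distr M N X)"
  shows "X -` Z \<inter> space M \<in> null_sets M"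
  using assms by (auto simp: null_sets_def emeasure_distr)

text \<open>Null sets of the law pull back to null sets of \<open>M\<close>; by completeness their
  subsets are null sets too, and the usual conditions put these into every \<open>F t\<close>.
  Functionals adapted only up to null sets, such as the kernel of a causal plan, can therefore be
  evaluated along \<open>X\<close>.\<close>

lemma adapted_process_completed_path_filtration:
  assumes basis: "complete_stochastic_basis M F" and X: "adapted_process F X" and t: "t \<in> {0..1}"
    and law: "distr M borel X = \<eta>"
  shows "X \<in> F t \<rightarrow>\<^sub>M completed_field \<eta> (path_filtration t)"
proof -
  interpret complete_measure M by (rule basisD[OF basis])
  note Xb = adapted_process_measurable[OF basis X]
  have [simp]: "space \<eta> = UNIV" using law by auto
  show ?thesis
    unfolding completed_field_def
  proof (rule measurable_measure_of)
    fix A assume "A \<in> sets (path_filtration t) \<union> negligible_sets \<eta>"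
    then show "X -` A \<inter> space (F t) \<in> sets (F t)"
    proof
      assume "A \<in> sets (path_filtration t)"
      then show ?thesis using adapted_process_path_filtration[OF basis X t] by (rule measurable_sets[rotated])
    next
      assume "A \<in> negligible_sets \<eta>"
      then obtain Z where Z: "Z \<in> null_sets \<eta>" "A \<subseteq> Z" by (auto simp: negligible_sets_def)
      have "X -` Z \<inter> space M \<in> null_sets M"
        using Xb Z(1) unfolding law[symmetric] by (rule null_sets_vimage)
      then have "X -` A \<inter> space M \<in> null_sets M"
        by (rule complete2[rotated]) (use Z(2) in blast)
      then show ?thesis using basisD(3,6)[OF basis t] by auto
    qed
  qed auto
qed


section \<open>Independent increments\<close>

lemma (in prob_space) indep_set_vimage_iff:
  assumes D: "D \<in> M \<rightarrow>\<^sub>M borel" and A: "\<A> \<subseteq> events"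
  shows "indep_set \<A> (sets (vimage_algebra (space M) D borel)) \<longleftrightarrow>
    (\<forall>A\<in>\<A>. \<forall>E\<in>sets borel. prob (A \<inter> (D -` E \<inter> space M)) = prob A * prob (D -` E \<inter> space M))"
proof -
  have V: "sets (vimage_algebra (space M) D borel) = {D -` E \<inter> space M | E. E \<in> sets borel}"
    by (rule sets_vimage_algebra2) auto
  show ?thesis
  proof
    assume "indep_set \<A> (sets (vimage_algebra (space M) D borel))"
    from indep_setD[OF this] show "\<forall>A\<in>\<A>. \<forall>E\<in>sets borel. prob (A \<inter> (D -` E \<inter> space M)) = prob A * prob (D -` E \<inter> space M)"
      unfolding V by blast
  next
    assume "\<forall>A\<in>\<A>. \<forall>E\<in>sets borel. prob (A \<inter> (D -` E \<inter> space M)) = prob A * prob (D -` E \<inter> space M)"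
    then show "indep_set \<A> (sets (vimage_algebra (space M) D borel))"
      using A measurable_sets[OF D] unfolding V by (intro indep_setI) auto
  qed
qed

text \<open>Independence of an event from \<open>D\<close> as an identity of measures: on
  \<open>A\<close> the law of \<open>D\<close> is the full law scaled by the mass of
  \<open>A\<close>. In this form it extends from sets to integrals of functions of
  \<open>D\<close>.\<close>

lemma (in prob_space) distr_density_indicator_eq_scale:
  assumes D: "D \<in> M \<rightarrow>\<^sub>M borel" and A: "A \<in> events"
    and indep: "\<And>E. E \<in> sets borel \<Longrightarrow> prob (A \<inter> (D -` E \<inter> space M)) = prob A * prob (D -` E \<inter> space M)"
  shows "distr (density M (indicator A)) borel D = scale_measure (emeasure M A) (distr M borel D)"
proof (rule measure_eqI)
  fix E assume "E \<in> sets (distr (density M (indicator A)) borel D)"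
  then have E: "E \<in> sets borel" by simp
  have DE: "D -` E \<inter> space M \<in> events" using D E by (rule measurable_sets)
  have "emeasure (distr (density M (indicator A)) borel D) E = (\<integral>\<^sup>+x. indicator A x * indicator (D -` E \<inter> space M) x \<partial>M)"
    using D E A DE by (simp add: emeasure_distr emeasure_density)
  also have "\<dots> = emeasure M (A \<inter> (D -` E \<inter> space M))"
    using A DE by (simp add: indicator_inter_arith[symmetric])
  also have "\<dots> = emeasure M A * emeasure M (D -` E \<inter> space M)"
    using indep[OF E] by (simp add: emeasure_eq_measure ennreal_mult)
  finally show "emeasure (distr (density M (indicator A)) borel D) E = emeasure (scale_measure (emeasure M A) (distr M borel D)) E"
    using D E by (simp add: emeasure_distr)
qed simp

text \<open>Convergence of \<open>Dn\<close> does not give convergence of the indicators of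
  \<open>E\<close>, so the product formula is passed to the limit for bounded continuous functions,
  from there to closed sets, and finally to all Borel sets, since the closed sets are an
  intersection-stable generator.\<close>

lemma (in prob_space) indep_event_limit:
  fixes D :: "'a \<Rightarrow> 'b::metric_space"
  assumes A: "A \<in> events" and Dn: "\<And>n. Dn n \<in> M \<rightarrow>\<^sub>M borel" and D: "D \<in> M \<rightarrow>\<^sub>M borel"
    and lim: "\<And>\<omega>. \<omega> \<in> space M \<Longrightarrow> (\<lambda>n. Dn n \<omega>) \<longlonglongrightarrow> D \<omega>"
    and indep: "\<And>n E. E \<in> sets borel \<Longrightarrow> prob (A \<inter> (Dn n -` E \<inter> space M)) = prob A * prob (Dn n -` E \<inter> space M)"
    and E: "E \<in> sets borel"
  shows "prob (A \<inter> (D -` E \<inter> space M)) = prob A * prob (D -` E \<inter> space M)"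
proof -
  have *: "(\<integral>\<^sup>+\<omega>. indicator A \<omega> * \<phi> (Dn n \<omega>) \<partial>M) = emeasure M A * (\<integral>\<^sup>+\<omega>. \<phi> (Dn n \<omega>) \<partial>M)"
    if \<phi>: "\<phi> \<in> borel_measurable borel" for \<phi> n
  proof -
    have "(\<integral>\<^sup>+\<omega>. indicator A \<omega> * \<phi> (Dn n \<omega>) \<partial>M) = (\<integral>\<^sup>+x. \<phi> x \<partial>distr (density M (indicator A)) borel (Dn n))"
      using \<phi> Dn A by (simp add: nn_integral_distr nn_integral_density)
    also have "\<dots> = emeasure M A * (\<integral>\<^sup>+\<omega>. \<phi> (Dn n \<omega>) \<partial>M)"
      using \<phi> Dn by (simp add: distr_density_indicator_eq_scale[OF Dn A indep] nn_integral_scale_measure nn_integral_distr)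
    finally show ?thesis .
  qed
  have cont: "(\<integral>\<^sup>+\<omega>. indicator A \<omega> * \<phi> (D \<omega>) \<partial>M) = emeasure M A * (\<integral>\<^sup>+\<omega>. \<phi> (D \<omega>) \<partial>M)"
    if \<phi>: "continuous_on UNIV \<phi>" and le: "\<And>x. \<phi> x \<le> 1" for \<phi> :: "'b \<Rightarrow> ennreal"
  proof -
    have [measurable]: "\<phi> \<in> borel_measurable borel" using \<phi> by (rule borel_measurable_continuous_onI)
    note [measurable] = Dn D A
    have l: "(\<lambda>n. \<phi> (Dn n \<omega>)) \<longlonglongrightarrow> \<phi> (D \<omega>)" if "\<omega> \<in> space M" for \<omega>
      using continuous_on_tendsto_compose[OF \<phi> lim[OF that]] by simp
    have "(\<lambda>n. \<integral>\<^sup>+\<omega>. indicator A \<omega> * \<phi> (Dn n \<omega>) \<partial>M) \<longlonglongrightarrow> (\<integral>\<^sup>+\<omega>. indicator A \<omega> * \<phi> (D \<omega>) \<partial>M)"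
      using l le by (intro nn_integral_dominated_convergence[where w = "\<lambda>_. 1"])
        (auto simp: emeasure_space_1 split: split_indicator)
    moreover have "(\<lambda>n. \<integral>\<^sup>+\<omega>. \<phi> (Dn n \<omega>) \<partial>M) \<longlonglongrightarrow> (\<integral>\<^sup>+\<omega>. \<phi> (D \<omega>) \<partial>M)"
      using l le by (intro nn_integral_dominated_convergence[where w = "\<lambda>_. 1"]) (auto simp: emeasure_space_1)
    then have "(\<lambda>n. emeasure M A * (\<integral>\<^sup>+\<omega>. \<phi> (Dn n \<omega>) \<partial>M)) \<longlonglongrightarrow> emeasure M A * (\<integral>\<^sup>+\<omega>. \<phi> (D \<omega>) \<partial>M)"
      by (intro ennreal_tendsto_cmult) (simp add: less_top[symmetric])
    ultimately show ?thesis
      unfolding *[OF \<open>\<phi> \<in> borel_measurable borel\<close>] by (rule LIMSEQ_unique)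
  qed
  have closed: "emeasure M (A \<inter> (D -` C \<inter> space M)) = emeasure M A * emeasure M (D -` C \<inter> space M)"
    if C: "closed C" for C
  proof (cases "C = {}")
    case False
    note [measurable] = D A
    \<comment> \<open>Continuous functions that decrease to the indicator of \<open>C\<close>: a
      point outside the closed set has positive distance from it, so they vanish there from some
      index on.\<close>
    define \<phi> :: "nat \<Rightarrow> 'b \<Rightarrow> ennreal" where "\<phi> k x = ennreal (max 0 (1 - real k * infdist x C))" for k x
    have \<phi>: "continuous_on UNIV (\<phi> k)" for k
      unfolding \<phi>_def by (intro continuous_on_ennreal continuous_intros)
    then have [measurable]: "\<phi> k \<in> borel_measurable borel" for k
      by (rule borel_measurable_continuous_onI)
    have le: "\<phi> k x \<le> 1" for k x
      unfolding \<phi>_def using ennreal_leI[of "max 0 (1 - real k * infdist x C)" 1] infdist_nonneg[of x C] by simp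
    have l: "(\<lambda>k. \<phi> k x) \<longlonglongrightarrow> indicator C x" for x
    proof (cases "x \<in> C")
      case True
      then show ?thesis by (simp add: \<phi>_def)
    next
      case nx: False
      then have "0 < infdist x C" using in_closed_iff_infdist_zero[OF C False] infdist_nonneg[of x C] by force
      then obtain N where N: "1 < real N * infdist x C" using reals_Archimedean3 by blast
      have "\<phi> k x = 0" if "N \<le> k" for k
      proof -
        have "real N * infdist x C \<le> real k * infdist x C"
          using that by (intro mult_right_mono infdist_nonneg) auto
        then show ?thesis using N by (simp add: \<phi>_def)
      qed
      then have "eventually (\<lambda>k. \<phi> k x = indicator C x) sequentially"
        using nx by (auto simp: eventually_sequentially)
      then show ?thesis by (rule tendsto_eventually)
    qed
    have [measurable]: "C \<in> sets borel" using C by (rule borel_closed)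
    have "(\<lambda>k. \<integral>\<^sup>+\<omega>. indicator A \<omega> * \<phi> k (D \<omega>) \<partial>M) \<longlonglongrightarrow> (\<integral>\<^sup>+\<omega>. indicator A \<omega> * indicator C (D \<omega>) \<partial>M)"
    proof (intro nn_integral_dominated_convergence[where w = "\<lambda>_. 1"] AE_I2)
      show "(\<lambda>k. indicator A \<omega> * \<phi> k (D \<omega>)) \<longlonglongrightarrow> indicator A \<omega> * indicator C (D \<omega>)" for \<omega>
        using l[of "D \<omega>"] by (cases "\<omega> \<in> A") simp_all
      show "indicator A \<omega> * \<phi> k (D \<omega>) \<le> 1" for k \<omega>
        using le by (simp split: split_indicator)
    qed (simp_all add: emeasure_space_1)
    moreover have "(\<lambda>k. \<integral>\<^sup>+\<omega>. \<phi> k (D \<omega>) \<partial>M) \<longlonglongrightarrow> (\<integral>\<^sup>+\<omega>. indicator C (D \<omega>) \<partial>M)"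
      using l le by (intro nn_integral_dominated_convergence[where w = "\<lambda>_. 1"]) (auto simp: emeasure_space_1)
    then have "(\<lambda>k. emeasure M A * (\<integral>\<^sup>+\<omega>. \<phi> k (D \<omega>) \<partial>M)) \<longlonglongrightarrow> emeasure M A * (\<integral>\<^sup>+\<omega>. indicator C (D \<omega>) \<partial>M)"
      by (intro ennreal_tendsto_cmult) (simp add: less_top[symmetric])
    ultimately have "(\<integral>\<^sup>+\<omega>. indicator A \<omega> * indicator C (D \<omega>) \<partial>M) = emeasure M A * (\<integral>\<^sup>+\<omega>. indicator C (D \<omega>) \<partial>M)"
      unfolding cont[OF \<phi> le] by (rule LIMSEQ_unique)
    moreover have "(\<integral>\<^sup>+\<omega>. indicator A \<omega> * indicator C (D \<omega>) \<partial>M) = (\<integral>\<^sup>+\<omega>. indicator (A \<inter> (D -` C \<inter> space M)) \<omega> \<partial>M)"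
      by (intro nn_integral_cong) (auto split: split_indicator)
    moreover have "(\<integral>\<^sup>+\<omega>. indicator C (D \<omega>) \<partial>M) = (\<integral>\<^sup>+\<omega>. indicator (D -` C \<inter> space M) \<omega> \<partial>M)"
      by (intro nn_integral_cong) (auto split: split_indicator)
    ultimately show ?thesis by simp
  qed simp
  have "distr (density M (indicator A)) borel D = scale_measure (emeasure M A) (distr M borel D)"
  proof (rule measure_eqI_generator_eq[where E = "Collect closed" and \<Omega> = UNIV and A = "\<lambda>_. UNIV"])
    note [measurable] = D A
    fix C :: "'b set" assume "C \<in> Collect closed"
    then have C: "closed C" and [measurable]: "C \<in> sets borel" by (auto intro: borel_closed)
    have "emeasure (distr (density M (indicator A)) borel D) C = (\<integral>\<^sup>+x. indicator A x * indicator (D -` C \<inter> space M) x \<partial>M)"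
      by (simp add: emeasure_distr emeasure_density)
    also have "\<dots> = emeasure M (A \<inter> (D -` C \<inter> space M))"
      by (simp add: indicator_inter_arith[symmetric])
    finally show "emeasure (distr (density M (indicator A)) borel D) C = emeasure (scale_measure (emeasure M A) (distr M borel D)) C"
      using closed[OF C] by (simp add: emeasure_distr)
  next
    note [measurable] = D A
    show "emeasure (distr (density M (indicator A)) borel D) UNIV \<noteq> \<infinity>" for i :: nat
    proof -
      have "emeasure (distr (density M (indicator A)) borel D) UNIV = (\<integral>\<^sup>+x. indicator A x * indicator (space M) x \<partial>M)"
        by (simp add: emeasure_distr emeasure_density)
      also have "\<dots> = emeasure M (A \<inter> space M)" by (simp add: indicator_inter_arith[symmetric])
      finally show ?thesis by simp
    qed
  qed (auto simp: Int_stable_def borel_eq_closed)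
  then have "emeasure (distr (density M (indicator A)) borel D) E = emeasure (scale_measure (emeasure M A) (distr M borel D)) E"
    by simp
  moreover have "emeasure (distr (density M (indicator A)) borel D) E = (\<integral>\<^sup>+x. indicator A x * indicator (D -` E \<inter> space M) x \<partial>M)"
    using D A E by (simp add: emeasure_distr emeasure_density)
  moreover have "\<dots> = emeasure M (A \<inter> (D -` E \<inter> space M))"
    using D A E by (simp add: indicator_inter_arith[symmetric])
  ultimately have "emeasure M (A \<inter> (D -` E \<inter> space M)) = emeasure M A * emeasure M (D -` E \<inter> space M)"
    using D E by (simp add: emeasure_distr)
  then show ?thesis by (simp add: emeasure_eq_measure flip: ennreal_mult)
qed

text \<open>An event of the enlarged field at \<open>s\<close> lies, up to null sets, in
  \<open>G u\<close> for every \<open>u\<close> between \<open>s\<close> and \<open>t\<close>, hence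
  is independent of the increment from \<open>u\<close> to \<open>t\<close>. Continuity of the paths
  allows \<open>u\<close> to decrease to \<open>s\<close>.\<close>

lemma brownian_motion_right_limit:
  fixes B :: "'a \<Rightarrow> 'd::finite wpath"
  assumes P: "prob_space P" and sub: "\<And>t. t \<in> {0..1} \<Longrightarrow> subalgebra P (G t)"
    and mono: "\<And>s t. s \<in> {0..1} \<Longrightarrow> t \<in> {0..1} \<Longrightarrow> s \<le> t \<Longrightarrow> sets (G s) \<subseteq> sets (G t)"
    and B: "brownian_motion P G B"
  shows "brownian_motion (completion P) (right_limit (\<lambda>t. completed_field P (G t))) B"
proof -
  define F where "F = right_limit (\<lambda>t. completed_field P (G t))"
  define \<Delta> where "\<Delta> s t \<omega> = path_at (B \<omega>) t - path_at (B \<omega>) s" for s t \<omega>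
  have basis: "complete_stochastic_basis (completion P) F"
    unfolding F_def by (rule complete_stochastic_basis_right_limit[OF P sub mono])
  interpret P: prob_space P by fact
  interpret M: prob_space "completion P" by (rule basisD[OF basis])
  have GF: "sets (G t) \<subseteq> sets (F t)" if "t \<in> {0..1}" for t
    unfolding F_def by (rule le_right_limit_completed_field[OF sub mono that])
  have space_F [simp]: "space (F t) = space P" for t by (simp add: F_def)
  have B_G: "(\<lambda>\<omega>. path_at (B \<omega>) t) \<in> G t \<rightarrow>\<^sub>M borel" if "t \<in> {0..1}" for t
    using B that by (simp add: brownian_motion_def adapted_process_def)
  then have B_F: "(\<lambda>\<omega>. path_at (B \<omega>) t) \<in> F t \<rightarrow>\<^sub>M borel" if "t \<in> {0..1}" for t
    using GF[OF that] that sub[OF that] by (intro measurable_from_subalg[of "F t" "G t"]) (auto simp: subalgebra_def)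
  have B_P [measurable]: "(\<lambda>\<omega>. path_at (B \<omega>) t) \<in> P \<rightarrow>\<^sub>M borel" if "t \<in> {0..1}" for t
    by (rule measurable_from_subalg[OF sub[OF that] B_G[OF that]])
  have \<Delta>_P: "\<Delta> s t \<in> P \<rightarrow>\<^sub>M borel" if "s \<in> {0..1}" "t \<in> {0..1}" for s t
    unfolding \<Delta>_def using that by (intro borel_measurable_diff B_P)
  have indep: "P.prob (A \<inter> (\<Delta> s t -` E \<inter> space P)) = P.prob A * P.prob (\<Delta> s t -` E \<inter> space P)"
    if "0 \<le> s" "s < t" "t \<le> 1" "A \<in> sets (G s)" "E \<in> sets borel" for s t A E
  proof -
    have "P.indep_set (sets (G s)) (sets (vimage_algebra (space P) (\<Delta> s t) borel))"
      using B that unfolding brownian_motion_def \<Delta>_def by blast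
    then show ?thesis
      using that \<Delta>_P[of s t] sub[of s] by (subst (asm) P.indep_set_vimage_iff) (auto simp: subalgebra_def)
  qed
  have indep': "M.prob (A \<inter> (\<Delta> s t -` E \<inter> space P)) = M.prob A * M.prob (\<Delta> s t -` E \<inter> space P)"
    if st: "0 \<le> s" "s < t" "t \<le> 1" and A: "A \<in> sets (completed_field P (G s))" and E: "E \<in> sets borel" for s t A E
  proof -
    have s: "s \<in> {0..1}" "t \<in> {0..1}" using st by auto
    obtain C where C: "C \<in> sets (G s)" "(A - C) \<union> (C - A) \<in> negligible_sets P"
      using completed_fieldE[OF sub[OF s(1)] A] .
    have CP: "C \<in> sets P" using C sub[OF s(1)] by (auto simp: subalgebra_def)
    have A': "A \<in> sets (completion P)" using A completed_field_le_completion[OF sub[OF s(1)]] by blast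
    have E': "\<Delta> s t -` E \<inter> space P \<in> sets P" by (rule measurable_sets[OF \<Delta>_P[OF s] E])
    have AE: "AE \<omega> in completion P. \<omega> \<in> A \<longleftrightarrow> \<omega> \<in> C"
      by (rule AE_I'[OF C(2)[unfolded negligible_sets_eq]]) auto
    have "M.prob A = M.prob C"
      using A' CP AE by (intro M.finite_measure_eq_AE) auto
    moreover have "M.prob (A \<inter> (\<Delta> s t -` E \<inter> space P)) = M.prob (C \<inter> (\<Delta> s t -` E \<inter> space P))"
      using A' CP AE E' by (intro M.finite_measure_eq_AE) auto
    ultimately show ?thesis
      using indep[OF st C(1) E] CP E' by simp
  qed
  have ind: "M.indep_set (sets (F s)) (sets (vimage_algebra (space P) (\<Delta> s t) borel))"
    if st: "0 \<le> s" "s < t" "t \<le> 1" for s t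
  proof -
    have s: "s \<in> {0..1}" "t \<in> {0..1}" using st by auto
    \<comment> \<open>The shift by 2 keeps \<open>u n\<close> strictly below \<open>t\<close> even
      for \<open>n = 0\<close>; the Brownian property speaks only of increments over intervals of
      positive length.\<close>
    define u where "u n = s + (t - s) / real (n + 2)" for n :: nat
    have u: "s < u n" "u n < t" for n
    proof -
      show "s < u n" using st by (simp add: u_def)
      have "(t - s) / real (n + 2) < (t - s) / 1" using st by (intro divide_strict_left_mono) auto
      then show "u n < t" by (simp add: u_def)
    qed
    have u01: "u n \<in> {0..1}" for n using u[of n] st by auto
    have u_lim: "u \<longlonglongrightarrow> s"
    proof -
      have "(\<lambda>n. (t - s) / real (n + 2)) \<longlonglongrightarrow> 0"
        using LIMSEQ_ignore_initial_segment[OF lim_const_over_n[of "t - s"], of 2] by simp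
      from tendsto_add[OF tendsto_const[of s] this] show ?thesis by (simp add: u_def[abs_def])
    qed
    have "M.prob (A \<inter> (\<Delta> s t -` E \<inter> space (completion P))) = M.prob A * M.prob (\<Delta> s t -` E \<inter> space (completion P))"
      if A: "A \<in> sets (F s)" and E: "E \<in> sets borel" for A E
    proof (rule M.indep_event_limit[where Dn = "\<lambda>n. \<Delta> (u n) t"])
      show "A \<in> M.events" using A basisD(4)[OF basis s(1)] by auto
      show "\<Delta> (u n) t \<in> completion P \<rightarrow>\<^sub>M borel" "\<Delta> s t \<in> completion P \<rightarrow>\<^sub>M borel" for n
        using s u01 by (auto intro!: measurable_completion \<Delta>_P)
      show "(\<lambda>n. \<Delta> (u n) t \<omega>) \<longlonglongrightarrow> \<Delta> s t \<omega>" for \<omega>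
        unfolding \<Delta>_def
        by (intro tendsto_intros continuous_on_tendsto_compose[OF continuous_on_path_at u_lim])
          (use s u01 in auto)
      show "M.prob (A \<inter> (\<Delta> (u n) t -` E' \<inter> space (completion P))) = M.prob A * M.prob (\<Delta> (u n) t -` E' \<inter> space (completion P))"
        if "E' \<in> sets borel" for n E'
      proof -
        have "A \<in> sets (completed_field P (G (min (s + (t - s) / real (n + 2)) 1)))"
          using A st unfolding F_def by (subst (asm) sets_right_limit[where \<Omega> = "space P"]) auto
        also have "min (s + (t - s) / real (n + 2)) 1 = u n" using u01[of n] by (simp add: u_def)
        finally show ?thesis using that u[of n] u01[of n] st(3) by (simp add: indep')
      qed
    qed (rule E)
    then show ?thesis
      using M.indep_set_vimage_iff[of "\<Delta> s t" "sets (F s)"] measurable_completion[OF \<Delta>_P[OF s]] basisD(4)[OF basis s(1)]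
      by simp
  qed
  have distr: "distr (completion P) borel (\<Delta> s t) = distr P borel (\<Delta> s t)" if "0 \<le> s" "s < t" "t \<le> 1" for s t
    using that by (intro distr_completion \<Delta>_P) auto
  show ?thesis
    unfolding brownian_motion_def adapted_process_def F_def[symmetric]
  proof (intro conjI ballI allI impI)
    show "(\<lambda>\<omega>. path_at (B \<omega>) t) \<in> F t \<rightarrow>\<^sub>M borel" if "t \<in> {0..1}" for t
      using that by (rule B_F)
    show "AE \<omega> in completion P. path_at (B \<omega>) 0 = 0"
      using B unfolding brownian_motion_def by (intro AE_completion) blast
    fix s t :: real assume st: "0 \<le> s \<and> s < t \<and> t \<le> 1"
    then have "distr P borel (\<lambda>\<omega>. path_at (B \<omega>) t - path_at (B \<omega>) s) =
        density lborel (\<lambda>x. ennreal (\<Prod>i\<in>UNIV. normal_density 0 (sqrt (t - s)) (x $ i)))"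
      using B unfolding brownian_motion_def by blast
    with distr[of s t] st
    show "distr (completion P) borel (\<lambda>\<omega>. path_at (B \<omega>) t - path_at (B \<omega>) s) =
        density lborel (\<lambda>x. ennreal (\<Prod>i\<in>UNIV. normal_density 0 (sqrt (t - s)) (x $ i)))"
      unfolding \<Delta>_def by simp
    show "M.indep_set (sets (F s)) (sets (vimage_algebra (space (completion P)) (\<lambda>\<omega>. path_at (B \<omega>) t - path_at (B \<omega>) s) borel))"
      using ind[of s t] st unfolding \<Delta>_def by simp
  qed
qed


section \<open>Frobenius norm and Gaussian moments\<close>

lemma norm_matrix_vector_mult_le: "norm (A *v x) \<le> norm A * norm x"
  for A :: "real ^ 'n ^ 'm"
proof -
  have "norm (A *v x) = L2_set (\<lambda>i. norm (A $ i \<bullet> x)) UNIV"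
    by (simp add: norm_vec_def matrix_vector_mul_component)
  also have "\<dots> \<le> L2_set (\<lambda>i. norm (A $ i) * norm x) UNIV"
    by (intro L2_set_mono) (auto simp: Cauchy_Schwarz_ineq2)
  also have "\<dots> = norm A * norm x"
    by (simp add: norm_vec_def[of A] L2_set_left_distrib)
  finally show ?thesis .
qed

text \<open>Each row of the product is a combination of the rows of \<open>B\<close>, with the
  entries of a row of \<open>A\<close> as coefficients, so Cauchy-Schwarz gives the bound row by
  row.\<close>

lemma norm_matrix_matrix_mult_le: "norm (A ** B) \<le> norm A * norm B"
  for A :: "real ^ 'n ^ 'm" and B :: "real ^ 'l ^ 'n"
proof -
  have row: "norm ((A ** B) $ i) \<le> norm (A $ i) * norm B" for i
  proof -
    have "(A ** B) $ i = (\<Sum>k\<in>UNIV. A $ i $ k *\<^sub>R B $ k)"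
      by (simp add: vec_eq_iff matrix_matrix_mult_def sum_component)
    also have "norm \<dots> \<le> (\<Sum>k\<in>UNIV. \<bar>A $ i $ k\<bar> * \<bar>norm (B $ k)\<bar>)"
      by (intro sum_norm_le) simp
    also have "\<dots> \<le> L2_set (\<lambda>k. A $ i $ k) UNIV * L2_set (\<lambda>k. norm (B $ k)) UNIV"
      by (rule L2_set_mult_ineq)
    also have "L2_set (\<lambda>k. A $ i $ k) UNIV = norm (A $ i)"
      by (simp add: norm_vec_def L2_set_def)
    also have "L2_set (\<lambda>k. norm (B $ k)) UNIV = norm B"
      by (simp add: norm_vec_def[of B])
    finally show ?thesis .
  qed
  have "norm (A ** B) = L2_set (\<lambda>i. norm ((A ** B) $ i)) UNIV"
    by (rule norm_vec_def)
  also have "\<dots> \<le> L2_set (\<lambda>i. norm (A $ i) * norm B) UNIV"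
    by (intro L2_set_mono row) auto
  also have "\<dots> = norm A * norm B"
    by (simp add: norm_vec_def[of A] L2_set_left_distrib)
  finally show ?thesis .
qed

lemma bounded_bilinear_matrix_vector_mult: "bounded_bilinear ((*v) :: real ^ 'n ^ 'm \<Rightarrow> real ^ 'n \<Rightarrow> real ^ 'm)"
proof
  show "\<exists>K. \<forall>(A :: real ^ 'n ^ 'm) x. norm (A *v x) \<le> norm A * norm x * K"
    by (intro exI[of _ 1]) (simp add: norm_matrix_vector_mult_le)
qed (simp_all add: vec_eq_iff matrix_vector_mult_def algebra_simps sum.distrib sum_distrib_left)

lemma bounded_bilinear_matrix_matrix_mult:
  "bounded_bilinear ((**) :: real ^ 'n ^ 'm \<Rightarrow> real ^ 'l ^ 'n \<Rightarrow> real ^ 'l ^ 'm)"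
proof
  show "\<exists>K. \<forall>(A :: real ^ 'n ^ 'm) (B :: real ^ 'l ^ 'n). norm (A ** B) \<le> norm A * norm B * K"
    by (intro exI[of _ 1]) (simp add: norm_matrix_matrix_mult_le)
qed (simp_all add: vec_eq_iff matrix_matrix_mult_def algebra_simps sum.distrib sum_distrib_left)

lemma borel_measurable_matrix_vector_mult [measurable]:
  fixes f :: "'a \<Rightarrow> real ^ 'n ^ 'm"
  assumes "f \<in> borel_measurable M" "g \<in> borel_measurable M"
  shows "(\<lambda>x. f x *v g x) \<in> borel_measurable M"
  using assms
  by (rule borel_measurable_continuous_Pair)
    (intro bounded_bilinear.continuous_on[OF bounded_bilinear_matrix_vector_mult] continuous_intros)

lemma borel_measurable_matrix_matrix_mult [measurable]:
  fixes f :: "'a \<Rightarrow> real ^ 'n ^ 'm" and g :: "'a \<Rightarrow> real ^ 'l ^ 'n"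
  assumes "f \<in> borel_measurable M" "g \<in> borel_measurable M"
  shows "(\<lambda>x. f x ** g x) \<in> borel_measurable M"
  using assms
  by (rule borel_measurable_continuous_Pair)
    (intro bounded_bilinear.continuous_on[OF bounded_bilinear_matrix_matrix_mult] continuous_intros)

lemma borel_measurable_vec_nth [measurable]:
  fixes f :: "'a \<Rightarrow> ('b::real_normed_vector) ^ 'n"
  shows "f \<in> borel_measurable M \<Longrightarrow> (\<lambda>x. f x $ i) \<in> borel_measurable M"
  by (rule borel_measurable_continuous_on[where f = "\<lambda>x. x $ i"]) (intro continuous_intros)

abbreviation gaussian :: "real \<Rightarrow> (real ^ 'd) measure"
  where "gaussian v \<equiv> density lborel (\<lambda>x. ennreal (\<Prod>i\<in>UNIV. normal_density 0 (sqrt v) (x $ i)))"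

text \<open>The density factorises over the coordinates, so Tonelli turns the integral into a
  product in which every factor except the k-th is the total mass 1.\<close>

lemma distr_gaussian_component:
  assumes v: "0 < v"
  shows "distr (gaussian v :: (real ^ 'd::finite) measure) borel (\<lambda>x. x $ k) = density lborel (normal_density 0 (sqrt v))"
proof (rule measure_eqI)
  fix A assume "A \<in> sets (distr (gaussian v :: (real ^ 'd) measure) borel (\<lambda>x. x $ k))"
  then have A [measurable]: "A \<in> sets borel" by simp
  \<comment> \<open>The test set is attached to the single basis vector \<open>axis k 1\<close>;
    this gives the integrand the product form over \<open>Basis\<close> in which Lebesgue measure
    splits.\<close>
  define f :: "real ^ 'd \<Rightarrow> real \<Rightarrow> ennreal" where
    "f b x = (if b = axis k 1 then indicator A x else 1) * ennreal (normal_density 0 (sqrt v) x)" for b x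
  have f [measurable]: "f b \<in> borel_measurable borel" for b
    unfolding f_def by (cases "b = axis k 1") simp_all
  have B: "(Basis :: (real ^ 'd) set) = (\<lambda>i. axis i 1) ` UNIV"
    by (auto simp: Basis_vec_def)
  have inj: "inj (\<lambda>i::'d. axis i (1::real))"
    by (auto simp: inj_on_def axis_eq_axis)
  have [measurable]: "(\<lambda>x::real ^ 'd. x $ k) \<in> borel_measurable borel" by simp
  have [measurable]: "(\<lambda>x::real ^ 'd. x $ k) -` A \<in> sets borel"
    using measurable_sets[of "\<lambda>x::real ^ 'd. x $ k" borel borel A] by simp
  have "emeasure (distr (gaussian v :: (real ^ 'd) measure) borel (\<lambda>x. x $ k)) A
      = (\<integral>\<^sup>+x. ennreal (\<Prod>i\<in>UNIV. normal_density 0 (sqrt v) (x $ i)) * indicator A (x $ k) \<partial>(lborel :: (real ^ 'd) measure))"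
    by (subst emeasure_distr, simp, simp, subst emeasure_density)
      (auto intro!: nn_integral_cong split: split_indicator)
  also have "\<dots> = (\<integral>\<^sup>+x. (\<Prod>b\<in>Basis. f b (x \<bullet> b)) \<partial>lborel)"
  proof (rule nn_integral_cong)
    fix x :: "real ^ 'd"
    have "(\<Prod>b\<in>Basis. f b (x \<bullet> b)) = (\<Prod>i\<in>UNIV. f (axis i 1) (x $ i))"
      unfolding B by (subst prod.reindex[OF inj]) (simp add: inner_axis)
    also have "\<dots> = (\<Prod>i\<in>UNIV. (if i = k then indicator A (x $ i) else 1)) * (\<Prod>i\<in>UNIV. ennreal (normal_density 0 (sqrt v) (x $ i)))"
      unfolding f_def by (subst prod.distrib) (simp add: axis_eq_axis)
    also have "(\<Prod>i\<in>UNIV. (if i = k then indicator A (x $ i) else 1)) = (indicator A (x $ k) :: ennreal)"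
      by (subst prod.delta) auto
    also have "(\<Prod>i\<in>UNIV. ennreal (normal_density 0 (sqrt v) (x $ i))) = ennreal (\<Prod>i\<in>UNIV. normal_density 0 (sqrt v) (x $ i))"
      by (rule prod_ennreal) (simp add: normal_density_nonneg)
    finally show "ennreal (\<Prod>i\<in>UNIV. normal_density 0 (sqrt v) (x $ i)) * indicator A (x $ k) = (\<Prod>b\<in>Basis. f b (x \<bullet> b))"
      by (simp add: mult.commute)
  qed
  also have "\<dots> = (\<Prod>b\<in>Basis. \<integral>\<^sup>+x. f b x \<partial>lborel)"
    by (rule nn_integral_lborel_prod) auto
  also have "\<dots> = (\<Prod>i\<in>UNIV. if i = k then \<integral>\<^sup>+x. indicator A x * ennreal (normal_density 0 (sqrt v) x) \<partial>lborel else 1)"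
  proof -
    have 1: "(\<integral>\<^sup>+x. ennreal (normal_density 0 (sqrt v) x) \<partial>lborel) = 1"
    proof -
      interpret N: prob_space "density lborel (normal_density 0 (sqrt v))"
        using v by (intro prob_space_normal_density) simp
      show ?thesis
        using N.emeasure_space_1 by (simp add: emeasure_density)
    qed
    have "(\<integral>\<^sup>+x. f (axis i 1) x \<partial>lborel) = (if i = k then \<integral>\<^sup>+x. indicator A x * ennreal (normal_density 0 (sqrt v) x) \<partial>lborel else 1)" for i
      by (cases "i = k") (simp_all add: f_def axis_eq_axis 1)
    then show ?thesis
      unfolding B by (subst prod.reindex[OF inj]) (simp add: comp_def)
  qed
  also have "\<dots> = (\<integral>\<^sup>+x. ennreal (normal_density 0 (sqrt v) x) * indicator A x \<partial>lborel)"
    by (subst prod.delta) (auto simp: mult.commute)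
  finally show "emeasure (distr (gaussian v :: (real ^ 'd) measure) borel (\<lambda>x. x $ k)) A = emeasure (density lborel (normal_density 0 (sqrt v))) A"
    by (simp add: emeasure_density)
qed simp

text \<open>The dimension factor is the sum of the component variances. It is the origin of the
  constant \<open>CARD('d)\<close> in the maximal inequalities.\<close>

lemma gaussian_moments:
  fixes D :: "'a \<Rightarrow> real ^ 'd::finite"
  assumes v: "0 < v" and D [measurable]: "D \<in> M \<rightarrow>\<^sub>M borel" and law: "distr M borel D = gaussian v"
  shows "integrable M (\<lambda>\<omega>. D \<omega> $ k)" "(\<integral>\<omega>. D \<omega> $ k \<partial>M) = 0"
    and "integrable M (\<lambda>\<omega>. (norm (D \<omega>))\<^sup>2)" "(\<integral>\<omega>. (norm (D \<omega>))\<^sup>2 \<partial>M) = real CARD('d) * v"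
proof -
  let ?N = "density lborel (normal_density 0 (sqrt v))"
  have N: "distr M borel (\<lambda>\<omega>. D \<omega> $ k) = ?N" for k
  proof -
    have "distr M borel (\<lambda>\<omega>. D \<omega> $ k) = distr (distr M borel D) borel (\<lambda>x. x $ k)"
      by (subst distr_distr) (auto simp: comp_def)
    then show ?thesis unfolding law distr_gaussian_component[OF v] .
  qed
  have Dk: "(\<lambda>\<omega>. D \<omega> $ k) \<in> M \<rightarrow>\<^sub>M borel" for k by measurable
  have s: "0 < sqrt v" using v by simp
  have "integrable ?N (\<lambda>x. x)"
    using integrable_normal_moment_nz_1[OF s, of 0] by (subst integrable_density) auto
  then show "integrable M (\<lambda>\<omega>. D \<omega> $ k)"
    unfolding N[of k, symmetric] by (rule integrable_distr[OF Dk])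
  have "(\<integral>\<omega>. D \<omega> $ k \<partial>M) = (\<integral>x. x \<partial>?N)"
    unfolding N[of k, symmetric] by (rule integral_distr[symmetric, OF Dk]) simp
  also have "\<dots> = 0"
    using integral_normal_moment_nz_1[OF s, of 0] by (subst integral_density) auto
  finally show "(\<integral>\<omega>. D \<omega> $ k \<partial>M) = 0" .
  have "integrable ?N (\<lambda>x. x\<^sup>2)"
    using integrable_normal_moment[OF s, of 0 2] by (subst integrable_density) auto
  then have i2: "integrable M (\<lambda>\<omega>. (D \<omega> $ k)\<^sup>2)" for k
    unfolding N[of k, symmetric] by (rule integrable_distr[OF Dk])
  have e2: "(\<integral>\<omega>. (D \<omega> $ k)\<^sup>2 \<partial>M) = v" for k
  proof -
    have "(\<integral>\<omega>. (D \<omega> $ k)\<^sup>2 \<partial>M) = (\<integral>x. x\<^sup>2 \<partial>?N)"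
      unfolding N[of k, symmetric] by (rule integral_distr[symmetric, OF Dk]) simp
    also have "\<dots> = v"
      using integral_normal_moment_even[OF s, of 0 1] v by (subst integral_density) auto
    finally show ?thesis .
  qed
  have n: "(norm x)\<^sup>2 = (\<Sum>k\<in>UNIV. (x $ k)\<^sup>2)" for x :: "real ^ 'd"
    by (simp add: norm_vec_def L2_set_def sum_nonneg)
  show "integrable M (\<lambda>\<omega>. (norm (D \<omega>))\<^sup>2)" "(\<integral>\<omega>. (norm (D \<omega>))\<^sup>2 \<partial>M) = real CARD('d) * v"
    unfolding n using i2 e2 by (auto simp: Bochner_Integration.integral_sum)
qed


section \<open>Integrals of step functions\<close>

text \<open>Simple processes and their integrals at one sample point: \<open>x\<close> holds fixed
  matrices, and the integrator is an arbitrary function of time. Refinement, linearity and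
  associativity are then algebra without probability, and the integrator may itself be an
  integral.\<close>

definition step_fun :: "nat \<Rightarrow> (nat \<Rightarrow> real) \<Rightarrow> (nat \<Rightarrow> real ^ 'd ^ 'd) \<Rightarrow> real \<Rightarrow> real ^ 'd ^ 'd::finite"
  where "step_fun n \<tau> x t = (\<Sum>i<n. indicator {\<tau> i<..\<tau> (Suc i)} t *\<^sub>R x i)"

definition step_integral ::
    "nat \<Rightarrow> (nat \<Rightarrow> real) \<Rightarrow> (nat \<Rightarrow> real ^ 'd ^ 'd) \<Rightarrow> (real \<Rightarrow> real ^ 'd) \<Rightarrow> real \<Rightarrow> real ^ 'd::finite"
  where "step_integral n \<tau> x w t = (\<Sum>i<n. x i *v (w (min (\<tau> (Suc i)) t) - w (min (\<tau> i) t)))"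

lemma simple_process_eq_step_fun: "simple_process n \<tau> \<xi> t \<omega> = step_fun n \<tau> (\<lambda>i. \<xi> i \<omega>) t"
  by (simp add: simple_process_def step_fun_def)

lemma simple_integral_process_eq_step_integral:
  "simple_integral_process B n \<tau> \<xi> t \<omega> = step_integral n \<tau> (\<lambda>i. \<xi> i \<omega>) (path_at (B \<omega>)) t"
  by (simp add: simple_integral_process_def step_integral_def)

text \<open>Points may coincide. Sorted times framed by 0 and 1 then always form a partition, even
  when 0 or 1 is among them; the price is that cells may be empty.\<close>

definition unit_partition :: "nat \<Rightarrow> (nat \<Rightarrow> real) \<Rightarrow> bool"
  where "unit_partition m p \<longleftrightarrow> p 0 = 0 \<and> p m = 1 \<and> (\<forall>j<m. p j \<le> p (Suc j))"

lemma unit_partition_mono: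
  assumes "unit_partition m p" "i \<le> j" "j \<le> m"
  shows "p i \<le> p j"
  using assms(2,3)
proof (induction j rule: dec_induct)
  case (step n)
  then have "p n \<le> p (Suc n)" using assms(1) by (auto simp: unit_partition_def)
  then show ?case using step by simp
qed simp

lemma unit_partition_bounds:
  assumes "unit_partition m p" "j \<le> m"
  shows "0 \<le> p j" "p j \<le> 1"
  using unit_partition_mono[OF assms(1), of 0 j] unit_partition_mono[OF assms(1), of j m] assms
  by (auto simp: unit_partition_def)

lemma unit_partition_less:
  assumes "unit_partition m p" "i \<le> m" "p i < p j"
  shows "i < j"
  using unit_partition_mono[OF assms(1), of j i] assms(2,3) by (cases "j \<le> i") auto

lemma unit_partition_exists:
  assumes "finite T" "T \<subseteq> {0..1}"
  shows "\<exists>m p. unit_partition m p \<and> T \<subseteq> p ` {..m}"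
proof -
  define L where "L = 0 # sorted_list_of_set T @ [1]"
  have sorted: "sorted L"
    using assms by (auto simp: L_def sorted_append)
  have len: "length L = Suc (Suc (card T))" using assms(1) by (simp add: L_def)
  have "unit_partition (Suc (card T)) ((!) L)"
    unfolding unit_partition_def
  proof (intro conjI allI impI)
    show "L ! Suc (card T) = 1" using assms(1) by (simp add: L_def nth_append)
    show "L ! j \<le> L ! Suc j" if "j < Suc (card T)" for j
      using that len by (intro sorted_nth_mono[OF sorted]) auto
  qed (simp add: L_def)
  moreover have "T \<subseteq> (!) L ` {..Suc (card T)}"
  proof
    fix t assume "t \<in> T"
    then have "t \<in> set L" using assms(1) by (simp add: L_def)
    then obtain j where "j < length L" "L ! j = t" by (auto simp: in_set_conv_nth)
    then show "t \<in> (!) L ` {..Suc (card T)}" using len by (intro image_eqI[of _ _ j]) auto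
  qed
  ultimately show ?thesis by blast
qed

lemma unit_partition_cell:
  assumes p: "unit_partition m p" and t: "0 < t" "t \<le> 1"
  obtains j where "j < m" "p j < t" "t \<le> p (Suc j)"
proof -
  define k where "k = (LEAST k. t \<le> p k)"
  have ex: "t \<le> p m" using p t by (simp add: unit_partition_def)
  then have k: "t \<le> p k" unfolding k_def by (rule LeastI)
  have km: "k \<le> m" unfolding k_def by (rule Least_le[of "\<lambda>k. t \<le> p k", OF ex])
  have "k \<noteq> 0" using k p t by (cases "k = 0") (auto simp: unit_partition_def)
  then obtain j where j: "k = Suc j" by (cases k) auto
  then have "\<not> t \<le> p j" using not_less_Least[of j "\<lambda>k. t \<le> p k"] by (simp add: k_def)
  then show thesis using that[of j] k km j by simp
qed

lemma step_fun_cell: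
  assumes p: "unit_partition m p" and j: "j < m" "p j < t" "t \<le> p (Suc j)"
  shows "step_fun m p x t = x j"
proof -
  have "indicator {p i<..p (Suc i)} t *\<^sub>R x i = (if i = j then x j else 0)" if i: "i < m" for i
  proof -
    consider "i < j" | "i = j" | "j < i" by linarith
    then show ?thesis
    proof cases
      case 1
      then have "p (Suc i) \<le> p j" using unit_partition_mono[OF p, of "Suc i" j] j by simp
      then show ?thesis using 1 j by simp
    next
      case 3
      then have "p (Suc j) \<le> p i" using unit_partition_mono[OF p, of "Suc j" i] i by simp
      then show ?thesis using 3 j by simp
    qed (use j in simp)
  qed
  then have "step_fun m p x t = (\<Sum>i<m. if i = j then x j else 0)"
    unfolding step_fun_def by (intro sum.cong) auto
  then show ?thesis using j(1) by simp
qed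

lemma step_fun_outside:
  assumes "\<And>i. i < n \<Longrightarrow> 0 \<le> \<tau> i \<and> \<tau> (Suc i) \<le> 1" "t \<le> 0 \<or> 1 < t"
  shows "step_fun n \<tau> x t = 0"
  unfolding step_fun_def using assms by (intro sum.neutral) (force split: split_indicator)

lemma step_fun_outside_partition:
  assumes "unit_partition m p" "t \<le> 0 \<or> 1 < t"
  shows "step_fun m p x t = 0"
  using unit_partition_bounds[OF assms(1)] assms(2) by (intro step_fun_outside) auto

definition subordinate :: "nat \<Rightarrow> (nat \<Rightarrow> real) \<Rightarrow> nat \<Rightarrow> (nat \<Rightarrow> real) \<Rightarrow> bool"
  where "subordinate n \<tau> m p \<longleftrightarrow>
    unit_partition m p \<and> (\<forall>i<n. \<tau> i \<in> p ` {..m} \<and> \<tau> (Suc i) \<in> p ` {..m} \<and> \<tau> i \<le> \<tau> (Suc i))"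

lemma subordinateD:
  assumes "subordinate n \<tau> m p" "i < n"
  obtains a b where "a \<le> m" "b \<le> m" "\<tau> i = p a" "\<tau> (Suc i) = p b" "p a \<le> p b"
  using assms unfolding subordinate_def by (metis atMost_iff imageE)

text \<open>No end point of \<tau> lies strictly inside a cell of \<open>p\<close>, and all
  intervals are open on the left and closed on the right. Hence the value at the right end point
  \<open>p (Suc j)\<close> is the value on the whole cell.\<close>

lemma step_fun_refine:
  assumes "subordinate n \<tau> m p"
  shows "step_fun m p (\<lambda>j. step_fun n \<tau> x (p (Suc j))) t = step_fun n \<tau> x t"
proof (cases "0 < t \<and> t \<le> 1")
  case True
  have p: "unit_partition m p" using assms by (simp add: subordinate_def)
  obtain j where j: "j < m" "p j < t" "t \<le> p (Suc j)"
    using unit_partition_cell[OF p] True by metis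
  have "indicator {\<tau> i<..\<tau> (Suc i)} (p (Suc j)) = (indicator {\<tau> i<..\<tau> (Suc i)} t :: real)" if i: "i < n" for i
  proof -
    obtain a b where ab: "a \<le> m" "b \<le> m" "\<tau> i = p a" "\<tau> (Suc i) = p b" "p a \<le> p b"
      using subordinateD[OF assms i] .
    have "p a < p (Suc j) \<longleftrightarrow> p a < t"
    proof
      assume "p a < p (Suc j)"
      then have "a \<le> j" using unit_partition_less[OF p ab(1), of "Suc j"] by simp
      then have "p a \<le> p j" using unit_partition_mono[OF p] j(1) by simp
      then show "p a < t" using j by simp
    qed (use j in simp)
    moreover have "p (Suc j) \<le> p b \<longleftrightarrow> t \<le> p b"
    proof
      assume "t \<le> p b"
      then have "p j < p b" using j by simp
      then have "j < b" using unit_partition_less[OF p, of j b] j by simp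
      then show "p (Suc j) \<le> p b" using unit_partition_mono[OF p, of "Suc j" b] ab by simp
    qed (use j in simp)
    ultimately show ?thesis unfolding ab by (simp add: indicator_def)
  qed
  then show ?thesis
    unfolding step_fun_cell[OF p j] by (simp add: step_fun_def)
next
  case False
  have p: "unit_partition m p" using assms by (simp add: subordinate_def)
  have "0 \<le> \<tau> i \<and> \<tau> (Suc i) \<le> 1" if "i < n" for i
    using subordinateD[OF assms that] unit_partition_bounds[OF p] by metis
  then have "step_fun n \<tau> x t = 0"
    using False by (intro step_fun_outside) auto
  moreover have "step_fun m p (\<lambda>j. step_fun n \<tau> x (p (Suc j))) t = 0"
    using False by (intro step_fun_outside_partition[OF p]) auto
  ultimately show ?thesis by simp
qed

text \<open>The indicator selects the cells between the indices \<open>a\<close> and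
  \<open>b\<close>. Since partition points may coincide, it can deviate from the index range
  \<open>{a..<b}\<close>, but only on cells of length zero, where the increment vanishes.\<close>

lemma partition_telescope:
  fixes v :: "real \<Rightarrow> 'b::real_vector"
  assumes p: "unit_partition m p" and ab: "a \<le> m" "b \<le> m" "p a \<le> p b"
  shows "(\<Sum>j<m. indicator {p a<..p b} (p (Suc j)) *\<^sub>R (v (p (Suc j)) - v (p j))) = v (p b) - v (p a)"
proof (cases "a \<le> b")
  case True
  have "indicator {p a<..p b} (p (Suc j)) *\<^sub>R (v (p (Suc j)) - v (p j)) = (if j \<in> {a..<b} then v (p (Suc j)) - v (p j) else 0)"
    if j: "j < m" for j
  proof -
    have jj: "p j \<le> p (Suc j)" using unit_partition_mono[OF p, of j "Suc j"] j by simp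
    consider "j < a" | "a \<le> j" "j < b" | "b \<le> j" by linarith
    then show ?thesis
    proof cases
      case 1
      then have "p (Suc j) \<le> p a" using unit_partition_mono[OF p, of "Suc j" a] ab by simp
      then show ?thesis using 1 by simp
    next
      case 2
      have "p a \<le> p j" "p (Suc j) \<le> p b"
        using unit_partition_mono[OF p, of a j] unit_partition_mono[OF p, of "Suc j" b] 2 j ab by auto
      show ?thesis
      proof (cases "p a < p (Suc j)")
        case False
        then have "p (Suc j) = p j" using jj \<open>p a \<le> p j\<close> by simp
        then show ?thesis by simp
      qed (use 2 \<open>p (Suc j) \<le> p b\<close> in simp)
    next
      case 3
      have b: "p b \<le> p j" using unit_partition_mono[OF p, of b j] 3 j by simp
      show ?thesis
      proof (cases "p (Suc j) \<le> p b")
        case True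
        then have "p (Suc j) = p j" using jj b by simp
        then show ?thesis by simp
      qed (use 3 in simp)
    qed
  qed
  then have "(\<Sum>j<m. indicator {p a<..p b} (p (Suc j)) *\<^sub>R (v (p (Suc j)) - v (p j)))
      = (\<Sum>j<m. if j \<in> {a..<b} then v (p (Suc j)) - v (p j) else 0)"
    by (intro sum.cong) auto
  also have "\<dots> = (\<Sum>j\<in>{..<m} \<inter> {a..<b}. v (p (Suc j)) - v (p j))"
    by (simp add: sum.inter_restrict)
  also have "{..<m} \<inter> {a..<b} = {a..<b}" using ab by auto
  also have "(\<Sum>j\<in>{a..<b}. v (p (Suc j)) - v (p j)) = v (p b) - v (p a)"
    using sum_Suc_diff'[OF True, of "\<lambda>j. v (p j)"] by simp
  finally show ?thesis .
next
  case False
  then have "p a = p b" using unit_partition_mono[OF p, of b a] ab by simp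
  then show ?thesis by simp
qed

lemma step_integral_refine:
  assumes "subordinate n \<tau> m p"
  shows "step_integral m p (\<lambda>j. step_fun n \<tau> x (p (Suc j))) w t = step_integral n \<tau> x w t"
proof -
  interpret mv: bounded_bilinear "(*v) :: real ^ 'a ^ 'a \<Rightarrow> real ^ 'a \<Rightarrow> real ^ 'a"
    by (rule bounded_bilinear_matrix_vector_mult)
  have p: "unit_partition m p" using assms by (simp add: subordinate_def)
  \<comment> \<open>Stopping at \<open>t\<close> is absorbed into the integrator, so the telescoping
    does not have to locate \<open>t\<close> among the partition points.\<close>
  define v where "v s = w (min s t)" for s
  have "step_integral m p (\<lambda>j. step_fun n \<tau> x (p (Suc j))) w t
      = (\<Sum>j<m. \<Sum>i<n. x i *v (indicator {\<tau> i<..\<tau> (Suc i)} (p (Suc j)) *\<^sub>R (v (p (Suc j)) - v (p j))))"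
    by (simp only: step_integral_def step_fun_def v_def mv.sum_left mv.scaleR_left mv.scaleR_right)
  also have "\<dots> = (\<Sum>i<n. x i *v (\<Sum>j<m. indicator {\<tau> i<..\<tau> (Suc i)} (p (Suc j)) *\<^sub>R (v (p (Suc j)) - v (p j))))"
    unfolding mv.sum_right by (rule sum.swap)
  also have "\<dots> = (\<Sum>i<n. x i *v (v (\<tau> (Suc i)) - v (\<tau> i)))"
  proof (intro sum.cong refl)
    fix i assume "i \<in> {..<n}"
    then obtain a b where ab: "a \<le> m" "b \<le> m" "\<tau> i = p a" "\<tau> (Suc i) = p b" "p a \<le> p b"
      using subordinateD[OF assms] by auto
    show "x i *v (\<Sum>j<m. indicator {\<tau> i<..\<tau> (Suc i)} (p (Suc j)) *\<^sub>R (v (p (Suc j)) - v (p j))) = x i *v (v (\<tau> (Suc i)) - v (\<tau> i))"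
      unfolding ab(3,4) partition_telescope[OF p ab(1,2,5)] ..
  qed
  finally show ?thesis by (simp add: step_integral_def v_def)
qed

lemma step_integral_diff_left:
  "step_integral n \<tau> (\<lambda>j. x j - y j) w t = step_integral n \<tau> x w t - step_integral n \<tau> y w t"
  by (simp add: step_integral_def matrix_vector_mult_diff_rdistrib sum_subtractf)

lemma step_integral_diff_right:
  "step_integral n \<tau> x (\<lambda>s. w s - w' s) t = step_integral n \<tau> x w t - step_integral n \<tau> x w' t"
proof -
  have "(w a - w' a) - (w c - w' c) = (w a - w c) - (w' a - w' c)" for a c by simp
  then show ?thesis
    by (simp only: step_integral_def matrix_vector_mult_diff_distrib sum_subtractf)
qed

lemma step_fun_diff: "step_fun n \<tau> (\<lambda>j. x j - y j) t = step_fun n \<tau> x t - step_fun n \<tau> y t"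
  by (simp add: step_fun_def scaleR_right_diff_distrib sum_subtractf)

lemma step_fun_mult:
  assumes p: "unit_partition m p"
  shows "step_fun m p (\<lambda>j. x j ** y j) t = step_fun m p x t ** step_fun m p y t"
proof (cases "0 < t \<and> t \<le> 1")
  case True
  then obtain j where "j < m" "p j < t" "t \<le> p (Suc j)" using unit_partition_cell[OF p] by metis
  then show ?thesis by (simp add: step_fun_cell[OF p])
qed (simp add: step_fun_outside_partition[OF p] not_less not_le)

text \<open>Between two neighbouring partition points only one term of the integral moves: earlier
  terms are complete and later ones have not begun.\<close>

lemma step_integral_increment:
  assumes p: "unit_partition m p" and j: "j < m"
  shows "step_integral m p y w (min (p (Suc j)) t) - step_integral m p y w (min (p j) t)
    = y j *v (w (min (p (Suc j)) t) - w (min (p j) t))"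
proof -
  have "step_integral m p y w (min (p (Suc j)) t) - step_integral m p y w (min (p j) t) =
      (\<Sum>k<m. y k *v (w (min (p (Suc k)) (min (p (Suc j)) t)) - w (min (p k) (min (p (Suc j)) t)))
        - y k *v (w (min (p (Suc k)) (min (p j) t)) - w (min (p k) (min (p j) t))))"
    by (simp add: step_integral_def sum_subtractf)
  also have "\<dots> = (\<Sum>k<m. if k = j then y j *v (w (min (p (Suc j)) t) - w (min (p j) t)) else 0)"
  proof (intro sum.cong refl)
    fix k assume "k \<in> {..<m}"
    then have k: "k < m" by simp
    have jj: "p j \<le> p (Suc j)" "p k \<le> p (Suc k)" using unit_partition_mono[OF p] j k by auto
    consider "k < j" | "k = j" | "j < k" by linarith
    then show "y k *v (w (min (p (Suc k)) (min (p (Suc j)) t)) - w (min (p k) (min (p (Suc j)) t)))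
        - y k *v (w (min (p (Suc k)) (min (p j) t)) - w (min (p k) (min (p j) t)))
      = (if k = j then y j *v (w (min (p (Suc j)) t) - w (min (p j) t)) else 0)"
    proof cases
      case 1
      then have "p (Suc k) \<le> p j" using unit_partition_mono[OF p, of "Suc k" j] j by simp
      then have "min (p (Suc k)) (min (p (Suc j)) t) = min (p (Suc k)) t" "min (p k) (min (p (Suc j)) t) = min (p k) t"
        "min (p (Suc k)) (min (p j) t) = min (p (Suc k)) t" "min (p k) (min (p j) t) = min (p k) t"
        using jj by (auto simp: min_def)
      then show ?thesis using 1 by simp
    next
      case 2
      have "min (p j) (min (p (Suc j)) t) = min (p j) t" "min (p (Suc j)) (min (p j) t) = min (p j) t"
        using jj by (auto simp: min_def)
      then show ?thesis using 2 by simp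
    next
      case 3
      then have "p (Suc j) \<le> p k" using unit_partition_mono[OF p, of "Suc j" k] k by simp
      then have "min (p (Suc k)) (min (p (Suc j)) t) = min (p (Suc j)) t" "min (p k) (min (p (Suc j)) t) = min (p (Suc j)) t"
        "min (p (Suc k)) (min (p j) t) = min (p j) t" "min (p k) (min (p j) t) = min (p j) t"
        using jj by (auto simp: min_def)
      then show ?thesis using 3 by simp
    qed
  qed
  also have "\<dots> = y j *v (w (min (p (Suc j)) t) - w (min (p j) t))" using j by simp
  finally show ?thesis .
qed

text \<open>The chain rule for integrals, cell by cell. It is what lets an approximate inverse of
  \<sigma> undo the integration of \<sigma>.\<close>

lemma step_integral_assoc:
  assumes p: "unit_partition m p"
  shows "step_integral m p x (step_integral m p y w) t = step_integral m p (\<lambda>j. x j ** y j) w t"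
proof -
  have "step_integral m p x (step_integral m p y w) t =
      (\<Sum>j<m. x j *v (y j *v (w (min (p (Suc j)) t) - w (min (p j) t))))"
    unfolding step_integral_def[of m p x]
  proof (intro sum.cong refl)
    fix j assume "j \<in> {..<m}"
    then show "x j *v (step_integral m p y w (min (p (Suc j)) t) - step_integral m p y w (min (p j) t)) =
        x j *v (y j *v (w (min (p (Suc j)) t) - w (min (p j) t)))"
      using step_integral_increment[OF p, of j y w t] by simp
  qed
  then show ?thesis by (simp add: step_integral_def matrix_vector_mul_assoc)
qed

lemma step_integral_identity:
  assumes p: "unit_partition m p" and t: "t \<in> {0..1}"
  shows "step_integral m p (\<lambda>_. mat 1) w t = w t - w 0"
proof -
  have "step_integral m p (\<lambda>_. mat 1) w t = (\<Sum>j<m. w (min (p (Suc j)) t) - w (min (p j) t))"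
    by (simp add: step_integral_def)
  also have "\<dots> = w (min (p m) t) - w (min (p 0) t)"
    using sum_Suc_diff'[of 0 m "\<lambda>j. w (min (p j) t)"] by (simp add: atLeast0LessThan)
  finally have "step_integral m p (\<lambda>_. mat 1) w t = w (min (p m) t) - w (min (p 0) t)" .
  moreover have "min (p m) t = t" "min (p 0) t = 0" using p t by (auto simp: unit_partition_def)
  ultimately show ?thesis by simp
qed

lemma step_fun_identity:
  assumes p: "unit_partition m p" and t: "0 < t" "t \<le> 1"
  shows "step_fun m p (\<lambda>_. x) t = x"
  using unit_partition_cell[OF p t] step_fun_cell[OF p] by metis

lemma step_integral_at_partition:
  assumes p: "unit_partition m p" and k: "k \<le> m"
  shows "step_integral m p x w (p k) = (\<Sum>j<k. x j *v (w (p (Suc j)) - w (p j)))"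
proof -
  have "step_integral m p x w (p k) = (\<Sum>j<m. if j < k then x j *v (w (p (Suc j)) - w (p j)) else 0)"
    unfolding step_integral_def
  proof (intro sum.cong refl)
    fix j assume "j \<in> {..<m}"
    then have j: "j < m" by simp
    show "x j *v (w (min (p (Suc j)) (p k)) - w (min (p j) (p k))) = (if j < k then x j *v (w (p (Suc j)) - w (p j)) else 0)"
    proof (cases "j < k")
      case True
      then have "p (Suc j) \<le> p k" "p j \<le> p k" using unit_partition_mono[OF p] k by auto
      then show ?thesis using True by simp
    next
      case False
      then have "p k \<le> p (Suc j)" "p k \<le> p j" using unit_partition_mono[OF p] j by auto
      then show ?thesis using False by (simp add: min_absorb2)
    qed
  qed
  also have "\<dots> = (\<Sum>j\<in>{..<m} \<inter> {j. j < k}. x j *v (w (p (Suc j)) - w (p j)))"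
    by (simp add: sum.inter_restrict)
  also have "{..<m} \<inter> {j. j < k} = {..<k}" using k by auto
  finally show ?thesis .
qed

lemma continuous_on_step_integral:
  assumes w: "continuous_on {0..1} w" and \<tau>: "\<And>i. i < n \<Longrightarrow> 0 \<le> \<tau> i \<and> 0 \<le> \<tau> (Suc i)"
  shows "continuous_on {0..1} (step_integral n \<tau> x w)"
proof -
  have "continuous_on {0..1} (\<lambda>t. w (min s t))" if "0 \<le> s" for s
    using that by (intro continuous_on_compose2[OF w] continuous_intros) auto
  then have "continuous_on {0..1} (\<lambda>t. \<Sum>i<n. x i *v (w (min (\<tau> (Suc i)) t) - w (min (\<tau> i) t)))"
    using \<tau> by (intro continuous_intros bounded_linear.continuous_on[OF matrix_vector_mul_bounded_linear]) auto
  then show ?thesis by (simp add: step_integral_def[abs_def])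
qed

text \<open>The cells are disjoint, so the squared norm of the sum is the sum of the squared norms;
  time 0 lies in no cell and contributes nothing.\<close>

lemma nn_integral_step_fun:
  assumes p: "unit_partition m p"
  shows "(\<integral>\<^sup>+t\<in>{0..1}. ennreal ((norm (step_fun m p x t))\<^sup>2) \<partial>lborel) = ennreal (\<Sum>j<m. (norm (x j))\<^sup>2 * (p (Suc j) - p j))"
proof -
  have "ennreal ((norm (step_fun m p x t))\<^sup>2) * indicator {0..1} t
      = (\<Sum>j<m. ennreal ((norm (x j))\<^sup>2) * indicator {p j<..p (Suc j)} t)" for t
  proof (cases "0 < t \<and> t \<le> 1")
    case True
    then obtain k where k: "k < m" "p k < t" "t \<le> p (Suc k)" using unit_partition_cell[OF p] by metis
    have "ennreal ((norm (x j))\<^sup>2) * indicator {p j<..p (Suc j)} t = (if j = k then ennreal ((norm (x k))\<^sup>2) else 0)"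
      if j: "j < m" for j
    proof -
      consider "j < k" | "j = k" | "k < j" by linarith
      then show ?thesis
      proof cases
        case 1
        then have "p (Suc j) \<le> p k" using unit_partition_mono[OF p, of "Suc j" k] k by simp
        then show ?thesis using 1 k by simp
      next
        case 3
        then have "p (Suc k) \<le> p j" using unit_partition_mono[OF p, of "Suc k" j] j by simp
        then show ?thesis using 3 k by simp
      qed (use k in simp)
    qed
    then have "(\<Sum>j<m. ennreal ((norm (x j))\<^sup>2) * indicator {p j<..p (Suc j)} t) = (\<Sum>j<m. if j = k then ennreal ((norm (x k))\<^sup>2) else 0)"
      by (intro sum.cong) auto
    then show ?thesis using k True by (simp add: step_fun_cell[OF p k])
  next
    case False
    have "indicator {p j<..p (Suc j)} t = (0::ennreal)" if "j < m" for j
      using unit_partition_bounds[OF p, of j] unit_partition_bounds[OF p, of "Suc j"] that False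
      by (auto split: split_indicator)
    moreover have "step_fun m p x t = 0" using False by (intro step_fun_outside_partition[OF p]) auto
    ultimately show ?thesis by simp
  qed
  then have "(\<integral>\<^sup>+t\<in>{0..1}. ennreal ((norm (step_fun m p x t))\<^sup>2) \<partial>lborel)
      = (\<integral>\<^sup>+t. (\<Sum>j<m. ennreal ((norm (x j))\<^sup>2) * indicator {p j<..p (Suc j)} t) \<partial>lborel)"
    by (intro nn_integral_cong)
  also have "\<dots> = (\<Sum>j<m. \<integral>\<^sup>+t. ennreal ((norm (x j))\<^sup>2) * indicator {p j<..p (Suc j)} t \<partial>lborel)"
    by (rule nn_integral_sum) measurable
  also have "\<dots> = (\<Sum>j<m. ennreal ((norm (x j))\<^sup>2) * emeasure lborel {p j<..p (Suc j)})"
    by (intro sum.cong refl nn_integral_cmult_indicator) simp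
  also have "\<dots> = (\<Sum>j<m. ennreal ((norm (x j))\<^sup>2 * (p (Suc j) - p j)))"
    using unit_partition_mono[OF p] by (intro sum.cong refl) (simp add: ennreal_mult)
  also have "\<dots> = ennreal (\<Sum>j<m. (norm (x j))\<^sup>2 * (p (Suc j) - p j))"
    using unit_partition_mono[OF p] by (intro sum_ennreal) simp
  finally show ?thesis .
qed


section \<open>Simple processes on a common partition\<close>

text \<open>A filtration without an ambient measure. The fields of a basis, the path fields with and
  without completion, and fields constant in time are all treated as instances; the subalgebra
  condition includes that the spaces coincide.\<close>

definition increasing_fields :: "(real \<Rightarrow> 'a measure) \<Rightarrow> bool"
  where "increasing_fields F \<longleftrightarrow> (\<forall>s\<in>{0..1}. \<forall>t\<in>{0..1}. s \<le> t \<longrightarrow> subalgebra (F t) (F s))"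

lemma increasing_fieldsD:
  assumes "increasing_fields F" "s \<in> {0..1}" "t \<in> {0..1}"
  shows "space (F s) = space (F t)" "s \<le> t \<Longrightarrow> f \<in> F s \<rightarrow>\<^sub>M N \<Longrightarrow> f \<in> F t \<rightarrow>\<^sub>M N"
proof -
  have *: "s \<le> t \<Longrightarrow> subalgebra (F t) (F s)" "t \<le> s \<Longrightarrow> subalgebra (F s) (F t)"
    using assms unfolding increasing_fields_def by blast+
  then show "space (F s) = space (F t)"
    unfolding subalgebra_def by (metis linear)
  show "s \<le> t \<Longrightarrow> f \<in> F s \<rightarrow>\<^sub>M N \<Longrightarrow> f \<in> F t \<rightarrow>\<^sub>M N"
    using *(1) by (rule measurable_from_subalg)
qed

lemma increasing_fields_basis: "complete_stochastic_basis M F \<Longrightarrow> increasing_fields F"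
  unfolding increasing_fields_def subalgebra_def using basisD(3,5) by metis

lemma increasing_fields_path_filtration: "increasing_fields path_filtration"
  unfolding increasing_fields_def subalgebra_def by (auto dest: subsetD[OF path_filtration_mono])

lemma simple_dataD:
  assumes "simple_data F n \<tau> \<xi>" "i < n"
  shows "0 \<le> \<tau> i" "\<tau> i \<le> \<tau> (Suc i)" "\<tau> (Suc i) \<le> 1" "\<tau> i \<in> {0..1}" "\<tau> (Suc i) \<in> {0..1}"
    "\<xi> i \<in> borel_measurable (F (\<tau> i))" "bounded (\<xi> i ` space (F (\<tau> i)))"
  using assms unfolding simple_data_def by force+

lemma simple_data_bound:
  assumes "simple_data F n \<tau> \<xi>" "i < n"
  obtains C where "0 \<le> C" "\<And>\<omega>. \<omega> \<in> space (F (\<tau> i)) \<Longrightarrow> norm (\<xi> i \<omega>) \<le> C"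
proof -
  obtain C where C: "\<And>x. x \<in> \<xi> i ` space (F (\<tau> i)) \<Longrightarrow> norm x \<le> C"
    using simple_dataD(7)[OF assms] by (auto simp: bounded_iff)
  show thesis
    by (rule that[of "max C 0"]) (auto intro: order_trans[OF C] simp: le_max_iff_disj)
qed

text \<open>The step function is evaluated at the right end point of a cell, yet its value is known
  at the left one: only coefficients with \<open>\<tau> i < p (Suc j)\<close> contribute, and since
  \<open>\<tau> i\<close> is itself a partition point this forces
  \<open>\<tau> i \<le> p j\<close>.\<close>

lemma simple_data_refine:
  assumes F: "increasing_fields F" and sd: "simple_data F n \<tau> \<xi>" and sub: "subordinate n \<tau> m p"
  shows "simple_data F m p (\<lambda>j \<omega>. step_fun n \<tau> (\<lambda>i. \<xi> i \<omega>) (p (Suc j)))"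
  unfolding simple_data_def
proof (intro allI impI conjI)
  have p: "unit_partition m p" using sub by (simp add: subordinate_def)
  fix j assume j: "j < m"
  have pj: "p j \<in> {0..1}" using unit_partition_bounds[OF p, of j] j by simp
  show "0 \<le> p j" "p (Suc j) \<le> 1" "p j \<le> p (Suc j)"
    using unit_partition_bounds[OF p] unit_partition_mono[OF p, of j "Suc j"] j by auto
  have "(\<lambda>\<omega>. indicator {\<tau> i<..\<tau> (Suc i)} (p (Suc j)) *\<^sub>R \<xi> i \<omega>) \<in> borel_measurable (F (p j))" if i: "i < n" for i
  proof (cases "\<tau> i < p (Suc j)")
    case True
    obtain a where a: "a \<le> m" "\<tau> i = p a" using subordinateD[OF sub i] by metis
    then have "a \<le> j" using True unit_partition_less[OF p a(1), of "Suc j"] by simp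
    then have "p a \<le> p j" using unit_partition_mono[OF p] j by simp
    then have "\<xi> i \<in> borel_measurable (F (p j))"
      using simple_dataD(4,6)[OF sd i] a(2) by (intro increasing_fieldsD(2)[OF F _ pj, of "\<tau> i"]) auto
    then show ?thesis by simp
  qed simp
  then show "(\<lambda>\<omega>. step_fun n \<tau> (\<lambda>i. \<xi> i \<omega>) (p (Suc j))) \<in> borel_measurable (F (p j))"
    unfolding step_fun_def by (intro borel_measurable_sum) auto
  have "\<exists>C\<ge>0. \<forall>\<omega>\<in>space (F (p j)). norm (\<xi> i \<omega>) \<le> C" if i: "i < n" for i
    using simple_data_bound[OF sd i] increasing_fieldsD(1)[OF F simple_dataD(4)[OF sd i] pj] by metis
  then obtain C where C: "\<And>i. i < n \<Longrightarrow> 0 \<le> C i" "\<And>i \<omega>. i < n \<Longrightarrow> \<omega> \<in> space (F (p j)) \<Longrightarrow> norm (\<xi> i \<omega>) \<le> C i"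
    by metis
  have "norm (step_fun n \<tau> (\<lambda>i. \<xi> i \<omega>) (p (Suc j))) \<le> (\<Sum>i<n. C i)" if "\<omega> \<in> space (F (p j))" for \<omega>
    unfolding step_fun_def using C that by (intro sum_norm_le) (auto split: split_indicator)
  then show "bounded ((\<lambda>\<omega>. step_fun n \<tau> (\<lambda>i. \<xi> i \<omega>) (p (Suc j))) ` space (F (p j)))"
    by (auto simp: bounded_iff)
qed

lemma common_partition:
  assumes "simple_data F n \<tau> \<xi>" "simple_data F n' \<tau>' \<zeta>"
  shows "\<exists>m p. subordinate n \<tau> m p \<and> subordinate n' \<tau>' m p"
proof -
  let ?T = "(\<Union>i<n. {\<tau> i, \<tau> (Suc i)}) \<union> (\<Union>i<n'. {\<tau>' i, \<tau>' (Suc i)})"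
  have "finite ?T" "?T \<subseteq> {0..1}"
    using simple_dataD(4,5)[OF assms(1)] simple_dataD(4,5)[OF assms(2)] by auto
  from unit_partition_exists[OF this] obtain m p where "unit_partition m p" "?T \<subseteq> p ` {..m}" by auto
  then show ?thesis
    using simple_dataD(2)[OF assms(1)] simple_dataD(2)[OF assms(2)]
    unfolding subordinate_def by (intro exI[of _ m] exI[of _ p]) auto
qed

lemma simple_data_combine:
  assumes "simple_data F m p x" "simple_data F m p y"
  shows simple_data_diff: "simple_data F m p (\<lambda>j \<omega>. x j \<omega> - y j \<omega>)"
    and simple_data_add: "simple_data F m p (\<lambda>j \<omega>. x j \<omega> + y j \<omega>)"
    and simple_data_mult: "simple_data F m p (\<lambda>j \<omega>. x j \<omega> ** y j \<omega>)"
proof -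
  have "bounded ((\<lambda>\<omega>. x j \<omega> - y j \<omega>) ` space (F (p j))) \<and> bounded ((\<lambda>\<omega>. x j \<omega> + y j \<omega>) ` space (F (p j))) \<and>
      bounded ((\<lambda>\<omega>. x j \<omega> ** y j \<omega>) ` space (F (p j)))" if "j < m" for j
  proof -
    obtain C where C: "0 \<le> C" "\<And>\<omega>. \<omega> \<in> space (F (p j)) \<Longrightarrow> norm (x j \<omega>) \<le> C"
      using simple_data_bound[OF assms(1) \<open>j < m\<close>] by metis
    obtain D where D: "0 \<le> D" "\<And>\<omega>. \<omega> \<in> space (F (p j)) \<Longrightarrow> norm (y j \<omega>) \<le> D"
      using simple_data_bound[OF assms(2) \<open>j < m\<close>] by metis
    have "norm (x j \<omega> - y j \<omega>) \<le> C + D" "norm (x j \<omega> + y j \<omega>) \<le> C + D" "norm (x j \<omega> ** y j \<omega>) \<le> C * D"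
      if "\<omega> \<in> space (F (p j))" for \<omega>
    proof -
      show "norm (x j \<omega> - y j \<omega>) \<le> C + D"
        using norm_triangle_ineq4[of "x j \<omega>" "y j \<omega>"] C(2)[OF that] D(2)[OF that] by linarith
      show "norm (x j \<omega> + y j \<omega>) \<le> C + D"
        using norm_triangle_ineq[of "x j \<omega>" "y j \<omega>"] C(2)[OF that] D(2)[OF that] by linarith
      have "norm (x j \<omega>) * norm (y j \<omega>) \<le> C * D"
        using C D that by (intro mult_mono) auto
      then show "norm (x j \<omega> ** y j \<omega>) \<le> C * D"
        using norm_matrix_matrix_mult_le[of "x j \<omega>" "y j \<omega>"] by linarith
    qed
    then show ?thesis unfolding bounded_iff by blast
  qed
  then show "simple_data F m p (\<lambda>j \<omega>. x j \<omega> - y j \<omega>)" "simple_data F m p (\<lambda>j \<omega>. x j \<omega> + y j \<omega>)"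
    "simple_data F m p (\<lambda>j \<omega>. x j \<omega> ** y j \<omega>)"
    using assms unfolding simple_data_def
    by (auto intro!: borel_measurable_diff borel_measurable_add borel_measurable_matrix_matrix_mult)
qed


section \<open>A maximal inequality for integrals of simple processes\<close>

text \<open>\<open>U\<close> and \<open>g (D \<omega>)\<close> generate subfields of the two
  independent fields, so the expectation of their product factorises. The hypothesis is about a
  whole field, because independence from the entire past is what the Brownian property
  supplies.\<close>

lemma (in prob_space) indep_set_vimage_integral:
  fixes D :: "'a \<Rightarrow> 'b::topological_space" and g :: "'b \<Rightarrow> real"
  assumes indep: "indep_set (sets G) (sets (vimage_algebra (space M) D borel))"
    and G: "subalgebra M G" and D [measurable]: "D \<in> M \<rightarrow>\<^sub>M borel"
    and U: "U \<in> borel_measurable G" "integrable M U"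
    and g [measurable]: "g \<in> borel_measurable borel" and gD: "integrable M (\<lambda>\<omega>. g (D \<omega>))"
  shows "integrable M (\<lambda>\<omega>. U \<omega> * g (D \<omega>))" (is ?int)
    and "(\<integral>\<omega>. U \<omega> * g (D \<omega>) \<partial>M) = (\<integral>\<omega>. U \<omega> \<partial>M) * (\<integral>\<omega>. g (D \<omega>) \<partial>M)" (is ?eq)
proof -
  have [simp]: "space G = space M" using G by (simp add: subalgebra_def)
  have 1: "sigma_sets (space M) {U -` A \<inter> space M | A. A \<in> sets borel} \<subseteq> sets G"
  proof -
    have "sigma_sets (space G) {U -` A \<inter> space M | A. A \<in> sets borel} \<subseteq> sets G"
      using measurable_sets[OF U(1)] by (intro sets.sigma_sets_subset) auto
    then show ?thesis by simp
  qed
  have 2: "sigma_sets (space M) {(\<lambda>\<omega>. g (D \<omega>)) -` A \<inter> space M | A. A \<in> sets borel} \<subseteq> sets (vimage_algebra (space M) D borel)"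
  proof -
    have "(\<lambda>\<omega>. g (D \<omega>)) -` A \<inter> space M \<in> sets (vimage_algebra (space M) D borel)" if "A \<in> sets borel" for A
    proof -
      have "g -` A \<in> sets borel" using measurable_sets[OF g that] by simp
      then have "D -` (g -` A) \<inter> space M \<in> sets (vimage_algebra (space M) D borel)"
        by (rule in_vimage_algebra)
      then show ?thesis by (simp add: vimage_def)
    qed
    then have "sigma_sets (space (vimage_algebra (space M) D borel)) {(\<lambda>\<omega>. g (D \<omega>)) -` A \<inter> space M | A. A \<in> sets borel}
        \<subseteq> sets (vimage_algebra (space M) D borel)"
      by (intro sets.sigma_sets_subset) auto
    then show ?thesis by simp
  qed
  have "indep_set (sigma_sets (space M) {U -` A \<inter> space M | A. A \<in> sets borel})
      (sigma_sets (space M) {(\<lambda>\<omega>. g (D \<omega>)) -` A \<inter> space M | A. A \<in> sets borel})"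
    using indep unfolding indep_set_def
    by (rule indep_sets_mono_sets) (use 1 2 in \<open>auto split: bool.splits\<close>)
  then have "indep_var borel U borel (\<lambda>\<omega>. g (D \<omega>))"
    unfolding indep_var_eq using borel_measurable_integrable[OF U(2)] by simp
  from indep_var_integrable[OF this U(2) gD] indep_var_lebesgue_integral[OF this U(2) gD]
  show ?int ?eq by simp_all
qed

locale brownian_basis =
  fixes M :: "'a measure" and F :: "real \<Rightarrow> 'a measure" and B :: "'a \<Rightarrow> 'd::finite wpath"
  assumes basis: "complete_stochastic_basis M F" and brownian: "brownian_motion M F B"
begin

sublocale prob_space M
  by (rule basisD[OF basis])

lemma F_space: "t \<in> {0..1} \<Longrightarrow> space (F t) = space M"
  by (rule basisD[OF basis])

lemma F_incr: "increasing_fields F"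
  by (rule increasing_fields_basis[OF basis])

lemma F_subalgebra: "t \<in> {0..1} \<Longrightarrow> subalgebra M (F t)"
  using basisD(3,4)[OF basis] by (simp add: subalgebra_def)

lemma F_to_M: "t \<in> {0..1} \<Longrightarrow> f \<in> F t \<rightarrow>\<^sub>M N \<Longrightarrow> f \<in> M \<rightarrow>\<^sub>M N"
  by (rule measurable_from_subalg[OF F_subalgebra])

lemma B_adapted: "t \<in> {0..1} \<Longrightarrow> (\<lambda>\<omega>. path_at (B \<omega>) t) \<in> borel_measurable (F t)"
  using brownian by (simp add: brownian_motion_def adapted_process_def)

lemma B_measurable: "t \<in> {0..1} \<Longrightarrow> (\<lambda>\<omega>. path_at (B \<omega>) t) \<in> borel_measurable M"
  using F_to_M B_adapted by blast

lemma increment_integral: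
  assumes st: "s \<in> {0..1}" "t \<in> {0..1}" "s \<le> t" and U: "U \<in> borel_measurable (F s)" "integrable M U"
  shows "integrable M (\<lambda>\<omega>. U \<omega> * (path_at (B \<omega>) t - path_at (B \<omega>) s) $ k)"
    and "(\<integral>\<omega>. U \<omega> * (path_at (B \<omega>) t - path_at (B \<omega>) s) $ k \<partial>M) = 0"
    and "integrable M (\<lambda>\<omega>. U \<omega> * (norm (path_at (B \<omega>) t - path_at (B \<omega>) s))\<^sup>2)"
    and "(\<integral>\<omega>. U \<omega> * (norm (path_at (B \<omega>) t - path_at (B \<omega>) s))\<^sup>2 \<partial>M) = (\<integral>\<omega>. U \<omega> \<partial>M) * (real CARD('d) * (t - s))"
proof -
  let ?D = "\<lambda>\<omega>. path_at (B \<omega>) t - path_at (B \<omega>) s"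
  have "integrable M (\<lambda>\<omega>. U \<omega> * ?D \<omega> $ k) \<and> (\<integral>\<omega>. U \<omega> * ?D \<omega> $ k \<partial>M) = 0 \<and>
      integrable M (\<lambda>\<omega>. U \<omega> * (norm (?D \<omega>))\<^sup>2) \<and>
      (\<integral>\<omega>. U \<omega> * (norm (?D \<omega>))\<^sup>2 \<partial>M) = (\<integral>\<omega>. U \<omega> \<partial>M) * (real CARD('d) * (t - s))"
  \<comment> \<open>The Brownian property speaks only of \<open>s < t\<close>. Empty cells do occur,
    and for them every claim is trivial.\<close>
  proof (cases "s = t")
    case False
    then have *: "0 \<le> s \<and> s < t \<and> t \<le> 1" using st by auto
    have D: "?D \<in> M \<rightarrow>\<^sub>M borel" using st by (intro borel_measurable_diff B_measurable)
    have law: "distr M borel ?D = gaussian (t - s)"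
      and indep: "indep_set (sets (F s)) (sets (vimage_algebra (space M) ?D borel))"
      using brownian * unfolding brownian_motion_def by blast+
    note mom = gaussian_moments[OF _ D law]
    note I = indep_set_vimage_integral[OF indep F_subalgebra[OF st(1)] D U]
    have ts: "0 < t - s" using * by simp
    have k: "(\<lambda>x::real ^ 'd. x $ k) \<in> borel_measurable borel" by simp
    have n: "(\<lambda>x::real ^ 'd. (norm x)\<^sup>2) \<in> borel_measurable borel" by simp
    show ?thesis
      using I[OF k mom(1)[OF ts]] I[OF n mom(3)[OF ts]] mom(2,4)[OF ts] by simp
  qed simp
  then show "integrable M (\<lambda>\<omega>. U \<omega> * ?D \<omega> $ k)" "(\<integral>\<omega>. U \<omega> * ?D \<omega> $ k \<partial>M) = 0"
      "integrable M (\<lambda>\<omega>. U \<omega> * (norm (?D \<omega>))\<^sup>2)"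
      "(\<integral>\<omega>. U \<omega> * (norm (?D \<omega>))\<^sup>2 \<partial>M) = (\<integral>\<omega>. U \<omega> \<partial>M) * (real CARD('d) * (t - s))"
    by blast+
qed

definition partial_integral :: "(nat \<Rightarrow> real) \<Rightarrow> (nat \<Rightarrow> 'a \<Rightarrow> real ^ 'd ^ 'd) \<Rightarrow> nat \<Rightarrow> 'a \<Rightarrow> real ^ 'd"
  where "partial_integral p h k \<omega> = (\<Sum>j<k. h j \<omega> *v (path_at (B \<omega>) (p (Suc j)) - path_at (B \<omega>) (p j)))"

lemma partial_integral_measurable:
  assumes p: "unit_partition m p" and sd: "simple_data F m p h" and k: "k \<le> m"
  shows "partial_integral p h k \<in> borel_measurable (F (p k))"
proof -
  have pk: "p k \<in> {0..1}" using unit_partition_bounds[OF p k] by simp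
  have "(\<lambda>\<omega>. h j \<omega> *v (path_at (B \<omega>) (p (Suc j)) - path_at (B \<omega>) (p j))) \<in> borel_measurable (F (p k))" if j: "j < k" for j
  proof -
    have jm: "j < m" using j k by simp
    have b: "p j \<in> {0..1}" "p (Suc j) \<in> {0..1}" "p j \<le> p k" "p (Suc j) \<le> p k"
      using unit_partition_bounds[OF p, of j] unit_partition_bounds[OF p, of "Suc j"] unit_partition_mono[OF p, of _ k] j k by auto
    show ?thesis
      by (intro borel_measurable_matrix_vector_mult borel_measurable_diff
          increasing_fieldsD(2)[OF F_incr b(1) pk b(3)] increasing_fieldsD(2)[OF F_incr b(2) pk b(4)]
          B_adapted b simple_dataD(6)[OF sd jm])
  qed
  then show ?thesis
    unfolding partial_integral_def[abs_def] by (intro borel_measurable_sum) auto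
qed

text \<open>One half of the Ito isometry, by induction on the number of cells: the cross term
  vanishes because the new increment is centred and independent of the past. Bounding the new term
  by the product of the Frobenius norm and the norm of the increment costs the factor
  \<open>CARD('d)\<close>.\<close>

lemma partial_integral_L2:
  assumes p: "unit_partition m p" and sd: "simple_data F m p h" and k: "k \<le> m"
  shows "integrable M (\<lambda>\<omega>. (norm (partial_integral p h k \<omega>))\<^sup>2)"
    and "(\<integral>\<omega>. (norm (partial_integral p h k \<omega>))\<^sup>2 \<partial>M)
      \<le> real CARD('d) * (\<integral>\<omega>. (\<Sum>j<k. (norm (h j \<omega>))\<^sup>2 * (p (Suc j) - p j)) \<partial>M)"
proof -
  have int_h: "integrable M (\<lambda>\<omega>. (norm (h j \<omega>))\<^sup>2)" if j: "j < m" for j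
  proof -
    obtain C where C: "0 \<le> C" "\<And>\<omega>. \<omega> \<in> space (F (p j)) \<Longrightarrow> norm (h j \<omega>) \<le> C"
      using simple_data_bound[OF sd j] by metis
    have [measurable]: "h j \<in> borel_measurable M"
      using F_to_M[OF simple_dataD(4)[OF sd j] simple_dataD(6)[OF sd j]] .
    show ?thesis
      using C F_space[OF simple_dataD(4)[OF sd j]]
      by (intro integrable_const_bound[where B = "C\<^sup>2"]) (auto intro!: power_mono AE_I2)
  qed
  have "integrable M (\<lambda>\<omega>. (norm (partial_integral p h k \<omega>))\<^sup>2) \<and>
      (\<integral>\<omega>. (norm (partial_integral p h k \<omega>))\<^sup>2 \<partial>M)
      \<le> real CARD('d) * (\<integral>\<omega>. (\<Sum>j<k. (norm (h j \<omega>))\<^sup>2 * (p (Suc j) - p j)) \<partial>M)"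
    using k
  proof (induction k)
    case 0
    then show ?case by (simp add: partial_integral_def)
  next
    case (Suc k)
    then have km: "k < m" by simp
    let ?N = "partial_integral p h k" and ?D = "\<lambda>\<omega>. path_at (B \<omega>) (p (Suc k)) - path_at (B \<omega>) (p k)"
    have IH: "integrable M (\<lambda>\<omega>. (norm (?N \<omega>))\<^sup>2)"
      "(\<integral>\<omega>. (norm (?N \<omega>))\<^sup>2 \<partial>M) \<le> real CARD('d) * (\<integral>\<omega>. (\<Sum>j<k. (norm (h j \<omega>))\<^sup>2 * (p (Suc j) - p j)) \<partial>M)"
      using Suc by auto
    have pk: "p k \<in> {0..1}" "p (Suc k) \<in> {0..1}" "p k \<le> p (Suc k)"
      using simple_dataD[OF sd km] by auto
    obtain C where C: "0 \<le> C" "\<And>\<omega>. \<omega> \<in> space M \<Longrightarrow> norm (h k \<omega>) \<le> C"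
      using simple_data_bound[OF sd km] F_space[OF pk(1)] by metis
    have hF [measurable]: "h k \<in> borel_measurable (F (p k))" by (rule simple_dataD(6)[OF sd km])
    have hM [measurable]: "h k \<in> borel_measurable M" by (rule F_to_M[OF pk(1) hF])
    have NF [measurable]: "?N \<in> borel_measurable (F (p k))" using partial_integral_measurable[OF p sd] km by simp
    have NM [measurable]: "?N \<in> borel_measurable M" by (rule F_to_M[OF pk(1) NF])
    have DM [measurable]: "?D \<in> borel_measurable M" using pk by (intro borel_measurable_diff B_measurable)
    \<comment> \<open>Coefficient of the i-th component of the increment in the cross term. It is
      known at \<open>p k\<close>, and integrable because \<open>h k\<close> is bounded and the
      partial integral is square integrable.\<close>
    define U where "U i \<omega> = (\<Sum>j\<in>UNIV. h k \<omega> $ j $ i * ?N \<omega> $ j)" for i \<omega>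
    have U_F: "U i \<in> borel_measurable (F (p k))" for i
      unfolding U_def[abs_def] by measurable
    have U_int: "integrable M (U i)" for i
      unfolding U_def[abs_def]
    proof (intro Bochner_Integration.integrable_sum)
      fix j
      show "integrable M (\<lambda>\<omega>. h k \<omega> $ j $ i * ?N \<omega> $ j)"
      proof (rule Bochner_Integration.integrable_bound)
        show "integrable M (\<lambda>\<omega>. C * (1 + (norm (?N \<omega>))\<^sup>2))" using IH by auto
        show "AE \<omega> in M. norm (h k \<omega> $ j $ i * ?N \<omega> $ j) \<le> norm (C * (1 + (norm (?N \<omega>))\<^sup>2))"
        proof (rule AE_I2)
          fix \<omega> assume w: "\<omega> \<in> space M"
          have "\<bar>h k \<omega> $ j $ i\<bar> \<le> C"
            using component_le_norm_cart[of "h k \<omega> $ j" i] Finite_Cartesian_Product.norm_nth_le[of "h k \<omega>" j] C(2)[OF w] by linarith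
          moreover have "\<bar>?N \<omega> $ j\<bar> \<le> 1 + (norm (?N \<omega>))\<^sup>2"
          proof -
            have "norm (?N \<omega>) \<le> 1 + (norm (?N \<omega>))\<^sup>2"
              using sum_power2_ge_zero[of "norm (?N \<omega>) - 1" 0] by (simp add: power2_eq_square algebra_simps) (smt (verit) mult_nonneg_nonneg norm_ge_zero)
            then show ?thesis using component_le_norm_cart[of "?N \<omega>" j] by linarith
          qed
          ultimately have "\<bar>h k \<omega> $ j $ i\<bar> * \<bar>?N \<omega> $ j\<bar> \<le> C * (1 + (norm (?N \<omega>))\<^sup>2)"
            using C(1) by (intro mult_mono) auto
          then show "norm (h k \<omega> $ j $ i * ?N \<omega> $ j) \<le> norm (C * (1 + (norm (?N \<omega>))\<^sup>2))"
            using C(1) by (simp add: abs_mult)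
        qed
      qed measurable
    qed
    have cross: "?N \<omega> \<bullet> (h k \<omega> *v ?D \<omega>) = (\<Sum>i\<in>UNIV. U i \<omega> * ?D \<omega> $ i)" for \<omega>
    proof -
      have "?N \<omega> \<bullet> (h k \<omega> *v ?D \<omega>) = (\<Sum>j\<in>UNIV. \<Sum>i\<in>UNIV. h k \<omega> $ j $ i * ?N \<omega> $ j * ?D \<omega> $ i)"
        by (simp add: inner_vec_def matrix_vector_mult_def sum_distrib_left ac_simps)
      also have "\<dots> = (\<Sum>i\<in>UNIV. U i \<omega> * ?D \<omega> $ i)"
        unfolding U_def sum_distrib_right by (rule sum.swap)
      finally show ?thesis .
    qed
    have cross_int: "integrable M (\<lambda>\<omega>. ?N \<omega> \<bullet> (h k \<omega> *v ?D \<omega>))"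
      and cross_0: "(\<integral>\<omega>. ?N \<omega> \<bullet> (h k \<omega> *v ?D \<omega>) \<partial>M) = 0"
      unfolding cross using increment_integral(1,2)[OF pk U_F U_int]
      by (auto simp: Bochner_Integration.integral_sum)
    have "integrable M (\<lambda>\<omega>. (norm (h k \<omega>))\<^sup>2 * (norm (?D \<omega>))\<^sup>2)"
      by (rule increment_integral(3)[OF pk _ int_h[OF km]]) measurable
    have sq: "(norm (h k \<omega> *v ?D \<omega>))\<^sup>2 \<le> (norm (h k \<omega>))\<^sup>2 * (norm (?D \<omega>))\<^sup>2" for \<omega>
      unfolding power_mult_distrib[symmetric] by (intro power_mono norm_matrix_vector_mult_le) simp
    have int_hD: "integrable M (\<lambda>\<omega>. (norm (h k \<omega> *v ?D \<omega>))\<^sup>2)"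
      by (rule Bochner_Integration.integrable_bound[OF \<open>integrable M (\<lambda>\<omega>. (norm (h k \<omega>))\<^sup>2 * (norm (?D \<omega>))\<^sup>2)\<close>])
        (use sq in auto)
    have hD: "(\<integral>\<omega>. (norm (h k \<omega> *v ?D \<omega>))\<^sup>2 \<partial>M) \<le> (\<integral>\<omega>. (norm (h k \<omega>))\<^sup>2 \<partial>M) * (real CARD('d) * (p (Suc k) - p k))"
    proof -
      have "(\<integral>\<omega>. (norm (h k \<omega> *v ?D \<omega>))\<^sup>2 \<partial>M) \<le> (\<integral>\<omega>. (norm (h k \<omega>))\<^sup>2 * (norm (?D \<omega>))\<^sup>2 \<partial>M)"
        using int_hD \<open>integrable M (\<lambda>\<omega>. (norm (h k \<omega>))\<^sup>2 * (norm (?D \<omega>))\<^sup>2)\<close> sq by (rule integral_mono)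
      also have "\<dots> = (\<integral>\<omega>. (norm (h k \<omega>))\<^sup>2 \<partial>M) * (real CARD('d) * (p (Suc k) - p k))"
        by (rule increment_integral(4)[OF pk _ int_h[OF km]]) measurable
      finally show ?thesis .
    qed
    have expand: "(norm (partial_integral p h (Suc k) \<omega>))\<^sup>2
        = (norm (?N \<omega>))\<^sup>2 + 2 * (?N \<omega> \<bullet> (h k \<omega> *v ?D \<omega>)) + (norm (h k \<omega> *v ?D \<omega>))\<^sup>2" for \<omega>
      unfolding power2_norm_eq_inner by (simp add: partial_integral_def inner_add_left inner_add_right inner_commute)
    have "(\<integral>\<omega>. (norm (partial_integral p h (Suc k) \<omega>))\<^sup>2 \<partial>M)
        = (\<integral>\<omega>. (norm (?N \<omega>))\<^sup>2 \<partial>M) + (\<integral>\<omega>. (norm (h k \<omega> *v ?D \<omega>))\<^sup>2 \<partial>M)"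
      unfolding expand using IH(1) cross_int int_hD cross_0 by simp
    also have "\<dots> \<le> real CARD('d) * (\<integral>\<omega>. (\<Sum>j<k. (norm (h j \<omega>))\<^sup>2 * (p (Suc j) - p j)) \<partial>M)
        + real CARD('d) * ((\<integral>\<omega>. (norm (h k \<omega>))\<^sup>2 \<partial>M) * (p (Suc k) - p k))"
      using IH(2) hD by (simp add: ac_simps)
    also have "\<dots> = real CARD('d) * (\<integral>\<omega>. (\<Sum>j<Suc k. (norm (h j \<omega>))\<^sup>2 * (p (Suc j) - p j)) \<partial>M)"
    proof -
      have "(\<integral>\<omega>. (\<Sum>j<Suc k. (norm (h j \<omega>))\<^sup>2 * (p (Suc j) - p j)) \<partial>M) =
          (\<integral>\<omega>. (\<Sum>j<k. (norm (h j \<omega>))\<^sup>2 * (p (Suc j) - p j)) \<partial>M) + (\<integral>\<omega>. (norm (h k \<omega>))\<^sup>2 * (p (Suc k) - p k) \<partial>M)"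
        unfolding sum.lessThan_Suc
        by (rule Bochner_Integration.integral_add)
          (use km int_h in \<open>auto intro!: Bochner_Integration.integrable_sum\<close>)
      then show ?thesis by (simp add: distrib_left)
    qed
    finally show ?case
      unfolding expand using IH(1) cross_int int_hD by auto
  qed
  then show "integrable M (\<lambda>\<omega>. (norm (partial_integral p h k \<omega>))\<^sup>2)"
    "(\<integral>\<omega>. (norm (partial_integral p h k \<omega>))\<^sup>2 \<partial>M)
      \<le> real CARD('d) * (\<integral>\<omega>. (\<Sum>j<k. (norm (h j \<omega>))\<^sup>2 * (p (Suc j) - p j)) \<partial>M)"
    by auto
qed

text \<open>
  Lenglart's argument.  The integrand is switched off once the energy exceeds \<open>\<delta>\<close> or the
  integral exceeds \<open>\<epsilon>\<close>; both conditions are known at the left end point of the next cell, so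
  the truncated integral is again of the same kind and stays at the first value beyond
  \<open>\<epsilon>\<close>.  Chebyshev's inequality for the terminal value suffices.
\<close>

lemma partial_integral_maximal:
  assumes p: "unit_partition m p" and sd: "simple_data F m p H" and \<epsilon>: "0 < \<epsilon>" and \<delta>: "0 \<le> \<delta>"
  shows "prob {\<omega>\<in>space M. \<exists>k\<le>m. \<epsilon> < norm (partial_integral p H k \<omega>)}
    \<le> real CARD('d) * \<delta> / \<epsilon>\<^sup>2 + prob {\<omega>\<in>space M. \<delta> < (\<Sum>j<m. (norm (H j \<omega>))\<^sup>2 * (p (Suc j) - p j))}"
proof -
  let ?N = "partial_integral p H"
  define Q where "Q k \<omega> = (\<Sum>j<k. (norm (H j \<omega>))\<^sup>2 * (p (Suc j) - p j))" for k \<omega>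
  \<comment> \<open>The energy is summed up to \<open>Suc j\<close>, thus including the cell about
    to be used, so that the truncated energy never overshoots \<delta>; the integral is tested only
    up to \<open>j\<close>, so that the first value beyond \<epsilon> is still reached.\<close>
  define good where "good j \<omega> \<longleftrightarrow> Q (Suc j) \<omega> \<le> \<delta> \<and> (\<forall>i\<le>j. norm (?N i \<omega>) \<le> \<epsilon>)" for j \<omega>
  define h where "h j \<omega> = (if good j \<omega> then H j \<omega> else 0)" for j \<omega>
  have inc: "0 \<le> p (Suc j) - p j" if "j < m" for j using simple_dataD(2)[OF sd that] by simp
  have p01: "p j \<in> {0..1}" if "j \<le> m" for j using unit_partition_bounds[OF p that] by simp
  have H_F: "H i \<in> borel_measurable (F (p j))" if "i \<le> j" "j < m" for i j
  proof -
    have "i < m" using that by simp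
    have "p i \<le> p j" using unit_partition_mono[OF p, of i j] that by simp
    then show ?thesis
      using that by (intro increasing_fieldsD(2)[OF F_incr p01 p01 _ simple_dataD(6)[OF sd \<open>i < m\<close>]]) auto
  qed
  have N_F: "?N i \<in> borel_measurable (F (p j))" if "i \<le> j" "j \<le> m" for i j
  proof -
    have "p i \<le> p j" using unit_partition_mono[OF p, of i j] that by simp
    then show ?thesis
      using that by (intro increasing_fieldsD(2)[OF F_incr p01 p01 _ partial_integral_measurable[OF p sd]]) auto
  qed
  have Q_F: "Q (Suc j) \<in> borel_measurable (F (p j))" if "j < m" for j
  proof -
    have [measurable]: "H i \<in> borel_measurable (F (p j))" if "i \<in> {..<Suc j}" for i
      using H_F[of i j] that \<open>j < m\<close> by simp
    show ?thesis unfolding Q_def[abs_def] by measurable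
  qed
  have good_F: "{\<omega>\<in>space (F (p j)). good j \<omega>} \<in> sets (F (p j))" if j: "j < m" for j
  proof -
    note [measurable] = Q_F[OF j]
    have [measurable]: "?N i \<in> borel_measurable (F (p j))" if "i \<in> {..j}" for i
      using N_F[of i j] j that by simp
    have "{\<omega>\<in>space (F (p j)). good j \<omega>} = {\<omega>\<in>space (F (p j)). Q (Suc j) \<omega> \<le> \<delta> \<and> (\<forall>i\<in>{..j}. norm (?N i \<omega>) \<le> \<epsilon>)}"
      by (auto simp: good_def)
    also have "\<dots> \<in> sets (F (p j))" by measurable
    finally show ?thesis .
  qed
  have sd_h: "simple_data F m p h"
    unfolding simple_data_def
  proof (intro allI impI conjI)
    fix j assume j: "j < m"
    show "0 \<le> p j" "p j \<le> p (Suc j)" "p (Suc j) \<le> 1" using simple_dataD[OF sd j] by auto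
    show "h j \<in> borel_measurable (F (p j))"
      unfolding h_def[abs_def] by (rule measurable_If) (use good_F[OF j] simple_dataD(6)[OF sd j] in auto)
    obtain C where C: "0 \<le> C" "\<And>\<omega>. \<omega> \<in> space (F (p j)) \<Longrightarrow> norm (H j \<omega>) \<le> C"
      using simple_data_bound[OF sd j] by metis
    then show "bounded (h j ` space (F (p j)))" unfolding bounded_iff h_def by (intro exI[of _ C]) auto
  qed
  have energy: "(\<Sum>j<k. (norm (h j \<omega>))\<^sup>2 * (p (Suc j) - p j)) \<le> \<delta>" if "k \<le> m" for k \<omega>
    using that
  proof (induction k)
    case (Suc k)
    show ?case
    proof (cases "good k \<omega>")
      case True
      have "(\<Sum>j<Suc k. (norm (h j \<omega>))\<^sup>2 * (p (Suc j) - p j)) \<le> Q (Suc k) \<omega>"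
        unfolding Q_def
      proof (rule sum_mono)
        fix j assume "j \<in> {..<Suc k}"
        then have "0 \<le> p (Suc j) - p j" using Suc(2) by (intro inc) auto
        then show "(norm (h j \<omega>))\<^sup>2 * (p (Suc j) - p j) \<le> (norm (H j \<omega>))\<^sup>2 * (p (Suc j) - p j)"
          by (intro mult_right_mono) (auto simp: h_def)
      qed
      then show ?thesis using True by (simp add: good_def)
    next
      case False
      then show ?thesis using Suc by (simp add: h_def)
    qed
  qed (use \<delta> in simp)
  have stop: "\<epsilon> < norm (partial_integral p h m \<omega>)"
    if ex: "\<exists>k\<le>m. \<epsilon> < norm (?N k \<omega>)" and Q: "Q m \<omega> \<le> \<delta>" for \<omega>
  proof -
    define k where "k = (LEAST k. \<epsilon> < norm (?N k \<omega>))"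
    obtain k' where k': "k' \<le> m" "\<epsilon> < norm (?N k' \<omega>)" using ex by blast
    have k: "\<epsilon> < norm (?N k \<omega>)" unfolding k_def by (rule LeastI[of "\<lambda>k. \<epsilon> < norm (?N k \<omega>)", OF k'(2)])
    have km: "k \<le> m" using Least_le[of "\<lambda>k. \<epsilon> < norm (?N k \<omega>)", OF k'(2)] k'(1) by (simp add: k_def)
    have before: "norm (?N i \<omega>) \<le> \<epsilon>" if "i < k" for i
      using not_less_Least[of i "\<lambda>k. \<epsilon> < norm (?N k \<omega>)"] that by (simp add: k_def not_less)
    have Q_mono: "Q i \<omega> \<le> Q m \<omega>" if "i \<le> m" for i
      unfolding Q_def using that inc by (intro sum_mono2) auto
    have "h j \<omega> = (if j < k then H j \<omega> else 0)" if j: "j < m" for j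
    proof (cases "j < k")
      case True
      then have "good j \<omega>" using before Q Q_mono[of "Suc j"] j by (auto simp: good_def)
      then show ?thesis using True by (simp add: h_def)
    next
      case False
      then have "\<not> good j \<omega>" using k by (auto simp: good_def not_le intro!: exI[of _ k])
      then show ?thesis using False by (simp add: h_def)
    qed
    then have "partial_integral p h m \<omega> = (\<Sum>j<m. if j < k then H j \<omega> *v (path_at (B \<omega>) (p (Suc j)) - path_at (B \<omega>) (p j)) else 0)"
      unfolding partial_integral_def by (intro sum.cong) auto
    also have "\<dots> = (\<Sum>j\<in>{..<m} \<inter> {j. j < k}. H j \<omega> *v (path_at (B \<omega>) (p (Suc j)) - path_at (B \<omega>) (p j)))"
      by (simp add: sum.inter_restrict)
    also have "{..<m} \<inter> {j. j < k} = {..<k}" using km by auto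
    finally show ?thesis using k by (simp add: partial_integral_def)
  qed
  have m01: "p m \<in> {0..1}" using p01 by simp
  have [measurable]: "?N k \<in> borel_measurable M" if "k \<in> {..m}" for k
    using F_to_M[OF p01 partial_integral_measurable[OF p sd]] that by simp
  have [measurable]: "partial_integral p h m \<in> borel_measurable M"
    using F_to_M[OF m01 partial_integral_measurable[OF p sd_h]] by simp
  have [measurable]: "Q m \<in> borel_measurable M"
  proof (cases m)
    case (Suc j)
    then show ?thesis using F_to_M[OF p01 Q_F[of j]] by simp
  qed (simp add: Q_def[abs_def])
  have "prob {\<omega>\<in>space M. \<exists>k\<le>m. \<epsilon> < norm (?N k \<omega>)}
      \<le> prob ({\<omega>\<in>space M. \<epsilon> < norm (partial_integral p h m \<omega>)} \<union> {\<omega>\<in>space M. \<delta> < Q m \<omega>})"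
    using stop by (intro finite_measure_mono) force+
  also have "\<dots> \<le> prob {\<omega>\<in>space M. \<epsilon> < norm (partial_integral p h m \<omega>)} + prob {\<omega>\<in>space M. \<delta> < Q m \<omega>}"
    by (rule measure_Un_le) measurable
  also have "prob {\<omega>\<in>space M. \<epsilon> < norm (partial_integral p h m \<omega>)} \<le> real CARD('d) * \<delta> / \<epsilon>\<^sup>2"
  proof -
    have "prob {\<omega>\<in>space M. \<epsilon> < norm (partial_integral p h m \<omega>)} \<le> prob {\<omega>\<in>space M. \<epsilon>\<^sup>2 \<le> (norm (partial_integral p h m \<omega>))\<^sup>2}"
      using \<epsilon> by (intro finite_measure_mono) (auto intro!: power_mono)
    also have "\<dots> \<le> (\<integral>\<omega>. (norm (partial_integral p h m \<omega>))\<^sup>2 \<partial>M) / \<epsilon>\<^sup>2"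
      using \<epsilon> by (intro integral_Markov_inequality_measure[where A = "{}"] partial_integral_L2[OF p sd_h]) auto
    also have "\<dots> \<le> (real CARD('d) * (\<integral>\<omega>. (\<Sum>j<m. (norm (h j \<omega>))\<^sup>2 * (p (Suc j) - p j)) \<partial>M)) / \<epsilon>\<^sup>2"
      by (intro divide_right_mono partial_integral_L2(2)[OF p sd_h]) auto
    also have "\<dots> \<le> real CARD('d) * \<delta> / \<epsilon>\<^sup>2"
    proof (intro divide_right_mono mult_left_mono)
      show "(\<integral>\<omega>. (\<Sum>j<m. (norm (h j \<omega>))\<^sup>2 * (p (Suc j) - p j)) \<partial>M) \<le> \<delta>"
      proof (rule integral_le_const)
        have [measurable]: "h j \<in> borel_measurable M" if "j \<in> {..<m}" for j
          using F_to_M[OF simple_dataD(4,6)[OF sd_h]] that by simp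
        show "integrable M (\<lambda>\<omega>. \<Sum>j<m. (norm (h j \<omega>))\<^sup>2 * (p (Suc j) - p j))"
        proof (rule integrable_const_bound[where B = \<delta>])
          have "0 \<le> (\<Sum>j<m. (norm (h j \<omega>))\<^sup>2 * (p (Suc j) - p j))" for \<omega>
            using inc by (intro sum_nonneg) auto
          then show "AE \<omega> in M. norm (\<Sum>j<m. (norm (h j \<omega>))\<^sup>2 * (p (Suc j) - p j)) \<le> \<delta>"
            using energy[of m] by (intro AE_I2) (simp only: real_norm_def abs_of_nonneg order_refl)
        qed measurable
      qed (use energy[of m] in auto)
    qed auto
    finally show ?thesis .
  qed
  finally show ?thesis by (simp add: Q_def)
qed

end

text \<open>A term whose interval begins after \<open>t\<close> has both of its times cut to
  \<open>t\<close> and vanishes, so a coefficient that is not yet known at \<open>t\<close> does not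
  spoil adaptedness. The integrator \<open>V\<close> is any adapted process.\<close>

lemma step_integral_measurable:
  assumes F: "increasing_fields F" and sd: "simple_data F n \<tau> \<xi>"
    and V: "\<And>s. s \<in> {0..1} \<Longrightarrow> (\<lambda>\<omega>. V \<omega> s) \<in> borel_measurable (F s)" and t: "t \<in> {0..1}"
  shows "(\<lambda>\<omega>. step_integral n \<tau> (\<lambda>i. \<xi> i \<omega>) (V \<omega>) t) \<in> borel_measurable (F t)"
proof -
  have "(\<lambda>\<omega>. \<xi> i \<omega> *v (V \<omega> (min (\<tau> (Suc i)) t) - V \<omega> (min (\<tau> i) t))) \<in> borel_measurable (F t)" if i: "i < n" for i
  proof (cases "\<tau> i \<le> t")
    case True
    have m: "min (\<tau> (Suc i)) t \<in> {0..1}" "min (\<tau> i) t \<in> {0..1}"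
      using simple_dataD[OF sd i] t by auto
    show ?thesis
      by (intro borel_measurable_matrix_vector_mult borel_measurable_diff
          increasing_fieldsD(2)[OF F simple_dataD(4)[OF sd i] t True simple_dataD(6)[OF sd i]]
          increasing_fieldsD(2)[OF F m(1) t _ V] increasing_fieldsD(2)[OF F m(2) t _ V] m) auto
  next
    case False
    then have "min (\<tau> (Suc i)) t = t" "min (\<tau> i) t = t" using simple_dataD(2)[OF sd i] by auto
    then show ?thesis by simp
  qed
  then show ?thesis unfolding step_integral_def by (intro borel_measurable_sum) auto
qed

section \<open>Maximal inequalities over all times\<close>

context brownian_basis
begin

lemma simple_integral_measurable:
  assumes sd: "simple_data F n \<tau> \<xi>" and t: "t \<in> {0..1}"
  shows "simple_integral_process B n \<tau> \<xi> t \<in> borel_measurable (F t)"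
  unfolding simple_integral_process_eq_step_integral[abs_def]
  by (intro step_integral_measurable[OF F_incr sd] B_adapted t)

lemma continuous_on_simple_integral:
  assumes sd: "simple_data F n \<tau> \<xi>"
  shows "continuous_on {0..1} (\<lambda>t. simple_integral_process B n \<tau> \<xi> t \<omega>)"
  unfolding simple_integral_process_eq_step_integral
proof (rule continuous_on_step_integral[OF continuous_on_path_at])
  show "0 \<le> \<tau> i \<and> 0 \<le> \<tau> (Suc i)" if "i < n" for i using simple_dataD(4,5)[OF sd that] by simp
qed

text \<open>The discrete inequality bounds the exceedance at finitely many times by a quantity free
  of their number. By continuity of the paths the rational times suffice, and the exceedance events
  at finitely many of them increase to the event for the whole interval.\<close>

lemma simple_integral_maximal:
  assumes sd: "simple_data F n \<tau> \<xi>" and \<epsilon>: "0 < \<epsilon>" and \<delta>: "0 \<le> \<delta>"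
  shows "prob {\<omega>\<in>space M. \<exists>t\<in>{0..1}. \<epsilon> < norm (simple_integral_process B n \<tau> \<xi> t \<omega>)}
    \<le> real CARD('d) * \<delta> / \<epsilon>\<^sup>2
      + prob {\<omega>\<in>space M. ennreal \<delta> < (\<integral>\<^sup>+t\<in>{0..1}. ennreal ((norm (simple_process n \<tau> \<xi> t \<omega>))\<^sup>2) \<partial>lborel)}"
    (is "_ \<le> ?R")
proof -
  let ?S = "simple_integral_process B n \<tau> \<xi>"
  define q where "q = from_nat_into (\<rat> \<inter> {0..1::real})"
  have ne: "\<rat> \<inter> {0..1::real} \<noteq> {}" using Rats_0 by force
  have q_range: "range q = \<rat> \<inter> {0..1}"
    unfolding q_def by (rule range_from_nat_into[OF ne countable_rationals_unit_interval])
  then have q01: "q i \<in> {0..1}" for i by auto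
  define A where "A N = {\<omega>\<in>space M. \<exists>i\<le>N. \<epsilon> < norm (?S (q i) \<omega>)}" for N :: nat
  have [measurable]: "?S (q i) \<in> borel_measurable M" for i
    using F_to_M[OF q01 simple_integral_measurable[OF sd q01]] .
  have A_sets: "A N \<in> events" for N
    unfolding A_def by measurable
  have "incseq A" unfolding incseq_def A_def by (auto intro: order_trans)
  moreover have union: "(\<Union>N. A N) = {\<omega>\<in>space M. \<exists>t\<in>{0..1}. \<epsilon> < norm (?S t \<omega>)}"
  proof -
    have "(\<exists>t\<in>{0..1}. \<epsilon> < norm (?S t \<omega>)) \<longleftrightarrow> (\<exists>t\<in>range q. \<epsilon> < norm (?S t \<omega>))" for \<omega>
      using le_on_unit_interval_iff[OF continuous_on_norm[OF continuous_on_simple_integral[OF sd, of \<omega>]], of \<epsilon>]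
      unfolding q_range by (meson not_le)
    then show ?thesis unfolding A_def by auto
  qed
  ultimately have lim: "(\<lambda>N. prob (A N)) \<longlonglongrightarrow> prob {\<omega>\<in>space M. \<exists>t\<in>{0..1}. \<epsilon> < norm (?S t \<omega>)}"
    using finite_Lim_measure_incseq[of A] A_sets by auto
  have "prob (A N) \<le> ?R" for N
  proof -
    \<comment> \<open>The listed rational times become partition points, so the discrete inequality
      sees the integral at each of them; refining the partition does not change the energy.\<close>
    let ?T = "(\<Union>i<n. {\<tau> i, \<tau> (Suc i)}) \<union> q ` {..N}"
    have "finite ?T" "?T \<subseteq> {0..1}"
      using simple_dataD(4,5)[OF sd] q01 by auto
    from unit_partition_exists[OF this] obtain m p where p: "unit_partition m p" and T: "?T \<subseteq> p ` {..m}" by auto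
    have sub: "subordinate n \<tau> m p"
      using simple_dataD(2)[OF sd] p T unfolding subordinate_def by auto
    define h where "h j \<omega> = step_fun n \<tau> (\<lambda>i. \<xi> i \<omega>) (p (Suc j))" for j \<omega>
    have h: "simple_data F m p h"
      unfolding h_def[abs_def] by (rule simple_data_refine[OF F_incr sd sub])
    have S_p: "?S (p k) \<omega> = partial_integral p h k \<omega>" if "k \<le> m" for k \<omega>
    proof -
      have "?S (p k) \<omega> = step_integral m p (\<lambda>j. h j \<omega>) (path_at (B \<omega>)) (p k)"
        unfolding simple_integral_process_eq_step_integral h_def step_integral_refine[OF sub] ..
      then show ?thesis by (simp only: step_integral_at_partition[OF p that] partial_integral_def)
    qed
    have energy: "(\<integral>\<^sup>+t\<in>{0..1}. ennreal ((norm (simple_process n \<tau> \<xi> t \<omega>))\<^sup>2) \<partial>lborel)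
        = ennreal (\<Sum>j<m. (norm (h j \<omega>))\<^sup>2 * (p (Suc j) - p j))" for \<omega>
    proof -
      have "simple_process n \<tau> \<xi> t \<omega> = step_fun m p (\<lambda>j. h j \<omega>) t" for t
        unfolding simple_process_eq_step_fun h_def step_fun_refine[OF sub] ..
      then show ?thesis by (simp only: nn_integral_step_fun[OF p])
    qed
    have [measurable]: "partial_integral p h k \<in> borel_measurable M" if "k \<in> {..m}" for k
      using F_to_M[OF _ partial_integral_measurable[OF p h]] unit_partition_bounds[OF p, of k] that by simp
    have "A N \<subseteq> {\<omega>\<in>space M. \<exists>k\<le>m. \<epsilon> < norm (partial_integral p h k \<omega>)}"
    proof
      fix \<omega> assume "\<omega> \<in> A N"
      then obtain i where i: "i \<le> N" "\<epsilon> < norm (?S (q i) \<omega>)" "\<omega> \<in> space M" by (auto simp: A_def)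
      then have "q i \<in> p ` {..m}" using T by auto
      then obtain k where "k \<le> m" "q i = p k" by auto
      then show "\<omega> \<in> {\<omega>\<in>space M. \<exists>k\<le>m. \<epsilon> < norm (partial_integral p h k \<omega>)}"
        using i S_p[of k \<omega>] by auto
    qed
    moreover have "{\<omega>\<in>space M. \<exists>k\<le>m. \<epsilon> < norm (partial_integral p h k \<omega>)} = {\<omega>\<in>space M. \<exists>k\<in>{..m}. \<epsilon> < norm (partial_integral p h k \<omega>)}"
      by auto
    moreover have "{\<omega>\<in>space M. \<exists>k\<in>{..m}. \<epsilon> < norm (partial_integral p h k \<omega>)} \<in> events"
      by measurable
    ultimately have "prob (A N) \<le> prob {\<omega>\<in>space M. \<exists>k\<le>m. \<epsilon> < norm (partial_integral p h k \<omega>)}"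
      by (intro finite_measure_mono) auto
    also have "\<dots> \<le> real CARD('d) * \<delta> / \<epsilon>\<^sup>2 + prob {\<omega>\<in>space M. \<delta> < (\<Sum>j<m. (norm (h j \<omega>))\<^sup>2 * (p (Suc j) - p j))}"
      by (rule partial_integral_maximal[OF p h \<epsilon> \<delta>])
    also have "{\<omega>\<in>space M. \<delta> < (\<Sum>j<m. (norm (h j \<omega>))\<^sup>2 * (p (Suc j) - p j))}
        = {\<omega>\<in>space M. ennreal \<delta> < (\<integral>\<^sup>+t\<in>{0..1}. ennreal ((norm (simple_process n \<tau> \<xi> t \<omega>))\<^sup>2) \<partial>lborel)}"
      unfolding energy using \<delta> by (simp add: ennreal_less_iff)
    finally show ?thesis .
  qed
  then show ?thesis by (intro LIMSEQ_le_const2[OF lim]) auto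
qed

text \<open>On a common partition the difference of two simple integrals is again one, with the
  difference of the coefficients, so the maximal inequality applies to it.\<close>

lemma simple_integral_close:
  assumes \<xi>: "simple_data F n \<tau> \<xi>" and \<zeta>: "simple_data F n' \<tau>' \<zeta>" and \<epsilon>: "0 < \<epsilon>" and \<delta>: "0 \<le> \<delta>"
  shows "prob {\<omega>\<in>space M. \<exists>t\<in>{0..1}. \<epsilon> < norm (simple_integral_process B n \<tau> \<xi> t \<omega> - simple_integral_process B n' \<tau>' \<zeta> t \<omega>)}
    \<le> real CARD('d) * \<delta> / \<epsilon>\<^sup>2
      + prob {\<omega>\<in>space M. ennreal \<delta> < (\<integral>\<^sup>+t\<in>{0..1}. ennreal ((norm (simple_process n \<tau> \<xi> t \<omega> - simple_process n' \<tau>' \<zeta> t \<omega>))\<^sup>2) \<partial>lborel)}"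
proof -
  obtain m p where sub: "subordinate n \<tau> m p" "subordinate n' \<tau>' m p"
    using common_partition[OF \<xi> \<zeta>] by auto
  have sd: "simple_data F m p (\<lambda>j \<omega>. step_fun n \<tau> (\<lambda>i. \<xi> i \<omega>) (p (Suc j)) - step_fun n' \<tau>' (\<lambda>i. \<zeta> i \<omega>) (p (Suc j)))"
    by (intro simple_data_diff simple_data_refine[OF F_incr] \<xi> \<zeta> sub)
  show ?thesis
    using simple_integral_maximal[OF sd \<epsilon> \<delta>]
    unfolding simple_integral_process_eq_step_integral simple_process_eq_step_fun
      step_integral_diff_left step_fun_diff step_integral_refine[OF sub(1)] step_integral_refine[OF sub(2)]
      step_fun_refine[OF sub(1)] step_fun_refine[OF sub(2)] .
qed

text \<open>Integrating \<kappa> against the integral of \<zeta> amounts to integrating their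
  product against \<open>B\<close>, and the increment of \<open>B\<close> is the integral of the
  identity. The deviation is thus a simple integral whose integrand measures how far \<kappa> is
  from an inverse of \<zeta>.\<close>

lemma simple_integral_inverse_close:
  assumes \<kappa>: "simple_data F n \<tau> \<kappa>" and \<zeta>: "simple_data F n' \<tau>' \<zeta>" and \<epsilon>: "0 < \<epsilon>" and \<delta>: "0 \<le> \<delta>"
  shows "prob {\<omega>\<in>space M. \<exists>t\<in>{0..1}. \<epsilon> <
      norm (step_integral n \<tau> (\<lambda>i. \<kappa> i \<omega>) (\<lambda>t. simple_integral_process B n' \<tau>' \<zeta> t \<omega>) t - (path_at (B \<omega>) t - path_at (B \<omega>) 0))}
    \<le> real CARD('d) * \<delta> / \<epsilon>\<^sup>2
      + prob {\<omega>\<in>space M. ennreal \<delta> < (\<integral>\<^sup>+t\<in>{0..1}. ennreal ((norm (simple_process n \<tau> \<kappa> t \<omega> ** simple_process n' \<tau>' \<zeta> t \<omega> - mat 1))\<^sup>2) \<partial>lborel)}"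
proof -
  obtain m p where sub: "subordinate n \<tau> m p" "subordinate n' \<tau>' m p"
    using common_partition[OF \<kappa> \<zeta>] by auto
  have p: "unit_partition m p" using sub(1) by (simp add: subordinate_def)
  define x where "x j \<omega> = step_fun n \<tau> (\<lambda>i. \<kappa> i \<omega>) (p (Suc j))" for j \<omega>
  define y where "y j \<omega> = step_fun n' \<tau>' (\<lambda>i. \<zeta> i \<omega>) (p (Suc j))" for j \<omega>
  have sdx: "simple_data F m p x" "simple_data F m p y"
    unfolding x_def[abs_def] y_def[abs_def] by (intro simple_data_refine[OF F_incr] \<kappa> \<zeta> sub)+
  have "simple_data F m p (\<lambda>_ _. mat 1)"
    using simple_dataD(1-3)[OF sdx(1)] by (auto simp: simple_data_def bounded_iff)
  then have sd: "simple_data F m p (\<lambda>j \<omega>. x j \<omega> ** y j \<omega> - mat 1)"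
    by (intro simple_data_diff simple_data_mult sdx)
  have int: "simple_integral_process B m p (\<lambda>j \<omega>. x j \<omega> ** y j \<omega> - mat 1) t \<omega>
      = step_integral n \<tau> (\<lambda>i. \<kappa> i \<omega>) (\<lambda>t. simple_integral_process B n' \<tau>' \<zeta> t \<omega>) t - (path_at (B \<omega>) t - path_at (B \<omega>) 0)"
    if "t \<in> {0..1}" for t \<omega>
  proof -
    have "simple_integral_process B n' \<tau>' \<zeta> t \<omega> = step_integral m p (\<lambda>j. y j \<omega>) (path_at (B \<omega>)) t" for t
      unfolding simple_integral_process_eq_step_integral y_def step_integral_refine[OF sub(2)] ..
    moreover have "step_integral n \<tau> (\<lambda>i. \<kappa> i \<omega>) w t = step_integral m p (\<lambda>j. x j \<omega>) w t" for w
      unfolding x_def step_integral_refine[OF sub(1)] ..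
    ultimately show ?thesis
      unfolding simple_integral_process_eq_step_integral[of B m p]
      by (simp add: step_integral_diff_left step_integral_identity[OF p that] step_integral_assoc[OF p])
  qed
  have energy: "(\<integral>\<^sup>+t\<in>{0..1}. ennreal ((norm (simple_process m p (\<lambda>j \<omega>. x j \<omega> ** y j \<omega> - mat 1) t \<omega>))\<^sup>2) \<partial>lborel)
      = (\<integral>\<^sup>+t\<in>{0..1}. ennreal ((norm (simple_process n \<tau> \<kappa> t \<omega> ** simple_process n' \<tau>' \<zeta> t \<omega> - mat 1))\<^sup>2) \<partial>lborel)" for \<omega>
  proof (rule nn_integral_cong_AE)
    have *: "simple_process m p (\<lambda>j \<omega>. x j \<omega> ** y j \<omega> - mat 1) t \<omega> = simple_process n \<tau> \<kappa> t \<omega> ** simple_process n' \<tau>' \<zeta> t \<omega> - mat 1"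
      if "0 < t" "t \<le> 1" for t
      unfolding simple_process_eq_step_fun step_fun_diff step_fun_mult[OF p] step_fun_identity[OF p that]
      unfolding x_def y_def step_fun_refine[OF sub(1)] step_fun_refine[OF sub(2)] ..
    \<comment> \<open>All cells exclude time 0, where every step function vanishes, including the
      one with constant value \<open>mat 1\<close>; the two integrands differ at most there.\<close>
    have "AE t in lborel. t \<noteq> (0::real)" by (rule AE_lborel_singleton)
    then show "AE t in lborel. ennreal ((norm (simple_process m p (\<lambda>j \<omega>. x j \<omega> ** y j \<omega> - mat 1) t \<omega>))\<^sup>2) * indicator {0..1} t
      = ennreal ((norm (simple_process n \<tau> \<kappa> t \<omega> ** simple_process n' \<tau>' \<zeta> t \<omega> - mat 1))\<^sup>2) * indicator {0..1} t"
      by eventually_elim (auto simp: * split: split_indicator)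
  qed
  have "{\<omega>\<in>space M. \<exists>t\<in>{0..1}. \<epsilon> < norm (simple_integral_process B m p (\<lambda>j \<omega>. x j \<omega> ** y j \<omega> - mat 1) t \<omega>)}
      = {\<omega>\<in>space M. \<exists>t\<in>{0..1}. \<epsilon> <
      norm (step_integral n \<tau> (\<lambda>i. \<kappa> i \<omega>) (\<lambda>t. simple_integral_process B n' \<tau>' \<zeta> t \<omega>) t - (path_at (B \<omega>) t - path_at (B \<omega>) 0))}"
    using int by (intro Collect_cong conj_cong bex_cong refl) simp
  then show ?thesis
    using simple_integral_maximal[OF sd \<epsilon> \<delta>] unfolding energy by simp
qed

end


section \<open>Approximation of predictable processes by simple processes\<close>

lemma space_predictable_field [simp]: "space (predictable_field F) = {0..1} \<times> space (F 0)"
  unfolding predictable_field_def by (simp add: space_measure_of_conv)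

lemma sets_predictable_field:
  assumes F: "increasing_fields F"
  shows "sets (predictable_field F) = sigma_sets ({0..1} \<times> space (F 0))
    ({{0} \<times> A | A. A \<in> sets (F 0)} \<union>
     {{s<..t} \<times> A | s t A. 0 \<le> s \<and> s < t \<and> t \<le> 1 \<and> A \<in> sets (F s)})"
  unfolding predictable_field_def
proof (rule sets_measure_of)
  show "{{0} \<times> A | A. A \<in> sets (F 0)} \<union> {{s<..t} \<times> A | s t A. 0 \<le> s \<and> s < t \<and> t \<le> 1 \<and> A \<in> sets (F s)}
      \<subseteq> Pow ({0..1} \<times> space (F 0))"
  proof safe
    fix a b and A :: "'a set" and x s t :: real and y
    assume "0 \<le> s" "s < t" "t \<le> 1" "A \<in> sets (F s)" "x \<in> {s<..t}" "y \<in> A"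
    then show "x \<in> {0..1}" "y \<in> space (F 0)"
      using increasing_fieldsD(1)[OF F, of s 0] sets.sets_into_space[of A "F s"] by auto
  qed (use sets.sets_into_space in auto)
qed

lemma predictable_generator:
  assumes F: "increasing_fields F" and "0 \<le> s" "s < t" "t \<le> 1" "A \<in> sets (F s)"
  shows "{s<..t} \<times> A \<in> sets (predictable_field F)"
  unfolding sets_predictable_field[OF F] by (rule sigma_sets.Basic) (use assms in blast)

lemma simple_process_predictable:
  assumes F: "increasing_fields F" and sd: "simple_data F n \<tau> \<xi>"
  shows "(\<lambda>x. simple_process n \<tau> \<xi> (fst x) (snd x)) \<in> borel_measurable (predictable_field F)"
  unfolding simple_process_def
proof (rule borel_measurable_sum)
  fix i assume "i \<in> {..<n}"
  then have i: "i < n" by simp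
  note D = simple_dataD[OF sd i]
  have sp: "space (F (\<tau> i)) = space (F 0)" using increasing_fieldsD(1)[OF F D(4), of 0] by simp
  show "(\<lambda>x. indicator {\<tau> i<..\<tau> (Suc i)} (fst x) *\<^sub>R \<xi> i (snd x)) \<in> borel_measurable (predictable_field F)"
  proof (cases "\<tau> i < \<tau> (Suc i)")
    case True
    let ?P = "predictable_field F"
    have gen: "{\<tau> i<..\<tau> (Suc i)} \<times> A \<in> sets ?P" if "A \<in> sets (F (\<tau> i))" for A
      by (rule predictable_generator[OF F D(1) True D(3) that])
    show ?thesis
    proof (rule measurableI)
      fix E :: "(real ^ 'b ^ 'b) set" assume E: "E \<in> sets borel"
      have "(\<lambda>x. indicator {\<tau> i<..\<tau> (Suc i)} (fst x) *\<^sub>R \<xi> i (snd x)) -` E \<inter> space ?P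
        = ({\<tau> i<..\<tau> (Suc i)} \<times> (\<xi> i -` E \<inter> space (F (\<tau> i)))) \<union>
          (if 0 \<in> E then space ?P - {\<tau> i<..\<tau> (Suc i)} \<times> space (F (\<tau> i)) else {})"
        using D(1,3) by (auto simp: sp split: split_indicator_asm if_splits)
      also have "\<dots> \<in> sets ?P"
        using gen measurable_sets[OF D(6) E] gen[OF sets.top] sets.top[of ?P]
        by (intro sets.Un) (auto intro!: sets.Diff simp del: space_predictable_field)
      finally show "(\<lambda>x. indicator {\<tau> i<..\<tau> (Suc i)} (fst x) *\<^sub>R \<xi> i (snd x)) -` E \<inter> space ?P \<in> sets ?P" .
    qed simp
  qed (use D(2) in simp)
qed

lemma nn_integral_norm_sq_triangle:
  fixes f g :: "'a \<Rightarrow> 'b::{second_countable_topology, real_normed_vector}"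
  assumes [measurable]: "f \<in> borel_measurable N" "g \<in> borel_measurable N"
  shows "(\<integral>\<^sup>+x. ennreal ((norm (f x + g x))\<^sup>2) \<partial>N) \<le> 2 * (\<integral>\<^sup>+x. ennreal ((norm (f x))\<^sup>2) \<partial>N) + 2 * (\<integral>\<^sup>+x. ennreal ((norm (g x))\<^sup>2) \<partial>N)"
proof -
  have le: "(norm (f x + g x))\<^sup>2 \<le> 2 * (norm (f x))\<^sup>2 + 2 * (norm (g x))\<^sup>2" for x
  proof -
    have "(norm (f x + g x))\<^sup>2 \<le> (norm (f x) + norm (g x))\<^sup>2"
      by (intro power_mono norm_triangle_ineq) simp
    also have "\<dots> \<le> 2 * (norm (f x))\<^sup>2 + 2 * (norm (g x))\<^sup>2"
      using zero_le_power2[of "norm (f x) - norm (g x)"] by (simp add: power2_eq_square algebra_simps)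
    finally show ?thesis .
  qed
  have "(\<integral>\<^sup>+x. ennreal ((norm (f x + g x))\<^sup>2) \<partial>N) \<le> (\<integral>\<^sup>+x. 2 * ennreal ((norm (f x))\<^sup>2) + 2 * ennreal ((norm (g x))\<^sup>2) \<partial>N)"
  proof (intro nn_integral_mono)
    fix x
    have "ennreal ((norm (f x + g x))\<^sup>2) \<le> ennreal (2 * (norm (f x))\<^sup>2 + 2 * (norm (g x))\<^sup>2)"
      using le by (rule ennreal_leI)
    then show "ennreal ((norm (f x + g x))\<^sup>2) \<le> 2 * ennreal ((norm (f x))\<^sup>2) + 2 * ennreal ((norm (g x))\<^sup>2)"
      by (simp add: ennreal_mult)
  qed
  also have "\<dots> = 2 * (\<integral>\<^sup>+x. ennreal ((norm (f x))\<^sup>2) \<partial>N) + 2 * (\<integral>\<^sup>+x. ennreal ((norm (g x))\<^sup>2) \<partial>N)"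
    by (simp add: nn_integral_add nn_integral_cmult)
  finally show ?thesis .
qed

text \<open>The condition at time 0 is forced by the goal of density: simple processes vanish at
  time 0, while \<open>{0} \<times> A\<close> is a predictable set.\<close>

locale predictable_measure =
  fixes F :: "real \<Rightarrow> 'a measure" and \<Lambda> :: "(real \<times> 'a) measure"
  assumes incr: "increasing_fields F" and fin: "finite_measure \<Lambda>"
    and sets_eq: "sets \<Lambda> = sets (predictable_field F)"
    and start: "\<And>A. A \<in> sets (F 0) \<Longrightarrow> emeasure \<Lambda> ({0} \<times> A) = 0"
begin

sublocale finite_measure \<Lambda> by (rule fin)

lemma space_eq: "space \<Lambda> = {0..1} \<times> space (F 0)"
  using sets_eq_imp_space_eq[OF sets_eq] by simp

definition approximable :: "(real \<times> 'a \<Rightarrow> real ^ 'd ^ 'd::finite) \<Rightarrow> bool"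
  where "approximable H \<longleftrightarrow> (\<forall>e>0. \<exists>n \<tau> \<xi>. simple_data F n \<tau> \<xi> \<and>
    (\<integral>\<^sup>+x. ennreal ((norm (H x - simple_process n \<tau> \<xi> (fst x) (snd x)))\<^sup>2) \<partial>\<Lambda>) < ennreal e)"

lemma simple_measurable:
  "simple_data F n \<tau> \<xi> \<Longrightarrow> (\<lambda>x. simple_process n \<tau> \<xi> (fst x) (snd x)) \<in> borel_measurable \<Lambda>"
  using simple_process_predictable[OF incr] measurable_cong_sets[OF sets_eq refl] by blast

lemma approximable_limit:
  assumes [measurable]: "H \<in> borel_measurable \<Lambda>"
    and ex: "\<And>e. 0 < e \<Longrightarrow> \<exists>H'. approximable H' \<and> H' \<in> borel_measurable \<Lambda> \<and> (\<integral>\<^sup>+x. ennreal ((norm (H x - H' x))\<^sup>2) \<partial>\<Lambda>) < ennreal e"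
  shows "approximable H"
  unfolding approximable_def
proof (intro allI impI)
  fix e :: real assume e: "0 < e"
  \<comment> \<open>A quarter of \<open>e\<close> for each of two errors, since each enters the
    squared triangle inequality with the factor 2.\<close>
  then obtain H' where H': "approximable H'" and [measurable]: "H' \<in> borel_measurable \<Lambda>"
    and 1: "(\<integral>\<^sup>+x. ennreal ((norm (H x - H' x))\<^sup>2) \<partial>\<Lambda>) < ennreal (e / 4)"
    using ex[of "e / 4"] by auto
  obtain n \<tau> \<xi> where sd: "simple_data F n \<tau> \<xi>"
    and 2: "(\<integral>\<^sup>+x. ennreal ((norm (H' x - simple_process n \<tau> \<xi> (fst x) (snd x)))\<^sup>2) \<partial>\<Lambda>) < ennreal (e / 4)"
    using H'[unfolded approximable_def, rule_format, of "e / 4"] e by auto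
  have [measurable]: "(\<lambda>x. simple_process n \<tau> \<xi> (fst x) (snd x)) \<in> borel_measurable \<Lambda>" by (rule simple_measurable[OF sd])
  have "(\<integral>\<^sup>+x. ennreal ((norm (H x - simple_process n \<tau> \<xi> (fst x) (snd x)))\<^sup>2) \<partial>\<Lambda>)
      = (\<integral>\<^sup>+x. ennreal ((norm ((H x - H' x) + (H' x - simple_process n \<tau> \<xi> (fst x) (snd x))))\<^sup>2) \<partial>\<Lambda>)" by simp
  also have "\<dots> \<le> 2 * (\<integral>\<^sup>+x. ennreal ((norm (H x - H' x))\<^sup>2) \<partial>\<Lambda>) + 2 * (\<integral>\<^sup>+x. ennreal ((norm (H' x - simple_process n \<tau> \<xi> (fst x) (snd x)))\<^sup>2) \<partial>\<Lambda>)"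
    by (rule nn_integral_norm_sq_triangle) measurable
  also have "\<dots> < 2 * ennreal (e / 4) + 2 * ennreal (e / 4)"
    using 1 2 by (intro add_strict_mono ennreal_mult_strict_left_mono) auto
  also have "\<dots> = ennreal e"
    using e by (simp flip: ennreal_numeral ennreal_mult ennreal_plus)
  finally show "\<exists>n \<tau> \<xi>. simple_data F n \<tau> \<xi> \<and>
      (\<integral>\<^sup>+x. ennreal ((norm (H x - simple_process n \<tau> \<xi> (fst x) (snd x)))\<^sup>2) \<partial>\<Lambda>) < ennreal e"
    using sd by blast
qed

lemma approximable_add:
  assumes H: "approximable H" "H \<in> borel_measurable \<Lambda>" and H': "approximable H'" "H' \<in> borel_measurable \<Lambda>"
  shows "approximable (\<lambda>x. H x + H' x)"
  unfolding approximable_def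
proof (intro allI impI)
  note [measurable] = H(2) H'(2)
  fix e :: real assume e: "0 < e"
  obtain n \<tau> \<xi> where sd: "simple_data F n \<tau> \<xi>"
    and 1: "(\<integral>\<^sup>+x. ennreal ((norm (H x - simple_process n \<tau> \<xi> (fst x) (snd x)))\<^sup>2) \<partial>\<Lambda>) < ennreal (e / 4)"
    using H(1)[unfolded approximable_def, rule_format, of "e / 4"] e by auto
  obtain n' \<tau>' \<xi>' where sd': "simple_data F n' \<tau>' \<xi>'"
    and 2: "(\<integral>\<^sup>+x. ennreal ((norm (H' x - simple_process n' \<tau>' \<xi>' (fst x) (snd x)))\<^sup>2) \<partial>\<Lambda>) < ennreal (e / 4)"
    using H'(1)[unfolded approximable_def, rule_format, of "e / 4"] e by auto
  note [measurable] = simple_measurable[OF sd] simple_measurable[OF sd']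
  obtain m p where sub: "subordinate n \<tau> m p" "subordinate n' \<tau>' m p"
    using common_partition[OF sd sd'] by auto
  define \<zeta> where "\<zeta> j \<omega> = step_fun n \<tau> (\<lambda>i. \<xi> i \<omega>) (p (Suc j)) + step_fun n' \<tau>' (\<lambda>i. \<xi>' i \<omega>) (p (Suc j))" for j \<omega>
  have sd_\<zeta>: "simple_data F m p \<zeta>"
    unfolding \<zeta>_def[abs_def] by (intro simple_data_add simple_data_refine[OF incr] sd sd' sub)
  have "step_fun m p (\<lambda>j. x j + y j) t = step_fun m p x t + step_fun m p y t"
    for x y :: "nat \<Rightarrow> real ^ 'b ^ 'b" and t
    by (simp add: step_fun_def scaleR_right_distrib sum.distrib)
  then have "simple_process m p \<zeta> t \<omega> = simple_process n \<tau> \<xi> t \<omega> + simple_process n' \<tau>' \<xi>' t \<omega>" for t \<omega>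
    by (simp only: simple_process_eq_step_fun \<zeta>_def step_fun_refine[OF sub(1)] step_fun_refine[OF sub(2)])
  then have "(\<integral>\<^sup>+x. ennreal ((norm (H x + H' x - simple_process m p \<zeta> (fst x) (snd x)))\<^sup>2) \<partial>\<Lambda>)
      = (\<integral>\<^sup>+x. ennreal ((norm ((H x - simple_process n \<tau> \<xi> (fst x) (snd x)) + (H' x - simple_process n' \<tau>' \<xi>' (fst x) (snd x))))\<^sup>2) \<partial>\<Lambda>)"
    by (simp add: algebra_simps)
  also have "\<dots> \<le> 2 * (\<integral>\<^sup>+x. ennreal ((norm (H x - simple_process n \<tau> \<xi> (fst x) (snd x)))\<^sup>2) \<partial>\<Lambda>)
      + 2 * (\<integral>\<^sup>+x. ennreal ((norm (H' x - simple_process n' \<tau>' \<xi>' (fst x) (snd x)))\<^sup>2) \<partial>\<Lambda>)"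
    by (rule nn_integral_norm_sq_triangle) measurable
  also have "\<dots> < 2 * ennreal (e / 4) + 2 * ennreal (e / 4)"
    using 1 2 by (intro add_strict_mono ennreal_mult_strict_left_mono) auto
  also have "\<dots> = ennreal e"
    using e by (simp flip: ennreal_numeral ennreal_mult ennreal_plus)
  finally show "\<exists>n \<tau> \<xi>. simple_data F n \<tau> \<xi> \<and>
      (\<integral>\<^sup>+x. ennreal ((norm (H x + H' x - simple_process n \<tau> \<xi> (fst x) (snd x)))\<^sup>2) \<partial>\<Lambda>) < ennreal e"
    using sd_\<zeta> by blast
qed

lemma approximableI_simple:
  assumes "simple_data F n \<tau> \<xi>"
    and "(\<integral>\<^sup>+x. ennreal ((norm (H x - simple_process n \<tau> \<xi> (fst x) (snd x)))\<^sup>2) \<partial>\<Lambda>) = 0"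
  shows "approximable H"
  unfolding approximable_def
  using assms by (intro allI impI exI[of _ n] exI[of _ \<tau>] exI[of _ \<xi>]) simp

lemma approximable_null:
  assumes "Z \<in> null_sets \<Lambda>"
  shows "approximable (\<lambda>x. indicator Z x *\<^sub>R v)"
proof (rule approximableI_simple)
  show "simple_data F 0 (\<lambda>_. 0) (\<lambda>_ _. 0)" by (simp add: simple_data_def)
  have "AE x in \<Lambda>. x \<notin> Z" by (rule AE_not_in[OF assms])
  then have "(\<integral>\<^sup>+x. ennreal ((norm (indicator Z x *\<^sub>R v - simple_process 0 (\<lambda>_. 0) (\<lambda>_ _. 0) (fst x) (snd x)))\<^sup>2) \<partial>\<Lambda>) = (\<integral>\<^sup>+x. 0 \<partial>\<Lambda>)"
    by (intro nn_integral_cong_AE) (auto simp: simple_process_def)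
  then show "(\<integral>\<^sup>+x. ennreal ((norm (indicator Z x *\<^sub>R v - simple_process 0 (\<lambda>_. 0) (\<lambda>_ _. 0) (fst x) (snd x)))\<^sup>2) \<partial>\<Lambda>) = 0" by simp
qed

lemma approximable_rectangle:
  assumes st: "0 \<le> s" "s < t" "t \<le> 1" and A: "A \<in> sets (F s)"
  shows "approximable (\<lambda>x. indicator ({s<..t} \<times> A) x *\<^sub>R v)"
proof (rule approximableI_simple)
  have "(\<lambda>\<omega>. indicator A \<omega> *\<^sub>R v) \<in> borel_measurable (F s)" using A by measurable
  moreover have "bounded ((\<lambda>\<omega>. indicator A \<omega> *\<^sub>R v) ` space (F s))"
    by (auto simp: bounded_iff split: split_indicator intro!: exI[of _ "norm v"])
  ultimately show "simple_data F 1 (\<lambda>i. if i = 0 then s else t) (\<lambda>_ \<omega>. indicator A \<omega> *\<^sub>R v)"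
    using st by (simp add: simple_data_def)
  have "simple_process 1 (\<lambda>i. if i = 0 then s else t) (\<lambda>_ \<omega>. indicator A \<omega> *\<^sub>R v) (fst x) (snd x) = indicator ({s<..t} \<times> A) x *\<^sub>R v" for x
    by (cases x) (simp add: simple_process_def indicator_times)
  then show "(\<integral>\<^sup>+x. ennreal ((norm (indicator ({s<..t} \<times> A) x *\<^sub>R v
      - simple_process 1 (\<lambda>i. if i = 0 then s else t) (\<lambda>_ \<omega>. indicator A \<omega> *\<^sub>R v) (fst x) (snd x)))\<^sup>2) \<partial>\<Lambda>) = 0"
    by simp
qed

lemma approximable_cong:
  assumes "approximable H" "\<And>x. x \<in> space \<Lambda> \<Longrightarrow> H x = H' x"
  shows "approximable H'"
proof -
  have "(\<integral>\<^sup>+x. ennreal ((norm (H x - S x))\<^sup>2) \<partial>\<Lambda>) = (\<integral>\<^sup>+x. ennreal ((norm (H' x - S x))\<^sup>2) \<partial>\<Lambda>)" for S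
    using assms(2) by (intro nn_integral_cong) simp
  then show ?thesis using assms(1) unfolding approximable_def by simp
qed

lemma approximable_sum:
  assumes "finite I" "\<And>i. i \<in> I \<Longrightarrow> approximable (H i)" "\<And>i. i \<in> I \<Longrightarrow> H i \<in> borel_measurable \<Lambda>"
  shows "approximable (\<lambda>x. \<Sum>i\<in>I. H i x)"
  using assms
proof (induction I rule: finite_induct)
  case empty
  show ?case using approximable_null[of "{}" 0] by simp
next
  case (insert i I)
  have "approximable (\<lambda>x. H i x + (\<Sum>i\<in>I. H i x))"
    using insert by (intro approximable_add borel_measurable_sum) auto
  then show ?case using insert(1,2) by simp
qed

text \<open>The sets with approximable indicator form a Dynkin system that contains the
  intersection-stable generator of the predictable field.\<close>

lemma approximable_indicator:
  assumes A: "A \<in> sets \<Lambda>"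
  shows "approximable (\<lambda>x. indicator A x *\<^sub>R v)"
proof -
  let ?G = "{{0} \<times> A | A. A \<in> sets (F 0)} \<union>
     {{s<..t} \<times> A | s t A. 0 \<le> s \<and> s < t \<and> t \<le> 1 \<and> A \<in> sets (F s)}"
  let ?\<Omega> = "{0..1} \<times> space (F 0)"
  have \<Lambda>: "sets \<Lambda> = sigma_sets ?\<Omega> ?G" using sets_eq sets_predictable_field[OF incr] by simp
  have "?G \<subseteq> Pow ?\<Omega>"
  proof -
    have "?G \<subseteq> sets \<Lambda>" unfolding \<Lambda> by (rule subsetI, rule sigma_sets.Basic)
    also have "\<dots> \<subseteq> Pow (space \<Lambda>)" by (rule sets.space_closed)
    finally show ?thesis unfolding space_eq .
  qed
  have F_mono: "sets (F s) \<subseteq> sets (F t)" if "0 \<le> s" "s \<le> t" "t \<le> 1" for s t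
    using incr that unfolding increasing_fields_def subalgebra_def by auto
  have "Int_stable ?G"
  proof (rule Int_stableI)
    fix a b assume "a \<in> ?G" "b \<in> ?G"
    have empty: "{} \<in> ?G" by (intro UnI1 CollectI exI[of _ "{}"]) auto
    have zero: "{0} \<times> A \<in> ?G" if "A \<in> sets (F 0)" for A
      using that by (intro UnI1 CollectI exI[of _ A] conjI refl)
    have rect: "{s<..t} \<times> A \<in> ?G" if "0 \<le> s" "s < t" "t \<le> 1" "A \<in> sets (F s)" for s t A
      using that by (intro UnI2 CollectI exI[of _ s] exI[of _ t] exI[of _ A] conjI refl)
    from \<open>a \<in> ?G\<close> \<open>b \<in> ?G\<close> show "a \<inter> b \<in> ?G"
    proof (elim UnE CollectE exE conjE)
      fix A A' assume "a = {0} \<times> A" "A \<in> sets (F 0)" "b = {0} \<times> A'" "A' \<in> sets (F 0)"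
      then have "a \<inter> b = {0} \<times> (A \<inter> A')" "A \<inter> A' \<in> sets (F 0)" by auto
      then show ?thesis using zero by simp
    next
      fix A s t A' assume "a = {0} \<times> A" "b = {s<..t} \<times> A'" "(0::real) \<le> s"
      then have "a \<inter> b = {}" by auto
      then show ?thesis using empty by simp
    next
      fix A s t A' assume "a = {s<..t} \<times> A" "b = {0} \<times> A'" "(0::real) \<le> s"
      then have "a \<inter> b = {}" by auto
      then show ?thesis using empty by simp
    next
      fix s t A s' t' A'
      assume *: "a = {s<..t} \<times> A" "0 \<le> s" "s < t" "t \<le> 1" "A \<in> sets (F s)"
        "b = {s'<..t'} \<times> A'" "0 \<le> s'" "s' < t'" "t' \<le> 1" "A' \<in> sets (F s')"
      have i: "a \<inter> b = {max s s'<..min t t'} \<times> (A \<inter> A')" using * by auto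
      show ?thesis
      proof (cases "max s s' < min t t'")
        case True
        have "A \<inter> A' \<in> sets (F (max s s'))"
          using * F_mono[of s "max s s'"] F_mono[of s' "max s s'"] by (intro sets.Int) auto
        then show ?thesis unfolding i using * True by (intro rect) auto
      next
        case False
        then have "a \<inter> b = {}" unfolding i by auto
        then show ?thesis using empty by simp
      qed
    qed
  qed
  have start_null: "{0} \<times> A \<in> null_sets \<Lambda>" if "A \<in> sets (F 0)" for A
    using start[OF that] that unfolding null_sets_def \<Lambda> by (blast intro: sigma_sets.Basic)
  have "A \<in> sigma_sets ?\<Omega> ?G" using A \<Lambda> by simp
  with \<open>Int_stable ?G\<close> \<open>?G \<subseteq> Pow ?\<Omega>\<close> show "approximable (\<lambda>x. indicator A x *\<^sub>R v)"
  proof (induction rule: sigma_sets_induct_disjoint)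
    case (basic A)
    then show ?case
      using approximable_null[OF start_null] approximable_rectangle by blast
  next
    case empty
    show ?case using approximable_null[of "{}"] by simp
  next
    case (compl A)
    then have A [measurable]: "A \<in> sets \<Lambda>" by (simp add: \<Lambda>)
    have [measurable]: "{0} \<times> space (F 0) \<in> sets \<Lambda>" "{0<..1} \<times> space (F 0) \<in> sets \<Lambda>"
      using start_null[of "space (F 0)"] predictable_generator[OF incr, of 0 1 "space (F 0)"] by (auto simp: sets_eq)
    have minus: "approximable (\<lambda>x. indicator A x *\<^sub>R (- v))"
      unfolding approximable_def
    proof (intro allI impI)
      fix e :: real assume "0 < e"
      then obtain n \<tau> \<xi> where sd: "simple_data F n \<tau> \<xi>"
        and 1: "(\<integral>\<^sup>+x. ennreal ((norm (indicator A x *\<^sub>R v - simple_process n \<tau> \<xi> (fst x) (snd x)))\<^sup>2) \<partial>\<Lambda>) < ennreal e"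
        using compl(2)[unfolded approximable_def] by blast
      have "simple_data F n \<tau> (\<lambda>i \<omega>. - \<xi> i \<omega>)"
        using sd unfolding simple_data_def bounded_iff by auto
      moreover have "norm (indicator A x *\<^sub>R (- v) - simple_process n \<tau> (\<lambda>i \<omega>. - \<xi> i \<omega>) (fst x) (snd x))
          = norm (indicator A x *\<^sub>R v - simple_process n \<tau> \<xi> (fst x) (snd x))" for x
        by (simp add: simple_process_def sum_negf norm_minus_commute)
      ultimately show "\<exists>n \<tau> \<xi>. simple_data F n \<tau> \<xi> \<and>
          (\<integral>\<^sup>+x. ennreal ((norm (indicator A x *\<^sub>R (- v) - simple_process n \<tau> \<xi> (fst x) (snd x)))\<^sup>2) \<partial>\<Lambda>) < ennreal e"
        using 1 by (intro exI[of _ n] exI[of _ \<tau>] exI[of _ "\<lambda>i \<omega>. - \<xi> i \<omega>"]) simp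
    qed
    \<comment> \<open>The complement is written as the whole space minus \<open>A\<close>, and the
      whole space as the null set at time 0 together with the generating rectangle over
      \<open>{0<..1}\<close>.\<close>
    have "approximable (\<lambda>x. (indicator ({0} \<times> space (F 0)) x *\<^sub>R v + indicator ({0<..1} \<times> space (F 0)) x *\<^sub>R v) + indicator A x *\<^sub>R (- v))"
      by (intro approximable_add minus approximable_null start_null approximable_rectangle) (simp_all, measurable)
    then show ?case
      by (rule approximable_cong) (auto simp: space_eq split: split_indicator)
  next
    case (union A)
    then have A [measurable]: "A i \<in> sets \<Lambda>" for i by (auto simp: \<Lambda>)
    define D where "D N = (\<Union>i. A i) - (\<Union>i<N. A i)" for N :: nat
    have D [measurable]: "D N \<in> sets \<Lambda>" for N unfolding D_def by measurable
    have "decseq D" unfolding decseq_def D_def by force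
    moreover have "(\<Inter>N. D N) = {}" unfolding D_def by (auto intro: lessI)
    ultimately have lim: "(\<lambda>N. measure \<Lambda> (D N)) \<longlonglongrightarrow> 0"
      using finite_Lim_measure_decseq[of D] D by (simp add: image_subset_iff)
    show ?case
    proof (rule approximable_limit)
      show "(\<lambda>x. indicator (\<Union>i. A i) x *\<^sub>R v) \<in> borel_measurable \<Lambda>" by measurable
      fix e :: real assume e: "0 < e"
      \<comment> \<open>Finiteness of \<Lambda> makes the mass of the tails \<open>D N\<close> tend
        to 0; the added 1 covers the case \<open>v = 0\<close>.\<close>
      have "0 < e / ((norm v)\<^sup>2 + 1)" using e by (simp add: add_nonneg_pos)
      from order_tendstoD(2)[OF lim this] obtain N where N: "measure \<Lambda> (D N) < e / ((norm v)\<^sup>2 + 1)"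
        by (auto simp: eventually_sequentially)
      have sum: "(\<Sum>i<N. indicator (A i) x *\<^sub>R v) = indicator (\<Union>i<N. A i) x *\<^sub>R v" for x
      proof -
        have "disjoint_family_on A {..<N}" using union(1) by (auto simp: disjoint_family_on_def)
        then have "(\<Sum>i<N. indicator (A i) x) = (indicator (\<Union>i<N. A i) x :: real)"
          by (intro indicator_UN_disjoint[symmetric]) auto
        then show ?thesis by (simp add: scaleR_left.sum[symmetric])
      qed
      have "approximable (\<lambda>x. \<Sum>i<N. indicator (A i) x *\<^sub>R v)"
        using union by (intro approximable_sum) auto
      moreover have "(\<integral>\<^sup>+x. ennreal ((norm (indicator (\<Union>i. A i) x *\<^sub>R v - (\<Sum>i<N. indicator (A i) x *\<^sub>R v)))\<^sup>2) \<partial>\<Lambda>) < ennreal e"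
      proof -
        have "(\<integral>\<^sup>+x. ennreal ((norm (indicator (\<Union>i. A i) x *\<^sub>R v - (\<Sum>i<N. indicator (A i) x *\<^sub>R v)))\<^sup>2) \<partial>\<Lambda>)
            = (\<integral>\<^sup>+x. ennreal ((norm v)\<^sup>2) * indicator (D N) x \<partial>\<Lambda>)"
          unfolding sum by (intro nn_integral_cong) (auto simp: D_def split: split_indicator)
        also have "\<dots> = ennreal ((norm v)\<^sup>2 * measure \<Lambda> (D N))"
          by (simp add: nn_integral_cmult_indicator emeasure_eq_measure ennreal_mult)
        also have "\<dots> < ennreal e"
        proof (rule ennreal_lessI[OF e])
          have "(norm v)\<^sup>2 * measure \<Lambda> (D N) \<le> ((norm v)\<^sup>2 + 1) * measure \<Lambda> (D N)"
            by (intro mult_right_mono) auto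
          also have "\<dots> < e" using N by (simp add: pos_less_divide_eq add_nonneg_pos mult.commute)
          finally show "(norm v)\<^sup>2 * measure \<Lambda> (D N) < e" .
        qed
        finally show ?thesis .
      qed
      ultimately show "\<exists>H'. approximable H' \<and> H' \<in> borel_measurable \<Lambda> \<and>
          (\<integral>\<^sup>+x. ennreal ((norm (indicator (\<Union>i. A i) x *\<^sub>R v - H' x))\<^sup>2) \<partial>\<Lambda>) < ennreal e"
        by (intro exI[of _ "\<lambda>x. \<Sum>i<N. indicator (A i) x *\<^sub>R v"]) (auto intro!: borel_measurable_sum)
    qed
  qed
qed

text \<open>A measurable \<open>H\<close> is a pointwise limit of simple functions dominated by a
  multiple of its norm, hence an L2 limit, and a simple function is a finite combination of
  indicators of predictable sets.\<close>

lemma approximable_L2: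
  assumes H [measurable]: "H \<in> borel_measurable \<Lambda>" and L2: "(\<integral>\<^sup>+x. ennreal ((norm (H x))\<^sup>2) \<partial>\<Lambda>) < \<infinity>"
  shows "approximable H"
proof (rule approximable_limit[OF H])
  fix e :: real assume e: "0 < e"
  obtain S where S: "\<And>i. simple_function \<Lambda> (S i)" "\<And>x. x \<in> space \<Lambda> \<Longrightarrow> (\<lambda>i. S i x) \<longlonglongrightarrow> H x"
    "\<And>i x. x \<in> space \<Lambda> \<Longrightarrow> dist (S i x) 0 \<le> 2 * dist (H x) 0"
    using borel_measurable_implies_sequence_metric[OF H, of 0] by blast
  have [measurable]: "S i \<in> borel_measurable \<Lambda>" for i using S(1) by (rule borel_measurable_simple_function)
  have "(\<lambda>i. \<integral>\<^sup>+x. ennreal ((norm (H x - S i x))\<^sup>2) \<partial>\<Lambda>) \<longlonglongrightarrow> (\<integral>\<^sup>+x. 0 \<partial>\<Lambda>)"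
  \<comment> \<open>The simple functions are at most twice as large as \<open>H\<close>, so the
    difference is at most three times as large, and 9 is the square of 3.\<close>
  proof (rule nn_integral_dominated_convergence[where w = "\<lambda>x. 9 * ennreal ((norm (H x))\<^sup>2)"])
    show "AE x in \<Lambda>. ennreal ((norm (H x - S i x))\<^sup>2) \<le> 9 * ennreal ((norm (H x))\<^sup>2)" for i
    proof (rule AE_I2)
      fix x assume x: "x \<in> space \<Lambda>"
      have "norm (H x - S i x) \<le> 3 * norm (H x)"
        using norm_triangle_ineq4[of "H x" "S i x"] S(3)[OF x, of i] by simp
      then have "(norm (H x - S i x))\<^sup>2 \<le> (3 * norm (H x))\<^sup>2" by (intro power_mono) auto
      then have "ennreal ((norm (H x - S i x))\<^sup>2) \<le> ennreal (9 * (norm (H x))\<^sup>2)"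
        by (intro ennreal_leI) (simp add: power_mult_distrib)
      then show "ennreal ((norm (H x - S i x))\<^sup>2) \<le> 9 * ennreal ((norm (H x))\<^sup>2)"
        by (simp add: ennreal_mult)
    qed
    show "(\<integral>\<^sup>+x. 9 * ennreal ((norm (H x))\<^sup>2) \<partial>\<Lambda>) < \<infinity>"
      using L2 by (simp add: nn_integral_cmult ennreal_mult_less_top)
    show "AE x in \<Lambda>. (\<lambda>i. ennreal ((norm (H x - S i x))\<^sup>2)) \<longlonglongrightarrow> 0"
    proof (rule AE_I2)
      fix x assume x: "x \<in> space \<Lambda>"
      have "(\<lambda>i. ennreal ((norm (H x - S i x))\<^sup>2)) \<longlonglongrightarrow> ennreal ((norm (H x - H x))\<^sup>2)"
        by (intro tendsto_intros S x)
      then show "(\<lambda>i. ennreal ((norm (H x - S i x))\<^sup>2)) \<longlonglongrightarrow> 0" by simp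
    qed
  qed measurable
  then have "eventually (\<lambda>i. (\<integral>\<^sup>+x. ennreal ((norm (H x - S i x))\<^sup>2) \<partial>\<Lambda>) < ennreal e) sequentially"
    using e by (intro order_tendstoD(2)) auto
  then obtain i where i: "(\<integral>\<^sup>+x. ennreal ((norm (H x - S i x))\<^sup>2) \<partial>\<Lambda>) < ennreal e"
    by (auto simp: eventually_sequentially)
  have "approximable (\<lambda>x. \<Sum>y\<in>S i ` space \<Lambda>. indicator (S i -` {y} \<inter> space \<Lambda>) x *\<^sub>R y)"
    using simple_functionD[OF S(1)[of i]] by (intro approximable_sum approximable_indicator) auto
  then have "approximable (S i)"
    by (rule approximable_cong) (simp add: simple_function_indicator_representation_banach[OF S(1)[of i], symmetric])
  then show "\<exists>H'. approximable H' \<and> H' \<in> borel_measurable \<Lambda> \<and> (\<integral>\<^sup>+x. ennreal ((norm (H x - H' x))\<^sup>2) \<partial>\<Lambda>) < ennreal e"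
    using i by auto
qed

end

section \<open>Progressive measurability and approximation with a weight\<close>

lemma predictable_generators_subset:
  assumes F: "increasing_fields F"
  shows "{{0} \<times> A | A. A \<in> sets (F 0)} \<union>
     {{s<..t} \<times> A | s t A. 0 \<le> s \<and> s < t \<and> t \<le> 1 \<and> A \<in> sets (F s)} \<subseteq> Pow ({0..1} \<times> space (F 0))" (is "?G \<subseteq> _")
proof -
  have "?G \<subseteq> sets (predictable_field F)"
    unfolding sets_predictable_field[OF F] by (rule subsetI, rule sigma_sets.Basic)
  also have "\<dots> \<subseteq> Pow (space (predictable_field F))" by (rule sets.space_closed)
  finally show ?thesis by simp
qed

text \<open>Within \<open>{0..u}\<close> a generating rectangle either disappears or starts at some
  \<open>s \<le> u\<close>, and then its base lies in the field at \<open>u\<close>. Predictable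
  processes are therefore progressive, which makes time integrals up to \<open>u\<close>
  adapted.\<close>

lemma measurable_progressive:
  assumes F: "increasing_fields F" and u: "u \<in> {0..1}" and N: "subalgebra N (F u)"
  shows "(\<lambda>x. x) \<in> restrict_space borel {0..u} \<Otimes>\<^sub>M N \<rightarrow>\<^sub>M predictable_field F"
proof (rule measurable_sigma_sets[OF sets_predictable_field[OF F] predictable_generators_subset[OF F]])
  have sp: "space N = space (F 0)"
    using N increasing_fieldsD(1)[OF F u, of 0] by (simp add: subalgebra_def)
  have in_N: "A \<in> sets N" if "A \<in> sets (F s)" "0 \<le> s" "s \<le> u" for A s
  proof -
    have "s \<in> {0..1}" using that u by auto
    then have "sets (F s) \<subseteq> sets (F u)" using F u that unfolding increasing_fields_def subalgebra_def by blast
    then show ?thesis using that N unfolding subalgebra_def by blast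
  qed
  have r: "E \<inter> {0..u} \<in> sets (restrict_space borel {0..u})" if "E \<in> sets borel" for E
    unfolding sets_restrict_space using that by (intro image_eqI[of _ _ E]) auto
  show "(\<lambda>x. x) \<in> space (restrict_space borel {0..u} \<Otimes>\<^sub>M N) \<rightarrow> {0..1} \<times> space (F 0)"
    using u by (auto simp: space_pair_measure sp)
  fix y assume "y \<in> {{0} \<times> A | A. A \<in> sets (F 0)} \<union>
     {{s<..t} \<times> A | s t A. 0 \<le> s \<and> s < t \<and> t \<le> 1 \<and> A \<in> sets (F s)}"
  then show "(\<lambda>x. x) -` y \<inter> space (restrict_space borel {0..u} \<Otimes>\<^sub>M N) \<in> sets (restrict_space borel {0..u} \<Otimes>\<^sub>M N)"
  proof (elim UnE CollectE exE conjE)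
    fix A assume y: "y = {0} \<times> A" "A \<in> sets (F 0)"
    have A: "A \<in> sets N" using in_N[OF y(2)] u by auto
    have "(\<lambda>x. x) -` y \<inter> space (restrict_space borel {0..u} \<Otimes>\<^sub>M N) = ({0} \<inter> {0..u}) \<times> A"
      using sets.sets_into_space[OF A] unfolding y(1) space_pair_measure by auto
    also have "\<dots> \<in> sets (restrict_space borel {0..u} \<Otimes>\<^sub>M N)"
      by (intro pair_measureI r A) simp
    finally show ?thesis .
  next
    fix s t :: real and A assume y: "y = {s<..t} \<times> A" "0 \<le> s" "s < t" "A \<in> sets (F s)"
    show ?thesis
    proof (cases "s \<le> u")
      case True
      have A: "A \<in> sets N" using in_N[OF y(4) y(2) True] .
      have "(\<lambda>x. x) -` y \<inter> space (restrict_space borel {0..u} \<Otimes>\<^sub>M N) = ({s<..t} \<inter> {0..u}) \<times> A"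
        using sets.sets_into_space[OF A] unfolding y(1) space_pair_measure by auto
      also have "\<dots> \<in> sets (restrict_space borel {0..u} \<Otimes>\<^sub>M N)"
        by (intro pair_measureI r A) simp
      finally show ?thesis .
    next
      case False
      then have "(\<lambda>x. x) -` y \<inter> space (restrict_space borel {0..u} \<Otimes>\<^sub>M N) = {}"
        unfolding y(1) space_pair_measure by auto
      then show ?thesis by simp
    qed
  qed
qed

abbreviation unit_lborel :: "real measure"
  where "unit_lborel \<equiv> restrict_space lborel {0..1}"

lemma sets_restrict_lborel: "sets (restrict_space lborel A) = sets (restrict_space borel A)"
  by (intro sets_restrict_space_cong) simp

lemma measurable_progressive_lborel:
  assumes F: "increasing_fields F" and u: "u \<in> {0..1}" and N: "subalgebra N (F u)"
    and f: "f \<in> predictable_field F \<rightarrow>\<^sub>M L"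
  shows "f \<in> restrict_space lborel {0..u} \<Otimes>\<^sub>M N \<rightarrow>\<^sub>M L"
proof -
  have "f \<in> restrict_space borel {0..u} \<Otimes>\<^sub>M N \<rightarrow>\<^sub>M L"
    using measurable_compose[OF measurable_progressive[OF F u N] f] by simp
  moreover have "sets (restrict_space lborel {0..u} \<Otimes>\<^sub>M N) = sets (restrict_space borel {0..u} \<Otimes>\<^sub>M N)"
    by (intro sets_pair_measure_cong sets_restrict_lborel refl)
  ultimately show ?thesis
    using measurable_cong_sets[OF _ refl] by blast
qed

lemma set_nn_integral_unit: "(\<integral>\<^sup>+t\<in>{0..1}. f t \<partial>lborel) = (\<integral>\<^sup>+t. f t \<partial>unit_lborel)"
  by (simp add: nn_integral_restrict_space)

lemma finite_measure_unit_lborel: "finite_measure unit_lborel"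
  by (rule finite_measureI) (simp add: emeasure_restrict_space)

lemma borel_measurable_unit_nn_integral:
  assumes "(\<lambda>x. f (fst x) (snd x)) \<in> borel_measurable (unit_lborel \<Otimes>\<^sub>M N)"
  shows "(\<lambda>\<omega>. \<integral>\<^sup>+t\<in>{0..1}. f t \<omega> \<partial>lborel) \<in> borel_measurable N"
proof -
  interpret finite_measure unit_lborel by (rule finite_measure_unit_lborel)
  have "(\<lambda>x. (\<lambda>x. f (fst x) (snd x)) (snd x, fst x)) \<in> borel_measurable (N \<Otimes>\<^sub>M unit_lborel)"
    using assms by (rule measurable_compose[rotated]) measurable
  then have "(\<lambda>\<omega>. \<integral>\<^sup>+t. f t \<omega> \<partial>unit_lborel) \<in> borel_measurable N"
    by (intro borel_measurable_nn_integral) (simp add: case_prod_beta)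
  then show ?thesis by (simp add: set_nn_integral_unit)
qed

lemma predictable_iff: "predictable F H \<longleftrightarrow> (\<lambda>x. H (fst x) (snd x)) \<in> borel_measurable (predictable_field F)"
  by (simp add: predictable_def case_prod_beta')

text \<open>The weight serves two applications: the constant weight 1 approximates \<sigma> itself,
  and the squared norm of \<sigma> as weight approximates a bounded inverse of \<sigma> so well that
  the product with \<sigma> is still under control.\<close>

lemma simple_approximation_weighted:
  fixes H :: "real \<Rightarrow> 'a \<Rightarrow> real ^ 'd ^ 'd::finite"
  assumes F: "increasing_fields F" and N: "prob_space N" and sub: "subalgebra N (F 1)"
    and w: "(\<lambda>x. w (fst x) (snd x)) \<in> borel_measurable (predictable_field F)"
    and w_fin: "(\<integral>\<^sup>+\<omega>. (\<integral>\<^sup>+t\<in>{0..1}. w t \<omega> \<partial>lborel) \<partial>N) < \<infinity>"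
    and H: "predictable F H"
    and H_fin: "(\<integral>\<^sup>+\<omega>. (\<integral>\<^sup>+t\<in>{0..1}. ennreal ((norm (H t \<omega>))\<^sup>2) * w t \<omega> \<partial>lborel) \<partial>N) < \<infinity>"
    and e: "0 < e"
  shows "\<exists>n \<tau> \<xi>. simple_data F n \<tau> \<xi> \<and>
    (\<integral>\<^sup>+\<omega>. (\<integral>\<^sup>+t\<in>{0..1}. ennreal ((norm (H t \<omega> - simple_process n \<tau> \<xi> t \<omega>))\<^sup>2) * w t \<omega> \<partial>lborel) \<partial>N) < ennreal e"
proof -
  interpret N: prob_space N by fact
  interpret U: finite_measure unit_lborel by (rule finite_measure_unit_lborel)
  interpret pair_sigma_finite unit_lborel N ..
  define D where "D = density (unit_lborel \<Otimes>\<^sub>M N) (\<lambda>x. w (fst x) (snd x))"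
  \<comment> \<open>The product field is finer than the predictable field. The image under the
    identity restricts the weighted measure to predictable sets, where the density of simple
    processes is available.\<close>
  define \<Lambda> where "\<Lambda> = distr D (predictable_field F) (\<lambda>x. x)"
  have one: "(1::real) \<in> {0..1}" by simp
  note prog = measurable_progressive_lborel[OF F one sub]
  have id: "(\<lambda>x. x) \<in> D \<rightarrow>\<^sub>M predictable_field F"
    unfolding D_def using prog[OF measurable_ident] by (simp add: id_def)
  have int: "(\<integral>\<^sup>+x. f x \<partial>\<Lambda>) = (\<integral>\<^sup>+\<omega>. (\<integral>\<^sup>+t\<in>{0..1}. f (t, \<omega>) * w t \<omega> \<partial>lborel) \<partial>N)"
    if f: "f \<in> borel_measurable (predictable_field F)" for f
  proof -
    note [measurable] = prog[OF f] prog[OF w]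
    have "(\<integral>\<^sup>+x. f x \<partial>\<Lambda>) = (\<integral>\<^sup>+x. w (fst x) (snd x) * f x \<partial>(unit_lborel \<Otimes>\<^sub>M N))"
      unfolding \<Lambda>_def using f id by (subst nn_integral_distr) (auto simp: D_def nn_integral_density)
    also have "\<dots> = (\<integral>\<^sup>+\<omega>. (\<integral>\<^sup>+t. w t \<omega> * f (t, \<omega>) \<partial>unit_lborel) \<partial>N)"
      by (subst nn_integral_snd[symmetric]) auto
    also have "\<dots> = (\<integral>\<^sup>+\<omega>. (\<integral>\<^sup>+t\<in>{0..1}. f (t, \<omega>) * w t \<omega> \<partial>lborel) \<partial>N)"
      unfolding set_nn_integral_unit by (simp only: mult.commute)
    finally show ?thesis .
  qed
  have pm: "predictable_measure F \<Lambda>"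
  proof (rule predictable_measure.intro)
    show "increasing_fields F" by (rule F)
    show "finite_measure \<Lambda>"
    proof (rule finite_measureI)
      have "emeasure \<Lambda> (space \<Lambda>) = (\<integral>\<^sup>+x. 1 \<partial>\<Lambda>)" by simp
      also have "\<dots> = (\<integral>\<^sup>+\<omega>. (\<integral>\<^sup>+t\<in>{0..1}. w t \<omega> \<partial>lborel) \<partial>N)"
        by (subst int) auto
      finally show "emeasure \<Lambda> (space \<Lambda>) \<noteq> \<infinity>" using w_fin by simp
    qed
    show "sets \<Lambda> = sets (predictable_field F)" by (simp add: \<Lambda>_def)
    fix A assume A: "A \<in> sets (F 0)"
    have Z: "{0} \<times> A \<in> sets (predictable_field F)"
      unfolding sets_predictable_field[OF F] by (rule sigma_sets.Basic) (use A in blast)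
    have "emeasure \<Lambda> ({0} \<times> A) = (\<integral>\<^sup>+x. indicator ({0} \<times> A) x \<partial>\<Lambda>)"
      using Z by (simp add: \<Lambda>_def)
    also have "\<dots> = (\<integral>\<^sup>+\<omega>. (\<integral>\<^sup>+t\<in>{0..1}. indicator ({0} \<times> A) (t, \<omega>) * w t \<omega> \<partial>lborel) \<partial>N)"
      using Z by (intro int) simp
    also have "\<dots> = (\<integral>\<^sup>+\<omega>. (\<integral>\<^sup>+t. 0 \<partial>(lborel :: real measure)) \<partial>N)"
    proof (rule nn_integral_cong)
      fix \<omega> assume "\<omega> \<in> space N"
      have "AE t in lborel. t \<noteq> (0::real)" by (rule AE_lborel_singleton)
      then have "AE t in lborel. indicator ({0} \<times> A) (t, \<omega>) * w t \<omega> * indicator {0..1} t = 0"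
        by eventually_elim auto
      from nn_integral_cong_AE[OF this]
      show "(\<integral>\<^sup>+t\<in>{0..1}. indicator ({0} \<times> A) (t, \<omega>) * w t \<omega> \<partial>lborel) = (\<integral>\<^sup>+t. 0 \<partial>(lborel :: real measure))"
        by simp
    qed
    finally show "emeasure \<Lambda> ({0} \<times> A) = 0" by simp
  qed
  interpret L: predictable_measure F \<Lambda> by (rule pm)
  have Hm [measurable]: "(\<lambda>x. H (fst x) (snd x)) \<in> borel_measurable (predictable_field F)"
    using H by (simp add: predictable_iff)
  have "L.approximable (\<lambda>x. H (fst x) (snd x))"
  proof (rule L.approximable_L2)
    show "(\<lambda>x. H (fst x) (snd x)) \<in> borel_measurable \<Lambda>" using Hm by (simp add: \<Lambda>_def)
    have "(\<integral>\<^sup>+x. ennreal ((norm (H (fst x) (snd x)))\<^sup>2) \<partial>\<Lambda>)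
        = (\<integral>\<^sup>+\<omega>. (\<integral>\<^sup>+t\<in>{0..1}. ennreal ((norm (H t \<omega>))\<^sup>2) * w t \<omega> \<partial>lborel) \<partial>N)"
      by (subst int) auto
    then show "(\<integral>\<^sup>+x. ennreal ((norm (H (fst x) (snd x)))\<^sup>2) \<partial>\<Lambda>) < \<infinity>" using H_fin by simp
  qed
  then obtain n \<tau> \<xi> where sd: "simple_data F n \<tau> \<xi>"
    and lt: "(\<integral>\<^sup>+x. ennreal ((norm (H (fst x) (snd x) - simple_process n \<tau> \<xi> (fst x) (snd x)))\<^sup>2) \<partial>\<Lambda>) < ennreal e"
    unfolding L.approximable_def using e by blast
  note [measurable] = simple_process_predictable[OF F sd]
  have "(\<integral>\<^sup>+x. ennreal ((norm (H (fst x) (snd x) - simple_process n \<tau> \<xi> (fst x) (snd x)))\<^sup>2) \<partial>\<Lambda>)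
      = (\<integral>\<^sup>+\<omega>. (\<integral>\<^sup>+t\<in>{0..1}. ennreal ((norm (H t \<omega> - simple_process n \<tau> \<xi> t \<omega>))\<^sup>2) * w t \<omega> \<partial>lborel) \<partial>N)"
    by (subst int) auto
  then show ?thesis using sd lt by auto
qed

section \<open>Convergence to zero in probability\<close>

lemma measure_gt_le_nn_integral:
  assumes M: "prob_space M" and Z [measurable]: "Z \<in> borel_measurable M" and \<epsilon>: "0 < \<epsilon>"
    and fin: "(\<integral>\<^sup>+\<omega>. Z \<omega> \<partial>M) < \<infinity>"
  shows "measure M {\<omega>\<in>space M. ennreal \<epsilon> < Z \<omega>} \<le> enn2real (\<integral>\<^sup>+\<omega>. Z \<omega> \<partial>M) / \<epsilon>"
proof -
  interpret prob_space M by fact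
  have "emeasure M {\<omega>\<in>space M. ennreal \<epsilon> < Z \<omega>} \<le> emeasure M {\<omega>\<in>space M. 1 \<le> ennreal (1 / \<epsilon>) * Z \<omega>}"
  proof (rule emeasure_mono)
    show "{\<omega>\<in>space M. ennreal \<epsilon> < Z \<omega>} \<subseteq> {\<omega>\<in>space M. 1 \<le> ennreal (1 / \<epsilon>) * Z \<omega>}"
    proof safe
      fix \<omega> assume "ennreal \<epsilon> < Z \<omega>"
      then have "ennreal (1 / \<epsilon>) * ennreal \<epsilon> \<le> ennreal (1 / \<epsilon>) * Z \<omega>"
        by (intro mult_left_mono) auto
      then show "1 \<le> ennreal (1 / \<epsilon>) * Z \<omega>" using \<epsilon> by (simp flip: ennreal_mult)
    qed
  qed measurable
  also have "\<dots> \<le> ennreal (1 / \<epsilon>) * (\<integral>\<^sup>+\<omega>. Z \<omega> * indicator (space M) \<omega> \<partial>M)"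
    by (rule nn_integral_Markov_inequality) auto
  also have "(\<integral>\<^sup>+\<omega>. Z \<omega> * indicator (space M) \<omega> \<partial>M) = (\<integral>\<^sup>+\<omega>. Z \<omega> \<partial>M)"
    by (intro nn_integral_cong) simp
  finally have le: "ennreal (measure M {\<omega>\<in>space M. ennreal \<epsilon> < Z \<omega>}) \<le> ennreal (1 / \<epsilon>) * (\<integral>\<^sup>+\<omega>. Z \<omega> \<partial>M)"
    by (simp add: emeasure_eq_measure)
  obtain r where r: "0 \<le> r" "(\<integral>\<^sup>+\<omega>. Z \<omega> \<partial>M) = ennreal r"
    using fin by (cases "\<integral>\<^sup>+\<omega>. Z \<omega> \<partial>M") auto
  show ?thesis
    using le \<epsilon> r by (simp add: ennreal_mult[symmetric])
qed

lemma null_in_probability_L1: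
  assumes M: "prob_space M" and Z: "\<And>k. Z k \<in> borel_measurable M"
    and lim: "(\<lambda>k. \<integral>\<^sup>+\<omega>. Z k \<omega> \<partial>M) \<longlonglongrightarrow> 0"
  shows "null_in_probability M Z"
  unfolding null_in_probability_def
proof (intro conjI allI impI Z)
  interpret prob_space M by fact
  fix \<epsilon> :: ennreal assume "0 < \<epsilon>"
  show "(\<lambda>k. measure M {\<omega>\<in>space M. \<epsilon> < Z k \<omega>}) \<longlonglongrightarrow> 0"
  proof (cases \<epsilon>)
    case (real r)
    then have r: "0 < r" using \<open>0 < \<epsilon>\<close> by simp
    have up: "(\<lambda>k. enn2real (\<integral>\<^sup>+\<omega>. Z k \<omega> \<partial>M) / r) \<longlonglongrightarrow> 0"
    proof -
      have "(\<lambda>k. enn2real (\<integral>\<^sup>+\<omega>. Z k \<omega> \<partial>M)) \<longlonglongrightarrow> 0"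
        using lim by (intro tendsto_enn2real) auto
      then show ?thesis by (rule tendsto_divide_zero)
    qed
    have fin: "eventually (\<lambda>k. (\<integral>\<^sup>+\<omega>. Z k \<omega> \<partial>M) < \<infinity>) sequentially"
      using order_tendstoD(2)[OF lim, of \<infinity>] by simp
    have ev: "eventually (\<lambda>k. measure M {\<omega>\<in>space M. \<epsilon> < Z k \<omega>} \<le> enn2real (\<integral>\<^sup>+\<omega>. Z k \<omega> \<partial>M) / r) sequentially"
      using fin
    proof eventually_elim
      case (elim k)
      then show ?case using measure_gt_le_nn_integral[OF M Z r, of k] by (simp only: real)
    qed
    have "eventually (\<lambda>k. 0 \<le> measure M {\<omega>\<in>space M. \<epsilon> < Z k \<omega>}) sequentially" by simp
    then show ?thesis by (rule tendsto_sandwich[OF _ ev tendsto_const up])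
  qed simp
qed

lemma null_in_probability_compose:
  assumes Z: "null_in_probability (distr M N X) Z" and X: "X \<in> M \<rightarrow>\<^sub>M N"
  shows "null_in_probability M (\<lambda>k \<omega>. Z k (X \<omega>))"
  unfolding null_in_probability_def
proof (intro conjI allI impI)
  have Zm: "Z k \<in> borel_measurable N" for k using Z by (simp add: null_in_probability_def)
  then show "(\<lambda>\<omega>. Z k (X \<omega>)) \<in> borel_measurable M" for k by (rule measurable_compose[OF X])
  fix \<epsilon> :: ennreal assume "0 < \<epsilon>"
  have "measure (distr M N X) {\<omega>\<in>space (distr M N X). \<epsilon> < Z k \<omega>} = measure M {\<omega>\<in>space M. \<epsilon> < Z k (X \<omega>)}" for k
  proof -
    have "{\<omega>\<in>space N. \<epsilon> < Z k \<omega>} \<in> sets N" using Zm[of k] by measurable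
    then show ?thesis
      using X by (subst measure_distr) (auto intro!: arg_cong[where f = "measure M"] dest: measurable_space)
  qed
  moreover have "(\<lambda>k. measure (distr M N X) {\<omega>\<in>space (distr M N X). \<epsilon> < Z k \<omega>}) \<longlonglongrightarrow> 0"
    using Z \<open>0 < \<epsilon>\<close> unfolding null_in_probability_def by blast
  ultimately show "(\<lambda>k. measure M {\<omega>\<in>space M. \<epsilon> < Z k (X \<omega>)}) \<longlonglongrightarrow> 0"
    by (simp only:)
qed

text \<open>The converse of the composition rule. Measurability of \<open>Z k\<close> is a separate
  hypothesis, since it cannot be recovered from that of the composition with \<open>X\<close>.
  Together the two rules move convergence between spaces on which the arguments have the same
  law.\<close>

lemma null_in_probability_distr:
  assumes Z: "null_in_probability M (\<lambda>k \<omega>. Z k (X \<omega>))" and Zm: "\<And>k. Z k \<in> borel_measurable N" and X: "X \<in> M \<rightarrow>\<^sub>M N"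
  shows "null_in_probability (distr M N X) Z"
  unfolding null_in_probability_def
proof (intro conjI allI impI)
  show "Z k \<in> borel_measurable (distr M N X)" for k using Zm by simp
  fix \<epsilon> :: ennreal assume "0 < \<epsilon>"
  have "measure (distr M N X) {\<omega>\<in>space (distr M N X). \<epsilon> < Z k \<omega>} = measure M {\<omega>\<in>space M. \<epsilon> < Z k (X \<omega>)}" for k
  proof -
    have "{\<omega>\<in>space N. \<epsilon> < Z k \<omega>} \<in> sets N" using Zm[of k] by measurable
    then show ?thesis
      using X by (subst measure_distr) (auto intro!: arg_cong[where f = "measure M"] dest: measurable_space)
  qed
  moreover have "(\<lambda>k. measure M {\<omega>\<in>space M. \<epsilon> < Z k (X \<omega>)}) \<longlonglongrightarrow> 0"
    using Z \<open>0 < \<epsilon>\<close> unfolding null_in_probability_def by blast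
  ultimately show "(\<lambda>k. measure (distr M N X) {\<omega>\<in>space (distr M N X). \<epsilon> < Z k \<omega>}) \<longlonglongrightarrow> 0"
    by (simp only:)
qed

lemma SUP_unit_interval_eq_rational:
  fixes g :: "real \<Rightarrow> real"
  assumes g: "continuous_on {0..1} g" and nonneg: "\<And>t. 0 \<le> g t"
  shows "(SUP t\<in>{0..1}. ennreal (g t)) = (SUP t\<in>\<rat> \<inter> {0..1}. ennreal (g t))" (is "_ = ?S")
proof (rule antisym)
  show "(SUP t\<in>{0..1}. ennreal (g t)) \<le> ?S"
  proof (rule SUP_least)
    fix t :: real assume t: "t \<in> {0..1}"
    show "ennreal (g t) \<le> ?S"
    proof (cases ?S)
      case (real c)
      have "g s \<le> c" if "s \<in> \<rat> \<inter> {0..1}" for s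
      proof -
        have "ennreal (g s) \<le> ?S" by (rule SUP_upper[OF that])
        then show ?thesis using real nonneg by simp
      qed
      then have "g t \<le> c" using le_on_unit_interval_iff[OF g, of c] t by blast
      then show ?thesis using real by (simp add: ennreal_leI)
    qed (simp only: top_greatest)
  qed
qed (rule SUP_subset_mono, auto)

lemma borel_measurable_SUP_norm:
  fixes f :: "'a \<Rightarrow> real \<Rightarrow> 'b::real_normed_vector"
  assumes "\<And>t. t \<in> {0..1} \<Longrightarrow> (\<lambda>\<omega>. f \<omega> t) \<in> borel_measurable M" "\<And>\<omega>. continuous_on {0..1} (f \<omega>)"
  shows "(\<lambda>\<omega>. SUP t\<in>{0..1}. ennreal (norm (f \<omega> t))) \<in> borel_measurable M"
proof -
  have "(\<lambda>\<omega>. SUP t\<in>\<rat> \<inter> {0..1}. ennreal (norm (f \<omega> t))) \<in> borel_measurable M"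
    using assms(1) countable_rationals_unit_interval by (intro borel_measurable_SUP) auto
  then show ?thesis
    using assms(2) by (subst SUP_unit_interval_eq_rational) (auto intro!: continuous_intros)
qed

lemma less_SUP_norm_iff:
  assumes "0 \<le> \<epsilon>"
  shows "ennreal \<epsilon> < (SUP t\<in>{0..1}. ennreal (norm (f t))) \<longleftrightarrow> (\<exists>t\<in>{0..1}. \<epsilon> < norm (f t))"
  using assms by (simp add: less_SUP_iff ennreal_less_iff)


section \<open>The driving integral as a functional of the solution\<close>

definition finite_drift :: "(real \<Rightarrow> 'd wpath \<Rightarrow> real ^ 'd::finite) \<Rightarrow> 'd wpath \<Rightarrow> bool"
  where "finite_drift b x \<longleftrightarrow> (\<integral>\<^sup>+t\<in>{0..1}. ennreal (norm (b t x)) \<partial>lborel) < \<infinity>"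

text \<open>The stochastic integral of \<sigma> against the noise, read off from the equation. The
  value 0 for a non-integrable drift keeps the path continuous for every \<open>x\<close>, so the
  functional is defined everywhere.\<close>

definition noise_path :: "(real \<Rightarrow> 'd wpath \<Rightarrow> real ^ 'd::finite) \<Rightarrow> 'd wpath \<Rightarrow> 'd wpath"
  where "noise_path b x = mk_path (\<lambda>t. if finite_drift b x
    then path_at x t - path_at x 0 - (LINT s:{0..t}|lborel. b s x) else 0)"

context
  fixes b :: "real \<Rightarrow> 'd wpath \<Rightarrow> real ^ 'd::finite"
  assumes b: "predictable path_filtration b"
begin

lemma drift_measurable:
  assumes "u \<in> {0..1}" "subalgebra N (path_filtration u)"
  shows "(\<lambda>x. b (fst x) (snd x)) \<in> borel_measurable (restrict_space lborel {0..u} \<Otimes>\<^sub>M N)"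
  using measurable_progressive_lborel[OF increasing_fields_path_filtration assms] b by (simp add: predictable_iff)

lemma subalgebra_borel_path_filtration: "subalgebra borel (path_filtration u :: 'd wpath measure)"
  by (rule subalgebra_path_filtration) simp

lemma drift_section_measurable: "(\<lambda>t. b t x) \<in> borel_measurable unit_lborel"
proof -
  have "(\<lambda>y. b (fst y) (snd y)) \<in> borel_measurable (unit_lborel \<Otimes>\<^sub>M (borel :: 'd wpath measure))"
    by (rule drift_measurable[OF _ subalgebra_borel_path_filtration]) simp
  from measurable_compose[OF measurable_Pair2'[of x borel unit_lborel] this] show ?thesis by simp
qed

lemma drift_set_integrable:
  assumes "finite_drift b x" shows "set_integrable lborel {0..1} (\<lambda>t. b t x)"
proof -
  have "integrable unit_lborel (\<lambda>t. b t x)"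
    using assms drift_section_measurable unfolding finite_drift_def set_nn_integral_unit
    by (intro integrableI_bounded) auto
  then show ?thesis by (simp add: integrable_restrict_space set_integrable_def)
qed

lemma continuous_on_noise:
  "continuous_on {0..1} (\<lambda>t. if finite_drift b x then path_at x t - path_at x 0 - (LINT s:{0..t}|lborel. b s x) else 0)"
proof (cases "finite_drift b x")
  case True
  have int: "set_integrable lborel {0..t} (\<lambda>s. b s x)" if "t \<in> {0..1}" for t
    by (rule set_integrable_subset[OF drift_set_integrable[OF True]]) (use that in auto)
  have "continuous_on {0..1} (\<lambda>t. integral {0..t} (\<lambda>s. b s x))"
    using set_borel_integral_eq_integral(1)[OF int[of 1]] by (intro indefinite_integral_continuous_1) simp
  then have "continuous_on {0..1} (\<lambda>t. LINT s:{0..t}|lborel. b s x)"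
    by (rule continuous_on_eq) (use set_borel_integral_eq_integral(2)[OF int] in auto)
  then show ?thesis using True by (auto intro!: continuous_intros continuous_on_path_at)
qed simp

lemma path_at_noise_path:
  assumes "t \<in> {0..1}"
  shows "path_at (noise_path b x) t = (if finite_drift b x
    then path_at x t - path_at x 0 - (LINT s:{0..t}|lborel. b s x) else 0)"
  unfolding noise_path_def by (rule path_at_mk_path[OF continuous_on_noise assms])

lemma finite_drift_sets: "{x. finite_drift b x} \<in> sets borel"
proof -
  have [measurable]: "(\<lambda>x. \<integral>\<^sup>+t\<in>{0..1}. ennreal (norm (b t x)) \<partial>lborel) \<in> borel_measurable borel"
    using drift_measurable[OF _ subalgebra_borel_path_filtration, of 1]
    by (intro borel_measurable_unit_nn_integral) auto
  have "{x \<in> space borel. (\<integral>\<^sup>+t\<in>{0..1}. ennreal (norm (b t x)) \<partial>lborel) < \<infinity>} \<in> sets borel"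
    by measurable
  then show ?thesis by (simp add: finite_drift_def)
qed

text \<open>Progressive measurability makes the integrand on \<open>{0..t}\<close> jointly
  measurable for the path field at time \<open>t\<close>, and integrating out the time preserves
  this. Paths with a non-integrable drift get the default value of the integral.\<close>

lemma drift_integral_measurable:
  assumes t: "t \<in> {0..1}"
  shows "(\<lambda>x. LINT s:{0..t}|lborel. b s x) \<in> borel_measurable (path_filtration t)"
proof -
  interpret finite_measure "restrict_space lborel {0..t}"
    using t by (intro finite_measureI) (simp add: emeasure_restrict_space)
  have "subalgebra (path_filtration t) (path_filtration t :: 'd wpath measure)" by (simp add: subalgebra_def)
  note m = drift_measurable[OF t this]
  have "(\<lambda>x. (\<lambda>x. b (fst x) (snd x)) (snd x, fst x)) \<in> borel_measurable (path_filtration t \<Otimes>\<^sub>M restrict_space lborel {0..t})"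
    using m by (rule measurable_compose[rotated]) measurable
  then have "(\<lambda>x. \<integral>s. b s x \<partial>restrict_space lborel {0..t}) \<in> borel_measurable (path_filtration t)"
    by (intro borel_measurable_lebesgue_integral) (simp add: case_prod_beta)
  then show ?thesis by (simp add: integral_restrict_space set_lebesgue_integral_def)
qed

lemma noise_path_measurable: "noise_path b \<in> borel \<rightarrow>\<^sub>M borel"
proof (rule borel_measurable_wpathI)
  fix s :: real assume s: "s \<in> {0..1}"
  have [measurable]: "(\<lambda>x. LINT r:{0..s}|lborel. b r x) \<in> borel_measurable borel"
    by (rule measurable_from_subalg[OF subalgebra_borel_path_filtration drift_integral_measurable[OF s]])
  have [measurable]: "Measurable.pred borel (finite_drift b)"
    using finite_drift_sets by (simp add: pred_def)
  have [measurable]: "(\<lambda>x::'d wpath. path_at x s) \<in> borel_measurable borel" "(\<lambda>x::'d wpath. path_at x 0) \<in> borel_measurable borel"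
    using s by (auto intro!: measurable_path_at_borel)
  show "(\<lambda>x. path_at (noise_path b x) s) \<in> borel_measurable borel"
    unfolding path_at_noise_path[OF s] by measurable
qed

text \<open>Whether the drift is integrable is decided only by the whole path. As it holds almost
  surely, the event belongs to the completed field at every time; this is the reason for working
  with completed path fields.\<close>

lemma noise_path_adapted:
  assumes \<eta>: "sets \<eta> = sets borel" and fin: "AE x in \<eta>. finite_drift b x" and t: "t \<in> {0..1}"
  shows "(\<lambda>x. path_at (noise_path b x) t) \<in> borel_measurable (completed_field \<eta> (path_filtration t))"
proof -
  have sub: "subalgebra \<eta> (path_filtration t)" by (rule subalgebra_path_filtration[OF \<eta>])
  let ?C = "completed_field \<eta> (path_filtration t)"
  have [simp]: "space \<eta> = UNIV" using sets_eq_imp_space_eq[OF \<eta>] by simp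
  have le: "f \<in> borel_measurable (path_filtration t) \<Longrightarrow> f \<in> borel_measurable ?C" for f :: "_ \<Rightarrow> real ^ 'd"
    using le_completed_field(1)[OF sub] by (intro measurable_from_subalg[of ?C "path_filtration t"]) (auto simp: subalgebra_def)
  have "{x. \<not> finite_drift b x} \<in> null_sets \<eta>"
  proof -
    have "{x. \<not> finite_drift b x} \<in> sets \<eta>"
      using sets.Diff[OF sets.top finite_drift_sets] by (simp add: \<eta> Diff_eq Collect_neg_eq)
    then show ?thesis using fin by (subst (asm) AE_iff_null) auto
  qed
  then have "{x. \<not> finite_drift b x} \<in> negligible_sets \<eta>" by (auto simp: negligible_sets_def)
  then have "{x. \<not> finite_drift b x} \<in> sets ?C" using le_completed_field(2)[OF sub] by blast
  then have "UNIV - {x. \<not> finite_drift b x} \<in> sets ?C"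
    using sets.compl_sets[of _ ?C] by fastforce
  then have [measurable]: "Measurable.pred ?C (finite_drift b)"
    by (simp add: pred_def Diff_eq Collect_neg_eq)
  have [measurable]: "(\<lambda>x. LINT r:{0..t}|lborel. b r x) \<in> borel_measurable ?C"
    by (rule le[OF drift_integral_measurable[OF t]])
  have [measurable]: "(\<lambda>x. path_at x t) \<in> borel_measurable ?C" "(\<lambda>x. path_at x 0) \<in> borel_measurable ?C"
    using t by (auto intro!: le measurable_path_at_path_filtration)
  show ?thesis
    unfolding path_at_noise_path[OF t] by measurable
qed

end


section \<open>Weak solutions are determined by their joint law\<close>

lemma exceedance_sets:
  fixes f :: "'a \<Rightarrow> real \<Rightarrow> 'b::real_normed_vector"
  assumes "\<And>t. t \<in> {0..1} \<Longrightarrow> (\<lambda>\<omega>. f \<omega> t) \<in> borel_measurable M" "\<And>\<omega>. continuous_on {0..1} (f \<omega>)" "0 \<le> \<epsilon>"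
  shows "{\<omega>\<in>space M. \<exists>t\<in>{0..1}. \<epsilon> < norm (f \<omega> t)} \<in> sets M"
proof -
  note [measurable] = borel_measurable_SUP_norm[of f M, OF assms(1,2)]
  have "{\<omega>\<in>space M. ennreal \<epsilon> < (SUP t\<in>{0..1}. ennreal (norm (f \<omega> t)))} \<in> sets M"
    by measurable
  then show ?thesis by (simp only: less_SUP_norm_iff[OF assms(3)])
qed

lemma simple_data_compose:
  assumes sd: "simple_data path_filtration n \<tau> \<zeta>"
    and X: "\<And>t. t \<in> {0..1} \<Longrightarrow> X \<in> F t \<rightarrow>\<^sub>M path_filtration t"
  shows "simple_data F n \<tau> (\<lambda>i \<omega>. \<zeta> i (X \<omega>))"
  unfolding simple_data_def
proof (intro allI impI conjI)
  fix i assume i: "i < n"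
  note D = simple_dataD[OF sd i]
  show "0 \<le> \<tau> i" "\<tau> i \<le> \<tau> (Suc i)" "\<tau> (Suc i) \<le> 1" using D by auto
  show "(\<lambda>\<omega>. \<zeta> i (X \<omega>)) \<in> borel_measurable (F (\<tau> i))"
    by (rule measurable_compose[OF X[OF D(4)] D(6)])
  show "bounded ((\<lambda>\<omega>. \<zeta> i (X \<omega>)) ` space (F (\<tau> i)))"
    using D(7) by (rule bounded_subset) auto
qed

text \<open>Generating rectangles pull back to generating rectangles of the same times, because
  \<open>X\<close> is measurable between the two fields at each time.\<close>

lemma predictable_compose:
  fixes X :: "'a \<Rightarrow> 'd::finite wpath"
  assumes F: "increasing_fields F" and X: "\<And>t. t \<in> {0..1} \<Longrightarrow> X \<in> F t \<rightarrow>\<^sub>M path_filtration t"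
    and H: "predictable path_filtration H"
  shows "predictable F (\<lambda>t \<omega>. H t (X \<omega>))"
proof -
  have "(\<lambda>x. (fst x, X (snd x))) \<in> predictable_field F \<rightarrow>\<^sub>M predictable_field path_filtration"
  proof (rule measurable_sigma_sets[OF sets_predictable_field[OF increasing_fields_path_filtration]
        predictable_generators_subset[OF increasing_fields_path_filtration]])
    show "(\<lambda>x. (fst x, X (snd x))) \<in> space (predictable_field F) \<rightarrow> {0..1} \<times> space (path_filtration 0)" by auto
    fix y :: "(real \<times> 'd wpath) set" assume "y \<in> {{0} \<times> A | A. A \<in> sets (path_filtration 0)} \<union>
     {{s<..t} \<times> A | s t A. 0 \<le> s \<and> s < t \<and> t \<le> 1 \<and> A \<in> sets (path_filtration s)}"
    then show "(\<lambda>x. (fst x, X (snd x))) -` y \<inter> space (predictable_field F) \<in> sets (predictable_field F)"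
    proof (elim UnE CollectE exE conjE)
      fix A assume y: "y = {0} \<times> A" "A \<in> sets (path_filtration 0)"
      have A: "X -` A \<inter> space (F 0) \<in> sets (F 0)" using measurable_sets[OF X y(2)] by simp
      have "(\<lambda>x. (fst x, X (snd x))) -` y \<inter> space (predictable_field F) = {0} \<times> (X -` A \<inter> space (F 0))"
        unfolding y(1) by auto
      also have "\<dots> \<in> sets (predictable_field F)"
        unfolding sets_predictable_field[OF F] by (rule sigma_sets.Basic) (use A in blast)
      finally show ?thesis .
    next
      fix s t :: real and A assume y: "y = {s<..t} \<times> A" "0 \<le> s" "s < t" "t \<le> 1" "A \<in> sets (path_filtration s)"
      have s: "s \<in> {0..1}" using y by simp
      have A: "X -` A \<inter> space (F s) \<in> sets (F s)" using measurable_sets[OF X[OF s] y(5)] .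
      have sp: "space (F s) = space (F 0)" by (rule increasing_fieldsD(1)[OF F s]) simp
      have "(\<lambda>x. (fst x, X (snd x))) -` y \<inter> space (predictable_field F) = {s<..t} \<times> (X -` A \<inter> space (F s))"
        unfolding y(1) using y(2-4) by (auto simp: sp)
      also have "\<dots> \<in> sets (predictable_field F)"
        by (rule predictable_generator[OF F y(2-4) A])
      finally show ?thesis .
    qed
  qed
  from measurable_compose[OF this, of "\<lambda>x. H (fst x) (snd x)" borel] H show ?thesis by (simp add: predictable_iff)
qed

lemma set_nn_integral_norm_sq_triangle:
  fixes f g :: "real \<Rightarrow> 'b::{second_countable_topology, real_normed_vector}"
  assumes "f \<in> borel_measurable unit_lborel" "g \<in> borel_measurable unit_lborel"
  shows "(\<integral>\<^sup>+t\<in>{0..1}. ennreal ((norm (f t + g t))\<^sup>2) \<partial>lborel)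
    \<le> 2 * (\<integral>\<^sup>+t\<in>{0..1}. ennreal ((norm (f t))\<^sup>2) \<partial>lborel) + 2 * (\<integral>\<^sup>+t\<in>{0..1}. ennreal ((norm (g t))\<^sup>2) \<partial>lborel)"
  unfolding set_nn_integral_unit by (rule nn_integral_norm_sq_triangle[OF assms])

lemma less_split_half:
  assumes "ennreal \<delta> < c" "c \<le> 2 * a + 2 * b" "0 \<le> \<delta>"
  shows "ennreal (\<delta> / 4) < a \<or> ennreal (\<delta> / 4) < b"
proof (rule ccontr)
  assume "\<not> ?thesis"
  then have "2 * a + 2 * b \<le> 2 * ennreal (\<delta> / 4) + 2 * ennreal (\<delta> / 4)"
    by (intro add_mono mult_left_mono) auto
  also have "\<dots> = ennreal \<delta>"
    using assms(3) by (simp flip: ennreal_numeral ennreal_mult ennreal_plus)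
  finally show False using assms by auto
qed

locale sde_law =
  fixes \<sigma> :: "real \<Rightarrow> 'd::finite wpath \<Rightarrow> real ^ 'd ^ 'd"
    and b :: "real \<Rightarrow> 'd wpath \<Rightarrow> real ^ 'd"
    and \<eta>\<^sub>0 :: "(real ^ 'd) measure" and \<eta> :: "'d wpath measure"
  assumes pred_\<sigma>: "predictable path_filtration \<sigma>" and pred_b: "predictable path_filtration b"
    and law: "\<eta> \<in> borel_probs"
    and energy: "(\<integral>\<^sup>+x. (\<integral>\<^sup>+t\<in>{0..1}. ennreal ((norm (\<sigma> t x))\<^sup>2) \<partial>lborel) \<partial>\<eta>) < \<infinity>"
begin

lemma sets_\<eta> [measurable_cong]: "sets \<eta> = sets borel" and prob_\<eta>: "prob_space \<eta>"
  using law by (auto simp: borel_probs_def)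

lemma space_\<eta> [simp]: "space \<eta> = UNIV"
  using sets_eq_imp_space_eq[OF sets_\<eta>] by simp

lemma section_measurable:
  fixes H :: "real \<Rightarrow> 'd wpath \<Rightarrow> 'c::topological_space"
  assumes "predictable path_filtration H"
  shows "(\<lambda>t. H t x) \<in> borel_measurable unit_lborel"
proof -
  have "(\<lambda>y. H (fst y) (snd y)) \<in> borel_measurable (unit_lborel \<Otimes>\<^sub>M (borel :: 'd wpath measure))"
    using assms
    by (intro measurable_progressive_lborel[OF increasing_fields_path_filtration _ subalgebra_path_filtration])
      (auto simp: predictable_iff)
  from measurable_compose[OF measurable_Pair2'[of x borel unit_lborel] this] show ?thesis by simp
qed

lemma predictable_simple:
  "simple_data path_filtration n \<tau> \<zeta> \<Longrightarrow> predictable path_filtration (simple_process n \<tau> \<zeta>)"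
  using simple_process_predictable[OF increasing_fields_path_filtration] by (simp add: predictable_iff)

lemma energy_measurable:
  fixes H :: "real \<Rightarrow> 'd wpath \<Rightarrow> 'c::real_normed_vector"
  assumes "predictable path_filtration H"
  shows "(\<lambda>x. \<integral>\<^sup>+t\<in>{0..1}. ennreal ((norm (H t x))\<^sup>2) \<partial>lborel) \<in> borel_measurable borel"
proof (rule borel_measurable_unit_nn_integral)
  have [measurable]: "(\<lambda>y. H (fst y) (snd y)) \<in> borel_measurable (unit_lborel \<Otimes>\<^sub>M (borel :: 'd wpath measure))"
    using assms
    by (intro measurable_progressive_lborel[OF increasing_fields_path_filtration _ subalgebra_path_filtration])
      (auto simp: predictable_iff)
  show "(\<lambda>y. ennreal ((norm (H (fst y) (snd y)))\<^sup>2)) \<in> borel_measurable (unit_lborel \<Otimes>\<^sub>M (borel :: 'd wpath measure))"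
    by measurable
qed

lemma predictable_diff:
  fixes G H :: "real \<Rightarrow> 'd wpath \<Rightarrow> 'c::{second_countable_topology, real_normed_vector}"
  shows "predictable path_filtration G \<Longrightarrow> predictable path_filtration H \<Longrightarrow> predictable path_filtration (\<lambda>t x. G t x - H t x)"
  unfolding predictable_iff by measurable

text \<open>The approximants depend on \<eta> and not on any stochastic basis, so one sequence
  serves every solution. Their existence is where finite energy is used.\<close>

lemma coefficient_approximation:
  "\<exists>n \<tau> \<zeta>. (\<forall>k. simple_data path_filtration (n k) (\<tau> k) (\<zeta> k)) \<and>
    null_in_probability \<eta> (\<lambda>k x. \<integral>\<^sup>+t\<in>{0..1}. ennreal ((norm (\<sigma> t x - simple_process (n k) (\<tau> k) (\<zeta> k) t x))\<^sup>2) \<partial>lborel)"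
proof -
  have "\<exists>n \<tau> \<xi>. simple_data path_filtration n \<tau> \<xi> \<and>
    (\<integral>\<^sup>+x. (\<integral>\<^sup>+t\<in>{0..1}. ennreal ((norm (\<sigma> t x - simple_process n \<tau> \<xi> t x))\<^sup>2) * 1 \<partial>lborel) \<partial>\<eta>) < ennreal (inverse (Suc k))"
    for k
    using energy
    by (intro simple_approximation_weighted[OF increasing_fields_path_filtration prob_\<eta> subalgebra_path_filtration[OF sets_\<eta>]] pred_\<sigma>)
      (auto simp: prob_space.emeasure_space_1[OF prob_\<eta>, simplified])
  then have "\<exists>q. simple_data path_filtration (fst q) (fst (snd q)) (snd (snd q)) \<and>
    (\<integral>\<^sup>+x. (\<integral>\<^sup>+t\<in>{0..1}. ennreal ((norm (\<sigma> t x - simple_process (fst q) (fst (snd q)) (snd (snd q)) t x))\<^sup>2) \<partial>lborel) \<partial>\<eta>) < ennreal (inverse (Suc k))"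
    for k
    unfolding mult_1_right split_paired_Ex fst_conv snd_conv .
  then have "\<exists>q. \<forall>k. simple_data path_filtration (fst (q k)) (fst (snd (q k))) (snd (snd (q k))) \<and>
    (\<integral>\<^sup>+x. (\<integral>\<^sup>+t\<in>{0..1}. ennreal ((norm (\<sigma> t x - simple_process (fst (q k)) (fst (snd (q k))) (snd (snd (q k))) t x))\<^sup>2) \<partial>lborel) \<partial>\<eta>) < ennreal (inverse (Suc k))"
    by (intro choice allI)
  then obtain q where q: "\<And>k. simple_data path_filtration (fst (q k)) (fst (snd (q k))) (snd (snd (q k)))"
    "\<And>k. (\<integral>\<^sup>+x. (\<integral>\<^sup>+t\<in>{0..1}. ennreal ((norm (\<sigma> t x - simple_process (fst (q k)) (fst (snd (q k))) (snd (snd (q k))) t x))\<^sup>2) \<partial>lborel) \<partial>\<eta>) < ennreal (inverse (Suc k))"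
    by blast
  define n where "n k = fst (q k)" for k
  define \<tau> where "\<tau> k = fst (snd (q k))" for k
  define \<zeta> where "\<zeta> k = snd (snd (q k))" for k
  have sd: "\<And>k. simple_data path_filtration (n k) (\<tau> k) (\<zeta> k)"
    and lt: "\<And>k. (\<integral>\<^sup>+x. (\<integral>\<^sup>+t\<in>{0..1}. ennreal ((norm (\<sigma> t x - simple_process (n k) (\<tau> k) (\<zeta> k) t x))\<^sup>2) \<partial>lborel) \<partial>\<eta>) < ennreal (inverse (Suc k))"
    unfolding n_def \<tau>_def \<zeta>_def by (fact q)+
  have "null_in_probability \<eta> (\<lambda>k x. \<integral>\<^sup>+t\<in>{0..1}. ennreal ((norm (\<sigma> t x - simple_process (n k) (\<tau> k) (\<zeta> k) t x))\<^sup>2) \<partial>lborel)"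
  proof (rule null_in_probability_L1[OF prob_\<eta>])
    show "(\<lambda>x. \<integral>\<^sup>+t\<in>{0..1}. ennreal ((norm (\<sigma> t x - simple_process (n k) (\<tau> k) (\<zeta> k) t x))\<^sup>2) \<partial>lborel) \<in> borel_measurable \<eta>" for k
      using energy_measurable[OF predictable_diff[OF pred_\<sigma> predictable_simple[OF sd]]]
      by (simp add: measurable_cong_sets[OF sets_\<eta> refl])
    have "(\<lambda>k. ennreal (inverse (real (Suc k)))) \<longlonglongrightarrow> ennreal 0"
      by (intro tendsto_ennrealI LIMSEQ_inverse_real_of_nat)
    then have up: "(\<lambda>k. ennreal (inverse (real (Suc k)))) \<longlonglongrightarrow> 0" by simp
    have "eventually (\<lambda>k. (\<integral>\<^sup>+x. (\<integral>\<^sup>+t\<in>{0..1}. ennreal ((norm (\<sigma> t x - simple_process (n k) (\<tau> k) (\<zeta> k) t x))\<^sup>2) \<partial>lborel) \<partial>\<eta>)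
        \<le> ennreal (inverse (real (Suc k)))) sequentially"
      by (intro always_eventually allI less_imp_le[OF lt])
    from tendsto_sandwich[OF always_eventually[OF allI[OF zero_le]] this tendsto_const up]
    show "(\<lambda>k. \<integral>\<^sup>+x. (\<integral>\<^sup>+t\<in>{0..1}. ennreal ((norm (\<sigma> t x - simple_process (n k) (\<tau> k) (\<zeta> k) t x))\<^sup>2) \<partial>lborel) \<partial>\<eta>) \<longlonglongrightarrow> 0" .
  qed
  then show ?thesis using sd by blast
qed

text \<open>
  Evaluated at \<open>(X, B)\<close>, this has a law that depends only on the joint law of \<open>(X, B)\<close>, so that
  its convergence to \<open>0\<close> in probability passes from one stochastic basis to another.
\<close>

definition ito_error :: "nat \<Rightarrow> (nat \<Rightarrow> real) \<Rightarrow> (nat \<Rightarrow> 'd wpath \<Rightarrow> real ^ 'd ^ 'd) \<Rightarrow> 'd wpath \<times> 'd wpath \<Rightarrow> ennreal"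
  where "ito_error n \<tau> \<zeta> z = (SUP t\<in>{0..1}. ennreal (norm (path_at (noise_path b (fst z)) t
    - step_integral n \<tau> (\<lambda>i. \<zeta> i (fst z)) (path_at (snd z)) t)))"

lemma simple_data_times:
  assumes sd: "simple_data path_filtration n \<tau> \<zeta>" and i: "i < n"
  shows "\<zeta> i \<in> borel_measurable borel"
  using simple_dataD(6)[OF sd i] by (rule measurable_from_subalg[OF subalgebra_path_filtration, rotated]) simp

lemma ito_error_measurable:
  assumes sd: "simple_data path_filtration n \<tau> \<zeta>"
  shows "ito_error n \<tau> \<zeta> \<in> borel_measurable (borel \<Otimes>\<^sub>M borel)"
  unfolding ito_error_def[abs_def]
proof (rule borel_measurable_SUP_norm)
  \<comment> \<open>Only joint measurability matters here, so the measurability of step integrals is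
    applied with a filtration constant in time.\<close>
  have "simple_data (\<lambda>_. borel \<Otimes>\<^sub>M borel) n \<tau> (\<lambda>i z. \<zeta> i (fst z))"
    unfolding simple_data_def
  proof (intro allI impI conjI)
    fix i assume i: "i < n"
    show "0 \<le> \<tau> i" "\<tau> i \<le> \<tau> (Suc i)" "\<tau> (Suc i) \<le> 1" using simple_dataD[OF sd i] by auto
    note [measurable] = simple_data_times[OF sd i]
    show "(\<lambda>z. \<zeta> i (fst z)) \<in> borel_measurable (borel \<Otimes>\<^sub>M borel)" by measurable
    show "bounded ((\<lambda>z. \<zeta> i (fst z)) ` space (borel \<Otimes>\<^sub>M borel))"
      using simple_dataD(7)[OF sd i] by (rule bounded_subset) auto
  qed
  moreover have "increasing_fields (\<lambda>_. borel \<Otimes>\<^sub>M borel)" by (simp add: increasing_fields_def subalgebra_def)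
  ultimately have "(\<lambda>z :: 'd wpath \<times> 'd wpath. step_integral n \<tau> (\<lambda>i. \<zeta> i (fst z)) (path_at (snd z)) t) \<in> borel_measurable (borel \<Otimes>\<^sub>M borel)"
    if "t \<in> {0..1}" for t
    using that
    by (intro step_integral_measurable[where F = "\<lambda>_. borel \<Otimes>\<^sub>M borel" and \<xi> = "\<lambda>i z. \<zeta> i (fst z)" and V = "\<lambda>z. path_at (snd z)"])
      (auto intro: measurable_compose[OF measurable_snd measurable_path_at_borel])
  moreover have "(\<lambda>z :: 'd wpath \<times> 'd wpath. path_at (noise_path b (fst z)) t) \<in> borel_measurable (borel \<Otimes>\<^sub>M borel)" if "t \<in> {0..1}" for t
    using measurable_compose[OF measurable_compose[OF measurable_fst noise_path_measurable[OF pred_b]] measurable_path_at_borel[OF that]] .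
  ultimately show "(\<lambda>z :: 'd wpath \<times> 'd wpath. path_at (noise_path b (fst z)) t - step_integral n \<tau> (\<lambda>i. \<zeta> i (fst z)) (path_at (snd z)) t) \<in> borel_measurable (borel \<Otimes>\<^sub>M borel)"
    if "t \<in> {0..1}" for t
    using that by (intro borel_measurable_diff) auto
  show "continuous_on {0..1} (\<lambda>t. path_at (noise_path b (fst z)) t - step_integral n \<tau> (\<lambda>i. \<zeta> i (fst z)) (path_at (snd z)) t)" for z :: "'d wpath \<times> 'd wpath"
    using simple_dataD(4,5)[OF sd] by (intro continuous_on_diff continuous_on_path_at continuous_on_step_integral) auto
qed

end

locale solution = sde_law \<sigma> b \<eta>\<^sub>0 \<eta> + brownian_basis M F B
  for \<sigma> :: "real \<Rightarrow> 'd::finite wpath \<Rightarrow> real ^ 'd ^ 'd" and b \<eta>\<^sub>0 \<eta>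
    and M :: "'a measure" and F and B :: "'a \<Rightarrow> 'd wpath" +
  fixes X :: "'a \<Rightarrow> 'd wpath"
  assumes sol: "weak_solution \<sigma> b \<eta>\<^sub>0 M F X B" and law_X: "distr M borel X = \<eta>"
begin

lemma X_adapted: "adapted_process F X"
  using sol by (simp add: weak_solution_def)

lemma X_filtration: "t \<in> {0..1} \<Longrightarrow> X \<in> F t \<rightarrow>\<^sub>M path_filtration t"
  by (rule adapted_process_path_filtration[OF basis X_adapted])

lemma X_measurable [measurable]: "X \<in> M \<rightarrow>\<^sub>M borel"
  by (rule adapted_process_measurable[OF basis X_adapted])

lemma B_measurable_path [measurable]: "B \<in> M \<rightarrow>\<^sub>M borel"
  by (rule adapted_process_measurable[OF basis]) (use brownian in \<open>simp add: brownian_motion_def\<close>)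

lemma finite_drift_AE: "AE x in \<eta>. finite_drift b x"
proof -
  have "AE \<omega> in M. finite_drift b (X \<omega>)"
    using sol unfolding weak_solution_def finite_drift_def by blast
  moreover have "Measurable.pred borel (finite_drift b)"
    using finite_drift_sets[OF pred_b] by (simp add: pred_def)
  ultimately show ?thesis
    unfolding law_X[symmetric] by (subst AE_distr_iff) auto
qed

text \<open>The approximating sequence from the definition of the Ito integral is an intermediate
  term. The integral is close to its simple integrals by definition; these are close to the
  integrals of the functionals \<zeta> of \<open>X\<close> by the maximal inequality, because both
  integrands are close to \<sigma>.\<close>

lemma ito_errors_null:
  assumes sd: "\<And>k. simple_data path_filtration (n k) (\<tau> k) (\<zeta> k)"
    and Z: "null_in_probability \<eta> (\<lambda>k x. \<integral>\<^sup>+t\<in>{0..1}. ennreal ((norm (\<sigma> t x - simple_process (n k) (\<tau> k) (\<zeta> k) t x))\<^sup>2) \<partial>lborel)"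
  shows "null_in_probability M (\<lambda>k \<omega>. ito_error (n k) (\<tau> k) (\<zeta> k) (X \<omega>, B \<omega>))"
  unfolding null_in_probability_def
proof (intro conjI allI impI)
  note [measurable] = ito_error_measurable[OF sd]
  show "(\<lambda>\<omega>. ito_error (n k) (\<tau> k) (\<zeta> k) (X \<omega>, B \<omega>)) \<in> borel_measurable M" for k by measurable
  obtain I where I: "ito_integral M F (\<lambda>t \<omega>. \<sigma> t (X \<omega>)) B I"
    and eq: "AE \<omega> in M. \<forall>t\<in>{0..1}. path_at (X \<omega>) t = path_at (X \<omega>) 0 + path_at (I \<omega>) t + (LINT s:{0..t}|lborel. b s (X \<omega>))"
    using sol unfolding weak_solution_def by blast
  have drift: "AE \<omega> in M. finite_drift b (X \<omega>)"
    using sol unfolding weak_solution_def finite_drift_def by blast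
  \<comment> \<open>The equation determines its own stochastic integral, which is therefore almost
    surely a functional of \<open>X\<close>.\<close>
  have I_eq: "AE \<omega> in M. I \<omega> = noise_path b (X \<omega>)"
    using eq drift
  proof eventually_elim
    case (elim \<omega>)
    show ?case
    proof (rule wpath_eqI)
      fix t :: real assume t: "t \<in> {0..1}"
      have "path_at (X \<omega>) t = path_at (X \<omega>) 0 + path_at (I \<omega>) t + (LINT s:{0..t}|lborel. b s (X \<omega>))"
        using elim t by blast
      then show "path_at (I \<omega>) t = path_at (noise_path b (X \<omega>)) t"
        using path_at_noise_path[OF pred_b t, of "X \<omega>"] elim(2) by (simp add: algebra_simps)
    qed
  qed
  obtain n' \<tau>' \<xi> where sd': "\<And>l. simple_data F (n' l) (\<tau>' l) (\<xi> l)"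
    and L2: "null_in_probability M (\<lambda>l \<omega>. \<integral>\<^sup>+t\<in>{0..1}. ennreal ((norm (\<sigma> t (X \<omega>) - simple_process (n' l) (\<tau>' l) (\<xi> l) t \<omega>))\<^sup>2) \<partial>lborel)"
    and ucp: "null_in_probability M (\<lambda>l \<omega>. SUP t\<in>{0..1}. ennreal (norm (path_at (I \<omega>) t - simple_integral_process B (n' l) (\<tau>' l) (\<xi> l) t \<omega>)))"
    and I_adapted: "adapted_process F I"
    using I unfolding ito_integral_def by blast
  have sdX: "simple_data F (n k) (\<tau> k) (\<lambda>i \<omega>. \<zeta> k i (X \<omega>))" for k
    by (rule simple_data_compose[OF sd X_filtration])
  have ZX: "null_in_probability M (\<lambda>k \<omega>. \<integral>\<^sup>+t\<in>{0..1}. ennreal ((norm (\<sigma> t (X \<omega>) - simple_process (n k) (\<tau> k) (\<zeta> k) t (X \<omega>)))\<^sup>2) \<partial>lborel)"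
    by (rule null_in_probability_compose[OF Z[folded law_X]]) measurable
  define z where "z k \<delta> = prob {\<omega>\<in>space M. ennreal \<delta> < (\<integral>\<^sup>+t\<in>{0..1}. ennreal ((norm (\<sigma> t (X \<omega>) - simple_process (n k) (\<tau> k) (\<zeta> k) t (X \<omega>)))\<^sup>2) \<partial>lborel)}" for k \<delta>
  define y where "y l \<delta> = prob {\<omega>\<in>space M. ennreal \<delta> < (\<integral>\<^sup>+t\<in>{0..1}. ennreal ((norm (\<sigma> t (X \<omega>) - simple_process (n' l) (\<tau>' l) (\<xi> l) t \<omega>))\<^sup>2) \<partial>lborel)}" for l \<delta>
  define a where "a l \<epsilon> = prob {\<omega>\<in>space M. ennreal \<epsilon> < (SUP t\<in>{0..1}. ennreal (norm (path_at (I \<omega>) t - simple_integral_process B (n' l) (\<tau>' l) (\<xi> l) t \<omega>)))}" for l \<epsilon>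
  have lims: "(\<lambda>k. z k \<delta>) \<longlonglongrightarrow> 0" "(\<lambda>l. y l \<delta>) \<longlonglongrightarrow> 0" "(\<lambda>l. a l \<delta>) \<longlonglongrightarrow> 0" if "0 < \<delta>" for \<delta> :: real
    using ZX L2 ucp that unfolding null_in_probability_def z_def y_def a_def by auto
  have X_section: "(\<lambda>t. \<sigma> t (X \<omega>)) \<in> borel_measurable unit_lborel" for \<omega>
    by (rule section_measurable[OF pred_\<sigma>])
  have F_section: "(\<lambda>t. simple_process m p \<kappa> t \<omega>) \<in> borel_measurable unit_lborel" for m p and \<kappa> :: "nat \<Rightarrow> 'a \<Rightarrow> real ^ 'd ^ 'd" and \<omega>
  proof -
    have "(\<lambda>t. simple_process m p \<kappa> t \<omega>) \<in> borel_measurable borel"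
      unfolding simple_process_def by measurable
    then show ?thesis by (intro measurable_restrict_space1) simp
  qed
  have le: "prob {\<omega>\<in>space M. ennreal \<epsilon> < ito_error (n k) (\<tau> k) (\<zeta> k) (X \<omega>, B \<omega>)}
      \<le> real CARD('d) * \<delta> / (\<epsilon> / 2)\<^sup>2 + z k (\<delta> / 4)" if \<epsilon>: "0 < \<epsilon>" and \<delta>: "0 < \<delta>" for \<epsilon> \<delta> k
  proof -
    have "prob {\<omega>\<in>space M. ennreal \<epsilon> < ito_error (n k) (\<tau> k) (\<zeta> k) (X \<omega>, B \<omega>)}
        \<le> a l (\<epsilon> / 2) + (real CARD('d) * \<delta> / (\<epsilon> / 2)\<^sup>2 + (y l (\<delta> / 4) + z k (\<delta> / 4)))" for l
    proof -
      let ?S = "simple_integral_process B (n' l) (\<tau>' l) (\<xi> l)"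
      let ?T = "simple_integral_process B (n k) (\<tau> k) (\<lambda>i \<omega>. \<zeta> k i (X \<omega>))"
      let ?A = "{\<omega>\<in>space M. ennreal (\<epsilon> / 2) < (SUP t\<in>{0..1}. ennreal (norm (path_at (I \<omega>) t - ?S t \<omega>)))}"
      let ?C = "{\<omega>\<in>space M. \<exists>t\<in>{0..1}. \<epsilon> / 2 < norm (?S t \<omega> - ?T t \<omega>)}"
      let ?Y = "{\<omega>\<in>space M. ennreal (\<delta> / 4) < (\<integral>\<^sup>+t\<in>{0..1}. ennreal ((norm (\<sigma> t (X \<omega>) - simple_process (n' l) (\<tau>' l) (\<xi> l) t \<omega>))\<^sup>2) \<partial>lborel)}"
      let ?Z = "{\<omega>\<in>space M. ennreal (\<delta> / 4) < (\<integral>\<^sup>+t\<in>{0..1}. ennreal ((norm (\<sigma> t (X \<omega>) - simple_process (n k) (\<tau> k) (\<zeta> k) t (X \<omega>)))\<^sup>2) \<partial>lborel)}"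
      have A_sets: "?A \<in> events"
      proof -
        have [measurable]: "(\<lambda>\<omega>. SUP t\<in>{0..1}. ennreal (norm (path_at (I \<omega>) t - ?S t \<omega>))) \<in> borel_measurable M"
          using ucp by (simp add: null_in_probability_def)
        show ?thesis by measurable
      qed
      have Y_sets: "?Y \<in> events"
      proof -
        have [measurable]: "(\<lambda>\<omega>. \<integral>\<^sup>+t\<in>{0..1}. ennreal ((norm (\<sigma> t (X \<omega>) - simple_process (n' l) (\<tau>' l) (\<xi> l) t \<omega>))\<^sup>2) \<partial>lborel) \<in> borel_measurable M"
          using L2 by (simp add: null_in_probability_def)
        show ?thesis by measurable
      qed
      have Z_sets: "?Z \<in> events"
      proof -
        have [measurable]: "(\<lambda>\<omega>. \<integral>\<^sup>+t\<in>{0..1}. ennreal ((norm (\<sigma> t (X \<omega>) - simple_process (n k) (\<tau> k) (\<zeta> k) t (X \<omega>)))\<^sup>2) \<partial>lborel) \<in> borel_measurable M"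
          using ZX by (simp add: null_in_probability_def)
        show ?thesis by measurable
      qed
      have C_sets: "?C \<in> events"
        using \<epsilon> by (intro exceedance_sets borel_measurable_diff continuous_on_diff continuous_on_simple_integral sd' sdX
            F_to_M[OF _ simple_integral_measurable]) auto
      have "prob {\<omega>\<in>space M. ennreal \<epsilon> < ito_error (n k) (\<tau> k) (\<zeta> k) (X \<omega>, B \<omega>)} \<le> prob (?A \<union> ?C)"
      proof (rule finite_measure_mono_AE)
        show "AE \<omega> in M. \<omega> \<in> {\<omega>\<in>space M. ennreal \<epsilon> < ito_error (n k) (\<tau> k) (\<zeta> k) (X \<omega>, B \<omega>)} \<longrightarrow> \<omega> \<in> ?A \<union> ?C"
          using I_eq
        proof (eventually_elim, intro impI)
          fix \<omega> assume I: "I \<omega> = noise_path b (X \<omega>)"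
            and w: "\<omega> \<in> {\<omega>\<in>space M. ennreal \<epsilon> < ito_error (n k) (\<tau> k) (\<zeta> k) (X \<omega>, B \<omega>)}"
          then obtain t where t: "t \<in> {0..1}" "\<epsilon> < norm (path_at (I \<omega>) t - ?T t \<omega>)"
            using \<epsilon> by (auto simp: ito_error_def less_SUP_norm_iff simple_integral_process_eq_step_integral)
          have "norm (path_at (I \<omega>) t - ?T t \<omega>) \<le> norm (path_at (I \<omega>) t - ?S t \<omega>) + norm (?S t \<omega> - ?T t \<omega>)"
            by (rule norm_triangle_ineq[of "path_at (I \<omega>) t - ?S t \<omega>" "?S t \<omega> - ?T t \<omega>", simplified])
          then have "\<epsilon> / 2 < norm (path_at (I \<omega>) t - ?S t \<omega>) \<or> \<epsilon> / 2 < norm (?S t \<omega> - ?T t \<omega>)" using t by linarith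
          then show "\<omega> \<in> ?A \<union> ?C" using t(1) w \<epsilon> by (auto simp: less_SUP_norm_iff)
        qed
      qed (use A_sets C_sets in auto)
      also have "\<dots> \<le> prob ?A + prob ?C" by (rule measure_Un_le[OF A_sets C_sets])
      also have "prob ?C \<le> real CARD('d) * \<delta> / (\<epsilon> / 2)\<^sup>2 + prob {\<omega>\<in>space M. ennreal \<delta> < (\<integral>\<^sup>+t\<in>{0..1}.
          ennreal ((norm (simple_process (n' l) (\<tau>' l) (\<xi> l) t \<omega> - simple_process (n k) (\<tau> k) (\<lambda>i \<omega>. \<zeta> k i (X \<omega>)) t \<omega>))\<^sup>2) \<partial>lborel)}"
        using \<epsilon> \<delta> by (intro simple_integral_close[OF sd' sdX]) auto
      also have "prob {\<omega>\<in>space M. ennreal \<delta> < (\<integral>\<^sup>+t\<in>{0..1}.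
          ennreal ((norm (simple_process (n' l) (\<tau>' l) (\<xi> l) t \<omega> - simple_process (n k) (\<tau> k) (\<lambda>i \<omega>. \<zeta> k i (X \<omega>)) t \<omega>))\<^sup>2) \<partial>lborel)} \<le> prob (?Y \<union> ?Z)"
      proof (rule finite_measure_mono)
        show "{\<omega>\<in>space M. ennreal \<delta> < (\<integral>\<^sup>+t\<in>{0..1}.
          ennreal ((norm (simple_process (n' l) (\<tau>' l) (\<xi> l) t \<omega> - simple_process (n k) (\<tau> k) (\<lambda>i \<omega>. \<zeta> k i (X \<omega>)) t \<omega>))\<^sup>2) \<partial>lborel)} \<subseteq> ?Y \<union> ?Z"
        proof (rule subsetI, elim CollectE conjE)
          fix \<omega> assume w: "\<omega> \<in> space M"
            and lt: "ennreal \<delta> < (\<integral>\<^sup>+t\<in>{0..1}.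
          ennreal ((norm (simple_process (n' l) (\<tau>' l) (\<xi> l) t \<omega> - simple_process (n k) (\<tau> k) (\<lambda>i \<omega>. \<zeta> k i (X \<omega>)) t \<omega>))\<^sup>2) \<partial>lborel)"
          let ?f = "\<lambda>t. simple_process (n' l) (\<tau>' l) (\<xi> l) t \<omega> - \<sigma> t (X \<omega>)"
          let ?g = "\<lambda>t. \<sigma> t (X \<omega>) - simple_process (n k) (\<tau> k) (\<zeta> k) t (X \<omega>)"
          have "simple_process (n k) (\<tau> k) (\<lambda>i \<omega>. \<zeta> k i (X \<omega>)) t \<omega> = simple_process (n k) (\<tau> k) (\<zeta> k) t (X \<omega>)" for t
            by (simp add: simple_process_def)
          then have "simple_process (n' l) (\<tau>' l) (\<xi> l) t \<omega> - simple_process (n k) (\<tau> k) (\<lambda>i \<omega>. \<zeta> k i (X \<omega>)) t \<omega> = ?f t + ?g t" for t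
            by simp
          then have "ennreal \<delta> < (\<integral>\<^sup>+t\<in>{0..1}. ennreal ((norm (?f t + ?g t))\<^sup>2) \<partial>lborel)" using lt by simp
          moreover have "(\<integral>\<^sup>+t\<in>{0..1}. ennreal ((norm (?f t + ?g t))\<^sup>2) \<partial>lborel) \<le>
              2 * (\<integral>\<^sup>+t\<in>{0..1}. ennreal ((norm (?f t))\<^sup>2) \<partial>lborel) + 2 * (\<integral>\<^sup>+t\<in>{0..1}. ennreal ((norm (?g t))\<^sup>2) \<partial>lborel)"
            by (intro set_nn_integral_norm_sq_triangle borel_measurable_diff F_section X_section
                section_measurable[OF predictable_simple[OF sd]])
          ultimately show "\<omega> \<in> ?Y \<union> ?Z"
            using less_split_half[of \<delta>] \<delta> w by (fastforce simp: norm_minus_commute)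
        qed
      qed (use Y_sets Z_sets in auto)
      also have "prob (?Y \<union> ?Z) \<le> y l (\<delta> / 4) + z k (\<delta> / 4)"
        unfolding y_def z_def by (rule measure_Un_le[OF Y_sets Z_sets])
      finally show ?thesis unfolding a_def by simp
    qed
    \<comment> \<open>The given approximation is eliminated here: its index \<open>l\<close> tends
      to infinity while \<open>k\<close> and \<delta> stay fixed.\<close>
    moreover have "(\<lambda>l. a l (\<epsilon> / 2) + (real CARD('d) * \<delta> / (\<epsilon> / 2)\<^sup>2 + (y l (\<delta> / 4) + z k (\<delta> / 4))))
        \<longlonglongrightarrow> 0 + (real CARD('d) * \<delta> / (\<epsilon> / 2)\<^sup>2 + (0 + z k (\<delta> / 4)))"
      using \<epsilon> \<delta> by (intro tendsto_add tendsto_const lims) auto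
    ultimately have "prob {\<omega>\<in>space M. ennreal \<epsilon> < ito_error (n k) (\<tau> k) (\<zeta> k) (X \<omega>, B \<omega>)}
        \<le> 0 + (real CARD('d) * \<delta> / (\<epsilon> / 2)\<^sup>2 + (0 + z k (\<delta> / 4)))"
      by (intro LIMSEQ_le_const) auto
    then show ?thesis by simp
  qed
  fix \<epsilon> :: ennreal assume "0 < \<epsilon>"
  show "(\<lambda>k. prob {\<omega>\<in>space M. \<epsilon> < ito_error (n k) (\<tau> k) (\<zeta> k) (X \<omega>, B \<omega>)}) \<longlonglongrightarrow> 0"
  proof (cases \<epsilon>)
    case (real r)
    then have r: "0 < r" using \<open>0 < \<epsilon>\<close> by simp
    show ?thesis
    proof (rule LIMSEQ_I)
      fix e :: real assume e: "0 < e"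
      \<comment> \<open>Chosen so that the first term of the bound is exactly e/2; the second falls
        below e/2 for large \<open>k\<close>.\<close>
      define \<delta> where "\<delta> = e * (r / 2)\<^sup>2 / (2 * real CARD('d))"
      have \<delta>: "0 < \<delta>" using e r by (simp add: \<delta>_def)
      have d: "real CARD('d) * \<delta> / (r / 2)\<^sup>2 = e / 2" using r by (simp add: \<delta>_def)
      have "eventually (\<lambda>k. z k (\<delta> / 4) < e / 2) sequentially"
        using lims(1)[of "\<delta> / 4"] \<delta> e by (intro order_tendstoD(2)) auto
      then obtain K where K: "\<And>k. K \<le> k \<Longrightarrow> z k (\<delta> / 4) < e / 2" by (auto simp: eventually_sequentially)
      have "norm (prob {\<omega>\<in>space M. \<epsilon> < ito_error (n k) (\<tau> k) (\<zeta> k) (X \<omega>, B \<omega>)} - 0) < e" if "K \<le> k" for k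
      proof -
        have "prob {\<omega>\<in>space M. ennreal r < ito_error (n k) (\<tau> k) (\<zeta> k) (X \<omega>, B \<omega>)} < e"
          using le[OF r \<delta>, of k] K[OF that] unfolding d by linarith
        then show ?thesis unfolding real(2) by simp
      qed
      then show "\<exists>K. \<forall>k\<ge>K. norm (prob {\<omega>\<in>space M. \<epsilon> < ito_error (n k) (\<tau> k) (\<zeta> k) (X \<omega>, B \<omega>)} - 0) < e" by blast
    qed
  qed simp
qed

text \<open>No limit is constructed on the new space. The candidate for the stochastic integral is
  the noise path of \<open>X'\<close>, for which the equation holds by construction; what remains is
  that simple integrals converge to it in probability, and this is a statement about the joint
  law.\<close>

theorem weak_solution_transfer:
  fixes M' :: "'c measure" and F' X' B'
  assumes basis': "complete_stochastic_basis M' F'" and X': "adapted_process F' X'"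
    and B': "brownian_motion M' F' B'"
    and joint: "distr M' (borel \<Otimes>\<^sub>M borel) (\<lambda>\<omega>. (X' \<omega>, B' \<omega>)) = distr M (borel \<Otimes>\<^sub>M borel) (\<lambda>\<omega>. (X \<omega>, B \<omega>))"
  shows "weak_solution \<sigma> b \<eta>\<^sub>0 M' F' X' B'"
proof -
  interpret M': brownian_basis M' F' B' by standard (rule basis' B')+
  have [measurable]: "X' \<in> M' \<rightarrow>\<^sub>M borel" by (rule adapted_process_measurable[OF basis' X'])
  have [measurable]: "B' \<in> M' \<rightarrow>\<^sub>M borel"
    by (rule adapted_process_measurable[OF basis']) (use B' in \<open>simp add: brownian_motion_def\<close>)
  have law_X': "distr M' borel X' = \<eta>"
  proof -
    have "distr M' borel X' = distr (distr M' (borel \<Otimes>\<^sub>M borel) (\<lambda>\<omega>. (X' \<omega>, B' \<omega>))) borel fst"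
      by (subst distr_distr) (auto simp: comp_def)
    also have "\<dots> = distr M borel X"
      unfolding joint by (subst distr_distr) (auto simp: comp_def)
    finally show ?thesis using law_X by simp
  qed
  have X'_filtration: "X' \<in> F' t \<rightarrow>\<^sub>M path_filtration t" if "t \<in> {0..1}" for t
    by (rule adapted_process_path_filtration[OF basis' X' that])
  have transfer: "AE \<omega> in M'. P (X' \<omega>)" if "AE x in \<eta>. P x" for P
    using that unfolding law_X'[symmetric] by (rule AE_distrD[rotated]) measurable
  obtain n \<tau> \<zeta> where sd: "\<And>k. simple_data path_filtration (n k) (\<tau> k) (\<zeta> k)"
    and Z: "null_in_probability \<eta> (\<lambda>k x. \<integral>\<^sup>+t\<in>{0..1}. ennreal ((norm (\<sigma> t x - simple_process (n k) (\<tau> k) (\<zeta> k) t x))\<^sup>2) \<partial>lborel)"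
    using coefficient_approximation by blast
  define I where "I \<omega> = noise_path b (X' \<omega>)" for \<omega>
  have drift: "AE \<omega> in M'. finite_drift b (X' \<omega>)"
    by (rule transfer[OF finite_drift_AE])
  have I_adapted: "adapted_process F' I"
    unfolding adapted_process_def I_def
  proof (intro ballI)
    fix t :: real assume t: "t \<in> {0..1}"
    show "(\<lambda>\<omega>. path_at (noise_path b (X' \<omega>)) t) \<in> borel_measurable (F' t)"
      by (rule measurable_compose[OF adapted_process_completed_path_filtration[OF basis' X' t law_X']
            noise_path_adapted[OF pred_b sets_\<eta> finite_drift_AE t]])
  qed
  have "ito_integral M' F' (\<lambda>t \<omega>. \<sigma> t (X' \<omega>)) B' I"
    unfolding ito_integral_def
  proof (intro conjI exI allI)
    show "predictable F' (\<lambda>t \<omega>. \<sigma> t (X' \<omega>))"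
      by (rule predictable_compose[OF M'.F_incr X'_filtration pred_\<sigma>])
    have "AE x in \<eta>. (\<integral>\<^sup>+t\<in>{0..1}. ennreal ((norm (\<sigma> t x))\<^sup>2) \<partial>lborel) \<noteq> \<infinity>"
      using energy energy_measurable[OF pred_\<sigma>]
      by (intro nn_integral_noteq_infinite) (auto simp: measurable_cong_sets[OF sets_\<eta> refl])
    from transfer[OF this] show "AE \<omega> in M'. (\<integral>\<^sup>+t\<in>{0..1}. ennreal ((norm (\<sigma> t (X' \<omega>)))\<^sup>2) \<partial>lborel) < \<infinity>"
      by eventually_elim (simp add: less_top)
    show "adapted_process F' I" by (rule I_adapted)
    show "simple_data F' (n k) (\<tau> k) (\<lambda>i \<omega>. \<zeta> k i (X' \<omega>))" for k
      by (rule simple_data_compose[OF sd X'_filtration])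
    have "null_in_probability M' (\<lambda>k \<omega>. \<integral>\<^sup>+t\<in>{0..1}. ennreal ((norm (\<sigma> t (X' \<omega>) - simple_process (n k) (\<tau> k) (\<zeta> k) t (X' \<omega>)))\<^sup>2) \<partial>lborel)"
      by (rule null_in_probability_compose[OF Z[folded law_X']]) measurable
    then show "null_in_probability M' (\<lambda>k \<omega>. \<integral>\<^sup>+t\<in>{0..1}. ennreal ((norm (\<sigma> t (X' \<omega>) - simple_process (n k) (\<tau> k) (\<lambda>i \<omega>. \<zeta> k i (X' \<omega>)) t \<omega>))\<^sup>2) \<partial>lborel)"
      by (simp add: simple_process_def)
    have "null_in_probability M' (\<lambda>k \<omega>. ito_error (n k) (\<tau> k) (\<zeta> k) (X' \<omega>, B' \<omega>))"
    proof (rule null_in_probability_compose[where N = "borel \<Otimes>\<^sub>M borel"])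
      show "null_in_probability (distr M' (borel \<Otimes>\<^sub>M borel) (\<lambda>\<omega>. (X' \<omega>, B' \<omega>))) (\<lambda>k. ito_error (n k) (\<tau> k) (\<zeta> k))"
        unfolding joint
        by (intro null_in_probability_distr ito_errors_null[OF sd Z] ito_error_measurable sd) measurable
    qed measurable
    then show "null_in_probability M' (\<lambda>k \<omega>. SUP t\<in>{0..1}. ennreal (norm (path_at (I \<omega>) t
        - simple_integral_process B' (n k) (\<tau> k) (\<lambda>i \<omega>. \<zeta> k i (X' \<omega>)) t \<omega>)))"
      by (simp add: ito_error_def I_def simple_integral_process_eq_step_integral)
  qed
  moreover have "AE \<omega> in M'. \<forall>t\<in>{0..1}. path_at (X' \<omega>) t = path_at (X' \<omega>) 0 + path_at (I \<omega>) t + (LINT s:{0..t}|lborel. b s (X' \<omega>))"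
    using drift by eventually_elim (simp add: I_def path_at_noise_path[OF pred_b])
  moreover have "distr M' borel (\<lambda>\<omega>. path_at (X' \<omega>) 0) = \<eta>\<^sub>0"
  proof -
    have [measurable]: "(\<lambda>x::'d wpath. path_at x 0) \<in> borel \<rightarrow>\<^sub>M borel" by (rule measurable_path_at_borel) simp
    have "distr M' borel (\<lambda>\<omega>. path_at (X' \<omega>) 0) = distr (distr M' borel X') borel (\<lambda>x. path_at x 0)"
      by (subst distr_distr) (auto simp: comp_def)
    also have "\<dots> = distr M borel (\<lambda>\<omega>. path_at (X \<omega>) 0)"
      unfolding law_X' law_X[symmetric] by (subst distr_distr) (auto simp: comp_def)
    finally show ?thesis using sol by (simp add: weak_solution_def)
  qed
  ultimately show ?thesis
    using X' B' drift unfolding weak_solution_def finite_drift_def by blast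
qed

end


section \<open>The Brownian motion as a functional of a non-degenerate solution\<close>

text \<open>Cramer's rule; unlike \<^const>\<open>matrix_inv\<close>, this inverse is visibly Borel measurable.\<close>

definition cofactor_inverse :: "real ^ 'd ^ 'd \<Rightarrow> real ^ 'd ^ 'd::finite"
  where "cofactor_inverse A = (\<chi> k l. det (\<chi> i j. if j = k then axis l 1 $ i else A $ i $ j) / det A)"

text \<open>Cramer's rule solves for the columns of a right inverse, and for a square matrix a right
  inverse is a left inverse.\<close>

lemma cofactor_inverse_mult:
  fixes A :: "real ^ 'd ^ 'd::finite"
  assumes "det A \<noteq> 0"
  shows "cofactor_inverse A ** A = mat 1"
proof -
  have "A *v (\<chi> k. cofactor_inverse A $ k $ l) = axis l 1" for l
    by (subst cramer[OF assms]) (simp add: cofactor_inverse_def)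
  then have "(\<Sum>k\<in>UNIV. A $ i $ k * cofactor_inverse A $ k $ l) = axis l 1 $ i" for i l
    by (simp add: vec_eq_iff matrix_vector_mult_def)
  then have "A ** cofactor_inverse A = mat 1"
    by (simp add: vec_eq_iff matrix_matrix_mult_def mat_def axis_def)
  then show ?thesis by (simp add: matrix_left_right_inverse)
qed

lemma borel_measurable_matrixI:
  fixes f :: "'a \<Rightarrow> real ^ 'n::finite ^ 'm::finite"
  assumes "\<And>i j. (\<lambda>x. f x $ i $ j) \<in> borel_measurable M"
  shows "f \<in> borel_measurable M"
proof (rule iffD2[OF borel_measurable_euclidean_space], rule ballI)
  fix u :: "real ^ 'n ^ 'm" assume "u \<in> Basis"
  then obtain i j where "u = axis i (axis j 1)" by (auto simp: Basis_vec_def)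
  then have "(\<lambda>x. f x \<bullet> u) = (\<lambda>x. f x $ i $ j)" by (simp add: inner_axis)
  then show "(\<lambda>x. f x \<bullet> u) \<in> borel_measurable M" using assms by simp
qed

lemma borel_measurable_det:
  fixes f :: "'a \<Rightarrow> real ^ 'n ^ 'n::finite"
  assumes [measurable]: "f \<in> borel_measurable M"
  shows "(\<lambda>x. det (f x)) \<in> borel_measurable M"
  unfolding det_def by measurable

lemma borel_measurable_cofactor_inverse:
  fixes f :: "'a \<Rightarrow> real ^ 'n ^ 'n::finite"
  assumes [measurable]: "f \<in> borel_measurable M"
  shows "(\<lambda>x. cofactor_inverse (f x)) \<in> borel_measurable M"
proof (rule borel_measurable_matrixI)
  fix k l
  have "(\<lambda>x. \<chi> i j. if j = k then axis l 1 $ i else f x $ i $ j) \<in> borel_measurable M"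
  proof (rule borel_measurable_matrixI)
    fix i j
    show "(\<lambda>x. (\<chi> i j. if j = k then axis l 1 $ i else f x $ i $ j) $ i $ j) \<in> borel_measurable M"
      by (cases "j = k") auto
  qed
  then have [measurable]: "(\<lambda>x. det (\<chi> i j. if j = k then axis l 1 $ i else f x $ i $ j)) \<in> borel_measurable M"
    by (rule borel_measurable_det)
  have [measurable]: "(\<lambda>x. det (f x)) \<in> borel_measurable M" by (rule borel_measurable_det) measurable
  show "(\<lambda>x. cofactor_inverse (f x) $ k $ l) \<in> borel_measurable M"
    by (simp add: cofactor_inverse_def)
qed

lemma simple_data_fields:
  assumes sd: "simple_data F n \<tau> \<zeta>" and le: "\<And>t. t \<in> {0..1} \<Longrightarrow> subalgebra (G t) (F t)"
  shows "simple_data G n \<tau> \<zeta>"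
  unfolding simple_data_def
proof (intro allI impI conjI)
  fix i assume i: "i < n"
  note D = simple_dataD[OF sd i]
  show "0 \<le> \<tau> i" "\<tau> i \<le> \<tau> (Suc i)" "\<tau> (Suc i) \<le> 1" using D by auto
  show "\<zeta> i \<in> borel_measurable (G (\<tau> i))" by (rule measurable_from_subalg[OF le[OF D(4)] D(6)])
  show "bounded (\<zeta> i ` space (G (\<tau> i)))" using D(7) le[OF D(4)] by (simp add: subalgebra_def)
qed

context sde_law
begin

abbreviation total_energy :: "(real \<Rightarrow> 'd wpath \<Rightarrow> real ^ 'd ^ 'd) \<Rightarrow> ennreal"
  where "total_energy H \<equiv> (\<integral>\<^sup>+x. (\<integral>\<^sup>+t\<in>{0..1}. ennreal ((norm (H t x))\<^sup>2) \<partial>lborel) \<partial>\<eta>)"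

lemma predictable_mult:
  fixes G H :: "real \<Rightarrow> 'd wpath \<Rightarrow> real ^ 'd ^ 'd"
  shows "predictable path_filtration G \<Longrightarrow> predictable path_filtration H \<Longrightarrow> predictable path_filtration (\<lambda>t x. G t x ** H t x)"
  unfolding predictable_iff by (rule borel_measurable_matrix_matrix_mult)

lemma predictable_const: "predictable path_filtration (\<lambda>_ _. c)"
  unfolding predictable_iff by simp

lemma total_energy_triangle:
  assumes G: "predictable path_filtration G" and H: "predictable path_filtration H"
  shows "total_energy (\<lambda>t x. G t x + H t x) \<le> 2 * total_energy G + 2 * total_energy H"
proof -
  have [measurable]: "(\<lambda>x. \<integral>\<^sup>+t\<in>{0..1}. ennreal ((norm (G t x))\<^sup>2) \<partial>lborel) \<in> borel_measurable \<eta>"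
    "(\<lambda>x. \<integral>\<^sup>+t\<in>{0..1}. ennreal ((norm (H t x))\<^sup>2) \<partial>lborel) \<in> borel_measurable \<eta>"
    using energy_measurable[OF G] energy_measurable[OF H] by (simp_all add: measurable_cong_sets[OF sets_\<eta> refl])
  have "total_energy (\<lambda>t x. G t x + H t x) \<le> (\<integral>\<^sup>+x. 2 * (\<integral>\<^sup>+t\<in>{0..1}. ennreal ((norm (G t x))\<^sup>2) \<partial>lborel)
      + 2 * (\<integral>\<^sup>+t\<in>{0..1}. ennreal ((norm (H t x))\<^sup>2) \<partial>lborel) \<partial>\<eta>)"
    by (intro nn_integral_mono set_nn_integral_norm_sq_triangle section_measurable[OF G] section_measurable[OF H])
  also have "\<dots> = 2 * total_energy G + 2 * total_energy H"
    by (simp add: nn_integral_add nn_integral_cmult)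
  finally show ?thesis .
qed

text \<open>The inverse of \<sigma> need not be integrable in any sense. Cutting it to 0 where its
  norm is large makes it bounded, and its product with \<sigma> is either the identity or 0.\<close>

definition truncated_inverse :: "nat \<Rightarrow> real \<Rightarrow> 'd wpath \<Rightarrow> real ^ 'd ^ 'd"
  where "truncated_inverse N t x = (if det (\<sigma> t x) \<noteq> 0 \<and> norm (cofactor_inverse (\<sigma> t x)) \<le> real N
    then cofactor_inverse (\<sigma> t x) else 0)"

lemma predictable_truncated_inverse: "predictable path_filtration (truncated_inverse N)"
proof -
  have [measurable]: "(\<lambda>x. \<sigma> (fst x) (snd x)) \<in> borel_measurable (predictable_field path_filtration)"
    using pred_\<sigma> by (simp add: predictable_iff)
  note [measurable] = borel_measurable_det[OF this] borel_measurable_cofactor_inverse[OF this]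
  show ?thesis unfolding predictable_iff truncated_inverse_def by measurable
qed

lemma norm_truncated_inverse: "norm (truncated_inverse N t x) \<le> real N"
  by (simp add: truncated_inverse_def)

lemma truncated_inverse_mult:
  "truncated_inverse N t x ** \<sigma> t x - mat 1 = (if det (\<sigma> t x) \<noteq> 0 \<and> norm (cofactor_inverse (\<sigma> t x)) \<le> real N then 0 else - mat 1)"
  by (simp add: truncated_inverse_def cofactor_inverse_mult
      bounded_bilinear.zero_left[OF bounded_bilinear_matrix_matrix_mult])

text \<open>At a fixed time and path the error is zero as soon as \<open>N\<close> exceeds the norm
  of the inverse, and it is always bounded by the norm of the identity; dominated convergence
  applies first in time and then in the path.\<close>

lemma truncated_inverse_limit:
  assumes det: "AE x in \<eta>. \<forall>t\<in>{0..1}. det (\<sigma> t x) \<noteq> 0"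
  shows "(\<lambda>N. total_energy (\<lambda>t x. truncated_inverse N t x ** \<sigma> t x - mat 1)) \<longlonglongrightarrow> 0"
proof -
  let ?c = "ennreal ((norm (mat 1 :: real ^ 'd ^ 'd))\<^sup>2)"
  interpret prob_space \<eta> by (rule prob_\<eta>)
  have pred: "predictable path_filtration (\<lambda>t x. truncated_inverse N t x ** \<sigma> t x - mat 1)" for N
    by (intro predictable_diff predictable_mult predictable_truncated_inverse pred_\<sigma> predictable_const)
  have le: "ennreal ((norm (truncated_inverse N t x ** \<sigma> t x - mat 1))\<^sup>2) \<le> ?c" for N t x
    unfolding truncated_inverse_mult by simp
  have space: "emeasure unit_lborel {0..1} = 1"
    by (simp add: emeasure_restrict_space)
  have inner_le: "(\<integral>\<^sup>+t\<in>{0..1}. ennreal ((norm (truncated_inverse N t x ** \<sigma> t x - mat 1))\<^sup>2) \<partial>lborel) \<le> ?c" for N x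
  proof -
    have "(\<integral>\<^sup>+t. ennreal ((norm (truncated_inverse N t x ** \<sigma> t x - mat 1))\<^sup>2) \<partial>unit_lborel) \<le> (\<integral>\<^sup>+t. ?c \<partial>unit_lborel)"
      by (intro nn_integral_mono le)
    also have "\<dots> = ?c" using space by simp
    finally show ?thesis unfolding set_nn_integral_unit .
  qed
  have inner: "(\<lambda>N. \<integral>\<^sup>+t\<in>{0..1}. ennreal ((norm (truncated_inverse N t x ** \<sigma> t x - mat 1))\<^sup>2) \<partial>lborel) \<longlonglongrightarrow> 0"
    if x: "\<forall>t\<in>{0..1}. det (\<sigma> t x) \<noteq> 0" for x
  proof -
    have "(\<lambda>N. \<integral>\<^sup>+t. ennreal ((norm (truncated_inverse N t x ** \<sigma> t x - mat 1))\<^sup>2) \<partial>unit_lborel) \<longlonglongrightarrow> (\<integral>\<^sup>+t. 0 \<partial>unit_lborel)"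
    proof (rule nn_integral_dominated_convergence[where w = "\<lambda>_. ?c"])
      show "(\<lambda>t. ennreal ((norm (truncated_inverse N t x ** \<sigma> t x - mat 1))\<^sup>2)) \<in> borel_measurable unit_lborel" for N
      proof -
        note [measurable] = section_measurable[OF pred[of N], of x]
        show ?thesis by measurable
      qed
      show "(\<integral>\<^sup>+t. ?c \<partial>unit_lborel) < \<infinity>" using space by simp
      show "AE t in unit_lborel. (\<lambda>N. ennreal ((norm (truncated_inverse N t x ** \<sigma> t x - mat 1))\<^sup>2)) \<longlonglongrightarrow> 0"
      proof (rule AE_I2)
        fix t assume "t \<in> space unit_lborel"
        then have t: "t \<in> {0..1}" by simp
        obtain N0 where N0: "norm (cofactor_inverse (\<sigma> t x)) \<le> real N0" using real_arch_simple by blast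
        have "eventually (\<lambda>N. ennreal ((norm (truncated_inverse N t x ** \<sigma> t x - mat 1))\<^sup>2) = 0) sequentially"
          unfolding truncated_inverse_mult eventually_sequentially
          using x t N0 by (intro exI[of _ N0]) auto
        then show "(\<lambda>N. ennreal ((norm (truncated_inverse N t x ** \<sigma> t x - mat 1))\<^sup>2)) \<longlonglongrightarrow> 0"
          by (rule tendsto_eventually)
      qed
    qed (use le in auto)
    then show ?thesis unfolding set_nn_integral_unit by simp
  qed
  have "(\<lambda>N. total_energy (\<lambda>t x. truncated_inverse N t x ** \<sigma> t x - mat 1)) \<longlonglongrightarrow> (\<integral>\<^sup>+x. 0 \<partial>\<eta>)"
  proof (rule nn_integral_dominated_convergence[where w = "\<lambda>_. ?c"])
    show "(\<lambda>x. \<integral>\<^sup>+t\<in>{0..1}. ennreal ((norm (truncated_inverse N t x ** \<sigma> t x - mat 1))\<^sup>2) \<partial>lborel) \<in> borel_measurable \<eta>" for N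
      using energy_measurable[OF pred] by (simp add: measurable_cong_sets[OF sets_\<eta> refl])
    show "(\<integral>\<^sup>+x. ?c \<partial>\<eta>) < \<infinity>" using emeasure_space_1 by simp
    show "AE x in \<eta>. (\<lambda>N. \<integral>\<^sup>+t\<in>{0..1}. ennreal ((norm (truncated_inverse N t x ** \<sigma> t x - mat 1))\<^sup>2) \<partial>lborel) \<longlonglongrightarrow> 0"
      using det by eventually_elim (rule inner)
  qed (use inner_le in auto)
  then show ?thesis by simp
qed

text \<open>Approximating the truncated inverse in plain L2 would not control its product with a
  possibly unbounded \<sigma>. With the squared norm of \<sigma> as weight, the approximation error
  is an upper bound for the energy of the product.\<close>

lemma inverse_approximation:
  assumes det: "AE x in \<eta>. \<forall>t\<in>{0..1}. det (\<sigma> t x) \<noteq> 0" and e: "0 < e"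
  shows "\<exists>n \<tau> \<kappa>. simple_data path_filtration n \<tau> \<kappa> \<and>
    total_energy (\<lambda>t x. simple_process n \<tau> \<kappa> t x ** \<sigma> t x - mat 1) < ennreal e"
proof -
  have "eventually (\<lambda>N. total_energy (\<lambda>t x. truncated_inverse N t x ** \<sigma> t x - mat 1) < ennreal (e / 4)) sequentially"
    using truncated_inverse_limit[OF det] e by (intro order_tendstoD(2)) auto
  then obtain N where N: "total_energy (\<lambda>t x. truncated_inverse N t x ** \<sigma> t x - mat 1) < ennreal (e / 4)"
    by (auto simp: eventually_sequentially)
  let ?K = "truncated_inverse N"
  have w: "(\<lambda>x. ennreal ((norm (\<sigma> (fst x) (snd x)))\<^sup>2)) \<in> borel_measurable (predictable_field path_filtration)"
  proof -
    have [measurable]: "(\<lambda>x. \<sigma> (fst x) (snd x)) \<in> borel_measurable (predictable_field path_filtration)"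
      using pred_\<sigma> by (simp add: predictable_iff)
    show ?thesis by measurable
  qed
  have "(\<integral>\<^sup>+x. (\<integral>\<^sup>+t\<in>{0..1}. ennreal ((norm (?K t x))\<^sup>2) * ennreal ((norm (\<sigma> t x))\<^sup>2) \<partial>lborel) \<partial>\<eta>)
      \<le> (\<integral>\<^sup>+x. ennreal ((real N)\<^sup>2) * (\<integral>\<^sup>+t\<in>{0..1}. ennreal ((norm (\<sigma> t x))\<^sup>2) \<partial>lborel) \<partial>\<eta>)"
  proof (rule nn_integral_mono)
    fix x
    have [measurable]: "(\<lambda>t. \<sigma> t x) \<in> borel_measurable unit_lborel" by (rule section_measurable[OF pred_\<sigma>])
    have "(\<integral>\<^sup>+t. ennreal ((norm (?K t x))\<^sup>2) * ennreal ((norm (\<sigma> t x))\<^sup>2) \<partial>unit_lborel)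
        \<le> (\<integral>\<^sup>+t. ennreal ((real N)\<^sup>2) * ennreal ((norm (\<sigma> t x))\<^sup>2) \<partial>unit_lborel)"
      using norm_truncated_inverse by (intro nn_integral_mono mult_right_mono ennreal_leI power_mono) auto
    then show "(\<integral>\<^sup>+t\<in>{0..1}. ennreal ((norm (?K t x))\<^sup>2) * ennreal ((norm (\<sigma> t x))\<^sup>2) \<partial>lborel)
        \<le> ennreal ((real N)\<^sup>2) * (\<integral>\<^sup>+t\<in>{0..1}. ennreal ((norm (\<sigma> t x))\<^sup>2) \<partial>lborel)"
      unfolding set_nn_integral_unit by (simp add: nn_integral_cmult)
  qed
  also have "\<dots> = ennreal ((real N)\<^sup>2) * total_energy \<sigma>"
    using energy_measurable[OF pred_\<sigma>] by (intro nn_integral_cmult) (simp add: measurable_cong_sets[OF sets_\<eta> refl])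
  also have "\<dots> < \<infinity>" using energy by (simp add: ennreal_mult_less_top)
  finally have fin: "(\<integral>\<^sup>+x. (\<integral>\<^sup>+t\<in>{0..1}. ennreal ((norm (?K t x))\<^sup>2) * ennreal ((norm (\<sigma> t x))\<^sup>2) \<partial>lborel) \<partial>\<eta>) < \<infinity>" .
  obtain n \<tau> \<kappa> where sd: "simple_data path_filtration n \<tau> \<kappa>"
    and lt: "(\<integral>\<^sup>+x. (\<integral>\<^sup>+t\<in>{0..1}. ennreal ((norm (?K t x - simple_process n \<tau> \<kappa> t x))\<^sup>2) * ennreal ((norm (\<sigma> t x))\<^sup>2) \<partial>lborel) \<partial>\<eta>) < ennreal (e / 4)"
    using simple_approximation_weighted[OF increasing_fields_path_filtration prob_\<eta> subalgebra_path_filtration[OF sets_\<eta>] w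
        energy predictable_truncated_inverse fin, of "e / 4"] e by auto
  let ?k = "simple_process n \<tau> \<kappa>"
  have "total_energy (\<lambda>t x. (?k t x - ?K t x) ** \<sigma> t x)
      \<le> (\<integral>\<^sup>+x. (\<integral>\<^sup>+t\<in>{0..1}. ennreal ((norm (?K t x - ?k t x))\<^sup>2) * ennreal ((norm (\<sigma> t x))\<^sup>2) \<partial>lborel) \<partial>\<eta>)"
  proof (intro nn_integral_mono mult_right_mono)
    fix t x
    have "(norm ((?k t x - ?K t x) ** \<sigma> t x))\<^sup>2 \<le> (norm (?k t x - ?K t x) * norm (\<sigma> t x))\<^sup>2"
      by (intro power_mono norm_matrix_matrix_mult_le) simp
    then show "ennreal ((norm ((?k t x - ?K t x) ** \<sigma> t x))\<^sup>2) \<le> ennreal ((norm (?K t x - ?k t x))\<^sup>2) * ennreal ((norm (\<sigma> t x))\<^sup>2)"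
      by (simp add: power_mult_distrib norm_minus_commute flip: ennreal_mult)
  qed simp
  then have lt': "total_energy (\<lambda>t x. (?k t x - ?K t x) ** \<sigma> t x) < ennreal (e / 4)" using lt by simp
  have "?k t x ** \<sigma> t x - mat 1 = (?k t x - ?K t x) ** \<sigma> t x + (?K t x ** \<sigma> t x - mat 1)" for t x
    by (simp add: bounded_bilinear.diff_left[OF bounded_bilinear_matrix_matrix_mult])
  then have "total_energy (\<lambda>t x. ?k t x ** \<sigma> t x - mat 1)
      = total_energy (\<lambda>t x. (?k t x - ?K t x) ** \<sigma> t x + (?K t x ** \<sigma> t x - mat 1))"
    by (simp only:)
  also have "\<dots> \<le> 2 * total_energy (\<lambda>t x. (?k t x - ?K t x) ** \<sigma> t x) + 2 * total_energy (\<lambda>t x. ?K t x ** \<sigma> t x - mat 1)"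
    by (intro total_energy_triangle predictable_mult predictable_diff predictable_simple[OF sd]
        predictable_truncated_inverse pred_\<sigma> predictable_const)
  also have "\<dots> < 2 * ennreal (e / 4) + 2 * ennreal (e / 4)"
    using lt' N by (intro add_strict_mono ennreal_mult_strict_left_mono) auto
  also have "\<dots> = ennreal e"
    using e by (simp flip: ennreal_numeral ennreal_mult ennreal_plus)
  finally show ?thesis using sd by blast
qed

end

context solution
begin

text \<open>Replacing \<sigma> by a simple functional \<zeta> causes two errors, one in the noise
  path and one in the product with \<kappa>. Both vanish as \<zeta> improves with \<kappa> fixed, so
  the final bound involves only the energy of the defect of \<kappa> as an inverse of
  \<sigma>.\<close>

lemma inverse_integral_close:
  assumes sd: "simple_data path_filtration n \<tau> \<kappa>"
    and en: "total_energy (\<lambda>t x. simple_process n \<tau> \<kappa> t x ** \<sigma> t x - mat 1) < ennreal e"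
    and \<epsilon>: "0 < \<epsilon>" and \<delta>: "0 < \<delta>" and e: "0 < e"
  shows "prob {\<omega>\<in>space M. \<exists>t\<in>{0..1}. \<epsilon> < norm (step_integral n \<tau> (\<lambda>i. \<kappa> i (X \<omega>)) (path_at (noise_path b (X \<omega>))) t - path_at (B \<omega>) t)}
    \<le> real CARD('d) * \<delta> / (\<epsilon> / 2)\<^sup>2 + e / (\<delta> / 4)" (is "prob ?E \<le> _")
proof -
  obtain n' \<tau>' \<zeta> where sd': "\<And>k. simple_data path_filtration (n' k) (\<tau>' k) (\<zeta> k)"
    and Z: "null_in_probability \<eta> (\<lambda>k x. \<integral>\<^sup>+t\<in>{0..1}. ennreal ((norm (\<sigma> t x - simple_process (n' k) (\<tau>' k) (\<zeta> k) t x))\<^sup>2) \<partial>lborel)"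
    using coefficient_approximation by blast
  have sdX: "simple_data F n \<tau> (\<lambda>i \<omega>. \<kappa> i (X \<omega>))" by (rule simple_data_compose[OF sd X_filtration])
  have sdX': "simple_data F (n' k) (\<tau>' k) (\<lambda>i \<omega>. \<zeta> k i (X \<omega>))" for k by (rule simple_data_compose[OF sd' X_filtration])
  have "\<exists>C\<ge>0. \<forall>x. norm (\<kappa> i x) \<le> C" if i: "i < n" for i
    using simple_data_bound[OF sd i] by (metis UNIV_I space_path_filtration)
  then have "\<exists>C. \<forall>i. i < n \<longrightarrow> 0 \<le> C i \<and> (\<forall>x. norm (\<kappa> i x) \<le> C i)"
    by (intro choice) blast
  then obtain C where C: "\<And>i. i < n \<Longrightarrow> 0 \<le> C i" "\<And>i x. i < n \<Longrightarrow> norm (\<kappa> i x) \<le> C i" by blast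
  \<comment> \<open>Bounds the simple process and, up to the factor 2, the step integral against any
    path of norm at most 1. It depends on \<kappa> alone, hence does not grow with
    \<open>k\<close>.\<close>
  define K where "K = (\<Sum>i<n. C i)"
  have K: "0 \<le> K" unfolding K_def using C(1) by (intro sum_nonneg) auto
  have \<kappa>_bound: "norm (simple_process n \<tau> \<kappa> t x) \<le> K" for t x
    unfolding simple_process_def K_def using C by (intro sum_norm_le) (auto split: split_indicator)
  have int_bound: "norm (step_integral n \<tau> (\<lambda>i. \<kappa> i x) v t) \<le> 2 * K * s"
    if v: "\<And>t. t \<in> {0..1} \<Longrightarrow> norm (v t) \<le> s" and t: "t \<in> {0..1}" for x v s t
  proof -
    have "norm (step_integral n \<tau> (\<lambda>i. \<kappa> i x) v t) \<le> (\<Sum>i<n. C i * (2 * s))"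
      unfolding step_integral_def
    proof (rule sum_norm_le)
      fix i assume "i \<in> {..<n}"
      then have i: "i < n" by simp
      have "norm (v (min (\<tau> (Suc i)) t) - v (min (\<tau> i) t)) \<le> norm (v (min (\<tau> (Suc i)) t)) + norm (v (min (\<tau> i) t))"
        by (rule norm_triangle_ineq4)
      also have "\<dots> \<le> s + s"
        using simple_dataD(4,5)[OF sd i] t by (intro add_mono v) auto
      finally have "norm (v (min (\<tau> (Suc i)) t) - v (min (\<tau> i) t)) \<le> 2 * s" by simp
      then have "norm (\<kappa> i x) * norm (v (min (\<tau> (Suc i)) t) - v (min (\<tau> i) t)) \<le> C i * (2 * s)"
        using C[OF i] by (intro mult_mono) auto
      then show "norm (\<kappa> i x *v (v (min (\<tau> (Suc i)) t) - v (min (\<tau> i) t))) \<le> C i * (2 * s)"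
        using norm_matrix_vector_mult_le order_trans by blast
    qed
    also have "\<dots> = 2 * K * s" by (simp add: K_def sum_distrib_right[symmetric] sum_distrib_left[symmetric] ac_simps)
    finally show ?thesis .
  qed
  \<comment> \<open>This threshold and the next are scaled so that, after amplification by \<kappa>,
    the errors stay within \<epsilon>/2 for the integrals and \<delta>/4 for the energies; the added
    1 avoids division by zero.\<close>
  define \<epsilon>' where "\<epsilon>' = \<epsilon> / (4 * (K + 1))"
  have \<epsilon>': "0 < \<epsilon>'" using \<epsilon> K by (simp add: \<epsilon>'_def)
  have K\<epsilon>': "2 * K * \<epsilon>' \<le> \<epsilon> / 2" using \<epsilon> K by (simp add: \<epsilon>'_def field_simps)
  define \<delta>' where "\<delta>' = \<delta> / 4 / (K\<^sup>2 + 1)"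
  have \<delta>': "0 < \<delta>'" using \<delta> by (simp add: \<delta>'_def add_nonneg_pos)
  have K\<delta>': "K\<^sup>2 * \<delta>' \<le> \<delta> / 4"
  proof -
    have "K\<^sup>2 * \<delta>' \<le> (K\<^sup>2 + 1) * \<delta>'" using \<delta>' by (intro mult_right_mono) auto
    also have "(K\<^sup>2 + 1) * \<delta>' = \<delta> / 4"
    proof -
      have "K\<^sup>2 + 1 \<noteq> 0" by (simp add: add_nonneg_eq_0_iff)
      moreover have "x * (y / x) = y" if "x \<noteq> 0" for x y :: real using that by simp
      ultimately show ?thesis unfolding \<delta>'_def by blast
    qed
    finally show ?thesis .
  qed
  define Q where "Q x = (\<integral>\<^sup>+t\<in>{0..1}. ennreal ((norm (simple_process n \<tau> \<kappa> t x ** \<sigma> t x - mat 1))\<^sup>2) \<partial>lborel)" for x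
  have pred_Q: "predictable path_filtration (\<lambda>t x. simple_process n \<tau> \<kappa> t x ** \<sigma> t x - mat 1)"
    by (intro predictable_diff predictable_mult predictable_simple[OF sd] pred_\<sigma> predictable_const)
  have Q_meas [measurable]: "Q \<in> borel_measurable borel"
    unfolding Q_def[abs_def] by (rule energy_measurable[OF pred_Q])
  let ?Q = "{\<omega>\<in>space M. ennreal (\<delta> / 4) < Q (X \<omega>)}"
  have Q_sets: "?Q \<in> events" by measurable
  have Q_prob: "prob ?Q \<le> e / (\<delta> / 4)"
  proof -
    have "(\<integral>\<^sup>+\<omega>. Q (X \<omega>) \<partial>M) = (\<integral>\<^sup>+x. Q x \<partial>\<eta>)"
      unfolding law_X[symmetric] by (rule nn_integral_distr[symmetric]) measurable
    then have lt: "(\<integral>\<^sup>+\<omega>. Q (X \<omega>) \<partial>M) < ennreal e" using en by (simp add: Q_def)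
    have "(\<integral>\<^sup>+\<omega>. Q (X \<omega>) \<partial>M) < \<infinity>" using lt by (rule less_trans) simp
    then have "prob ?Q \<le> enn2real (\<integral>\<^sup>+\<omega>. Q (X \<omega>) \<partial>M) / (\<delta> / 4)"
      using \<delta> by (intro measure_gt_le_nn_integral) (auto simp: prob_space_axioms)
    also have "\<dots> \<le> e / (\<delta> / 4)"
    proof (rule divide_right_mono)
      have "enn2real (\<integral>\<^sup>+\<omega>. Q (X \<omega>) \<partial>M) \<le> enn2real (ennreal e)"
        using lt by (intro enn2real_mono) auto
      then show "enn2real (\<integral>\<^sup>+\<omega>. Q (X \<omega>) \<partial>M) \<le> e" using e by simp
    qed (use \<delta> in simp)
    finally show ?thesis .
  qed
  have ZX: "null_in_probability M (\<lambda>k \<omega>. \<integral>\<^sup>+t\<in>{0..1}. ennreal ((norm (\<sigma> t (X \<omega>) - simple_process (n' k) (\<tau>' k) (\<zeta> k) t (X \<omega>)))\<^sup>2) \<partial>lborel)"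
    by (rule null_in_probability_compose[OF Z[folded law_X]]) measurable
  define z where "z k = prob {\<omega>\<in>space M. ennreal \<delta>' < (\<integral>\<^sup>+t\<in>{0..1}. ennreal ((norm (\<sigma> t (X \<omega>) - simple_process (n' k) (\<tau>' k) (\<zeta> k) t (X \<omega>)))\<^sup>2) \<partial>lborel)}" for k
  define a where "a k = prob {\<omega>\<in>space M. ennreal \<epsilon>' < ito_error (n' k) (\<tau>' k) (\<zeta> k) (X \<omega>, B \<omega>)}" for k
  have lims: "z \<longlonglongrightarrow> 0" "a \<longlonglongrightarrow> 0"
    using ZX ito_errors_null[OF sd' Z] \<epsilon>' \<delta>' unfolding null_in_probability_def z_def[abs_def] a_def[abs_def] by auto
  have B0: "AE \<omega> in M. path_at (B \<omega>) 0 = 0" using brownian by (simp add: brownian_motion_def)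
  have le: "prob ?E \<le> a k + (real CARD('d) * \<delta> / (\<epsilon> / 2)\<^sup>2 + (z k + e / (\<delta> / 4)))" for k
  proof -
    let ?T = "\<lambda>\<omega> t. simple_integral_process B (n' k) (\<tau>' k) (\<lambda>i \<omega>. \<zeta> k i (X \<omega>)) t \<omega>"
    let ?A = "{\<omega>\<in>space M. ennreal \<epsilon>' < ito_error (n' k) (\<tau>' k) (\<zeta> k) (X \<omega>, B \<omega>)}"
    let ?C = "{\<omega>\<in>space M. \<exists>t\<in>{0..1}. \<epsilon> / 2 < norm (step_integral n \<tau> (\<lambda>i. \<kappa> i (X \<omega>)) (?T \<omega>) t - (path_at (B \<omega>) t - path_at (B \<omega>) 0))}"
    let ?Z = "{\<omega>\<in>space M. ennreal \<delta>' < (\<integral>\<^sup>+t\<in>{0..1}. ennreal ((norm (\<sigma> t (X \<omega>) - simple_process (n' k) (\<tau>' k) (\<zeta> k) t (X \<omega>)))\<^sup>2) \<partial>lborel)}"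
    have A_sets: "?A \<in> events"
    proof -
      note [measurable] = ito_error_measurable[OF sd']
      show ?thesis by measurable
    qed
    have Z_sets: "?Z \<in> events"
    proof -
      have [measurable]: "(\<lambda>\<omega>. \<integral>\<^sup>+t\<in>{0..1}. ennreal ((norm (\<sigma> t (X \<omega>) - simple_process (n' k) (\<tau>' k) (\<zeta> k) t (X \<omega>)))\<^sup>2) \<partial>lborel) \<in> borel_measurable M"
        using ZX by (simp add: null_in_probability_def)
      show ?thesis by measurable
    qed
    have C_sets: "?C \<in> events"
    proof (rule exceedance_sets)
      fix t :: real assume t: "t \<in> {0..1}"
      have "(\<lambda>\<omega>. step_integral n \<tau> (\<lambda>i. \<kappa> i (X \<omega>)) (?T \<omega>) t) \<in> borel_measurable (F t)"
        by (rule step_integral_measurable[OF F_incr sdX _ t]) (rule simple_integral_measurable[OF sdX'])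
      then show "(\<lambda>\<omega>. step_integral n \<tau> (\<lambda>i. \<kappa> i (X \<omega>)) (?T \<omega>) t - (path_at (B \<omega>) t - path_at (B \<omega>) 0)) \<in> borel_measurable M"
        using t by (intro borel_measurable_diff B_measurable F_to_M[OF t]) auto
    next
      show "continuous_on {0..1} (\<lambda>t. step_integral n \<tau> (\<lambda>i. \<kappa> i (X \<omega>)) (?T \<omega>) t - (path_at (B \<omega>) t - path_at (B \<omega>) 0))" for \<omega>
        using simple_dataD(4,5)[OF sd]
        by (intro continuous_on_diff continuous_on_const continuous_on_path_at continuous_on_step_integral
            continuous_on_simple_integral[OF sdX']) auto
    qed (use \<epsilon> in simp)
    have "prob ?E \<le> prob (?A \<union> ?C)"
    proof (rule finite_measure_mono_AE)
      show "AE \<omega> in M. \<omega> \<in> ?E \<longrightarrow> \<omega> \<in> ?A \<union> ?C"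
        using B0
      proof (eventually_elim, intro impI)
        fix \<omega> assume B0: "path_at (B \<omega>) 0 = 0" and "\<omega> \<in> ?E"
        then obtain t where w: "\<omega> \<in> space M" and t: "t \<in> {0..1}"
          and gt: "\<epsilon> < norm (step_integral n \<tau> (\<lambda>i. \<kappa> i (X \<omega>)) (path_at (noise_path b (X \<omega>))) t - path_at (B \<omega>) t)"
          by blast
        let ?u = "path_at (noise_path b (X \<omega>))"
        show "\<omega> \<in> ?A \<union> ?C"
        proof (cases "\<omega> \<in> ?A")
          case False
          have "norm (?u s - ?T \<omega> s) \<le> \<epsilon>'" if "s \<in> {0..1}" for s
          proof (rule ccontr)
            assume "\<not> ?thesis"
            then have "\<exists>s\<in>{0..1}. \<epsilon>' < norm (?u s - ?T \<omega> s)" using that not_le by blast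
            then have "ennreal \<epsilon>' < (SUP s\<in>{0..1}. ennreal (norm (?u s - ?T \<omega> s)))"
              using \<epsilon>' by (subst less_SUP_norm_iff) auto
            then show False using False w by (simp add: ito_error_def simple_integral_process_eq_step_integral)
          qed
          then have "norm (step_integral n \<tau> (\<lambda>i. \<kappa> i (X \<omega>)) (\<lambda>s. ?u s - ?T \<omega> s) t) \<le> 2 * K * \<epsilon>'"
            using t by (rule int_bound)
          then have *: "norm (step_integral n \<tau> (\<lambda>i. \<kappa> i (X \<omega>)) ?u t - step_integral n \<tau> (\<lambda>i. \<kappa> i (X \<omega>)) (?T \<omega>) t) \<le> \<epsilon> / 2"
            using K\<epsilon>' by (simp add: step_integral_diff_right)
          have "\<epsilon> / 2 < norm (step_integral n \<tau> (\<lambda>i. \<kappa> i (X \<omega>)) (?T \<omega>) t - path_at (B \<omega>) t)"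
            using gt * norm_triangle_ineq[of "step_integral n \<tau> (\<lambda>i. \<kappa> i (X \<omega>)) ?u t - step_integral n \<tau> (\<lambda>i. \<kappa> i (X \<omega>)) (?T \<omega>) t"
              "step_integral n \<tau> (\<lambda>i. \<kappa> i (X \<omega>)) (?T \<omega>) t - path_at (B \<omega>) t"] by simp
          then have "\<omega> \<in> ?C" using w t B0 by auto
          then show ?thesis by simp
        qed simp
      qed
    qed (use A_sets C_sets in auto)
    also have "\<dots> \<le> prob ?A + prob ?C" by (rule measure_Un_le[OF A_sets C_sets])
    also have "prob ?C \<le> real CARD('d) * \<delta> / (\<epsilon> / 2)\<^sup>2 + prob {\<omega>\<in>space M. ennreal \<delta> < (\<integral>\<^sup>+t\<in>{0..1}.
        ennreal ((norm (simple_process n \<tau> (\<lambda>i \<omega>. \<kappa> i (X \<omega>)) t \<omega> ** simple_process (n' k) (\<tau>' k) (\<lambda>i \<omega>. \<zeta> k i (X \<omega>)) t \<omega> - mat 1))\<^sup>2) \<partial>lborel)}"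
      using \<epsilon> \<delta> by (intro simple_integral_inverse_close[OF sdX sdX']) auto
    also have "prob {\<omega>\<in>space M. ennreal \<delta> < (\<integral>\<^sup>+t\<in>{0..1}.
        ennreal ((norm (simple_process n \<tau> (\<lambda>i \<omega>. \<kappa> i (X \<omega>)) t \<omega> ** simple_process (n' k) (\<tau>' k) (\<lambda>i \<omega>. \<zeta> k i (X \<omega>)) t \<omega> - mat 1))\<^sup>2) \<partial>lborel)} \<le> prob (?Z \<union> ?Q)"
    proof (rule finite_measure_mono)
      show "{\<omega>\<in>space M. ennreal \<delta> < (\<integral>\<^sup>+t\<in>{0..1}.
        ennreal ((norm (simple_process n \<tau> (\<lambda>i \<omega>. \<kappa> i (X \<omega>)) t \<omega> ** simple_process (n' k) (\<tau>' k) (\<lambda>i \<omega>. \<zeta> k i (X \<omega>)) t \<omega> - mat 1))\<^sup>2) \<partial>lborel)} \<subseteq> ?Z \<union> ?Q"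
      proof (rule subsetI, elim CollectE conjE)
        fix \<omega> assume w: "\<omega> \<in> space M"
          and lt: "ennreal \<delta> < (\<integral>\<^sup>+t\<in>{0..1}.
        ennreal ((norm (simple_process n \<tau> (\<lambda>i \<omega>. \<kappa> i (X \<omega>)) t \<omega> ** simple_process (n' k) (\<tau>' k) (\<lambda>i \<omega>. \<zeta> k i (X \<omega>)) t \<omega> - mat 1))\<^sup>2) \<partial>lborel)"
        let ?x = "X \<omega>"
        let ?k = "\<lambda>t. simple_process n \<tau> \<kappa> t ?x" and ?h = "\<lambda>t. simple_process (n' k) (\<tau>' k) (\<zeta> k) t ?x"
        let ?f = "\<lambda>t. ?k t ** (?h t - \<sigma> t ?x)" and ?g = "\<lambda>t. ?k t ** \<sigma> t ?x - mat 1"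
        note [measurable] = section_measurable[OF pred_\<sigma>, of ?x] section_measurable[OF predictable_simple[OF sd'[of k]], of ?x]
          section_measurable[OF predictable_simple[OF sd], of ?x]
        have "simple_process n \<tau> (\<lambda>i \<omega>. \<kappa> i (X \<omega>)) t \<omega> ** simple_process (n' k) (\<tau>' k) (\<lambda>i \<omega>. \<zeta> k i (X \<omega>)) t \<omega> - mat 1 = ?f t + ?g t" for t
          by (simp add: simple_process_def bounded_bilinear.diff_right[OF bounded_bilinear_matrix_matrix_mult])
        then have 1: "ennreal \<delta> < (\<integral>\<^sup>+t\<in>{0..1}. ennreal ((norm (?f t + ?g t))\<^sup>2) \<partial>lborel)" using lt by (simp only:)
        have 2: "(\<integral>\<^sup>+t\<in>{0..1}. ennreal ((norm (?f t + ?g t))\<^sup>2) \<partial>lborel) \<le>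
            2 * (\<integral>\<^sup>+t\<in>{0..1}. ennreal ((norm (?f t))\<^sup>2) \<partial>lborel) + 2 * (\<integral>\<^sup>+t\<in>{0..1}. ennreal ((norm (?g t))\<^sup>2) \<partial>lborel)"
          by (intro set_nn_integral_norm_sq_triangle) measurable
        have 3: "(\<integral>\<^sup>+t\<in>{0..1}. ennreal ((norm (?f t))\<^sup>2) \<partial>lborel)
            \<le> ennreal (K\<^sup>2) * (\<integral>\<^sup>+t\<in>{0..1}. ennreal ((norm (\<sigma> t ?x - ?h t))\<^sup>2) \<partial>lborel)"
        proof -
          have "(norm (?f t))\<^sup>2 \<le> K\<^sup>2 * (norm (\<sigma> t ?x - ?h t))\<^sup>2" for t
          proof -
            have "norm (?f t) \<le> norm (?k t) * norm (?h t - \<sigma> t ?x)" by (rule norm_matrix_matrix_mult_le)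
            also have "\<dots> \<le> K * norm (\<sigma> t ?x - ?h t)"
              using \<kappa>_bound by (subst norm_minus_commute) (intro mult_right_mono, auto)
            finally have "(norm (?f t))\<^sup>2 \<le> (K * norm (\<sigma> t ?x - ?h t))\<^sup>2" by (intro power_mono) auto
            then show ?thesis by (simp add: power_mult_distrib)
          qed
          then have "(\<integral>\<^sup>+t. ennreal ((norm (?f t))\<^sup>2) \<partial>unit_lborel) \<le> (\<integral>\<^sup>+t. ennreal (K\<^sup>2) * ennreal ((norm (\<sigma> t ?x - ?h t))\<^sup>2) \<partial>unit_lborel)"
            by (intro nn_integral_mono) (simp add: ennreal_leI flip: ennreal_mult)
          also have "\<dots> = ennreal (K\<^sup>2) * (\<integral>\<^sup>+t. ennreal ((norm (\<sigma> t ?x - ?h t))\<^sup>2) \<partial>unit_lborel)"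
            by (rule nn_integral_cmult) measurable
          finally show ?thesis unfolding set_nn_integral_unit .
        qed
        from less_split_half[OF 1 2 less_imp_le[OF \<delta>]] show "\<omega> \<in> ?Z \<union> ?Q"
        proof
          assume "ennreal (\<delta> / 4) < (\<integral>\<^sup>+t\<in>{0..1}. ennreal ((norm (?f t))\<^sup>2) \<partial>lborel)"
          also note 3
          finally have gt: "ennreal (\<delta> / 4) < ennreal (K\<^sup>2) * (\<integral>\<^sup>+t\<in>{0..1}. ennreal ((norm (\<sigma> t ?x - ?h t))\<^sup>2) \<partial>lborel)" .
          have "ennreal \<delta>' < (\<integral>\<^sup>+t\<in>{0..1}. ennreal ((norm (\<sigma> t ?x - ?h t))\<^sup>2) \<partial>lborel)"
          proof (rule ccontr)
            assume "\<not> ?thesis"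
            then have "ennreal (K\<^sup>2) * (\<integral>\<^sup>+t\<in>{0..1}. ennreal ((norm (\<sigma> t ?x - ?h t))\<^sup>2) \<partial>lborel) \<le> ennreal (K\<^sup>2) * ennreal \<delta>'"
              by (intro mult_left_mono) auto
            also have "\<dots> \<le> ennreal (\<delta> / 4)"
              using K\<delta>' \<delta>' by (simp add: ennreal_leI flip: ennreal_mult)
            finally show False using gt by simp
          qed
          then show ?thesis using w by simp
        next
          assume "ennreal (\<delta> / 4) < (\<integral>\<^sup>+t\<in>{0..1}. ennreal ((norm (?g t))\<^sup>2) \<partial>lborel)"
          then show ?thesis using w by (simp add: Q_def)
        qed
      qed
    qed (use Z_sets Q_sets in auto)
    also have "prob (?Z \<union> ?Q) \<le> prob ?Z + prob ?Q" by (rule measure_Un_le[OF Z_sets Q_sets])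
    also have "prob ?Q \<le> e / (\<delta> / 4)" by (rule Q_prob)
    finally show ?thesis unfolding a_def z_def by simp
  qed
  have "(\<lambda>k. a k + (real CARD('d) * \<delta> / (\<epsilon> / 2)\<^sup>2 + (z k + e / (\<delta> / 4))))
      \<longlonglongrightarrow> 0 + (real CARD('d) * \<delta> / (\<epsilon> / 2)\<^sup>2 + (0 + e / (\<delta> / 4)))"
    by (intro tendsto_add tendsto_const lims)
  from LIMSEQ_le_const[OF this, of "prob ?E"] le
  have "prob ?E \<le> 0 + (real CARD('d) * \<delta> / (\<epsilon> / 2)\<^sup>2 + (0 + e / (\<delta> / 4)))" by blast
  then show ?thesis by simp
qed

text \<open>The integrals of approximate inverses against the noise path tend to \<open>B\<close>
  fast enough for the Borel-Cantelli lemma, hence uniformly in time almost surely. The limit is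
  formed path by path on the path space, without reference to the sample space.\<close>

theorem driving_functional:
  assumes det: "AE x in \<eta>. \<forall>t\<in>{0..1}. det (\<sigma> t x) \<noteq> 0"
  shows "\<exists>\<Psi> \<in> borel \<rightarrow>\<^sub>M borel. (AE \<omega> in M. B \<omega> = \<Psi> (X \<omega>)) \<and>
    (\<forall>t\<in>{0..1}. (\<lambda>x. path_at (\<Psi> x) t) \<in> borel_measurable (completed_field \<eta> (path_filtration t)))"
proof -
  define \<epsilon> :: "nat \<Rightarrow> real" where "\<epsilon> j = (1 / 2) ^ j" for j
  have \<epsilon>: "0 < \<epsilon> j" for j by (simp add: \<epsilon>_def)
  \<comment> \<open>Chosen backwards from the bound: the cubic power makes the maximal inequality
    contribute half of \<open>\<epsilon> j\<close>, and \<open>e j\<close> makes the Markov term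
    contribute the other half. The exceedance probabilities are then dominated by a geometric
    series.\<close>
  define \<delta> where "\<delta> j = \<epsilon> j ^ 3 / (8 * real CARD('d))" for j
  have \<delta>: "0 < \<delta> j" for j using \<epsilon> by (simp add: \<delta>_def)
  define e where "e j = \<delta> j * \<epsilon> j / 8" for j
  have e: "0 < e j" for j using \<epsilon> \<delta> by (simp add: e_def)
  have bound: "real CARD('d) * \<delta> j / (\<epsilon> j / 2)\<^sup>2 + e j / (\<delta> j / 4) = \<epsilon> j" for j
  proof -
    have "real CARD('d) * \<delta> j / (\<epsilon> j / 2)\<^sup>2 = \<epsilon> j / 2"
      using \<epsilon>[of j] by (simp add: \<delta>_def power2_eq_square power3_eq_cube)
    moreover have "e j / (\<delta> j / 4) = \<epsilon> j / 2" using \<delta>[of j] by (simp add: e_def)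
    ultimately show ?thesis by linarith
  qed
  have "\<exists>q. simple_data path_filtration (fst q) (fst (snd q)) (snd (snd q)) \<and>
    total_energy (\<lambda>t x. simple_process (fst q) (fst (snd q)) (snd (snd q)) t x ** \<sigma> t x - mat 1) < ennreal (e j)" for j
    using inverse_approximation[OF det e] unfolding split_paired_Ex fst_conv snd_conv .
  then have "\<exists>q. \<forall>j. simple_data path_filtration (fst (q j)) (fst (snd (q j))) (snd (snd (q j))) \<and>
    total_energy (\<lambda>t x. simple_process (fst (q j)) (fst (snd (q j))) (snd (snd (q j))) t x ** \<sigma> t x - mat 1) < ennreal (e j)"
    by (intro choice allI)
  then obtain q where q: "\<And>j. simple_data path_filtration (fst (q j)) (fst (snd (q j))) (snd (snd (q j)))"
    "\<And>j. total_energy (\<lambda>t x. simple_process (fst (q j)) (fst (snd (q j))) (snd (snd (q j))) t x ** \<sigma> t x - mat 1) < ennreal (e j)"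
    by blast
  define n where "n j = fst (q j)" for j
  define \<tau> where "\<tau> j = fst (snd (q j))" for j
  define \<kappa> where "\<kappa> j = snd (snd (q j))" for j
  have sd: "simple_data path_filtration (n j) (\<tau> j) (\<kappa> j)"
    and en: "total_energy (\<lambda>t x. simple_process (n j) (\<tau> j) (\<kappa> j) t x ** \<sigma> t x - mat 1) < ennreal (e j)" for j
    unfolding n_def \<tau>_def \<kappa>_def by (fact q)+
  define r where "r j x = step_integral (n j) (\<tau> j) (\<lambda>i. \<kappa> j i x) (path_at (noise_path b x))" for j x
  define R where "R j x = mk_path (r j x)" for j x
  have r_cont: "continuous_on {0..1} (r j x)" for j x
    unfolding r_def using simple_dataD(4,5)[OF sd] by (intro continuous_on_step_integral continuous_on_path_at) auto
  have R_at: "path_at (R j x) t = r j x t" if "t \<in> {0..1}" for j x t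
    unfolding R_def by (rule path_at_mk_path[OF r_cont that])
  have R_meas [measurable]: "R j \<in> borel \<rightarrow>\<^sub>M borel" for j
  proof (rule borel_measurable_wpathI)
    fix s :: real assume s: "s \<in> {0..1}"
    have "(\<lambda>x. r j x s) \<in> borel_measurable borel"
      unfolding r_def
    proof (rule step_integral_measurable[where F = "\<lambda>_. borel"])
      show "increasing_fields (\<lambda>_. borel)" by (simp add: increasing_fields_def subalgebra_def)
      show "simple_data (\<lambda>_. borel) (n j) (\<tau> j) (\<kappa> j)"
        by (rule simple_data_fields[OF sd]) (simp add: subalgebra_path_filtration)
      show "(\<lambda>x. path_at (noise_path b x) s) \<in> borel_measurable borel" if "s \<in> {0..1}" for s
        by (rule measurable_compose[OF noise_path_measurable[OF pred_b] measurable_path_at_borel[OF that]])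
    qed (rule s)
    then show "(\<lambda>x. path_at (R j x) s) \<in> borel_measurable borel" by (simp add: R_at[OF s])
  qed
  have sub: "subalgebra \<eta> (path_filtration t)" for t by (rule subalgebra_path_filtration[OF sets_\<eta>])
  have R_adapted: "(\<lambda>x. path_at (R j x) t) \<in> borel_measurable (completed_field \<eta> (path_filtration t))" if t: "t \<in> {0..1}" for j t
  proof -
    have "(\<lambda>x. r j x t) \<in> borel_measurable (completed_field \<eta> (path_filtration t))"
      unfolding r_def
    proof (rule step_integral_measurable[where F = "\<lambda>t. completed_field \<eta> (path_filtration t)"])
      show "increasing_fields (\<lambda>t. completed_field \<eta> (path_filtration t))"
        unfolding increasing_fields_def subalgebra_def
        by (intro ballI impI conjI completed_field_mono sub path_filtration_mono) auto
      show "simple_data (\<lambda>t. completed_field \<eta> (path_filtration t)) (n j) (\<tau> j) (\<kappa> j)"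
        by (rule simple_data_fields[OF sd]) (use le_completed_field(1)[OF sub] in \<open>simp add: subalgebra_def\<close>)
      show "(\<lambda>x. path_at (noise_path b x) s) \<in> borel_measurable (completed_field \<eta> (path_filtration s))" if "s \<in> {0..1}" for s
        by (rule noise_path_adapted[OF pred_b sets_\<eta> finite_drift_AE that])
    qed (rule t)
    then show ?thesis by (simp add: R_at[OF t])
  qed
  define A where "A j = {\<omega>\<in>space M. \<exists>t\<in>{0..1}. \<epsilon> j < norm (r j (X \<omega>) t - path_at (B \<omega>) t)}" for j
  have A_sets: "A j \<in> events" for j
    unfolding A_def
  proof (rule exceedance_sets)
    show "(\<lambda>\<omega>. r j (X \<omega>) t - path_at (B \<omega>) t) \<in> borel_measurable M" if t: "t \<in> {0..1}" for t
    proof -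
      have "(\<lambda>\<omega>. path_at (R j (X \<omega>)) t) \<in> borel_measurable M"
        by (rule measurable_compose[OF _ measurable_path_at_borel[OF t]]) measurable
      then show ?thesis using B_measurable[OF t] by (simp add: R_at[OF t])
    qed
    show "continuous_on {0..1} (\<lambda>t. r j (X \<omega>) t - path_at (B \<omega>) t)" for \<omega>
      by (intro continuous_on_diff r_cont continuous_on_path_at)
  qed (use \<epsilon> in \<open>simp add: less_imp_le\<close>)
  have A_prob: "prob (A j) \<le> \<epsilon> j" for j
    using inverse_integral_close[OF sd[of j] en[of j] \<epsilon>[of j] \<delta>[of j] e[of j]] unfolding A_def r_def bound .
  have "summable (\<lambda>j. prob (A j))"
  proof (rule summable_comparison_test')
    show "summable \<epsilon>" unfolding \<epsilon>_def[abs_def] by (rule summable_geometric) simp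
    show "norm (prob (A j)) \<le> \<epsilon> j" for j using A_prob[of j] by simp
  qed
  then have "AE \<omega> in M. eventually (\<lambda>j. \<omega> \<in> space M - A j) sequentially"
    by (intro borel_cantelli_AE1 A_sets) (auto simp: less_top[symmetric])
  then have conv: "AE \<omega> in M. (\<lambda>j. R j (X \<omega>)) \<longlonglongrightarrow> B \<omega>"
  proof eventually_elim
    case (elim \<omega>)
    have \<epsilon>_lim: "\<epsilon> \<longlonglongrightarrow> 0" unfolding \<epsilon>_def[abs_def] by (intro LIMSEQ_realpow_zero) auto
    have "eventually (\<lambda>j. dist (R j (X \<omega>)) (B \<omega>) \<le> \<epsilon> j) sequentially"
      using elim
    proof eventually_elim
      case (elim j)
      then have "\<forall>t\<in>{0..1}. norm (r j (X \<omega>) t - path_at (B \<omega>) t) \<le> \<epsilon> j" by (auto simp: A_def not_less)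
      then show ?case by (intro dist_wpath_le) (simp add: R_at dist_norm)
    qed
    from tendsto_sandwich[OF always_eventually[OF allI[OF zero_le_dist]] this tendsto_const \<epsilon>_lim]
    show ?case by (rule iffD2[OF tendsto_dist_iff])
  qed
  define G where "G = {x. Cauchy (\<lambda>j. R j x)}"
  have G [measurable]: "G \<in> sets borel"
    using sets_Collect_Cauchy[of R borel] by (simp add: G_def)
  \<comment> \<open>Off \<open>G\<close> the paths are replaced by the zero path, so the limit
    exists everywhere and is Borel. Membership in \<open>G\<close> depends on the whole path, but
    \<open>G\<close> has full measure and thus belongs to the completed field of every time.\<close>
  define R' where "R' j x = (if x \<in> G then R j x else mk_path (\<lambda>_. 0))" for j x
  define \<Psi> where "\<Psi> x = lim (\<lambda>j. R' j x)" for x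
  have R'_lim: "(\<lambda>j. R' j x) \<longlonglongrightarrow> \<Psi> x" for x
  proof -
    have "convergent (\<lambda>j. R' j x)"
      by (cases "x \<in> G") (auto simp: R'_def G_def Cauchy_convergent convergent_const)
    then show ?thesis unfolding \<Psi>_def by (simp add: convergent_LIMSEQ_iff)
  qed
  have \<Psi>_meas: "\<Psi> \<in> borel \<rightarrow>\<^sub>M borel"
  proof (rule borel_measurable_LIMSEQ_metric)
    show "R' j \<in> borel \<rightarrow>\<^sub>M borel" for j unfolding R'_def[abs_def] by measurable
  qed (rule R'_lim)
  have eq: "AE \<omega> in M. B \<omega> = \<Psi> (X \<omega>)"
    using conv
  proof eventually_elim
    case (elim \<omega>)
    then have "X \<omega> \<in> G" by (auto simp: G_def intro: LIMSEQ_imp_Cauchy)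
    then have "(\<lambda>j. R j (X \<omega>)) \<longlonglongrightarrow> \<Psi> (X \<omega>)" using R'_lim[of "X \<omega>"] by (simp add: R'_def)
    then show ?case using elim LIMSEQ_unique by blast
  qed
  have G_AE: "AE x in \<eta>. x \<in> G"
  proof -
    have "AE \<omega> in M. X \<omega> \<in> G" using conv by eventually_elim (auto simp: G_def intro: LIMSEQ_imp_Cauchy)
    then show ?thesis unfolding law_X[symmetric] by (subst AE_distr_iff) auto
  qed
  have "(\<lambda>x. path_at (\<Psi> x) t) \<in> borel_measurable (completed_field \<eta> (path_filtration t))" if t: "t \<in> {0..1}" for t
  proof (rule borel_measurable_LIMSEQ_metric)
    let ?C = "completed_field \<eta> (path_filtration t)"
    have "- G \<in> null_sets \<eta>"
      using G_AE G by (subst (asm) AE_iff_null) (auto simp: sets_\<eta> Compl_eq_Diff_UNIV Collect_neg_eq)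
    then have "- G \<in> negligible_sets \<eta>" by (auto simp: negligible_sets_def)
    then have "- G \<in> sets ?C" using le_completed_field(2)[OF sub] by blast
    then have "space ?C - (- G) \<in> sets ?C" by (rule sets.compl_sets)
    then have [measurable]: "G \<in> sets ?C" by simp
    note [measurable] = R_adapted[OF t]
    have "path_at (R' j x) t = (if x \<in> G then path_at (R j x) t else path_at (mk_path (\<lambda>_. 0)) t)" for j x
      by (simp add: R'_def)
    then show "(\<lambda>x. path_at (R' j x) t) \<in> borel_measurable ?C" for j by simp
    show "(\<lambda>j. path_at (R' j x) t) \<longlonglongrightarrow> path_at (\<Psi> x) t" for x
    proof -
      have "(\<lambda>j. dist (R' j x) (\<Psi> x)) \<longlonglongrightarrow> 0" by (rule iffD1[OF tendsto_dist_iff R'_lim])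
      from tendsto_sandwich[OF always_eventually[OF allI[OF zero_le_dist]]
          always_eventually[OF allI[OF dist_path_at_le[OF t]]] tendsto_const this]
      show ?thesis by (rule iffD2[OF tendsto_dist_iff])
    qed
  qed
  then show ?thesis using \<Psi>_meas eq by blast
qed

end


section \<open>Continuity sets of a regular filtration\<close>

lemma regular_filtrationD:
  fixes BS :: "real \<Rightarrow> 's::topological_space measure"
  assumes "regular_filtration BS"
  shows "t \<in> {0..1} \<Longrightarrow> space (BS t) = UNIV"
    and "t \<in> {0..1} \<Longrightarrow> sets (BS t) \<subseteq> sets borel"
    and "s \<in> {0..1} \<Longrightarrow> t \<in> {0..1} \<Longrightarrow> s \<le> t \<Longrightarrow> sets (BS s) \<subseteq> sets (BS t)"
proof -
  obtain \<rho> :: "real \<Rightarrow> 's \<Rightarrow> 's" where \<rho>: "\<forall>t\<in>{0..1}. continuous_on UNIV (\<rho> t)"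
      "\<forall>t\<in>{0..1}. space (BS t) = UNIV \<and> sets (BS t) = {\<rho> t -` A | A. A \<in> sets borel}"
      "\<forall>s\<in>{0..1}. \<forall>t\<in>{0..1}. \<rho> s \<circ> \<rho> t = \<rho> (min s t)"
    using assms unfolding regular_filtration_def by (elim exE conjE) (rule that)
  note cont = bspec[OF \<rho>(1)]
  note BS = conjunct1[OF bspec[OF \<rho>(2)]] conjunct2[OF bspec[OF \<rho>(2)]]
  note comp = bspec[OF bspec[OF \<rho>(3)]]
  have pre: "\<rho> t -` A \<in> sets borel" if "t \<in> {0..1}" "A \<in> sets borel" for t A
    using measurable_sets[OF borel_measurable_continuous_onI[OF cont[OF that(1)]] that(2)] by simp
  show "space (BS t) = UNIV" if "t \<in> {0..1}" by (rule BS(1)[OF that])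
  show "sets (BS t) \<subseteq> sets borel" if "t \<in> {0..1}"
    unfolding BS(2)[OF that] using pre[OF that] by blast
  show "sets (BS s) \<subseteq> sets (BS t)" if st: "s \<in> {0..1}" "t \<in> {0..1}" "s \<le> t"
  proof
    fix C assume "C \<in> sets (BS s)"
    then obtain A where A: "A \<in> sets borel" "C = \<rho> s -` A" using BS(2)[OF st(1)] by auto
    \<comment> \<open>For \<open>s \<le> t\<close> the map \<open>\<rho> s\<close> factors through
      \<open>\<rho> t\<close>; this is what makes the fields increase.\<close>
    have "C = (\<rho> s \<circ> \<rho> t) -` A" using comp[OF st(1,2)] st(3) A(2) by (simp add: min_absorb1)
    then have "C = \<rho> t -` (\<rho> s -` A)" by (simp add: vimage_comp)
    then show "C \<in> sets (BS t)" using pre[OF st(1) A(1)] BS(2)[OF st(2)] by blast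
  qed
qed

text \<open>
  A closed set is the intersection of its closed \<open>r\<close>-neighbourhoods, whose boundaries are
  disjoint for different \<open>r\<close>; hence all but countably many of them are continuity sets.
\<close>

lemma continuity_sets_generate:
  fixes BS :: "real \<Rightarrow> 's::metric_space measure"
  assumes reg: "regular_filtration BS" and \<nu>: "\<nu> \<in> borel_probs" and s: "s \<in> {0..1}"
  shows "sets (BS s) = sigma_sets UNIV {C \<in> sets (BS s). measure \<nu> (frontier C) = 0}" (is "_ = sigma_sets UNIV ?K")
proof
  obtain \<rho>' :: "real \<Rightarrow> 's \<Rightarrow> 's" where \<rho>': "\<forall>t\<in>{0..1}. continuous_on UNIV (\<rho>' t)"
      "\<forall>t\<in>{0..1}. space (BS t) = UNIV \<and> sets (BS t) = {\<rho>' t -` A | A. A \<in> sets borel}"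
    using reg unfolding regular_filtration_def by (elim exE conjE) (rule that)
  define \<rho> where "\<rho> = \<rho>' s"
  have cont: "continuous_on UNIV \<rho>" and BS: "space (BS s) = UNIV" "sets (BS s) = {\<rho> -` A | A. A \<in> sets borel}"
    unfolding \<rho>_def using bspec[OF \<rho>'(1) s] bspec[OF \<rho>'(2) s] by simp_all
  interpret \<nu>: prob_space \<nu> using \<nu> by (simp add: borel_probs_def)
  have sets_\<nu> [measurable_cong]: "sets \<nu> = sets borel" using \<nu> by (simp add: borel_probs_def)
  have space_\<nu>: "space \<nu> = UNIV" using sets_eq_imp_space_eq[OF sets_\<nu>] by simp
  have [measurable]: "\<rho> \<in> borel \<rightarrow>\<^sub>M borel" using cont by (rule borel_measurable_continuous_onI)
  show "sigma_sets UNIV ?K \<subseteq> sets (BS s)"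
  proof -
    have "sigma_sets (space (BS s)) ?K \<subseteq> sets (BS s)" by (rule sets.sigma_sets_subset) blast
    then show ?thesis unfolding BS(1) .
  qed
  have closed: "\<rho> -` H \<in> sigma_sets UNIV ?K" if H: "closed H" for H
  proof (cases "H = {}")
    case True
    then show ?thesis by (simp add: sigma_sets.Empty)
  next
    case False
    \<comment> \<open>The neighbourhoods are taken around \<open>H\<close> in the range of \<rho>
      and pulled back. They then belong to the field at \<open>s\<close>, and continuity of
      \<open>f\<close> confines their frontiers to level sets of \<open>f\<close>.\<close>
    define f where "f y = infdist (\<rho> y) H" for y
    have f_cont: "continuous_on UNIV f" unfolding f_def by (intro continuous_intros cont)
    then have f [measurable]: "f \<in> borel \<rightarrow>\<^sub>M borel" by (rule borel_measurable_continuous_onI)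
    interpret D: prob_space "distr \<nu> borel f" by (rule \<nu>.prob_space_distr) measurable
    have cnt: "countable {r. D.prob {r} \<noteq> 0}" by (rule D.countable_support)
    have "\<exists>r. r \<in> {0<..<inverse (real (Suc n))} \<and> D.prob {r} = 0" for n
    proof (rule ccontr)
      assume "\<not> ?thesis"
      then have "{0<..<inverse (real (Suc n))} \<subseteq> {r. D.prob {r} \<noteq> 0}" by blast
      then have "countable {0<..<inverse (real (Suc n))}" using cnt countable_subset by blast
      then show False using uncountable_open_interval[of 0 "inverse (real (Suc n))"] by simp
    qed
    then have "\<exists>r. \<forall>n. r n \<in> {0<..<inverse (real (Suc n))} \<and> D.prob {r n} = 0" by (intro choice allI)
    then obtain r where r: "\<And>n. 0 < r n" "\<And>n. r n < inverse (real (Suc n))" "\<And>n. D.prob {r n} = 0" by auto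
    define C where "C n = {y. f y \<le> r n}" for n
    have C_K: "C n \<in> ?K" for n
    proof
      have "{x. infdist x H \<le> r n} \<in> sets borel"
        by (intro borel_closed closed_Collect_le continuous_intros)
      moreover have "C n = \<rho> -` {x. infdist x H \<le> r n}" by (auto simp: C_def f_def)
      ultimately have "C n \<in> sets (BS s)" using BS(2) by blast
      moreover have "measure \<nu> (frontier (C n)) = 0"
      proof -
        have cl: "closed (C n)" unfolding C_def by (intro closed_Collect_le f_cont continuous_intros)
        have int: "{y. f y < r n} \<subseteq> interior (C n)"
          by (rule interior_maximal) (auto simp: C_def intro!: open_Collect_less f_cont continuous_intros)
        have sub: "frontier (C n) \<subseteq> f -` {r n}"
        proof
          fix y assume "y \<in> frontier (C n)"
          then have "y \<in> C n" "y \<notin> interior (C n)" using cl by (simp_all add: frontier_def)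
          then have "f y \<le> r n" "\<not> f y < r n" using subsetD[OF int, of y] by (auto simp only: C_def mem_Collect_eq)
          then show "y \<in> f -` {r n}" by simp
        qed
        have "measure \<nu> (frontier (C n)) \<le> measure \<nu> (f -` {r n} \<inter> space \<nu>)"
        proof (rule \<nu>.finite_measure_mono)
          show "f -` {r n} \<inter> space \<nu> \<in> \<nu>.events"
            using measurable_sets[OF f, of "{r n}"] by (simp add: sets_\<nu> space_\<nu>)
        qed (use sub in \<open>simp add: space_\<nu>\<close>)
        also have "\<dots> = D.prob {r n}" by (rule measure_distr[symmetric]) auto
        finally show ?thesis using r(3)[of n] measure_nonneg[of \<nu>] by (simp add: order_antisym)
      qed
      ultimately show "C n \<in> sets (BS s) \<and> measure \<nu> (frontier (C n)) = 0" ..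
    qed
    have "\<rho> -` H = (\<Inter>n. C n)"
    proof
      show "\<rho> -` H \<subseteq> (\<Inter>n. C n)" using r(1) by (auto simp: C_def f_def less_imp_le)
      show "(\<Inter>n. C n) \<subseteq> \<rho> -` H"
      proof
        fix y assume y: "y \<in> (\<Inter>n. C n)"
        have "f y \<le> 0"
        proof (rule ccontr)
          assume "\<not> f y \<le> 0"
          then obtain n where "inverse (real (Suc n)) < f y" using reals_Archimedean[of "f y"] by auto
          moreover have "f y \<le> r n" using y by (auto simp: C_def)
          ultimately show False using r(2)[of n] by simp
        qed
        then have "infdist (\<rho> y) H = 0" using infdist_nonneg[of "\<rho> y" H] by (simp add: f_def)
        then show "y \<in> \<rho> -` H" using in_closed_iff_infdist_zero[OF H False] by simp
      qed
    qed
    also have "\<dots> \<in> sigma_sets UNIV ?K"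
      using C_K by (intro sigma_sets_INTER) (auto intro: sigma_sets.Basic)
    finally show ?thesis .
  qed
  \<comment> \<open>Preimages commute with the generation of sigma-fields, so it is enough to treat
    preimages of closed sets.\<close>
  have "{\<rho> -` A \<inter> UNIV | A. A \<in> sigma_sets UNIV (Collect closed)} = sigma_sets UNIV {\<rho> -` A \<inter> UNIV | A. A \<in> Collect closed}"
    by (rule sigma_sets_vimage_commute) simp
  also have "\<dots> \<subseteq> sigma_sets UNIV ?K"
    using closed by (intro sigma_sets_mono) auto
  finally show "sets (BS s) \<subseteq> sigma_sets UNIV ?K"
    unfolding BS(2) by (simp add: borel_eq_closed)
qed


section \<open>Gluing the solution and the second coordinate of a causal plan\<close>

lemma sets_pair_mono:
  assumes "space A = space A'" "space B = space B'" "sets A \<subseteq> sets A'" "sets B \<subseteq> sets B'"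
  shows "sets (A \<Otimes>\<^sub>M B) \<subseteq> sets (A' \<Otimes>\<^sub>M B')"
  unfolding sets_pair_measure assms(1,2) using assms(3,4) by (intro sigma_sets_mono') auto

text \<open>A measure-preserving map pulls null sets back to null sets, so measurability at every
  single time survives the completion and then the right limit.\<close>

lemma measurable_right_limit_completed:
  assumes T: "T \<in> P \<rightarrow>\<^sub>M Q" "distr P Q T = Q"
    and G: "\<And>t. t \<in> {0..1} \<Longrightarrow> subalgebra P (G t)"
    and H: "\<And>t. t \<in> {0..1} \<Longrightarrow> subalgebra Q (H t)"
    and GH: "\<And>t. t \<in> {0..1} \<Longrightarrow> T \<in> G t \<rightarrow>\<^sub>M H t" and s: "s \<in> {0..1}"
  shows "T \<in> right_limit (\<lambda>t. completed_field P (G t)) s \<rightarrow>\<^sub>M right_limit (\<lambda>t. completed_field Q (H t)) s"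
proof (rule measurableI)
  show "T x \<in> space (right_limit (\<lambda>t. completed_field Q (H t)) s)" if "x \<in> space (right_limit (\<lambda>t. completed_field P (G t)) s)" for x
    using measurable_space[OF T(1)] that by simp
  have T_u: "T -` A \<inter> space P \<in> sets (completed_field P (G u))"
    if u: "u \<in> {0..1}" and A: "A \<in> sets (completed_field Q (H u))" for u A
  proof -
    have "T \<in> completed_field P (G u) \<rightarrow>\<^sub>M completed_field Q (H u)"
      unfolding completed_field_def[of Q]
    proof (rule measurable_measure_of)
      show "sets (H u) \<union> negligible_sets Q \<subseteq> Pow (space Q)"
        using sets.space_closed[of "H u"] H[OF u] negligible_sets_subset_Pow[of Q] by (simp add: subalgebra_def)
      show "T \<in> space (completed_field P (G u)) \<rightarrow> space Q" using measurable_space[OF T(1)] by simp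
      fix A assume "A \<in> sets (H u) \<union> negligible_sets Q"
      then show "T -` A \<inter> space (completed_field P (G u)) \<in> sets (completed_field P (G u))"
      proof
        assume "A \<in> sets (H u)"
        from measurable_sets[OF GH[OF u] this] show ?thesis
          using le_completed_field(1)[OF G[OF u]] G[OF u] by (auto simp: subalgebra_def)
      next
        assume "A \<in> negligible_sets Q"
        then obtain Z where Z: "Z \<in> null_sets Q" "A \<subseteq> Z" by (auto simp: negligible_sets_def)
        have "T -` Z \<inter> space P \<in> null_sets P"
          using Z(1) null_sets_vimage[OF T(1)] unfolding T(2) by simp
        moreover have "T -` A \<inter> space P \<subseteq> T -` Z \<inter> space P" using Z(2) by blast
        ultimately have "T -` A \<inter> space P \<in> negligible_sets P"
          unfolding negligible_sets_def by (intro CollectI bexI[of _ "T -` Z \<inter> space P"])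
        then show ?thesis using le_completed_field(2)[OF G[OF u]] by auto
      qed
    qed
    from measurable_sets[OF this A] show ?thesis by simp
  qed
  show "T -` A \<inter> space (right_limit (\<lambda>t. completed_field P (G t)) s) \<in> sets (right_limit (\<lambda>t. completed_field P (G t)) s)"
    if A: "A \<in> sets (right_limit (\<lambda>t. completed_field Q (H t)) s)" for A
  proof -
    have R: "sets (right_limit (\<lambda>t. completed_field P (G t)) s) = (\<Inter>\<epsilon>\<in>{0<..}. sets (completed_field P (G (min (s + \<epsilon>) 1))))"
      by (rule sets_right_limit) simp
    have "A \<in> (\<Inter>\<epsilon>\<in>{0<..}. sets (completed_field Q (H (min (s + \<epsilon>) 1))))"
      using A sets_right_limit[of "\<lambda>t. completed_field Q (H t)" "space Q" s] by simp
    then have "T -` A \<inter> space P \<in> sets (completed_field P (G (min (s + \<epsilon>) 1)))" if "0 < \<epsilon>" for \<epsilon>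
      using s that by (intro T_u) auto
    then show ?thesis unfolding R by simp
  qed
qed

text \<open>One solution and one version of the kernel are fixed, and causality holds for this
  version at all times. Both halves of the theorem are derived from these data.\<close>

locale coupling = solution \<sigma> b \<eta>\<^sub>0 \<eta> M F B X
  for \<sigma> :: "real \<Rightarrow> 'd::finite wpath \<Rightarrow> real ^ 'd ^ 'd" and b \<eta>\<^sub>0 \<eta>
    and M :: "'a measure" and F and B X +
  fixes BS :: "real \<Rightarrow> 's::polish_space measure" and \<nu> :: "'s measure" and \<gamma> :: "('d wpath \<times> 's) measure"
    and \<Theta> :: "'d wpath \<Rightarrow> 's measure"
  assumes regular: "regular_filtration BS" and \<nu>: "\<nu> \<in> borel_probs" and plan: "\<gamma> \<in> plans \<eta> \<nu>"
    and kernel: "kernel_of \<gamma> \<eta> \<Theta>"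
    and causal: "\<And>t C. t \<in> {0..1} \<Longrightarrow> C \<in> sets (BS t) \<Longrightarrow> measure \<nu> (frontier C) = 0 \<Longrightarrow>
      (\<lambda>x. measure (\<Theta> x) C) \<in> borel_measurable (completed_field \<eta> (path_filtration t))"
begin

lemma kernel_prob: "prob_space (\<Theta> x)" and kernel_sets [simp]: "sets (\<Theta> x) = sets borel"
  using kernel by (auto simp: kernel_of_def borel_probs_def)

lemma kernel_space [simp]: "space (\<Theta> x) = UNIV"
  using sets_eq_imp_space_eq[OF kernel_sets] by simp

lemma kernel_emeasure: "emeasure (\<Theta> x) C = ennreal (measure (\<Theta> x) C)"
proof -
  interpret K: prob_space "\<Theta> x" by (rule kernel_prob)
  show ?thesis by (rule K.emeasure_eq_measure)
qed

lemma kernel_measure_measurable: "C \<in> sets borel \<Longrightarrow> (\<lambda>x. measure (\<Theta> x) C) \<in> borel_measurable borel"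
  using kernel by (simp add: kernel_of_def)

lemma kernel_measurable: "\<Theta> \<in> borel \<rightarrow>\<^sub>M subprob_algebra borel"
proof (rule measurable_subprob_algebra)
  show "subprob_space (\<Theta> x)" for x using kernel_prob by (rule prob_space_imp_subprob_space)
  show "(\<lambda>x. emeasure (\<Theta> x) C) \<in> borel_measurable borel" if "C \<in> sets borel" for C
    unfolding kernel_emeasure using kernel_measure_measurable[OF that] by measurable
qed simp

abbreviation triple_borel :: "('d wpath \<times> 's \<times> 'd wpath) measure"
  where "triple_borel \<equiv> borel \<Otimes>\<^sub>M (borel \<Otimes>\<^sub>M borel)"

text \<open>The coordinates \<open>y\<close> and \<open>w\<close> of \<open>(x, y, w)\<close> are conditionally independent given \<open>x\<close>.\<close>

definition glued :: "('d wpath \<times> 's \<times> 'd wpath) measure"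
  where "glued = distr M (borel \<Otimes>\<^sub>M borel) (\<lambda>\<omega>. (X \<omega>, B \<omega>)) \<bind>
    (\<lambda>z. distr (\<Theta> (fst z)) triple_borel (\<lambda>y. (fst z, y, snd z)))"

lemma glued_kernel_measurable:
  "(\<lambda>z. distr (\<Theta> (fst z)) triple_borel (\<lambda>y. (fst z, y, snd z))) \<in> borel \<Otimes>\<^sub>M borel \<rightarrow>\<^sub>M subprob_algebra triple_borel"
proof (rule measurable_distr2)
  show "(\<lambda>(z, y). (fst z, y, snd z)) \<in> (borel \<Otimes>\<^sub>M borel) \<Otimes>\<^sub>M borel \<rightarrow>\<^sub>M triple_borel"
    by measurable
  show "(\<lambda>z :: 'd wpath \<times> 'd wpath. \<Theta> (fst z)) \<in> borel \<Otimes>\<^sub>M borel \<rightarrow>\<^sub>M subprob_algebra borel"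
    by (rule measurable_compose[OF measurable_fst kernel_measurable])
qed

lemma sets_glued [measurable_cong]: "sets glued = sets triple_borel"
  unfolding glued_def by (rule sets_bind[of _ _ triple_borel]) (auto simp: space_pair_measure)

lemma space_glued [simp]: "space glued = UNIV"
  using sets_eq_imp_space_eq[OF sets_glued] by (simp add: space_pair_measure)

text \<open>Given the pair of solution and noise, the middle coordinate is drawn from the kernel at
  the solution, whatever the noise. All computations on the glued space are thereby reduced to
  integrals over the original basis.\<close>

lemma emeasure_glued:
  assumes D: "D \<in> sets (borel \<Otimes>\<^sub>M borel)" and C: "C \<in> sets borel"
  shows "emeasure glued {z. (fst z, snd (snd z)) \<in> D \<and> fst (snd z) \<in> C}
    = (\<integral>\<^sup>+\<omega>. indicator D (X \<omega>, B \<omega>) * emeasure (\<Theta> (X \<omega>)) C \<partial>M)"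
proof -
  let ?T = "{z :: 'd wpath \<times> 's \<times> 'd wpath. (fst z, snd (snd z)) \<in> D \<and> fst (snd z) \<in> C}"
  have "?T = (\<lambda>z. (fst z, snd (snd z))) -` D \<inter> (\<lambda>z. fst (snd z)) -` C \<inter> space triple_borel"
    by (auto simp: space_pair_measure)
  also have "\<dots> = ((\<lambda>z. (fst z, snd (snd z))) -` D \<inter> space triple_borel) \<inter> ((\<lambda>z. fst (snd z)) -` C \<inter> space triple_borel)"
    by auto
  also have "\<dots> \<in> sets triple_borel"
    by (intro sets.Int measurable_sets[OF _ D] measurable_sets[OF _ C]) measurable
  finally have T: "?T \<in> sets triple_borel" .
  have "emeasure glued ?T = (\<integral>\<^sup>+z. emeasure (distr (\<Theta> (fst z)) triple_borel (\<lambda>y. (fst z, y, snd z))) ?T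
      \<partial>distr M (borel \<Otimes>\<^sub>M borel) (\<lambda>\<omega>. (X \<omega>, B \<omega>)))"
    unfolding glued_def
    by (rule emeasure_bind[OF _ _ T]) (use glued_kernel_measurable in \<open>auto simp: space_pair_measure\<close>)
  also have "\<dots> = (\<integral>\<^sup>+z. indicator D z * emeasure (\<Theta> (fst z)) C \<partial>distr M (borel \<Otimes>\<^sub>M borel) (\<lambda>\<omega>. (X \<omega>, B \<omega>)))"
  proof (rule nn_integral_cong)
    fix z :: "'d wpath \<times> 'd wpath"
    have m: "(\<lambda>y. (fst z, y, snd z)) \<in> \<Theta> (fst z) \<rightarrow>\<^sub>M triple_borel"
      by (subst measurable_cong_sets[OF kernel_sets refl]) measurable
    have "emeasure (distr (\<Theta> (fst z)) triple_borel (\<lambda>y. (fst z, y, snd z))) ?T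
        = emeasure (\<Theta> (fst z)) ((\<lambda>y. (fst z, y, snd z)) -` ?T \<inter> UNIV)"
      using emeasure_distr[OF m T] by simp
    also have "(\<lambda>y. (fst z, y, snd z)) -` ?T \<inter> UNIV = (if z \<in> D then C else {})" by auto
    finally show "emeasure (distr (\<Theta> (fst z)) triple_borel (\<lambda>y. (fst z, y, snd z))) ?T = indicator D z * emeasure (\<Theta> (fst z)) C"
      by simp
  qed
  also have "\<dots> = (\<integral>\<^sup>+\<omega>. indicator D (X \<omega>, B \<omega>) * emeasure (\<Theta> (X \<omega>)) C \<partial>M)"
  proof -
    have [measurable]: "(\<lambda>x. emeasure (\<Theta> x) C) \<in> borel_measurable borel"
      unfolding kernel_emeasure using kernel_measure_measurable[OF C] by measurable
    note [measurable] = D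
    have "(\<lambda>z :: 'd wpath \<times> 'd wpath. indicator D z * emeasure (\<Theta> (fst z)) C) \<in> borel_measurable (borel \<Otimes>\<^sub>M borel)"
      by measurable
    then show ?thesis by (subst nn_integral_distr) auto
  qed
  finally show ?thesis .
qed

lemma kernel_UNIV [simp]: "emeasure (\<Theta> x) UNIV = 1"
  using prob_space.emeasure_space_1[OF kernel_prob] by simp

lemma emeasure_glued_pair:
  assumes D: "D \<in> sets (borel \<Otimes>\<^sub>M borel)"
  shows "emeasure glued {z. (fst z, snd (snd z)) \<in> D} = emeasure M {\<omega>\<in>space M. (X \<omega>, B \<omega>) \<in> D}"
proof -
  note [measurable] = D
  have "emeasure glued {z. (fst z, snd (snd z)) \<in> D} = (\<integral>\<^sup>+\<omega>. indicator D (X \<omega>, B \<omega>) \<partial>M)"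
    using emeasure_glued[OF D, of UNIV] by simp
  also have "\<dots> = (\<integral>\<^sup>+\<omega>. indicator {\<omega>\<in>space M. (X \<omega>, B \<omega>) \<in> D} \<omega> \<partial>M)"
    by (intro nn_integral_cong) (auto split: split_indicator)
  also have "\<dots> = emeasure M {\<omega>\<in>space M. (X \<omega>, B \<omega>) \<in> D}"
    by (rule nn_integral_indicator) measurable
  finally show ?thesis .
qed

lemma prob_glued: "prob_space glued"
proof
  have U: "UNIV \<in> sets (borel \<Otimes>\<^sub>M borel :: ('d wpath \<times> 'd wpath) measure)"
    using sets.top[of "borel \<Otimes>\<^sub>M borel :: ('d wpath \<times> 'd wpath) measure"] by (simp add: space_pair_measure)
  show "emeasure glued (space glued) = 1"
    using emeasure_glued_pair[OF U] emeasure_space_1 by simp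
qed

lemma glued_joint:
  "distr glued (borel \<Otimes>\<^sub>M borel) (\<lambda>z. (fst z, snd (snd z))) = distr M (borel \<Otimes>\<^sub>M borel) (\<lambda>\<omega>. (X \<omega>, B \<omega>))"
proof (rule measure_eqI)
  fix D assume "D \<in> sets (distr glued (borel \<Otimes>\<^sub>M borel) (\<lambda>z. (fst z, snd (snd z))))"
  then have D: "D \<in> sets (borel \<Otimes>\<^sub>M borel)" by simp
  have m: "(\<lambda>z. (fst z, snd (snd z))) \<in> glued \<rightarrow>\<^sub>M borel \<Otimes>\<^sub>M borel" by measurable
  have m': "(\<lambda>\<omega>. (X \<omega>, B \<omega>)) \<in> M \<rightarrow>\<^sub>M borel \<Otimes>\<^sub>M borel" by measurable
  have "emeasure (distr glued (borel \<Otimes>\<^sub>M borel) (\<lambda>z. (fst z, snd (snd z)))) D = emeasure glued {z. (fst z, snd (snd z)) \<in> D}"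
    unfolding emeasure_distr[OF m D] by (simp add: vimage_def)
  also have "\<dots> = emeasure (distr M (borel \<Otimes>\<^sub>M borel) (\<lambda>\<omega>. (X \<omega>, B \<omega>))) D"
    unfolding emeasure_glued_pair[OF D] emeasure_distr[OF m' D] by (intro arg_cong[where f = "emeasure M"]) auto
  finally show "emeasure (distr glued (borel \<Otimes>\<^sub>M borel) (\<lambda>z. (fst z, snd (snd z)))) D
      = emeasure (distr M (borel \<Otimes>\<^sub>M borel) (\<lambda>\<omega>. (X \<omega>, B \<omega>))) D" .
qed simp

lemma sets_\<gamma> [measurable_cong]: "sets \<gamma> = sets (borel \<Otimes>\<^sub>M borel)" and prob_\<gamma>: "prob_space \<gamma>"
proof -
  have "\<gamma> \<in> borel_probs" using plan unfolding plans_def by blast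
  then show "sets \<gamma> = sets (borel \<Otimes>\<^sub>M borel)" "prob_space \<gamma>"
    unfolding borel_probs_def borel_prod by blast+
qed

lemma space_\<gamma> [simp]: "space \<gamma> = UNIV"
  using sets_eq_imp_space_eq[OF sets_\<gamma>] by (simp add: space_pair_measure)

text \<open>Forgetting the noise leaves the kernel integrated against the law of \<open>X\<close>,
  which is \<eta>. On rectangles this is the defining identity of the kernel, and rectangles
  determine a probability on the product.\<close>

lemma glued_plan: "distr glued \<gamma> (\<lambda>z. (fst z, fst (snd z))) = \<gamma>"
proof (rule measure_eqI_generator_eq[where E = "{A \<times> C | A C. A \<in> sets borel \<and> C \<in> sets borel}" and \<Omega> = UNIV and A = "\<lambda>_. UNIV"])
  interpret G: prob_space glued by (rule prob_glued)
  interpret \<gamma>: prob_space \<gamma> by (rule prob_\<gamma>)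
  have m: "(\<lambda>z. (fst z, fst (snd z))) \<in> glued \<rightarrow>\<^sub>M \<gamma>" by measurable
  show "Int_stable {A \<times> C | A C. A \<in> sets (borel :: 'd wpath measure) \<and> C \<in> sets (borel :: 's measure)}"
    by (rule Int_stable_pair_measure_generator)
  show "sets (distr glued \<gamma> (\<lambda>z. (fst z, fst (snd z)))) = sigma_sets UNIV {A \<times> C | A C. A \<in> sets borel \<and> C \<in> sets borel}"
    "sets \<gamma> = sigma_sets UNIV {A \<times> C | A C. A \<in> sets borel \<and> C \<in> sets borel}"
    by (simp_all add: sets_\<gamma> sets_pair_measure)
  show "range (\<lambda>_. UNIV) \<subseteq> {A \<times> C | A C. A \<in> sets (borel :: 'd wpath measure) \<and> C \<in> sets (borel :: 's measure)}"
    by (auto intro!: exI[of _ UNIV])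
  fix T :: "('d wpath \<times> 's) set" assume "T \<in> {A \<times> C | A C. A \<in> sets borel \<and> C \<in> sets borel}"
  then obtain A C where T: "T = A \<times> C" and A [measurable]: "A \<in> sets borel" and C [measurable]: "C \<in> sets borel" by auto
  have T_sets: "T \<in> sets \<gamma>" unfolding T sets_\<gamma> by (rule pair_measureI[OF A C])
  have D: "A \<times> UNIV \<in> sets (borel \<Otimes>\<^sub>M borel :: ('d wpath \<times> 'd wpath) measure)" by (rule pair_measureI[OF A]) simp
  note [measurable] = kernel_measure_measurable[OF C]
  have "emeasure (distr glued \<gamma> (\<lambda>z. (fst z, fst (snd z)))) T = emeasure glued ((\<lambda>z. (fst z, fst (snd z))) -` T \<inter> space glued)"
    by (rule emeasure_distr[OF m T_sets])
  also have "(\<lambda>z. (fst z, fst (snd z))) -` T \<inter> space glued = {z. (fst z, snd (snd z)) \<in> A \<times> UNIV \<and> fst (snd z) \<in> C}"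
    unfolding T by auto
  also have "emeasure glued {z. (fst z, snd (snd z)) \<in> A \<times> UNIV \<and> fst (snd z) \<in> C}
      = (\<integral>\<^sup>+\<omega>. indicator A (X \<omega>) * ennreal (measure (\<Theta> (X \<omega>)) C) \<partial>M)"
    unfolding emeasure_glued[OF D C] kernel_emeasure by (simp add: indicator_times)
  also have "\<dots> = (\<integral>\<^sup>+x. indicator A x * ennreal (measure (\<Theta> x) C) \<partial>\<eta>)"
    unfolding law_X[symmetric] by (rule nn_integral_distr[symmetric]) measurable
  also have "\<dots> = (\<integral>\<^sup>+x. ennreal (indicator A x *\<^sub>R measure (\<Theta> x) C) \<partial>\<eta>)"
    by (intro nn_integral_cong) (simp split: split_indicator)
  also have "\<dots> = ennreal (\<integral>x. indicator A x *\<^sub>R measure (\<Theta> x) C \<partial>\<eta>)"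
  proof (rule nn_integral_eq_integral)
    interpret \<eta>: prob_space \<eta> by (rule prob_\<eta>)
    show "integrable \<eta> (\<lambda>x. indicator A x *\<^sub>R measure (\<Theta> x) C)"
      using prob_space.prob_le_1[OF kernel_prob]
      by (intro \<eta>.integrable_const_bound[where B = 1]) (auto split: split_indicator)
  qed simp
  also have "\<dots> = ennreal (measure \<gamma> T)"
    using kernel A C unfolding kernel_of_def T set_lebesgue_integral_def by simp
  finally show "emeasure (distr glued \<gamma> (\<lambda>z. (fst z, fst (snd z)))) T = emeasure \<gamma> T"
    by (simp add: \<gamma>.emeasure_eq_measure)
next
  show "emeasure (distr glued \<gamma> (\<lambda>z. (fst z, fst (snd z)))) UNIV \<noteq> \<infinity>" for i :: nat
  proof -
    have m: "(\<lambda>z. (fst z, fst (snd z))) \<in> glued \<rightarrow>\<^sub>M \<gamma>" by measurable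
    interpret D: prob_space "distr glued \<gamma> (\<lambda>z. (fst z, fst (snd z)))"
      by (rule prob_space.prob_space_distr[OF prob_glued m])
    show ?thesis by simp
  qed
qed auto

text \<open>Deliberately neither completed nor made right-continuous as a product, so that it is
  generated by explicit rectangles. Completion and right limit are applied afterwards.\<close>

definition glued_filtration :: "real \<Rightarrow> ('d wpath \<times> 's \<times> 'd wpath) measure"
  where "glued_filtration t = path_filtration t \<Otimes>\<^sub>M (BS t \<Otimes>\<^sub>M path_filtration t)"

lemma space_BS: "t \<in> {0..1} \<Longrightarrow> space (BS t) = UNIV"
  by (rule regular_filtrationD[OF regular])

lemma space_glued_filtration: "t \<in> {0..1} \<Longrightarrow> space (glued_filtration t) = UNIV"
  by (simp add: glued_filtration_def space_pair_measure space_BS)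

lemma glued_filtration_subalgebra: "t \<in> {0..1} \<Longrightarrow> subalgebra glued (glued_filtration t)"
  unfolding subalgebra_def sets_glued
proof
  assume t: "t \<in> {0..1}"
  show "space (glued_filtration t) = space glued" using space_glued_filtration[OF t] by simp
  show "sets (glued_filtration t) \<subseteq> sets triple_borel"
    unfolding glued_filtration_def
    by (intro sets_pair_mono path_filtration_le_borel regular_filtrationD(2)[OF regular t])
      (simp_all add: space_pair_measure space_BS[OF t])
qed

lemma glued_filtration_mono:
  assumes "s \<in> {0..1}" "t \<in> {0..1}" "s \<le> t"
  shows "sets (glued_filtration s) \<subseteq> sets (glued_filtration t)"
  unfolding glued_filtration_def using assms
  by (intro sets_pair_mono path_filtration_mono regular_filtrationD[OF regular]) (auto simp: space_pair_measure space_BS)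

text \<open>
  The middle factor is a continuity set, so by causality \<open>\<Theta>\<close> contributes to these rectangles only
  a function that is measurable with respect to the past of the original solution.
\<close>

definition rectangles :: "real \<Rightarrow> ('d wpath \<times> 's \<times> 'd wpath) set set"
  where "rectangles s = {A \<times> (C \<times> D) | A C D. A \<in> sets (path_filtration s) \<and>
    C \<in> {C \<in> sets (BS s). measure \<nu> (frontier C) = 0} \<and> D \<in> sets (path_filtration s)}"

text \<open>Continuity sets are stable under intersection, since the frontier of an intersection is
  contained in the union of the frontiers.\<close>

lemma Int_stable_rectangles: "Int_stable (rectangles s)"
proof (rule Int_stableI)
  fix a a' assume "a \<in> rectangles s" "a' \<in> rectangles s"
  then obtain A C D A' C' D' where a: "a = A \<times> (C \<times> D)" "a' = A' \<times> (C' \<times> D')"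
    and AD: "A \<in> sets (path_filtration s)" "D \<in> sets (path_filtration s)" "A' \<in> sets (path_filtration s)" "D' \<in> sets (path_filtration s)"
    and C: "C \<in> sets (BS s)" "measure \<nu> (frontier C) = 0" "C' \<in> sets (BS s)" "measure \<nu> (frontier C') = 0"
    unfolding rectangles_def by blast
  interpret \<nu>: prob_space \<nu> using \<nu> by (simp add: borel_probs_def)
  have f: "frontier S \<in> sets \<nu>" for S
    using \<nu> by (simp add: borel_probs_def borel_closed)
  have "measure \<nu> (frontier (C \<inter> C')) \<le> measure \<nu> (frontier C \<union> frontier C')"
    by (intro \<nu>.finite_measure_mono sets.Un f frontier_Int_subset)
  also have "\<dots> \<le> 0" using measure_Un_le[OF f f, of C C'] C by simp
  finally have "measure \<nu> (frontier (C \<inter> C')) = 0" using measure_nonneg[of \<nu>] by (simp add: order_antisym)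
  moreover have "a \<inter> a' = (A \<inter> A') \<times> ((C \<inter> C') \<times> (D \<inter> D'))" unfolding a by auto
  ultimately show "a \<inter> a' \<in> rectangles s"
    unfolding rectangles_def
    by (intro CollectI exI[of _ "A \<inter> A'"] exI[of _ "C \<inter> C'"] exI[of _ "D \<inter> D'"] conjI sets.Int AD C)
qed

text \<open>A product field is generated by rectangles with sides in generators, provided these
  contain the whole space; \<open>UNIV\<close> is a continuity set because its frontier is empty.
  The claim is obtained as measurability of the identity, checked coordinate by coordinate.\<close>

lemma glued_filtration_generated:
  assumes s: "s \<in> {0..1}"
  shows "sets (glued_filtration s) \<subseteq> sigma_sets UNIV (rectangles s)"
proof -
  let ?S = "sigma UNIV (rectangles s)"
  let ?K = "{C \<in> sets (BS s). measure \<nu> (frontier C) = 0}"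
  have S: "sets ?S = sigma_sets UNIV (rectangles s)" "space ?S = UNIV" by simp_all
  have UK: "UNIV \<in> ?K" using sets.top[of "BS s"] space_BS[OF s] by simp
  have UP: "UNIV \<in> sets (path_filtration s)" using sets.top[of "path_filtration s"] by simp
  have rect: "A \<times> (C \<times> D) \<in> sets ?S" if "A \<in> sets (path_filtration s)" "C \<in> ?K" "D \<in> sets (path_filtration s)" for A C D
    unfolding S(1) by (rule sigma_sets.Basic) (use that in \<open>auto simp: rectangles_def\<close>)
  have "(\<lambda>z. (fst z, (fst (snd z), snd (snd z)))) \<in> ?S \<rightarrow>\<^sub>M glued_filtration s"
    unfolding glued_filtration_def
  proof (intro measurable_Pair)
    show "(\<lambda>z. fst z) \<in> ?S \<rightarrow>\<^sub>M path_filtration s"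
    proof (rule measurableI)
      fix A :: "'d wpath set" assume A: "A \<in> sets (path_filtration s)"
      have "fst -` A \<inter> space ?S = A \<times> (UNIV \<times> UNIV)" by auto
      then show "fst -` A \<inter> space ?S \<in> sets ?S" using rect[OF A UK UP] by simp
    qed simp
    show "(\<lambda>z. snd (snd z)) \<in> ?S \<rightarrow>\<^sub>M path_filtration s"
    proof (rule measurableI)
      fix D :: "'d wpath set" assume D: "D \<in> sets (path_filtration s)"
      have "(\<lambda>z. snd (snd z)) -` D \<inter> space ?S = UNIV \<times> (UNIV \<times> D)" by auto
      then show "(\<lambda>z. snd (snd z)) -` D \<inter> space ?S \<in> sets ?S" using rect[OF UP UK D] by simp
    qed simp
    show "(\<lambda>z. fst (snd z)) \<in> ?S \<rightarrow>\<^sub>M BS s"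
    proof (rule measurable_sigma_sets[OF continuity_sets_generate[OF regular \<nu> s]])
      show "?K \<subseteq> Pow UNIV" by simp
      fix C assume C: "C \<in> ?K"
      have "(\<lambda>z. fst (snd z)) -` C \<inter> space ?S = UNIV \<times> (C \<times> UNIV)" by auto
      then show "(\<lambda>z. fst (snd z)) -` C \<inter> space ?S \<in> sets ?S" using rect[OF UP C UP] by simp
    qed simp
  qed
  then have "(\<lambda>z. z) \<in> ?S \<rightarrow>\<^sub>M glued_filtration s" by simp
  from measurable_sets[OF this] show ?thesis unfolding S by auto
qed

text \<open>Integrating out the middle coordinate turns the rectangle into a bounded weight
  \<open>U\<close> that is known at time \<open>s\<close>, and independence of the increment on the
  original basis factorises the integral. Taking \<open>UNIV\<close> for the test set identifies the
  integral of \<open>U\<close> with the mass of the rectangle.\<close>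

lemma glued_rectangle:
  assumes st: "0 \<le> s" "s < t" "t \<le> 1" and T: "T \<in> rectangles s" and E: "E \<in> sets borel"
  shows "measure glued (T \<inter> {z. path_at (snd (snd z)) t - path_at (snd (snd z)) s \<in> E})
    = measure glued T * prob {\<omega>\<in>space M. path_at (B \<omega>) t - path_at (B \<omega>) s \<in> E}"
proof -
  have s: "s \<in> {0..1}" "t \<in> {0..1}" using st by auto
  obtain A C D where T: "T = A \<times> (C \<times> D)" and A: "A \<in> sets (path_filtration s)" and D: "D \<in> sets (path_filtration s)"
    and C: "C \<in> sets (BS s)" "measure \<nu> (frontier C) = 0"
    using T unfolding rectangles_def by blast
  have C_borel: "C \<in> sets borel" using C(1) regular_filtrationD(2)[OF regular s(1)] by blast
  have AD: "A \<in> sets borel" "D \<in> sets borel" using A D path_filtration_le_borel by blast+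
  let ?\<Delta> = "\<lambda>w :: 'd wpath. path_at w t - path_at w s"
  have \<Delta>_meas [measurable]: "?\<Delta> \<in> borel \<rightarrow>\<^sub>M borel" using s by (intro borel_measurable_diff measurable_path_at_borel)
  define U where "U \<omega> = indicator A (X \<omega>) * indicator D (B \<omega>) * measure (\<Theta> (X \<omega>)) C" for \<omega>
  have B_ad: "adapted_process F B" using brownian by (simp add: brownian_motion_def)
  have U_F: "U \<in> borel_measurable (F s)"
    unfolding U_def[abs_def]
  proof (intro borel_measurable_times)
    show "(\<lambda>\<omega>. indicator A (X \<omega>) :: real) \<in> borel_measurable (F s)"
      by (rule measurable_compose[OF X_filtration[OF s(1)]]) (use A in measurable)
    show "(\<lambda>\<omega>. indicator D (B \<omega>) :: real) \<in> borel_measurable (F s)"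
      by (rule measurable_compose[OF adapted_process_path_filtration[OF basis B_ad s(1)]]) (use D in measurable)
    show "(\<lambda>\<omega>. measure (\<Theta> (X \<omega>)) C) \<in> borel_measurable (F s)"
      by (rule measurable_compose[OF adapted_process_completed_path_filtration[OF basis X_adapted s(1) law_X]
            causal[OF s(1) C]])
  qed
  have U_bound: "0 \<le> U \<omega>" "U \<omega> \<le> 1" for \<omega>
    using prob_space.prob_le_1[OF kernel_prob] by (auto simp: U_def split: split_indicator)
  have U_int: "integrable M U"
    using U_bound F_to_M[OF s(1) U_F] by (intro integrable_const_bound[where B = 1]) auto
  have \<Delta>B: "(\<lambda>\<omega>. ?\<Delta> (B \<omega>)) \<in> M \<rightarrow>\<^sub>M borel" by measurable
  have indep: "indep_set (sets (F s)) (sets (vimage_algebra (space M) (\<lambda>\<omega>. ?\<Delta> (B \<omega>)) borel))"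
    using brownian st unfolding brownian_motion_def by blast
  have main: "measure glued (T \<inter> {z. ?\<Delta> (snd (snd z)) \<in> E'}) = (\<integral>\<omega>. U \<omega> \<partial>M) * prob {\<omega>\<in>space M. ?\<Delta> (B \<omega>) \<in> E'}"
    if E': "E' \<in> sets borel" for E'
  proof -
    let ?D = "{z :: 'd wpath \<times> 'd wpath. fst z \<in> A \<and> snd z \<in> D \<and> ?\<Delta> (snd z) \<in> E'}"
    note [measurable] = E' AD
    have "?D = {z \<in> space (borel \<Otimes>\<^sub>M borel). fst z \<in> A \<and> snd z \<in> D \<and> ?\<Delta> (snd z) \<in> E'}" by (simp add: space_pair_measure)
    also have "\<dots> \<in> sets (borel \<Otimes>\<^sub>M borel)" by measurable
    finally have D': "?D \<in> sets (borel \<Otimes>\<^sub>M borel)" .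
    have ind: "(indicator E' :: _ \<Rightarrow> real) \<in> borel_measurable borel" by measurable
    have ind_int: "integrable M (\<lambda>\<omega>. indicator E' (?\<Delta> (B \<omega>)) :: real)"
      by (rule integrable_const_bound[where B = 1]) (auto split: split_indicator)
    have "T \<inter> {z. ?\<Delta> (snd (snd z)) \<in> E'} = {z. (fst z, snd (snd z)) \<in> ?D \<and> fst (snd z) \<in> C}"
      unfolding T by auto
    then have "emeasure glued (T \<inter> {z. ?\<Delta> (snd (snd z)) \<in> E'})
        = (\<integral>\<^sup>+\<omega>. indicator ?D (X \<omega>, B \<omega>) * emeasure (\<Theta> (X \<omega>)) C \<partial>M)"
      using emeasure_glued[OF D' C_borel] by simp
    also have "\<dots> = (\<integral>\<^sup>+\<omega>. ennreal (U \<omega> * indicator E' (?\<Delta> (B \<omega>))) \<partial>M)"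
      unfolding kernel_emeasure by (intro nn_integral_cong) (auto simp: U_def split: split_indicator)
    also have "\<dots> = ennreal (\<integral>\<omega>. U \<omega> * indicator E' (?\<Delta> (B \<omega>)) \<partial>M)"
      using U_bound indep_set_vimage_integral(1)[OF indep F_subalgebra[OF s(1)] \<Delta>B U_F U_int ind ind_int]
      by (intro nn_integral_eq_integral) auto
    also have "(\<integral>\<omega>. U \<omega> * indicator E' (?\<Delta> (B \<omega>)) \<partial>M) = (\<integral>\<omega>. U \<omega> \<partial>M) * (\<integral>\<omega>. indicator E' (?\<Delta> (B \<omega>)) \<partial>M)"
      by (rule indep_set_vimage_integral(2)[OF indep F_subalgebra[OF s(1)] \<Delta>B U_F U_int ind ind_int])
    also have "(\<integral>\<omega>. indicator E' (?\<Delta> (B \<omega>)) \<partial>M) = (\<integral>\<omega>. indicator {\<omega>\<in>space M. ?\<Delta> (B \<omega>) \<in> E'} \<omega> \<partial>M)"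
      by (intro Bochner_Integration.integral_cong) (auto split: split_indicator)
    also have "\<dots> = prob {\<omega>\<in>space M. ?\<Delta> (B \<omega>) \<in> E'}"
    proof -
      have "{\<omega>\<in>space M. ?\<Delta> (B \<omega>) \<in> E'} \<in> events" by measurable
      then show ?thesis by (simp add: Int_absorb2 sets.sets_into_space)
    qed
    finally show ?thesis
      using U_bound(1) by (simp add: measure_def integral_nonneg)
  qed
  have "measure glued T = (\<integral>\<omega>. U \<omega> \<partial>M)"
    using main[of UNIV] by (simp add: prob_space)
  then show ?thesis using main[OF E] by simp
qed

text \<open>The initial value and the laws of the increments concern only the joint law of solution
  and noise, which gluing leaves unchanged. Independence is known on an intersection-stable
  generator of the past and extends to the generated field.\<close>

lemma glued_brownian: "brownian_motion glued glued_filtration (\<lambda>z. snd (snd z))"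
  unfolding brownian_motion_def adapted_process_def
proof (intro conjI ballI allI impI)
  interpret G: prob_space glued by (rule prob_glued)
  have m: "(\<lambda>z. (fst z, snd (snd z))) \<in> glued \<rightarrow>\<^sub>M borel \<Otimes>\<^sub>M borel" by measurable
  have m': "(\<lambda>\<omega>. (X \<omega>, B \<omega>)) \<in> M \<rightarrow>\<^sub>M borel \<Otimes>\<^sub>M borel" by measurable
  show "(\<lambda>z. path_at (snd (snd z)) t) \<in> borel_measurable (glued_filtration t)" if t: "t \<in> {0..1}" for t
  proof -
    have "(\<lambda>z :: 'd wpath \<times> 's \<times> 'd wpath. snd (snd z)) \<in> glued_filtration t \<rightarrow>\<^sub>M path_filtration t"
      unfolding glued_filtration_def by measurable
    from measurable_compose[OF this measurable_path_at_path_filtration] t show ?thesis by simp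
  qed
  have [measurable]: "(\<lambda>x::'d wpath. path_at x 0) \<in> borel \<rightarrow>\<^sub>M borel" by (rule measurable_path_at_borel) simp
  have "AE z in distr M (borel \<Otimes>\<^sub>M borel) (\<lambda>\<omega>. (X \<omega>, B \<omega>)). path_at (snd z) 0 = 0"
    using brownian by (subst AE_distr_iff[OF m']) (simp_all add: brownian_motion_def)
  then show "AE z in glued. path_at (snd (snd z)) 0 = 0"
    unfolding glued_joint[symmetric] by (subst (asm) AE_distr_iff[OF m]) simp_all
  fix s t :: real assume st: "0 \<le> s \<and> s < t \<and> t \<le> 1"
  then have s: "s \<in> {0..1}" "t \<in> {0..1}" by auto
  let ?\<Delta> = "\<lambda>w :: 'd wpath. path_at w t - path_at w s"
  have \<Delta> [measurable]: "?\<Delta> \<in> borel \<rightarrow>\<^sub>M borel" using s by (intro borel_measurable_diff measurable_path_at_borel)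
  have law: "distr glued borel (\<lambda>z. ?\<Delta> (snd (snd z))) = distr M borel (\<lambda>\<omega>. ?\<Delta> (B \<omega>))"
  proof -
    have "distr glued borel (\<lambda>z. ?\<Delta> (snd (snd z))) = distr (distr glued (borel \<Otimes>\<^sub>M borel) (\<lambda>z. (fst z, snd (snd z)))) borel (\<lambda>z. ?\<Delta> (snd z))"
      by (subst distr_distr[OF _ m]) (auto simp: comp_def)
    also have "\<dots> = distr M borel (\<lambda>\<omega>. ?\<Delta> (B \<omega>))"
      unfolding glued_joint by (subst distr_distr[OF _ m']) (auto simp: comp_def)
    finally show ?thesis .
  qed
  then show "distr glued borel (\<lambda>z. ?\<Delta> (snd (snd z))) = gaussian (t - s)"
    using brownian st unfolding brownian_motion_def by simp
  have \<Delta>g: "(\<lambda>z. ?\<Delta> (snd (snd z))) \<in> glued \<rightarrow>\<^sub>M borel" by measurable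
  have rect_sets: "rectangles s \<subseteq> G.events"
  proof
    fix T assume "T \<in> rectangles s"
    then obtain A C D where "T = A \<times> (C \<times> D)" "A \<in> sets (path_filtration s)" "D \<in> sets (path_filtration s)" "C \<in> sets (BS s)"
      unfolding rectangles_def by blast
    then show "T \<in> G.events"
      using path_filtration_le_borel regular_filtrationD(2)[OF regular s(1)] unfolding sets_glued
      by (auto intro!: pair_measureI)
  qed
  have "G.indep_set (rectangles s) (sets (vimage_algebra (space glued) (\<lambda>z. ?\<Delta> (snd (snd z))) borel))"
  proof (subst G.indep_set_vimage_iff[OF \<Delta>g rect_sets], intro ballI)
    fix T and E :: "(real ^ 'd) set" assume T: "T \<in> rectangles s" and E: "E \<in> sets borel"
    have "G.prob ((\<lambda>z. ?\<Delta> (snd (snd z))) -` E \<inter> space glued) = measure (distr glued borel (\<lambda>z. ?\<Delta> (snd (snd z)))) E"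
      by (rule measure_distr[symmetric, OF \<Delta>g E])
    also have "\<dots> = prob {\<omega>\<in>space M. ?\<Delta> (B \<omega>) \<in> E}"
      unfolding law by (subst measure_distr[OF _ E]) (auto intro!: arg_cong[where f = "measure M"])
    finally have 1: "G.prob ((\<lambda>z. ?\<Delta> (snd (snd z))) -` E \<inter> space glued) = prob {\<omega>\<in>space M. ?\<Delta> (B \<omega>) \<in> E}" .
    have "(\<lambda>z. ?\<Delta> (snd (snd z))) -` E \<inter> space glued = {z. ?\<Delta> (snd (snd z)) \<in> E}" by auto
    then show "G.prob (T \<inter> ((\<lambda>z. ?\<Delta> (snd (snd z))) -` E \<inter> space glued))
        = G.prob T * G.prob ((\<lambda>z. ?\<Delta> (snd (snd z))) -` E \<inter> space glued)"
      using glued_rectangle[OF _ _ _ T E, of t] st 1 by simp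
  qed
  then have "G.indep_set (sigma_sets (space glued) (rectangles s))
      (sigma_sets (space glued) (sets (vimage_algebra (space glued) (\<lambda>z. ?\<Delta> (snd (snd z))) borel)))"
    by (rule G.indep_set_sigma_sets) (rule Int_stable_rectangles, rule sets.Int_stable)
  then show "G.indep_set (sets (glued_filtration s)) (sets (vimage_algebra (space glued) (\<lambda>z. ?\<Delta> (snd (snd z))) borel))"
    unfolding G.indep_set_def
  proof (rule G.indep_sets_mono_sets)
    fix i :: bool
    have "sets (vimage_algebra (space glued) (\<lambda>z. ?\<Delta> (snd (snd z))) borel)
        \<subseteq> sigma_sets (space glued) (sets (vimage_algebra (space glued) (\<lambda>z. ?\<Delta> (snd (snd z))) borel))"
      by (rule sigma_sets_superset_generator)
    then show "(case i of True \<Rightarrow> sets (glued_filtration s) | False \<Rightarrow> sets (vimage_algebra (space glued) (\<lambda>z. ?\<Delta> (snd (snd z))) borel))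
      \<subseteq> (case i of True \<Rightarrow> sigma_sets (space glued) (rectangles s) |
          False \<Rightarrow> sigma_sets (space glued) (sets (vimage_algebra (space glued) (\<lambda>z. ?\<Delta> (snd (snd z))) borel)))"
      using glued_filtration_generated[OF s(1)] by (cases i) auto
  qed
qed

abbreviation glued_fields :: "real \<Rightarrow> ('d wpath \<times> 's \<times> 'd wpath) measure"
  where "glued_fields \<equiv> right_limit (\<lambda>t. completed_field glued (glued_filtration t))"

lemma glued_basis: "complete_stochastic_basis (completion glued) glued_fields"
  by (rule complete_stochastic_basis_right_limit[OF prob_glued glued_filtration_subalgebra glued_filtration_mono])

lemma glued_fields_brownian: "brownian_motion (completion glued) glued_fields (\<lambda>z. snd (snd z))"
  by (rule brownian_motion_right_limit[OF prob_glued glued_filtration_subalgebra glued_filtration_mono glued_brownian])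

lemma glued_fields_measurable:
  assumes t: "t \<in> {0..1}" and f: "f \<in> glued_filtration t \<rightarrow>\<^sub>M N"
  shows "f \<in> glued_fields t \<rightarrow>\<^sub>M N"
proof (rule measurable_from_subalg[OF _ f])
  show "subalgebra (glued_fields t) (glued_filtration t)"
    unfolding subalgebra_def
    using le_right_limit_completed_field[OF glued_filtration_subalgebra glued_filtration_mono t]
    by (simp add: space_glued_filtration[OF t])
qed

lemma sets_plan: "sets \<gamma> = sets borel"
  unfolding sets_\<gamma> borel_prod ..

text \<open>Since gluing preserves the joint law of solution and noise, the equation carries over;
  adaptedness of all three coordinates is built into the product filtration.\<close>

theorem glued_realizes_plan:
  "realizes_plan \<sigma> b \<eta>\<^sub>0 BS \<gamma> (completion glued) glued_fields fst (\<lambda>z. snd (snd z)) (\<lambda>z. fst (snd z))"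
  unfolding realizes_plan_def
proof (intro conjI ballI)
  show "complete_stochastic_basis (completion glued) glued_fields" by (rule glued_basis)
  have X_ad: "adapted_process glued_fields fst"
    unfolding adapted_process_def
  proof
    fix t :: real assume t: "t \<in> {0..1}"
    have "(\<lambda>z :: 'd wpath \<times> 's \<times> 'd wpath. fst z) \<in> glued_filtration t \<rightarrow>\<^sub>M path_filtration t"
      unfolding glued_filtration_def by measurable
    from glued_fields_measurable[OF t measurable_compose[OF this measurable_path_at_path_filtration]] t
    show "(\<lambda>z. path_at (fst z) t) \<in> borel_measurable (glued_fields t)" by simp
  qed
  have m: "(\<lambda>z. (fst z, snd (snd z))) \<in> glued \<rightarrow>\<^sub>M borel \<Otimes>\<^sub>M borel" by measurable
  show "weak_solution \<sigma> b \<eta>\<^sub>0 (completion glued) glued_fields fst (\<lambda>z. snd (snd z))"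
    by (rule weak_solution_transfer[OF glued_basis X_ad glued_fields_brownian])
      (simp only: distr_completion[OF m] glued_joint)
  show "fst \<in> completion glued \<rightarrow>\<^sub>M borel" "(\<lambda>z. fst (snd z)) \<in> completion glued \<rightarrow>\<^sub>M borel"
    by (intro measurable_completion, measurable)+
  show "(\<lambda>z. fst (snd z)) \<in> glued_fields t \<rightarrow>\<^sub>M BS t" if t: "t \<in> {0..1}" for t
  proof (rule glued_fields_measurable[OF t])
    show "(\<lambda>z. fst (snd z)) \<in> glued_filtration t \<rightarrow>\<^sub>M BS t"
      unfolding glued_filtration_def by measurable
  qed
  have m': "(\<lambda>z. (fst z, fst (snd z))) \<in> glued \<rightarrow>\<^sub>M borel"
    unfolding borel_prod[symmetric] by measurable
  have "\<gamma> = distr glued \<gamma> (\<lambda>z. (fst z, fst (snd z)))" by (rule glued_plan[symmetric])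
  also have "\<dots> = distr glued borel (\<lambda>z. (fst z, fst (snd z)))"
    by (rule distr_cong) (simp_all only: sets_plan)
  finally show "\<gamma> = distr (completion glued) borel (\<lambda>z. (fst z, fst (snd z)))"
    by (simp only: distr_completion[OF m'])
qed

section \<open>The canonical basis on the product of path space and second space\<close>

definition plan_filtration :: "real \<Rightarrow> ('d wpath \<times> 's) measure"
  where "plan_filtration t = path_filtration t \<Otimes>\<^sub>M BS t"

abbreviation plan_fields :: "real \<Rightarrow> ('d wpath \<times> 's) measure"
  where "plan_fields \<equiv> right_limit (\<lambda>t. completed_field \<gamma> (plan_filtration t))"

lemma space_plan_filtration: "t \<in> {0..1} \<Longrightarrow> space (plan_filtration t) = UNIV"
  by (simp add: plan_filtration_def space_pair_measure space_BS)

lemma plan_filtration_subalgebra: "t \<in> {0..1} \<Longrightarrow> subalgebra \<gamma> (plan_filtration t)"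
  unfolding subalgebra_def sets_\<gamma>
proof
  assume t: "t \<in> {0..1}"
  show "space (plan_filtration t) = space \<gamma>" using space_plan_filtration[OF t] by simp
  show "sets (plan_filtration t) \<subseteq> sets (borel \<Otimes>\<^sub>M borel)"
    unfolding plan_filtration_def
    by (intro sets_pair_mono path_filtration_le_borel regular_filtrationD(2)[OF regular t])
      (simp_all add: space_BS[OF t])
qed

lemma plan_filtration_mono:
  assumes "s \<in> {0..1}" "t \<in> {0..1}" "s \<le> t"
  shows "sets (plan_filtration s) \<subseteq> sets (plan_filtration t)"
  unfolding plan_filtration_def using assms
  by (intro sets_pair_mono path_filtration_mono regular_filtrationD(3)[OF regular]) (simp_all add: space_BS)

lemma plan_basis: "complete_stochastic_basis (completion \<gamma>) plan_fields"
  by (rule complete_stochastic_basis_right_limit[OF prob_\<gamma> plan_filtration_subalgebra plan_filtration_mono])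

lemma plan_fields_measurable:
  assumes t: "t \<in> {0..1}" and f: "f \<in> plan_filtration t \<rightarrow>\<^sub>M N"
  shows "f \<in> plan_fields t \<rightarrow>\<^sub>M N"
proof (rule measurable_from_subalg[OF _ f])
  show "subalgebra (plan_fields t) (plan_filtration t)"
    unfolding subalgebra_def
    using le_right_limit_completed_field[OF plan_filtration_subalgebra plan_filtration_mono t]
    by (simp add: space_plan_filtration[OF t])
qed

text \<open>
  The Brownian motion \<open>\<Psi>(X)\<close> on \<open>W \<times> S\<close> inherits the independence of its increments from the
  glued space, of which \<open>(W \<times> S, \<gamma>)\<close> is a factor.
\<close>

theorem plan_space_realizes_plan:
  assumes det: "AE x in \<eta>. \<forall>t\<in>{0..1}. det (\<sigma> t x) \<noteq> 0"
  shows "\<exists>B'. realizes_plan \<sigma> b \<eta>\<^sub>0 BS \<gamma> (completion \<gamma>) plan_fields fst B' snd"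
proof -
  obtain \<Psi> where \<Psi> [measurable]: "\<Psi> \<in> borel \<rightarrow>\<^sub>M borel" and B_eq: "AE \<omega> in M. B \<omega> = \<Psi> (X \<omega>)"
    and \<Psi>_ad: "\<And>t. t \<in> {0..1} \<Longrightarrow> (\<lambda>x. path_at (\<Psi> x) t) \<in> borel_measurable (completed_field \<eta> (path_filtration t))"
    using driving_functional[OF det] by blast
  define B' :: "'d wpath \<times> 's \<Rightarrow> 'd wpath" where "B' z = \<Psi> (fst z)" for z
  define T :: "'d wpath \<times> 's \<times> 'd wpath \<Rightarrow> 'd wpath \<times> 's" where "T z = (fst z, fst (snd z))" for z
  have T: "T \<in> glued \<rightarrow>\<^sub>M \<gamma>" unfolding T_def by measurable
  have T_law: "distr glued \<gamma> T = \<gamma>" unfolding T_def[abs_def] by (rule glued_plan)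
  \<comment> \<open>Every event of the plan fields is seen through \<open>T\<close> as an event of
    the glued fields, where independence of the increments is already known.\<close>
  have T_fields: "T \<in> glued_fields s \<rightarrow>\<^sub>M plan_fields s" if s: "s \<in> {0..1}" for s
  proof (rule measurable_right_limit_completed[OF T T_law glued_filtration_subalgebra plan_filtration_subalgebra _ s])
    show "T \<in> glued_filtration t \<rightarrow>\<^sub>M plan_filtration t" if "t \<in> {0..1}" for t
      unfolding T_def glued_filtration_def plan_filtration_def by measurable
  qed
  have m: "(\<lambda>\<omega>. (X \<omega>, B \<omega>)) \<in> M \<rightarrow>\<^sub>M borel \<Otimes>\<^sub>M borel" by measurable
  have mg: "(\<lambda>z. (fst z, snd (snd z))) \<in> glued \<rightarrow>\<^sub>M borel \<Otimes>\<^sub>M borel" by measurable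
  \<comment> \<open>The relation between solution and noise is membership in the graph of \<Psi>, a
    measurable set of pairs; it is therefore decided by the joint law and passes to the glued
    space.\<close>
  have graph: "{z \<in> space (borel \<Otimes>\<^sub>M borel). snd z = \<Psi> (fst z)} \<in> sets (borel \<Otimes>\<^sub>M borel)"
    by measurable
  have "AE z in distr M (borel \<Otimes>\<^sub>M borel) (\<lambda>\<omega>. (X \<omega>, B \<omega>)). snd z = \<Psi> (fst z)"
    using B_eq by (subst AE_distr_iff[OF m graph]) simp
  then have B_glued: "AE z in glued. snd (snd z) = B' (T z)"
    unfolding glued_joint[symmetric] by (subst (asm) AE_distr_iff[OF mg graph]) (simp add: B'_def T_def)
  have fst_law: "distr (completion \<gamma>) borel fst = \<eta>"
    using plan by (simp add: plans_def distr_completion borel_prod[symmetric] cong: measurable_cong_sets)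
  have X_ad: "adapted_process plan_fields fst"
    unfolding adapted_process_def
  proof
    fix t :: real assume t: "t \<in> {0..1}"
    have "(\<lambda>z :: 'd wpath \<times> 's. fst z) \<in> plan_filtration t \<rightarrow>\<^sub>M path_filtration t"
      unfolding plan_filtration_def by measurable
    from plan_fields_measurable[OF t measurable_compose[OF this measurable_path_at_path_filtration]] t
    show "(\<lambda>z. path_at (fst z) t) \<in> borel_measurable (plan_fields t)" by simp
  qed
  have B'_ad: "adapted_process plan_fields B'"
    unfolding adapted_process_def B'_def
    using measurable_compose[OF adapted_process_completed_path_filtration[OF plan_basis X_ad _ fst_law] \<Psi>_ad] by blast
  have B'_meas [measurable]: "B' \<in> \<gamma> \<rightarrow>\<^sub>M borel" unfolding B'_def by measurable
  \<comment> \<open>Events of the plan fields are guaranteed to be measurable only for the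
    completion, so \<open>T\<close> has to preserve measure between the completed spaces.\<close>
  have Tc: "T \<in> completion glued \<rightarrow>\<^sub>M completion \<gamma>"
    by (rule completion.measurable_completion2[OF measurable_completion[OF T]]) (simp add: distr_completion[OF T] T_law)
  have Tc_law: "distr (completion glued) (completion \<gamma>) T = completion \<gamma>"
    using completion.completion_distr_eq[OF measurable_completion[OF T]] by (simp add: distr_completion[OF T] T_law)
  have T_prob: "measure (completion \<gamma>) S = measure (completion glued) (T -` S)" if "S \<in> sets (completion \<gamma>)" for S
    using measure_distr[OF Tc that] unfolding Tc_law by simp
  interpret C: prob_space "completion \<gamma>" by (rule basisD[OF plan_basis])
  interpret G: prob_space "completion glued" by (rule basisD[OF glued_basis])
  have brownian': "brownian_motion (completion \<gamma>) plan_fields B'"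
    unfolding brownian_motion_def
  proof (intro conjI allI impI)
    show "adapted_process plan_fields B'" by (rule B'_ad)
    have [measurable]: "(\<lambda>x::'d wpath. path_at x 0) \<in> borel \<rightarrow>\<^sub>M borel" by (rule measurable_path_at_borel) simp
    have "AE z in glued. path_at (B' (T z)) 0 = 0"
    proof -
      have "AE z in glued. path_at (snd (snd z)) 0 = 0" using glued_brownian by (simp add: brownian_motion_def)
      with B_glued show ?thesis by eventually_elim simp
    qed
    moreover have "{z \<in> space \<gamma>. path_at (B' z) 0 = 0} \<in> sets \<gamma>" by measurable
    ultimately have "AE z in distr glued \<gamma> T. path_at (B' z) 0 = 0" by (simp only: AE_distr_iff[OF T])
    then show "AE z in completion \<gamma>. path_at (B' z) 0 = 0" unfolding T_law by (rule AE_completion)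
    fix s t :: real assume st: "0 \<le> s \<and> s < t \<and> t \<le> 1"
    then have s: "s \<in> {0..1}" "t \<in> {0..1}" by auto
    let ?\<Delta> = "\<lambda>w :: 'd wpath. path_at w t - path_at w s"
    have \<Delta> [measurable]: "?\<Delta> \<in> borel \<rightarrow>\<^sub>M borel" using s by (intro borel_measurable_diff measurable_path_at_borel)
    have \<Delta>B': "(\<lambda>z. ?\<Delta> (B' z)) \<in> \<gamma> \<rightarrow>\<^sub>M borel" by measurable
    have \<Delta>g: "(\<lambda>z. ?\<Delta> (snd (snd z))) \<in> glued \<rightarrow>\<^sub>M borel" by measurable
    have \<Delta>T: "(\<lambda>z. ?\<Delta> (B' (T z))) \<in> glued \<rightarrow>\<^sub>M borel" using measurable_compose[OF T \<Delta>B'] .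
    have law: "distr \<gamma> borel (\<lambda>z. ?\<Delta> (B' z)) = distr glued borel (\<lambda>z. ?\<Delta> (snd (snd z)))"
    proof -
      have "distr \<gamma> borel (\<lambda>z. ?\<Delta> (B' z)) = distr glued borel (\<lambda>z. ?\<Delta> (B' (T z)))"
        by (subst T_law[symmetric], subst distr_distr[OF \<Delta>B' T]) (simp add: comp_def)
      also have "\<dots> = distr glued borel (\<lambda>z. ?\<Delta> (snd (snd z)))"
        by (rule distr_cong_AE) (use B_glued \<Delta>g \<Delta>T in auto)
      finally show ?thesis .
    qed
    have "distr glued borel (\<lambda>z. ?\<Delta> (snd (snd z))) = gaussian (t - s)"
      using glued_brownian st unfolding brownian_motion_def by blast
    then show "distr (completion \<gamma>) borel (\<lambda>z. ?\<Delta> (B' z)) = gaussian (t - s)"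
      by (simp only: distr_completion[OF \<Delta>B'] law)
    have indep_g: "G.indep_set (sets (glued_fields s)) (sets (vimage_algebra (space (completion glued)) (\<lambda>z. ?\<Delta> (snd (snd z))) borel))"
      using glued_fields_brownian st unfolding brownian_motion_def by blast
    show "C.indep_set (sets (plan_fields s)) (sets (vimage_algebra (space (completion \<gamma>)) (\<lambda>z. ?\<Delta> (B' z)) borel))"
    proof (subst C.indep_set_vimage_iff[OF measurable_completion[OF \<Delta>B'] basisD(4)[OF plan_basis s(1)]], intro ballI)
      fix A and E :: "(real ^ 'd) set" assume A: "A \<in> sets (plan_fields s)" and E: "E \<in> sets borel"
      let ?E' = "(\<lambda>z. ?\<Delta> (B' z)) -` E"
      let ?E = "(\<lambda>z. ?\<Delta> (snd (snd z))) -` E"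
      have TA: "T -` A \<in> sets (glued_fields s)" using measurable_sets[OF T_fields[OF s(1)] A] by simp
      have TA': "T -` A \<in> G.events" using TA basisD(4)[OF glued_basis s(1)] by blast
      have A': "A \<in> C.events" using A basisD(4)[OF plan_basis s(1)] by blast
      have E': "?E' \<in> C.events" using measurable_sets[OF \<Delta>B' E] by simp
      have gE: "?E \<in> G.events" using measurable_sets[OF \<Delta>g E] by simp
      have TE: "T -` ?E' \<in> G.events" using measurable_sets[OF Tc E'] by simp
      have AE: "AE z in completion glued. z \<in> T -` ?E' \<longleftrightarrow> z \<in> ?E"
        using AE_completion[OF B_glued] by eventually_elim simp
      have "C.prob (A \<inter> ?E') = G.prob (T -` A \<inter> T -` ?E')"
        using T_prob[of "A \<inter> ?E'"] A' E' by simp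
      also have "\<dots> = G.prob (T -` A \<inter> ?E)"
        using AE TA' TE gE by (intro G.finite_measure_eq_AE) auto
      also have "\<dots> = G.prob (T -` A) * G.prob ?E"
        using indep_g TA E
        by (subst (asm) G.indep_set_vimage_iff[OF measurable_completion[OF \<Delta>g] basisD(4)[OF glued_basis s(1)]]) auto
      also have "G.prob ?E = G.prob (T -` ?E')"
        using AE TE gE by (intro G.finite_measure_eq_AE) auto
      finally show "C.prob (A \<inter> (?E' \<inter> space (completion \<gamma>))) = C.prob A * C.prob (?E' \<inter> space (completion \<gamma>))"
        using T_prob[OF A'] T_prob[OF E'] by simp
    qed
  qed
  have mB: "(\<lambda>z. (fst z, B' z)) \<in> \<gamma> \<rightarrow>\<^sub>M borel \<Otimes>\<^sub>M borel" by measurable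
  have joint: "distr \<gamma> (borel \<Otimes>\<^sub>M borel) (\<lambda>z. (fst z, B' z)) = distr M (borel \<Otimes>\<^sub>M borel) (\<lambda>\<omega>. (X \<omega>, B \<omega>))"
  proof -
    have "distr \<gamma> (borel \<Otimes>\<^sub>M borel) (\<lambda>z. (fst z, B' z)) = distr glued (borel \<Otimes>\<^sub>M borel) (\<lambda>z. (fst (T z), B' (T z)))"
      by (subst T_law[symmetric], subst distr_distr[OF mB T]) (simp add: comp_def)
    also have "\<dots> = distr glued (borel \<Otimes>\<^sub>M borel) (\<lambda>z. (fst z, snd (snd z)))"
    proof (rule distr_cong_AE)
      show "AE z in glued. (fst (T z), B' (T z)) = (fst z, snd (snd z))"
        using B_glued by eventually_elim (simp add: T_def)
      show "(\<lambda>z. (fst (T z), B' (T z))) \<in> glued \<rightarrow>\<^sub>M borel \<Otimes>\<^sub>M borel" using measurable_compose[OF T mB] .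
    qed (rule refl | rule mg)+
    finally show ?thesis unfolding glued_joint .
  qed
  show ?thesis
    unfolding realizes_plan_def
  proof (intro exI[of _ B'] conjI ballI)
    show "complete_stochastic_basis (completion \<gamma>) plan_fields" by (rule plan_basis)
    show "weak_solution \<sigma> b \<eta>\<^sub>0 (completion \<gamma>) plan_fields fst B'"
      by (rule weak_solution_transfer[OF plan_basis X_ad brownian']) (simp only: distr_completion[OF mB] joint)
    show "fst \<in> completion \<gamma> \<rightarrow>\<^sub>M borel" "snd \<in> completion \<gamma> \<rightarrow>\<^sub>M borel"
      by (intro measurable_completion, measurable)+
    show "snd \<in> plan_fields t \<rightarrow>\<^sub>M BS t" if t: "t \<in> {0..1}" for t
    proof (rule plan_fields_measurable[OF t])
      show "snd \<in> plan_filtration t \<rightarrow>\<^sub>M BS t" unfolding plan_filtration_def by measurable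
    qed
    have id: "(\<lambda>z. z) \<in> \<gamma> \<rightarrow>\<^sub>M borel" by (rule measurable_ident_sets[OF sets_plan])
    show "\<gamma> = distr (completion \<gamma>) borel (\<lambda>z. (fst z, snd z))"
      by (simp add: distr_completion[OF id] distr_id2[OF sets_plan[symmetric]])
  qed
qed

end

lemma norm_sq_eq_trace: "(norm A)\<^sup>2 = (\<Sum>i\<in>UNIV. (A ** transpose A) $ i $ i)"
  for A :: "real ^ 'n ^ 'm"
proof -
  have "(A ** transpose A) $ i $ i = (norm (A $ i))\<^sup>2" for i
    by (simp add: matrix_matrix_mult_def transpose_def power2_norm_eq_inner inner_vec_def)
  then show ?thesis by (simp add: norm_vec_def[of A] L2_set_def sum_nonneg)
qed

text \<open>The diagonal entries of the product of \<sigma> with its transpose are nonnegative and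
  add up to the squared Frobenius norm, so the energy is a finite sum of the given
  integrals.\<close>

lemma finite_energy:
  fixes \<sigma> :: "real \<Rightarrow> 'd::finite wpath \<Rightarrow> real ^ 'd ^ 'd"
  assumes \<eta>: "sets \<eta> = sets borel" and pred: "predictable path_filtration \<sigma>"
    and fin: "\<And>i j. (\<integral>\<^sup>+x. (\<integral>\<^sup>+t\<in>{0..1}. ennreal \<bar>(\<sigma> t x ** transpose (\<sigma> t x)) $ i $ j\<bar> \<partial>lborel) \<partial>\<eta>) < \<infinity>"
  shows "(\<integral>\<^sup>+x. (\<integral>\<^sup>+t\<in>{0..1}. ennreal ((norm (\<sigma> t x))\<^sup>2) \<partial>lborel) \<partial>\<eta>) < \<infinity>"
proof -
  let ?a = "\<lambda>i t x. (\<sigma> t x ** transpose (\<sigma> t x)) $ i $ i"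
  have nonneg: "0 \<le> ?a i t x" for i t x
    by (simp add: matrix_matrix_mult_def transpose_def sum_nonneg)
  have pm: "(\<lambda>y. \<sigma> (fst y) (snd y)) \<in> borel_measurable (unit_lborel \<Otimes>\<^sub>M \<eta>)"
    using pred
    by (intro measurable_progressive_lborel[OF increasing_fields_path_filtration _ subalgebra_path_filtration[OF \<eta>]])
      (auto simp: predictable_iff)
  have am: "(\<lambda>y. ?a i (fst y) (snd y)) \<in> borel_measurable (unit_lborel \<Otimes>\<^sub>M \<eta>)" for i
  proof -
    note [measurable] = pm
    have "?a i t x = (\<Sum>k\<in>UNIV. \<sigma> t x $ i $ k * \<sigma> t x $ i $ k)" for t x
      by (simp add: matrix_matrix_mult_def transpose_def)
    then show ?thesis by simp
  qed
  have sec: "(\<lambda>t. ?a i t x) \<in> borel_measurable unit_lborel" for i x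
  proof -
    have "x \<in> space \<eta>" using sets_eq_imp_space_eq[OF \<eta>] by simp
    from measurable_compose[OF measurable_Pair2'[OF this] am] show ?thesis by simp
  qed
  have "(\<integral>\<^sup>+x. (\<integral>\<^sup>+t\<in>{0..1}. ennreal ((norm (\<sigma> t x))\<^sup>2) \<partial>lborel) \<partial>\<eta>)
      = (\<integral>\<^sup>+x. (\<Sum>i\<in>UNIV. \<integral>\<^sup>+t\<in>{0..1}. ennreal \<bar>?a i t x\<bar> \<partial>lborel) \<partial>\<eta>)"
  proof (rule nn_integral_cong)
    fix x
    have "(\<integral>\<^sup>+t. ennreal ((norm (\<sigma> t x))\<^sup>2) \<partial>unit_lborel) = (\<integral>\<^sup>+t. (\<Sum>i\<in>UNIV. ennreal \<bar>?a i t x\<bar>) \<partial>unit_lborel)"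
      using nonneg by (intro nn_integral_cong) (simp add: norm_sq_eq_trace sum_nonneg flip: sum_ennreal)
    also have "\<dots> = (\<Sum>i\<in>UNIV. \<integral>\<^sup>+t. ennreal \<bar>?a i t x\<bar> \<partial>unit_lborel)"
      using sec by (intro nn_integral_sum) auto
    finally show "(\<integral>\<^sup>+t\<in>{0..1}. ennreal ((norm (\<sigma> t x))\<^sup>2) \<partial>lborel) = (\<Sum>i\<in>UNIV. \<integral>\<^sup>+t\<in>{0..1}. ennreal \<bar>?a i t x\<bar> \<partial>lborel)"
      unfolding set_nn_integral_unit .
  qed
  also have "\<dots> = (\<Sum>i\<in>UNIV. \<integral>\<^sup>+x. (\<integral>\<^sup>+t\<in>{0..1}. ennreal \<bar>?a i t x\<bar> \<partial>lborel) \<partial>\<eta>)"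
  proof (rule nn_integral_sum)
    fix i
    note [measurable] = am[of i]
    show "(\<lambda>x. \<integral>\<^sup>+t\<in>{0..1}. ennreal \<bar>?a i t x\<bar> \<partial>lborel) \<in> borel_measurable \<eta>"
      by (rule borel_measurable_unit_nn_integral) measurable
  qed
  also have "\<dots> < \<infinity>" using fin by simp
  finally show ?thesis .
qed

theorem proposition4:
  fixes \<sigma> :: "real \<Rightarrow> 'd::finite wpath \<Rightarrow> real ^ 'd ^ 'd"
    and b :: "real \<Rightarrow> 'd wpath \<Rightarrow> real ^ 'd"
    and \<eta>\<^sub>0 :: "(real ^ 'd) measure"
    and \<eta> :: "'d wpath measure"
    and BS :: "real \<Rightarrow> 's::polish_space measure"
    and \<nu> :: "'s measure"
    and \<gamma> :: "('d wpath \<times> 's) measure"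
  assumes "predictable path_filtration \<sigma>" and "predictable path_filtration b"
    and "\<eta>\<^sub>0 \<in> borel_probs"
    and "weak_existence TYPE('o) \<sigma> b \<eta>\<^sub>0"
    and "weak_uniqueness TYPE('o) \<sigma> b \<eta>\<^sub>0"
    and "law_of_solutions TYPE('o) \<sigma> b \<eta>\<^sub>0 \<eta>"
    and "\<And>i j. (\<integral>\<^sup>+\<omega>. (\<integral>\<^sup>+t\<in>{0..1}. ennreal \<bar>(\<sigma> t \<omega> ** transpose (\<sigma> t \<omega>)) $ i $ j\<bar> \<partial>lborel) \<partial>\<eta>) < \<infinity>"
    and "regular_filtration BS"
    and "\<nu> \<in> borel_probs"
    and "\<gamma> \<in> causal_plans path_filtration BS \<eta> \<nu>"
  shows "(\<exists>(M :: ('d wpath \<times> 's \<times> 'd wpath) measure) F X B Y.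
            realizes_plan \<sigma> b \<eta>\<^sub>0 BS \<gamma> M F X B Y) \<and>
         ((AE \<omega> in \<eta>. \<forall>t\<in>{0..1}. det (\<sigma> t \<omega>) \<noteq> 0) \<longrightarrow>
            (\<exists>B. realizes_plan \<sigma> b \<eta>\<^sub>0 BS \<gamma> (completion \<gamma>)
                  (right_limit (\<lambda>t. completed_field \<gamma> (path_filtration t \<Otimes>\<^sub>M BS t)))
                  fst B snd))"
proof -
  have \<eta>: "\<eta> \<in> borel_probs" using assms(6) by (simp add: law_of_solutions_def)
  have energy: "(\<integral>\<^sup>+x. (\<integral>\<^sup>+t\<in>{0..1}. ennreal ((norm (\<sigma> t x))\<^sup>2) \<partial>lborel) \<partial>\<eta>) < \<infinity>"
    using \<eta> by (intro finite_energy assms(1,7)) (simp add: borel_probs_def)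
  obtain M :: "'o measure" and F X B
    where basis: "complete_stochastic_basis M F" and sol: "weak_solution \<sigma> b \<eta>\<^sub>0 M F X B"
    using assms(4) unfolding weak_existence_def by blast
  \<comment> \<open>Uniqueness in law enters here: the kernel disintegrates \<gamma> under \<eta>,
    and the gluing integrates it along this particular \<open>X\<close>.\<close>
  have law: "distr M borel X = \<eta>" using assms(6) basis sol unfolding law_of_solutions_def by blast
  have brownian: "brownian_motion M F B" using sol by (simp add: weak_solution_def)
  obtain \<Theta> where plan: "\<gamma> \<in> plans \<eta> \<nu>" and kernel: "kernel_of \<gamma> \<eta> \<Theta>"
    and causal: "\<And>t C. t \<in> {0..1} \<Longrightarrow> C \<in> sets (BS t) \<Longrightarrow> measure \<nu> (frontier C) = 0 \<Longrightarrow>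
      (\<lambda>x. measure (\<Theta> x) C) \<in> borel_measurable (completed_field \<eta> (path_filtration t))"
    using assms(10) unfolding causal_plans_def by blast
  interpret coupling \<sigma> b \<eta>\<^sub>0 \<eta> M F B X BS \<nu> \<gamma> \<Theta>
    by unfold_locales (fact assms(1,2,8,9) \<eta> energy basis brownian sol law plan kernel | rule causal; assumption)+
  show ?thesis
    using glued_realizes_plan plan_space_realizes_plan unfolding plan_filtration_def[abs_def] by blast
qed

end
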